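(* Let $n=1$, and let $$b=(e^{-s}-e^s)\frac{z_1}{2T^{1/2}}\cdot e_0-(e^{-s}+e^s-2)\cdot\frac{e_1}{2},\qquad c=(e^s-e^{-s})T^{1/2},$$ where $b$ acts on $M_1$ by left multiplication. Then $b\in\widehat{\mathcal M}(\mathrm{End}(M_1)^s,c)$, i.e. $b$ is a bounding cochain with potential $c$, and $\Theta(\widetilde{\exp}(b))=s$.
   Context: Tensor products and direct sums are completed with respect to the relevant valuations. $R=R_1=\{\sum_{i\ge0}a_iT^{\beta_i}\mid a_i\in\mathbb R,\beta_i\in\frac12\mathbb Z,\lim\beta_i=\infty\}$, $|T^\beta|=4\beta$, trivial differential, $\nu_R(\sum a_iT^{\beta_i})=\inf_{a_i\ne0}\beta_i$. $S=R\langle z_0,z_1\rangle/\langle z_0z_1-T\rangle$ (quotient of the Tate algebra), $|z_i|=2$; for $\zeta=(\zeta_0,\zeta_1)$ with $\zeta_0+\zeta_1=1$, $\zeta_i>0$, $\nu_\zeta^S$ is the valuation with $\nu^S_\zeta(z_i)=\zeta_i$ and the monomials $z_0^a,z_1^a$ orthogonal over $R$. $W=-z_0+z_1=z_1-T/z_1$. $\mathrm{Cl}$ is the $S$-algebra generated by $e_0,e_1$ ($|e_i|=1$) with $e_0^2=-z_0$, $e_1^2=z_1$, $e_0e_1+e_1e_0=0$, with valuations $\nu_\zeta$ determined by $\nu_\zeta(e_i)=\frac12\zeta_i$ and $1,e_0,e_1,e_0e_1$ orthogonal over $S$. $M=M_1=\mathrm{Cl}/\langle e_0e_1-T^{1/2}\rangle$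 (quotient by the left ideal), a free $S$-module with basis $1,e_1$ and induced valuations $\nu^M_\zeta$; $D$ is left multiplication by $e_0+e_1$, so $D^2=W$. Elements of $\mathrm{Cl}$ act on $M$ by left multiplication. $\mathrm{End}(M)$ (the $S$-linear endomorphisms) has differential $\delta(\Phi)=D\Phi-(-1)^{|\Phi|}\Phi D$ and norm $\nu_M(\Phi)=\inf_\zeta\inf_{m\ne0}\{\nu^M_\zeta(\Phi m)-\nu^M_\zeta(m)\}$. $s$ is a formal variable of degree $1-n=0$; $R^s=\mathbb R[[s]]\otimes R$, $\mathrm{End}(M)^s=\mathbb R[[s]]\otimes\mathrm{End}(M)$, with $\nu(s^ix)=i+\nu(x)$. For $c\in R^s$ of degree $2$ with $\nu(c)>0$, $\widehat{\mathcal M}(\mathrm{End}(M)^s,c)$ is the set of $b\in\mathrm{End}(M)^s$ of degree $1$ with $\nu(b)>0$ and $\delta(b)-b^2=c\cdot\mathrm{id}$. Cyclic complex of $A=\mathrm{End}(M)^s$: $C_l(A)=A\otimes A[1]^{\otimes(l-1)}$ (over $R^s$), $C_*=\bigoplus_{l\ge1}C_l$. With $|sa|=|a|-1$ and $\epsilon_i=\sum_{j\ge i}|sa_j|$, $d_{cc}=b(\mu_1)+b(\mu_2)$, $b(\mu_1)(a_l\otimes\cdots\otimes a_1)=\delta(a_l)\otimes\cdots\otimes a_1+\sum_{i=1}^{l-1}(-1)^{\epsilon_{i+1}}a_l\otimes\cdots\otimes\delta(a_i)\otimes\cdots\otimes a_1$, $b(\mu_2)(a_l\otimes\cdots\otimes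 a_1)=(-1)^{|a_l|}a_la_{l-1}\otimes a_{l-2}\otimes\cdots\otimes a_1-\sum_{i=1}^{l-2}(-1)^{\epsilon_{i+1}}a_l\otimes\cdots\otimes a_{i+1}a_i\otimes\cdots\otimes a_1-(-1)^{|sa_1|(\epsilon_2+1)}a_1a_l\otimes a_{l-1}\otimes\cdots\otimes a_2$ ($0$ for $l=1$); $t(a_l\otimes\cdots\otimes a_1)=(-1)^{|sa_l|(\epsilon_1-|sa_l|)}a_{l-1}\otimes\cdots\otimes a_1\otimes a_l$; $C^\lambda_*(A)=C_*(A)/\mathrm{Im}(\mathrm{id}-t)$. $\mathcal R^\lambda_*\subset C^\lambda_*(A)$ is the subcomplex of (infinite) sums of elements $a_l\otimes\cdots\otimes a_1$ with some $a_i\in R^s$, and $C^\lambda_*(R^s)$ is the $R^s$-span of the $\mathrm{id}^{\otimes l}$. For a bounding cochain $b$, $\exp(b)=\mathrm{id}+\sum_{k\ge1}\frac1kb^{\otimes k}$ and $\widetilde{\exp}(b)=\exp(b)-y_b$, where $y_b\in\mathcal R^\lambda_*$ satisfies $d_{cc}(y_b)-d_{cc}(\exp(b))\in C^\lambda_*(R^s)$; such $y_b$ exists and the value $\Theta(\widetilde{\exp}(b))$ does not depend on its choice. $\Theta=\sum_{l\ge1}\Theta_l:C^\lambda_*(A)\to R^s$ is the $R^s$-multilinear extension of $\Theta_l(\Phi_l\otimes\cdots\otimes\Phi_1)=-\sum_{x=\pm iT^{1/2}}\mathrm{Res}_{z_1=x}\frac{\mathrm{str}(\Phi_l\,\partial_1D\,\Phi_{l-1}\,\partial_1D\cdots\Phi_1\,\partial_1D)}{(\partial_1W)^l}\frac{dz_1}{z_1}$,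 where endomorphisms are written as $2\times2$ matrices in the basis $1,e_1$ (even, odd), $z_0=T/z_1$, $\partial_1=\partial/\partial z_1$ acts entrywise on the matrix of $D$, $\mathrm{str}$ is the supertrace, and $\pm iT^{1/2}$ are the critical points of $W=z_1-T/z_1$. *)

theory Defs
  imports
    "HOL-Analysis.Analysis"
    "HOL-Computational_Algebra.Computational_Algebra"
    "HOL-Library.Poly_Mapping"
    "HOL-Library.Extended_Real"
begin

section \<open>The Novikov ring\<close>

text \<open>
  An element $\sum a_i T^{\beta_i}$ of $R$, $\beta_i \in \frac12\mathbb Z$, $\beta_i\to\infty$, is a
  formal Laurent series in $T^{1/2}$; thus $R$ is the type \<^typ>\<open>real fls\<close>, the variable
  \<^term>\<open>fls_X\<close> being $T^{1/2}$. It has valuation $1/2$ and degree $2$.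
\<close>

type_synonym R = "real fls"

abbreviation T_half :: R where "T_half \<equiv> fls_X"
abbreviation T :: R where "T \<equiv> T_half ^ 2"

definition R_val :: "R \<Rightarrow> ereal" where
  "R_val r = (if r = 0 then \<infinity> else ereal (of_int (fls_subdegree r) / 2))"

definition R_deg :: "int \<Rightarrow> R \<Rightarrow> bool" where
  "R_deg d r \<longleftrightarrow> (\<forall>n. fls_nth r n \<noteq> 0 \<longrightarrow> 2 * n = d)"

lemma R_val_0 [simp]: "R_val 0 = \<infinity>"
  by (simp add: R_val_def)

lemma R_val_uminus [simp]: "R_val (- r) = R_val r"
  by (simp add: R_val_def)

lemma R_val_mult: "R_val (r * r') = R_val r + R_val r'"
  by (auto simp: R_val_def add_divide_distrib)

lemma R_val_add:
  assumes "ereal N \<le> R_val r" "ereal N \<le> R_val r'"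
  shows "ereal N \<le> R_val (r + r')"
proof (cases "r = 0 \<or> r' = 0 \<or> r + r' = 0")
  case True
  then show ?thesis using assms by (auto simp: R_val_def)
next
  case False
  then have "min (fls_subdegree r) (fls_subdegree r') \<le> fls_subdegree (r + r')"
    using fls_plus_subdegree by blast
  then show ?thesis using assms False by (auto simp: R_val_def min_def split: if_splits)
qed

lemma R_val_sum:
  assumes "\<And>i. i \<in> I \<Longrightarrow> ereal N \<le> R_val (g i)"
  shows "ereal N \<le> R_val (sum g I)"
  using assms by (induction I rule: infinite_finite_induct) (auto intro: R_val_add)


section \<open>The Tate algebra and its quotient $S$\<close>

text \<open>
  A power series $\sum c_{ij} z_0^i z_1^j$ over $R$ is represented as a power series in $z_0$ whose
  coefficients are power series in $z_1$; the Tate algebra $R\langle z_0,z_1\rangle$ consists of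
  those with $\nu_R(c_{ij}) \to \infty$.
\<close>

definition coeff2 :: "R fps fps \<Rightarrow> nat \<Rightarrow> nat \<Rightarrow> R" where
  "coeff2 f i j = fps_nth (fps_nth f i) j"

definition tate_series :: "R fps fps \<Rightarrow> bool" where
  "tate_series f \<longleftrightarrow> (\<forall>N::real. finite {(i, j). R_val (coeff2 f i j) < ereal N})"

lemma coeff2_simps [simp]:
  "coeff2 0 i j = 0"
  "coeff2 (f + g) i j = coeff2 f i j + coeff2 g i j"
  "coeff2 (f - g) i j = coeff2 f i j - coeff2 g i j"
  "coeff2 (- f) i j = - coeff2 f i j"
  by (simp_all add: coeff2_def)

lemma coeff2_mult:
  "coeff2 (f * g) i j = (\<Sum>k=0..i. \<Sum>l=0..j. coeff2 f k l * coeff2 g (i - k) (j - l))"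
  by (simp add: coeff2_def fps_mult_nth fps_sum_nth)

lemma tate_seriesI:
  assumes "\<And>N::real. \<exists>F. finite F \<and> (\<forall>i j. (i, j) \<notin> F \<longrightarrow> ereal N \<le> R_val (coeff2 f i j))"
  shows "tate_series f"
  unfolding tate_series_def
proof
  fix N :: real
  obtain F where F: "finite F" "\<And>i j. (i, j) \<notin> F \<Longrightarrow> ereal N \<le> R_val (coeff2 f i j)"
    using assms by blast
  have "{(i, j). R_val (coeff2 f i j) < ereal N} \<subseteq> F"
    using F(2) by (auto simp: not_le[symmetric])
  then show "finite {(i, j). R_val (coeff2 f i j) < ereal N}"
    using F(1) finite_subset by blast
qed

lemma tate_seriesD:
  assumes "tate_series f"
  obtains F where "finite F" "\<And>i j. (i, j) \<notin> F \<Longrightarrow> ereal N \<le> R_val (coeff2 f i j)"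
proof (rule that)
  show "finite {(i, j). R_val (coeff2 f i j) < ereal N}"
    using assms by (simp add: tate_series_def)
qed auto

lemma tate_series_bounded_below:
  assumes "tate_series f"
  obtains B where "\<And>i j. ereal B \<le> R_val (coeff2 f i j)"
proof -
  obtain F where F: "finite F" "\<And>i j. (i, j) \<notin> F \<Longrightarrow> ereal 0 \<le> R_val (coeff2 f i j)"
    using tate_seriesD[OF assms] by blast
  define B where "B = Min (insert 0 ((\<lambda>(i, j). of_int (fls_subdegree (coeff2 f i j)) / 2 :: real) ` F))"
  have "ereal B \<le> R_val (coeff2 f i j)" for i j
  proof (cases "(i, j) \<in> F")
    case True
    then have "B \<le> of_int (fls_subdegree (coeff2 f i j)) / 2"
      unfolding B_def using F(1) by (intro Min_le) (auto intro!: image_eqI[where x = "(i, j)"])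
    then show ?thesis by (simp add: R_val_def)
  next
    case False
    have "B \<le> 0" unfolding B_def using F(1) by (intro Min_le) auto
    then show ?thesis using F(2)[OF False] by (meson ereal_less_eq(3) order_trans)
  qed
  then show thesis using that by blast
qed

lemma tate_series_finite_support:
  assumes "finite {(i, j). coeff2 f i j \<noteq> 0}"
  shows "tate_series f"
  by (rule tate_seriesI) (use assms in \<open>force intro!: exI[of _ "{(i, j). coeff2 f i j \<noteq> 0}"]\<close>)

lemma tate_series_0: "tate_series 0"
  by (rule tate_series_finite_support) simp

lemma coeff2_const: "coeff2 (fps_const (fps_const r)) i j = (if i = 0 \<and> j = 0 then r else 0)"
  by (simp add: coeff2_def)

lemma tate_series_const: "tate_series (fps_const (fps_const r))"
  by (rule tate_series_finite_support, rule finite_subset[of _ "{(0, 0)}"])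
    (auto simp: coeff2_const split: if_splits)

lemma tate_series_1: "tate_series 1"
  using tate_series_const[of 1] by simp

lemma tate_series_X: "tate_series fps_X"
  by (rule tate_series_finite_support, rule finite_subset[of _ "{(1, 0)}"])
    (auto simp: coeff2_def fps_X_def split: if_splits)

lemma tate_series_const_X: "tate_series (fps_const fps_X)"
  by (rule tate_series_finite_support, rule finite_subset[of _ "{(0, 1)}"])
    (auto simp: coeff2_def fps_X_def split: if_splits)

lemma tate_series_uminus: "tate_series f \<Longrightarrow> tate_series (- f)"
  by (simp add: tate_series_def)

lemma tate_series_add:
  assumes "tate_series f" "tate_series g"
  shows "tate_series (f + g)"
proof (rule tate_seriesI)
  fix N :: real
  obtain F where F: "finite F" "\<And>i j. (i, j) \<notin> F \<Longrightarrow> ereal N \<le> R_val (coeff2 f i j)"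
    using tate_seriesD[OF assms(1)] by blast
  obtain G where G: "finite G" "\<And>i j. (i, j) \<notin> G \<Longrightarrow> ereal N \<le> R_val (coeff2 g i j)"
    using tate_seriesD[OF assms(2)] by blast
  show "\<exists>F. finite F \<and> (\<forall>i j. (i, j) \<notin> F \<longrightarrow> ereal N \<le> R_val (coeff2 (f + g) i j))"
    using F G by (intro exI[of _ "F \<union> G"]) (auto intro: R_val_add)
qed

lemma tate_series_diff: "tate_series f \<Longrightarrow> tate_series g \<Longrightarrow> tate_series (f - g)"
  using tate_series_add[of f "- g"] by (simp add: tate_series_uminus)

lemma tate_series_mult:
  assumes "tate_series f" "tate_series g"
  shows "tate_series (f * g)"
proof (rule tate_seriesI)
  fix N :: real
  obtain A where A: "\<And>i j. ereal A \<le> R_val (coeff2 f i j)"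
    using tate_series_bounded_below[OF assms(1)] by blast
  obtain B where B: "\<And>i j. ereal B \<le> R_val (coeff2 g i j)"
    using tate_series_bounded_below[OF assms(2)] by blast
  obtain F where F: "finite F" "\<And>i j. (i, j) \<notin> F \<Longrightarrow> ereal (N - B) \<le> R_val (coeff2 f i j)"
    using tate_seriesD[OF assms(1)] by blast
  obtain G where G: "finite G" "\<And>i j. (i, j) \<notin> G \<Longrightarrow> ereal (N - A) \<le> R_val (coeff2 g i j)"
    using tate_seriesD[OF assms(2)] by blast
  define H where "H = (\<lambda>((i, j), (k, l)). (i + k, j + l)) ` (F \<times> G)"
  have "ereal N \<le> R_val (coeff2 (f * g) i j)" if H: "(i, j) \<notin> H" for i j
    unfolding coeff2_mult
  proof (intro R_val_sum)
    fix k l assume kl: "k \<in> {0..i}" "l \<in> {0..j}"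
    have "(k, l) \<notin> F \<or> (i - k, j - l) \<notin> G"
    proof (rule ccontr)
      assume "\<not> ?thesis"
      then have "((k, l), (i - k, j - l)) \<in> F \<times> G" by simp
      then have "(k + (i - k), l + (j - l)) \<in> H"
        unfolding H_def by (metis (mono_tags, lifting) case_prod_conv image_eqI)
      then show False using H kl by simp
    qed
    then have "ereal (N - B) + ereal B \<le> R_val (coeff2 f k l) + R_val (coeff2 g (i - k) (j - l))
      \<or> ereal A + ereal (N - A) \<le> R_val (coeff2 f k l) + R_val (coeff2 g (i - k) (j - l))"
      using A B F(2) G(2) by (meson add_mono)
    then show "ereal N \<le> R_val (coeff2 f k l * coeff2 g (i - k) (j - l))"
      by (simp add: R_val_mult)
  qed
  moreover have "finite H" unfolding H_def using F(1) G(1) by blast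
  ultimately show "\<exists>F. finite F \<and> (\<forall>i j. (i, j) \<notin> F \<longrightarrow> ereal N \<le> R_val (coeff2 (f * g) i j))"
    by blast
qed

typedef tate = "{f. tate_series f}"
  using tate_series_0 by blast

setup_lifting type_definition_tate

lifting_forget fls.lifting

instantiation tate :: comm_ring_1
begin
lift_definition zero_tate :: tate is 0 by (rule tate_series_0)
lift_definition one_tate :: tate is 1 by (rule tate_series_1)
lift_definition plus_tate :: "tate \<Rightarrow> tate \<Rightarrow> tate" is "(+)" by (rule tate_series_add)
lift_definition minus_tate :: "tate \<Rightarrow> tate \<Rightarrow> tate" is "(-)" by (rule tate_series_diff)
lift_definition uminus_tate :: "tate \<Rightarrow> tate" is uminus by (rule tate_series_uminus)
lift_definition times_tate :: "tate \<Rightarrow> tate \<Rightarrow> tate" is "(*)" by (rule tate_series_mult)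
instance by standard (transfer; simp add: algebra_simps)+
end

lift_definition tate_coeff :: "tate \<Rightarrow> nat \<Rightarrow> nat \<Rightarrow> R" is coeff2 .
lift_definition tate_const :: "R \<Rightarrow> tate" is "\<lambda>r. fps_const (fps_const r)" by (rule tate_series_const)
lift_definition tate_z0 :: tate is fps_X by (rule tate_series_X)
lift_definition tate_z1 :: tate is "fps_const fps_X" by (rule tate_series_const_X)

definition tate_deg :: "int \<Rightarrow> tate \<Rightarrow> bool" where
  "tate_deg d f \<longleftrightarrow> (\<forall>i j. R_deg (d - 2 * int i - 2 * int j) (tate_coeff f i j))"

text \<open>
  The vector field $\partial_1 = \partial/\partial z_1$ on $\{z_0 z_1 = T\}$ with coordinate $z_1$
  satisfies $\partial_1 z_0 = -T z_1^{-2} = -T^{-1} z_0^2$. It is induced by the derivation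
  $\partial/\partial z_1 - T^{-1} z_0^2\, \partial/\partial z_0$ of the Tate algebra.
\<close>

lemma tate_series_deriv_z0:
  assumes "tate_series f"
  shows "tate_series (fps_deriv f)"
proof (rule tate_seriesI)
  fix N :: real
  obtain F where F: "finite F" "\<And>i j. (i, j) \<notin> F \<Longrightarrow> ereal N \<le> R_val (coeff2 f i j)"
    using tate_seriesD[OF assms] by blast
  have *: "coeff2 (fps_deriv f) i j = of_nat (Suc i) * coeff2 f (Suc i) j" for i j
    by (simp add: coeff2_def fps_of_nat[symmetric] flip: fps_const_add fps_const_mult)
      (simp add: algebra_simps)
  have "R_val (of_nat (Suc i)) = 0" for i
    by (simp add: R_val_def del: of_nat_Suc)
  then have "ereal N \<le> R_val (coeff2 (fps_deriv f) i j)" if "(Suc i, j) \<notin> F" for i j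
    using F(2)[OF that] by (simp add: * R_val_mult del: of_nat_Suc)
  moreover have "finite ((\<lambda>(i, j). (Suc i, j)) -` F)"
    using F(1) by (intro finite_vimageI) (auto simp: inj_def)
  ultimately show "\<exists>F. finite F \<and> (\<forall>i j. (i, j) \<notin> F \<longrightarrow> ereal N \<le> R_val (coeff2 (fps_deriv f) i j))"
    by (intro exI[of _ "(\<lambda>(i, j). (Suc i, j)) -` F"]) auto
qed

lemma tate_series_deriv_z1:
  assumes "tate_series f"
  shows "tate_series (Abs_fps (\<lambda>i. fps_deriv (fps_nth f i)))" (is "tate_series ?f")
proof (rule tate_seriesI)
  fix N :: real
  obtain F where F: "finite F" "\<And>i j. (i, j) \<notin> F \<Longrightarrow> ereal N \<le> R_val (coeff2 f i j)"
    using tate_seriesD[OF assms] by blast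
  have *: "coeff2 ?f i j = of_nat (Suc j) * coeff2 f i (Suc j)" for i j
    by (simp add: coeff2_def)
  have "R_val (of_nat (Suc i)) = 0" for i
    by (simp add: R_val_def del: of_nat_Suc)
  then have "ereal N \<le> R_val (coeff2 ?f i j)" if "(i, Suc j) \<notin> F" for i j
    using F(2)[OF that] by (simp add: * R_val_mult del: of_nat_Suc)
  moreover have "finite ((\<lambda>(i, j). (i, Suc j)) -` F)"
    using F(1) by (intro finite_vimageI) (auto simp: inj_def)
  ultimately show "\<exists>F. finite F \<and> (\<forall>i j. (i, j) \<notin> F \<longrightarrow> ereal N \<le> R_val (coeff2 ?f i j))"
    by (intro exI[of _ "(\<lambda>(i, j). (i, Suc j)) -` F"]) auto
qed

lift_definition tate_deriv0 :: "tate \<Rightarrow> tate" is fps_deriv by (rule tate_series_deriv_z0)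
lift_definition tate_deriv1 :: "tate \<Rightarrow> tate" is "\<lambda>f. Abs_fps (\<lambda>i. fps_deriv (fps_nth f i))"
  by (rule tate_series_deriv_z1)

definition tate_d1 :: "tate \<Rightarrow> tate" where
  "tate_d1 f = tate_deriv1 f - tate_const (inverse T) * tate_z0\<^sup>2 * tate_deriv0 f"

lemma tate_deriv0_diff: "tate_deriv0 (f - g) = tate_deriv0 f - tate_deriv0 g"
  by transfer simp

lemma tate_deriv1_diff: "tate_deriv1 (f - g) = tate_deriv1 f - tate_deriv1 g"
  by transfer (simp add: fps_eq_iff algebra_simps)

lemma tate_deriv0_mult: "tate_deriv0 (f * g) = f * tate_deriv0 g + tate_deriv0 f * g"
  by transfer simp

lemma tate_deriv1_mult: "tate_deriv1 (f * g) = f * tate_deriv1 g + tate_deriv1 f * g"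
  by transfer (rule fps_ext, simp add: fps_mult_nth fps_deriv_sum sum.distrib)

lemma tate_deriv_gens:
  "tate_deriv0 (tate_const r) = 0" "tate_deriv1 (tate_const r) = 0"
  "tate_deriv0 tate_z0 = 1" "tate_deriv1 tate_z0 = 0"
  "tate_deriv0 tate_z1 = 0" "tate_deriv1 tate_z1 = 1"
  by (transfer, simp add: fps_eq_iff fps_X_def)+

lemma tate_const_mult: "tate_const r * tate_const r' = tate_const (r * r')"
  by transfer simp

lemma tate_const_1: "tate_const 1 = 1"
  by transfer simp

abbreviation tate_rel :: tate where "tate_rel \<equiv> tate_z0 * tate_z1 - tate_const T"

lemma tate_d1_rel: "tate_d1 tate_rel = - tate_const (inverse T) * tate_z0 * tate_rel"
proof -
  have 1: "tate_const (inverse T) * tate_const T = 1"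
    by (simp add: tate_const_mult tate_const_1)
  have "- tate_const (inverse T) * tate_z0 * tate_rel
      = (tate_const (inverse T) * tate_const T) * tate_z0
        - tate_const (inverse T) * tate_z0\<^sup>2 * tate_z1"
    by (simp add: algebra_simps power2_eq_square)
  then show ?thesis
    by (simp add: 1 tate_d1_def tate_deriv0_diff tate_deriv1_diff tate_deriv0_mult tate_deriv1_mult
        tate_deriv_gens)
qed

lemma tate_d1_diff: "tate_d1 (f - g) = tate_d1 f - tate_d1 g"
  by (simp add: tate_d1_def tate_deriv0_diff tate_deriv1_diff algebra_simps)

lemma tate_d1_mult: "tate_d1 (f * g) = f * tate_d1 g + tate_d1 f * g"
  by (simp add: tate_d1_def tate_deriv0_mult tate_deriv1_mult algebra_simps)

quotient_type S = tate / "\<lambda>f g. tate_rel dvd f - g"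
proof (rule equivpI)
  show "reflp (\<lambda>f g. tate_rel dvd f - g)" by (auto intro: reflpI)
  show "symp (\<lambda>f g. tate_rel dvd f - g)"
    by (rule sympI, subst minus_diff_eq[symmetric], simp only: dvd_minus_iff)
  show "transp (\<lambda>f g. tate_rel dvd f - g)"
    by (rule transpI) (use dvd_add in fastforce)
qed

lemma tate_rel_not_unit: "\<not> tate_rel dvd 0 - 1"
proof
  assume "tate_rel dvd 0 - 1"
  then obtain h where *: "0 - 1 = h * tate_rel" by (metis dvdE mult.commute)
  obtain B where B: "\<And>i j. ereal B \<le> R_val (tate_coeff h i j)"
    by (metis tate_series_bounded_below tate_coeff.rep_eq Rep_tate mem_Collect_eq)
  have coeff: "tate_coeff (h * tate_rel) i j
      = (if 0 < i \<and> 0 < j then tate_coeff h (i - 1) (j - 1) else 0) - T * tate_coeff h i j"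
    (is "?l = ?r") for i j
  proof -
    have "?l = tate_coeff (h * tate_z1 * tate_z0) i j - tate_coeff (tate_const T * h) i j"
      by (simp only: right_diff_distrib mult_ac) (transfer, simp)
    moreover have "tate_coeff (tate_const T * h) i j = T * tate_coeff h i j"
      by transfer (simp add: coeff2_def)
    moreover have "tate_coeff (h * tate_z1 * tate_z0) i j
        = (if 0 < i \<and> 0 < j then tate_coeff h (i - 1) (j - 1) else 0)"
      by transfer (auto simp: coeff2_def)
    ultimately show ?thesis by simp
  qed
  have diag: "tate_coeff h n n = inverse T ^ Suc n" for n
  proof (induction n)
    case 0
    have "tate_coeff (0 - 1) 0 0 = - 1" by transfer (simp add: coeff2_def)
    then have "T * tate_coeff h 0 0 = 1" using coeff[of 0 0] unfolding * by simp
    then have "inverse T * (T * tate_coeff h 0 0) = inverse T" by simp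
    then show ?case by (simp only: mult.assoc[symmetric]) simp
  next
    case (Suc n)
    have "tate_coeff (0 - 1) (Suc n) (Suc n) = 0" by transfer (simp add: coeff2_def)
    then have "T * tate_coeff h (Suc n) (Suc n) = tate_coeff h n n"
      using coeff[of "Suc n" "Suc n"] unfolding * by simp
    then have "inverse T * (T * tate_coeff h (Suc n) (Suc n)) = inverse T * inverse T ^ Suc n"
      using Suc by simp
    moreover have "inverse T * (T * tate_coeff h (Suc n) (Suc n)) = tate_coeff h (Suc n) (Suc n)"
      by (simp only: mult.assoc[symmetric]) simp
    ultimately show ?case by simp
  qed
  have "R_val (tate_coeff h n n) = ereal (- real (Suc n))" for n
  proof -
    have "inverse T ^ Suc n * T ^ Suc n = 1" by (simp flip: power_mult_distrib del: power_Suc power_mult)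
    then have "R_val (inverse T ^ Suc n) + R_val (T ^ Suc n) = R_val 1"
      by (metis R_val_mult)
    moreover have "R_val (T ^ Suc n) = ereal (real (Suc n))"
      by (simp add: R_val_def fls_subdegree_pow del: power_Suc)
    moreover have "R_val 1 = ereal 0"
      by (simp add: R_val_def)
    ultimately have "R_val (inverse T ^ Suc n) + ereal (real (Suc n)) = ereal 0"
      by metis
    then have "R_val (inverse T ^ Suc n) = ereal (- real (Suc n))"
      by (cases "R_val (inverse T ^ Suc n)") (simp_all del: power_Suc of_nat_Suc)
    then show ?thesis unfolding diag .
  qed
  then have "ereal B \<le> ereal (- real (Suc n))" for n
    using B[of n n] by simp
  then have "real n < - B" for n by (simp add: algebra_simps) (smt (verit))
  then show False using reals_Archimedean2[of "- B"] by (meson less_asym)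
qed

lifting_forget tate.lifting

instantiation S :: comm_ring_1
begin
lift_definition zero_S :: S is 0 .
lift_definition one_S :: S is 1 .
lift_definition plus_S :: "S \<Rightarrow> S \<Rightarrow> S" is "(+)"
proof -
  fix f g f' g' assume *: "tate_rel dvd f - g" "tate_rel dvd f' - g'"
  have "f + f' - (g + g') = (f - g) + (f' - g')" by simp
  then show "tate_rel dvd f + f' - (g + g')" using * by (simp only: dvd_add)
qed
lift_definition minus_S :: "S \<Rightarrow> S \<Rightarrow> S" is "(-)"
proof -
  fix f g f' g' assume *: "tate_rel dvd f - g" "tate_rel dvd f' - g'"
  have "f - f' - (g - g') = (f - g) - (f' - g')" by simp
  then show "tate_rel dvd f - f' - (g - g')" using * by (simp only: dvd_diff)
qed
lift_definition uminus_S :: "S \<Rightarrow> S" is uminus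
proof -
  fix f g assume *: "tate_rel dvd f - g"
  have "- f - - g = - (f - g)" by simp
  then show "tate_rel dvd - f - - g" using * by (simp only: dvd_minus_iff)
qed
lift_definition times_S :: "S \<Rightarrow> S \<Rightarrow> S" is "(*)"
proof -
  fix f g f' g' assume *: "tate_rel dvd f - g" "tate_rel dvd f' - g'"
  have "f * f' - g * g' = (f - g) * f' + g * (f' - g')" by (simp add: algebra_simps)
  then show "tate_rel dvd f * f' - g * g'" using * by (simp only: dvd_add dvd_mult dvd_mult2)
qed
instance
proof
  have eqI: "tate_rel dvd f - g" if "f = g" for f g
    using that by simp
  fix a b c :: S
  show "a + b + c = a + (b + c)" by transfer (rule eqI, simp add: algebra_simps)
  show "a + b = b + a" by transfer (rule eqI, simp add: algebra_simps)
  show "0 + a = a" by transfer (rule eqI, simp)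
  show "- a + a = 0" by transfer (rule eqI, simp)
  show "a - b = a + - b" by transfer (rule eqI, simp)
  show "a * b * c = a * (b * c)" by transfer (rule eqI, simp add: algebra_simps)
  show "a * b = b * a" by transfer (rule eqI, simp add: algebra_simps)
  show "1 * a = a" by transfer (rule eqI, simp)
  show "(a + b) * c = a * c + b * c" by transfer (rule eqI, simp add: algebra_simps)
  show "(0::S) \<noteq> 1"
    by transfer (rule tate_rel_not_unit)
qed
end


lemma tate_d1_cong:
  assumes "tate_rel dvd f - g"
  shows "tate_rel dvd tate_d1 f - tate_d1 g"
proof -
  obtain h where "f - g = tate_rel * h" using assms by (elim dvdE)
  then have "tate_d1 f - tate_d1 g = tate_d1 (tate_rel * h)" by (metis tate_d1_diff)
  then show ?thesis by (simp add: tate_d1_mult tate_d1_rel)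
qed

lift_definition S_const :: "R \<Rightarrow> S" is tate_const .
lift_definition z0 :: S is tate_z0 .
lift_definition z1 :: S is tate_z1 .
lift_definition S_d1 :: "S \<Rightarrow> S" is tate_d1 by (rule tate_d1_cong)

lemma z0_z1: "z0 * z1 = S_const T"
  by transfer simp

definition S_deg :: "int \<Rightarrow> S \<Rightarrow> bool" where
  "S_deg d F \<longleftrightarrow> (\<exists>f. tate_deg d f \<and> abs_S f = F)"

text \<open>
  Each element of $S$ has a unique representative $\sum_i c_{i0} z_0^i + \sum_{j>0} c_{0j} z_1^j$;
  orthogonality of the monomials means that $\nu_\zeta^S$ is the infimum of the valuations of its
  terms. The parameter is $\zeta=(\zeta_0,\zeta_1)$.
\<close>

definition S_normal :: "S \<Rightarrow> tate" where
  "S_normal F = (THE f. abs_S f = F \<and> (\<forall>i>0. \<forall>j>0. tate_coeff f i j = 0))"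

definition S_val :: "real \<times> real \<Rightarrow> S \<Rightarrow> ereal" where
  "S_val \<zeta> F = (INF (i, j). R_val (tate_coeff (S_normal F) i j)
      + ereal (real i * fst \<zeta> + real j * snd \<zeta>))"

definition zetas :: "(real \<times> real) set" where
  "zetas = {(\<zeta>\<^sub>0, \<zeta>\<^sub>1). 0 < \<zeta>\<^sub>0 \<and> 0 < \<zeta>\<^sub>1 \<and> \<zeta>\<^sub>0 + \<zeta>\<^sub>1 = 1}"

definition W :: S where "W = - z0 + z1"


section \<open>The Clifford algebra and the module $M$\<close>

text \<open>\<open>Cl a b c d\<close> stands for $a + b\,e_0 + c\,e_1 + d\,e_0e_1$.\<close>

datatype Cl = Cl (cl_1: S) (cl_e0: S) (cl_e1: S) (cl_e01: S)

instantiation Cl :: ring_1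
begin
definition "0 = Cl 0 0 0 0"
definition "1 = Cl 1 0 0 0"
definition "x + y = Cl (cl_1 x + cl_1 y) (cl_e0 x + cl_e0 y) (cl_e1 x + cl_e1 y) (cl_e01 x + cl_e01 y)"
definition "x - y = Cl (cl_1 x - cl_1 y) (cl_e0 x - cl_e0 y) (cl_e1 x - cl_e1 y) (cl_e01 x - cl_e01 y)"
definition "- x = Cl (- cl_1 x) (- cl_e0 x) (- cl_e1 x) (- cl_e01 x)"
definition "x * y = Cl
  (cl_1 x * cl_1 y - z0 * cl_e0 x * cl_e0 y + z1 * cl_e1 x * cl_e1 y + z0 * z1 * cl_e01 x * cl_e01 y)
  (cl_1 x * cl_e0 y + cl_e0 x * cl_1 y - z1 * cl_e1 x * cl_e01 y + z1 * cl_e01 x * cl_e1 y)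
  (cl_1 x * cl_e1 y + cl_e1 x * cl_1 y - z0 * cl_e0 x * cl_e01 y + z0 * cl_e01 x * cl_e0 y)
  (cl_1 x * cl_e01 y + cl_e01 x * cl_1 y + cl_e0 x * cl_e1 y - cl_e1 x * cl_e0 y)"
instance
  by standard
    (simp_all add: zero_Cl_def one_Cl_def plus_Cl_def minus_Cl_def uminus_Cl_def times_Cl_def algebra_simps)
end

lemmas Cl_defs = zero_Cl_def one_Cl_def plus_Cl_def minus_Cl_def uminus_Cl_def times_Cl_def

definition Cl_S :: "S \<Rightarrow> Cl" where "Cl_S F = Cl F 0 0 0"
definition e0 :: Cl where "e0 = Cl 0 1 0 0"
definition e1 :: Cl where "e1 = Cl 0 0 1 0"

lemma Cl_relations:
  "e0 * e0 = - Cl_S z0" "e1 * e1 = Cl_S z1" "e0 * e1 + e1 * e0 = 0"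
  "Cl a b c d = Cl_S a + Cl_S b * e0 + Cl_S c * e1 + Cl_S d * (e0 * e1)"
  by (simp_all add: e0_def e1_def Cl_S_def Cl_defs)

lemma Cl_S_hom:
  "Cl_S (F + G) = Cl_S F + Cl_S G" "Cl_S (F * G) = Cl_S F * Cl_S G" "Cl_S 1 = 1"
  "Cl_S F * x = x * Cl_S F"
  by (simp_all add: Cl_S_def Cl_defs mult_ac)

definition Cl_val :: "real \<times> real \<Rightarrow> Cl \<Rightarrow> ereal" where
  "Cl_val \<zeta> x = Min {S_val \<zeta> (cl_1 x), S_val \<zeta> (cl_e0 x) + ereal (fst \<zeta> / 2),
    S_val \<zeta> (cl_e1 x) + ereal (snd \<zeta> / 2), S_val \<zeta> (cl_e01 x) + ereal (fst \<zeta> / 2 + snd \<zeta> / 2)}"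

definition Cl_deg :: "int \<Rightarrow> Cl \<Rightarrow> bool" where
  "Cl_deg d x \<longleftrightarrow> S_deg d (cl_1 x) \<and> S_deg (d - 1) (cl_e0 x) \<and> S_deg (d - 1) (cl_e1 x)
    \<and> S_deg (d - 2) (cl_e01 x)"

abbreviation Cl_rel :: Cl where "Cl_rel \<equiv> e0 * e1 - Cl_S (S_const T_half)"

lemma Cl_rel_annihilated: "Cl_rel * (e0 * e1 + Cl_S (S_const T_half)) = 0"
proof -
  have "S_const T_half * S_const T_half = z0 * z1"
    unfolding z0_z1 by transfer (simp add: tate_const_mult power2_eq_square)
  then show ?thesis
    by (simp add: e0_def e1_def Cl_S_def Cl_defs)
qed

quotient_type M = Cl / "\<lambda>x y. \<exists>u. x - y = u * Cl_rel"
proof (rule equivpI)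
  show "reflp (\<lambda>x y. \<exists>u. x - y = u * Cl_rel)"
    by (auto intro!: reflpI exI[of _ 0])
  show "symp (\<lambda>x y. \<exists>u. x - y = u * Cl_rel)"
  proof (rule sympI)
    fix x y assume "\<exists>u. x - y = u * Cl_rel"
    then obtain u where *: "x - y = u * Cl_rel" by blast
    have "y - x = - (x - y)" by simp
    also have "\<dots> = (- u) * Cl_rel" unfolding * by (rule mult_minus_left[symmetric])
    finally show "\<exists>u. y - x = u * Cl_rel" by blast
  qed
  show "transp (\<lambda>x y. \<exists>u. x - y = u * Cl_rel)"
  proof (rule transpI)
    fix x y z assume "\<exists>u. x - y = u * Cl_rel" "\<exists>u. y - z = u * Cl_rel"
    then obtain u v where *: "x - y = u * Cl_rel" "y - z = v * Cl_rel" by blast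
    have "x - z = (x - y) + (y - z)" by simp
    also have "\<dots> = (u + v) * Cl_rel" unfolding * by (rule distrib_right[symmetric])
    finally show "\<exists>u. x - z = u * Cl_rel" by blast
  qed
qed

instantiation M :: ab_group_add
begin
lift_definition zero_M :: M is 0 .
lift_definition plus_M :: "M \<Rightarrow> M \<Rightarrow> M" is "(+)"
proof -
  fix x y x' y' assume "\<exists>u. x - y = u * Cl_rel" "\<exists>u. x' - y' = u * Cl_rel"
  then obtain u u' where *: "x - y = u * Cl_rel" "x' - y' = u' * Cl_rel" by blast
  have "(x + x') - (y + y') = (x - y) + (x' - y')" by simp
  also have "\<dots> = (u + u') * Cl_rel" unfolding * by (rule distrib_right[symmetric])
  finally show "\<exists>u. (x + x') - (y + y') = u * Cl_rel" by blast
qed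
lift_definition minus_M :: "M \<Rightarrow> M \<Rightarrow> M" is "(-)"
proof -
  fix x y x' y' assume "\<exists>u. x - y = u * Cl_rel" "\<exists>u. x' - y' = u * Cl_rel"
  then obtain u u' where *: "x - y = u * Cl_rel" "x' - y' = u' * Cl_rel" by blast
  have "(x - x') - (y - y') = (x - y) - (x' - y')" by simp
  also have "\<dots> = (u - u') * Cl_rel" unfolding * by (rule left_diff_distrib[symmetric])
  finally show "\<exists>u. (x - x') - (y - y') = u * Cl_rel" by blast
qed
lift_definition uminus_M :: "M \<Rightarrow> M" is uminus
proof -
  fix x y assume "\<exists>u. x - y = u * Cl_rel"
  then obtain u where *: "x - y = u * Cl_rel" by blast
  have "- x - - y = - (x - y)" by simp
  also have "\<dots> = (- u) * Cl_rel" unfolding * by (rule mult_minus_left[symmetric])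
  finally show "\<exists>u. - x - - y = u * Cl_rel" by blast
qed
instance
proof
  have eqI: "\<exists>u. x - y = u * Cl_rel" if "x = y" for x y
    using that by (auto intro!: exI[of _ 0])
  fix a b c :: M
  show "a + b + c = a + (b + c)" by transfer (rule eqI, simp add: algebra_simps)
  show "a + b = b + a" by transfer (rule eqI, simp add: algebra_simps)
  show "0 + a = a" by transfer (rule eqI, simp)
  show "- a + a = 0" by transfer (rule eqI, simp)
  show "a - b = a + - b" by transfer (rule eqI, simp)
qed
end

lift_definition M_act :: "Cl \<Rightarrow> M \<Rightarrow> M" is "(*)"
proof -
  fix a x y assume "\<exists>u. x - y = u * Cl_rel"
  then obtain u where *: "x - y = u * Cl_rel" by blast
  have "a * x - a * y = a * (x - y)" by (rule right_diff_distrib[symmetric])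
  also have "\<dots> = (a * u) * Cl_rel" unfolding * by (rule mult.assoc[symmetric])
  finally show "\<exists>u. a * x - a * y = u * Cl_rel" by blast
qed

definition M_scale :: "S \<Rightarrow> M \<Rightarrow> M" where "M_scale F m = M_act (Cl_S F) m"

lemma M_act_simps:
  "M_act x (m + m') = M_act x m + M_act x m'" "M_act (x + y) m = M_act x m + M_act y m"
  "M_act (x * y) m = M_act x (M_act y m)" "M_act 1 m = m"
  by (transfer, rule exI[of _ 0], simp add: algebra_simps)+

text \<open>The $S$-basis $1, e_1$ of $M$, indexed by the two elements \<open>1\<close>, \<open>2\<close> of type \<open>2\<close>.\<close>

definition M_basis :: "2 \<Rightarrow> M" where
  "M_basis i = (if i = 1 then abs_M 1 else abs_M e1)"

definition M_coord :: "M \<Rightarrow> S ^ 2" where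
  "M_coord m = (THE v. m = (\<Sum>i\<in>UNIV. M_scale (v $ i) (M_basis i)))"

definition M_val :: "real \<times> real \<Rightarrow> M \<Rightarrow> ereal" where
  "M_val \<zeta> m = (SUP x\<in>{x. abs_M x = m}. Cl_val \<zeta> x)"

definition M_deg :: "int \<Rightarrow> M \<Rightarrow> bool" where
  "M_deg d m \<longleftrightarrow> (\<exists>x. Cl_deg d x \<and> abs_M x = m)"


section \<open>Endomorphisms of $M$\<close>

typedef End_M = "{\<Phi> :: M \<Rightarrow> M. (\<forall>m m'. \<Phi> (m + m') = \<Phi> m + \<Phi> m')
    \<and> (\<forall>F m. \<Phi> (M_scale F m) = M_scale F (\<Phi> m))}"
  morphisms End_apply Abs_End_M
  by (rule exI[of _ "\<lambda>m. m"]) simp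

setup_lifting type_definition_End_M

lemma M_scale_hom:
  "M_scale F (m + m') = M_scale F m + M_scale F m'"
  by (simp add: M_scale_def M_act_simps)

lemma M_scale_0: "M_scale F 0 = 0"
  using M_scale_hom[of F 0 0] by simp

lemma M_scale_minus: "M_scale F (- m) = - M_scale F m"
  using M_scale_hom[of F m "- m"] M_scale_0 by (simp add: eq_neg_iff_add_eq_0 add.commute)

lemma M_scale_diff: "M_scale F (m - m') = M_scale F m - M_scale F m'"
  using M_scale_hom[of F "m - m'" m'] by (simp add: algebra_simps)

lemma M_nontrivial: "abs_M 1 \<noteq> 0"
proof
  assume "abs_M 1 = 0"
  then obtain u where "1 = u * Cl_rel"
    unfolding zero_M_def M.abs_eq_iff by auto
  then have "e0 * e1 + Cl_S (S_const T_half) = u * (Cl_rel * (e0 * e1 + Cl_S (S_const T_half)))"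
    by (metis mult.assoc mult_1_left)
  then have "e0 * e1 + Cl_S (S_const T_half) = 0"
    unfolding Cl_rel_annihilated by simp
  then show False by (simp add: e0_def e1_def Cl_S_def Cl_defs)
qed

instantiation End_M :: ring_1
begin
lift_definition zero_End_M :: End_M is "\<lambda>m. 0" by (simp add: M_scale_0)
lift_definition one_End_M :: End_M is "\<lambda>m. m" by simp
lift_definition plus_End_M :: "End_M \<Rightarrow> End_M \<Rightarrow> End_M" is "\<lambda>\<Phi> \<Psi> m. \<Phi> m + \<Psi> m"
  by (simp add: M_scale_hom)
lift_definition uminus_End_M :: "End_M \<Rightarrow> End_M" is "\<lambda>\<Phi> m. - \<Phi> m"
  by (simp add: M_scale_minus)
lift_definition minus_End_M :: "End_M \<Rightarrow> End_M \<Rightarrow> End_M" is "\<lambda>\<Phi> \<Psi> m. \<Phi> m - \<Psi> m"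
  by (simp add: M_scale_diff)
lift_definition times_End_M :: "End_M \<Rightarrow> End_M \<Rightarrow> End_M" is "\<lambda>\<Phi> \<Psi> m. \<Phi> (\<Psi> m)"
  by simp
instance
proof
  fix a b c :: End_M
  show "a * b * c = a * (b * c)" "a + b + c = a + (b + c)" "a + b = b + a" "0 + a = a"
    "- a + a = 0" "a - b = a + - b" "1 * a = a" "a * 1 = a"
    "(a + b) * c = a * c + b * c" "a * (b + c) = a * b + a * c"
    by (transfer, simp add: fun_eq_iff algebra_simps)+
  show "(0::End_M) \<noteq> 1"
    by transfer (metis M_nontrivial)
qed
end

lift_definition End_act :: "Cl \<Rightarrow> End_M" is M_act
  by (simp add: M_act_simps M_scale_def flip: M_act_simps(3)) (simp add: Cl_S_hom(4))

definition End_const :: "R \<Rightarrow> End_M" where "End_const r = End_act (Cl_S (S_const r))"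

definition D :: End_M where "D = End_act (e0 + e1)"

definition End_val :: "End_M \<Rightarrow> ereal" where
  "End_val \<Phi> = (INF \<zeta>\<in>zetas. INF m\<in>- {0}. M_val \<zeta> (End_apply \<Phi> m) - M_val \<zeta> m)"

definition End_deg :: "int \<Rightarrow> End_M \<Rightarrow> bool" where
  "End_deg d \<Phi> \<longleftrightarrow> (\<forall>k m. M_deg k m \<longrightarrow> M_deg (k + d) (End_apply \<Phi> m))"

definition matrix_of :: "End_M \<Rightarrow> S ^ 2 ^ 2" where
  "matrix_of \<Phi> = (\<chi> i j. M_coord (End_apply \<Phi> (M_basis j)) $ i)"


section \<open>Adjoining $s$\<close>

text \<open>
  Elements of the completed tensor products with $\mathbb R[[s]]$ are power series in $s$ whose
  terms have valuations tending to infinity. The variable $s$ is \<^term>\<open>fps_X\<close>, of degree $0$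
  and valuation $1$.
\<close>

definition Rs_val :: "R fps \<Rightarrow> ereal" where
  "Rs_val c = (INF i. ereal (real i) + R_val (fps_nth c i))"

definition Rs :: "R fps set" where
  "Rs = {c. (\<lambda>i. ereal (real i) + R_val (fps_nth c i)) \<longlonglongrightarrow> \<infinity>}"

definition Rs_deg :: "int \<Rightarrow> R fps \<Rightarrow> bool" where
  "Rs_deg d c \<longleftrightarrow> (\<forall>i. R_deg d (fps_nth c i))"

definition Ends_val :: "End_M fps \<Rightarrow> ereal" where
  "Ends_val \<Phi> = (INF i. ereal (real i) + End_val (fps_nth \<Phi> i))"

definition Ends :: "End_M fps set" where
  "Ends = {\<Phi>. (\<lambda>i. ereal (real i) + End_val (fps_nth \<Phi> i)) \<longlonglongrightarrow> \<infinity>}"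

definition Ends_deg :: "int \<Rightarrow> End_M fps \<Rightarrow> bool" where
  "Ends_deg d \<Phi> \<longleftrightarrow> (\<forall>i. End_deg d (fps_nth \<Phi> i))"

text \<open>$c \mapsto c\cdot\mathrm{id}$\<close>

definition Rs_id :: "R fps \<Rightarrow> End_M fps" where
  "Rs_id c = Abs_fps (\<lambda>i. End_const (fps_nth c i))"

definition psign :: "int \<Rightarrow> 'a::ring_1" where
  "psign d = (if even d then 1 else - 1)"

text \<open>The differential on elements of degree $d$.\<close>

definition delta :: "int \<Rightarrow> End_M fps \<Rightarrow> End_M fps" where
  "delta d \<Phi> = fps_const D * \<Phi> - psign d * \<Phi> * fps_const D"

definition MC_hat :: "R fps \<Rightarrow> End_M fps set" where
  "MC_hat c = {b \<in> Ends. c \<in> Rs \<and> Rs_deg 2 c \<and> 0 < Rs_val c \<and>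
     Ends_deg 1 b \<and> 0 < Ends_val b \<and> delta 1 b - b ^ 2 = Rs_id c}"


section \<open>The cyclic complex\<close>

text \<open>
  A letter is a homogeneous element of \<^term>\<open>Ends\<close> together with its degree; the word
  $[a_l,\dots,a_1]$ stands for $a_l\otimes\cdots\otimes a_1$, so that $a_l$ is the head of the list.
  The algebraic tensor products over $R^s$ are spanned by words subject to additivity in each letter
  and to balancing of scalars. Homogeneous elements are dense, so homogeneous letters and scalars
  suffice for the completed tensor products.
\<close>

type_synonym letter = "int \<times> End_M fps"
type_synonym chain = "letter list \<Rightarrow>\<^sub>0 int"

definition letters :: "letter set" where
  "letters = {(d, a). a \<in> Ends \<and> Ends_deg d a}"

definition words :: "letter list set" where
  "words = {w. w \<noteq> [] \<and> set w \<subseteq> letters}"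

definition word_val :: "letter list \<Rightarrow> ereal" where
  "word_val w = (\<Sum>x\<leftarrow>w. Ends_val (snd x))"

definition word_chains :: "chain set" where
  "word_chains = {x. Poly_Mapping.keys x \<subseteq> words}"

text \<open>
  Representatives of the elements of tensor valuation at least $N$: the subgroup of the free abelian
  group generated by the tensor product relations and the words of valuation at least $N$. (A
  nonzero homogeneous element of $R^s$ has even degree, hence contributes no signs.)
\<close>

inductive_set small :: "real \<Rightarrow> chain set" for N :: real where
  zero: "0 \<in> small N"
| diff: "x \<in> small N \<Longrightarrow> y \<in> small N \<Longrightarrow> x - y \<in> small N"
| short: "w \<in> words \<Longrightarrow> ereal N \<le> word_val w \<Longrightarrow> frag_of w \<in> small N"
| additive: "u @ (d, a) # v \<in> words \<Longrightarrow> u @ (d, a') # v \<in> words \<Longrightarrow> u @ (d, a + a') # v \<in> words \<Longrightarrow>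
    frag_of (u @ (d, a + a') # v) - frag_of (u @ (d, a) # v) - frag_of (u @ (d, a') # v) \<in> small N"
| balanced: "r \<in> Rs \<Longrightarrow> Rs_deg e r \<Longrightarrow> even e \<Longrightarrow>
    u @ (d + e, Rs_id r * a) # v @ (d', a') # w \<in> words \<Longrightarrow>
    u @ (d, a) # v @ (d' + e, Rs_id r * a') # w \<in> words \<Longrightarrow>
    frag_of (u @ (d + e, Rs_id r * a) # v @ (d', a') # w)
      - frag_of (u @ (d, a) # v @ (d' + e, Rs_id r * a') # w) \<in> small N"

lemma small_uminus: "x \<in> small N \<Longrightarrow> - x \<in> small N"
  using small.diff[OF small.zero] by fastforce

lemma small_add: "x \<in> small N \<Longrightarrow> y \<in> small N \<Longrightarrow> x + y \<in> small N"
  using small.diff[of x N "- y"] small_uminus by fastforce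

definition cauchy_chain :: "(nat \<Rightarrow> chain) \<Rightarrow> bool" where
  "cauchy_chain X \<longleftrightarrow> (\<forall>n. X n \<in> word_chains) \<and> (\<forall>N. \<exists>n0. \<forall>m\<ge>n0. \<forall>n\<ge>n0. X m - X n \<in> small N)"

definition null_chain :: "(nat \<Rightarrow> chain) \<Rightarrow> bool" where
  "null_chain X \<longleftrightarrow> (\<forall>N. \<exists>n0. \<forall>n\<ge>n0. X n \<in> small N)"

lemma chains_diff: "x \<in> word_chains \<Longrightarrow> y \<in> word_chains \<Longrightarrow> x - y \<in> word_chains"
  unfolding word_chains_def using keys_diff[of x y] by blast

lemma chains_0: "0 \<in> word_chains"
  by (simp add: word_chains_def)

lemma null_chain_0: "null_chain (\<lambda>n. 0)"
  by (simp add: null_chain_def small.zero)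

lemma null_chain_diff: "null_chain X \<Longrightarrow> null_chain Y \<Longrightarrow> null_chain (\<lambda>n. X n - Y n)"
  unfolding null_chain_def
proof
  fix N
  assume "\<forall>N. \<exists>n0. \<forall>n\<ge>n0. X n \<in> small N" "\<forall>N. \<exists>n0. \<forall>n\<ge>n0. Y n \<in> small N"
  then obtain p q where "\<forall>n\<ge>p. X n \<in> small N" "\<forall>n\<ge>q. Y n \<in> small N" by meson
  then show "\<exists>n0. \<forall>n\<ge>n0. X n - Y n \<in> small N"
    by (intro exI[of _ "max p q"]) (auto intro: small.diff)
qed

lemma null_chain_uminus: "null_chain X \<Longrightarrow> null_chain (\<lambda>n. - X n)"
  using null_chain_diff[OF null_chain_0] by fastforce

lemma null_chain_add: "null_chain X \<Longrightarrow> null_chain Y \<Longrightarrow> null_chain (\<lambda>n. X n + Y n)"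
  using null_chain_diff[of X "\<lambda>n. - Y n"] null_chain_uminus by fastforce

lemma cauchy_chain_0: "cauchy_chain (\<lambda>n. 0)"
  by (simp add: cauchy_chain_def chains_0 small.zero)

lemma cauchy_chain_diff:
  assumes "cauchy_chain X" "cauchy_chain Y"
  shows "cauchy_chain (\<lambda>n. X n - Y n)"
  unfolding cauchy_chain_def
proof (intro conjI allI)
  show "X n - Y n \<in> word_chains" for n
    using assms by (simp add: cauchy_chain_def chains_diff)
  fix N
  obtain p q where "\<forall>m\<ge>p. \<forall>n\<ge>p. X m - X n \<in> small N" "\<forall>m\<ge>q. \<forall>n\<ge>q. Y m - Y n \<in> small N"
    using assms unfolding cauchy_chain_def by meson
  then have "\<forall>m\<ge>max p q. \<forall>n\<ge>max p q. (X m - X n) - (Y m - Y n) \<in> small N"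
    by (auto intro: small.diff)
  then show "\<exists>n0. \<forall>m\<ge>n0. \<forall>n\<ge>n0. X m - Y m - (X n - Y n) \<in> small N"
    by (intro exI[of _ "max p q"]) (simp add: algebra_simps)
qed

lemma cauchy_chain_uminus: "cauchy_chain X \<Longrightarrow> cauchy_chain (\<lambda>n. - X n)"
  using cauchy_chain_diff[OF cauchy_chain_0] by fastforce

lemma cauchy_chain_add: "cauchy_chain X \<Longrightarrow> cauchy_chain Y \<Longrightarrow> cauchy_chain (\<lambda>n. X n + Y n)"
  using cauchy_chain_diff[of X "\<lambda>n. - Y n"] cauchy_chain_uminus by fastforce

text \<open>$C_*$, the completion of the direct sum of the tensor products for the tensor valuation.\<close>

quotient_type C_cyc = "nat \<Rightarrow> chain" / partial:
  "\<lambda>X Y. cauchy_chain X \<and> cauchy_chain Y \<and> null_chain (\<lambda>n. X n - Y n)"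
proof (rule part_equivpI)
  show "\<exists>X. cauchy_chain X \<and> cauchy_chain X \<and> null_chain (\<lambda>n. X n - X n)"
    using cauchy_chain_0 null_chain_0 by auto
  show "symp (\<lambda>X Y. cauchy_chain X \<and> cauchy_chain Y \<and> null_chain (\<lambda>n. X n - Y n))"
    by (rule sympI) (use null_chain_uminus in fastforce)
  show "transp (\<lambda>X Y. cauchy_chain X \<and> cauchy_chain Y \<and> null_chain (\<lambda>n. X n - Y n))"
    by (rule transpI) (use null_chain_add in fastforce)
qed

instantiation C_cyc :: ab_group_add
begin
lift_definition zero_C_cyc :: C_cyc is "\<lambda>n. 0"
  by (simp add: cauchy_chain_0 null_chain_0)
lift_definition plus_C_cyc :: "C_cyc \<Rightarrow> C_cyc \<Rightarrow> C_cyc" is "\<lambda>X Y n. X n + Y n"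
  by (auto intro: cauchy_chain_add simp: add_diff_add intro!: null_chain_add)
lift_definition minus_C_cyc :: "C_cyc \<Rightarrow> C_cyc \<Rightarrow> C_cyc" is "\<lambda>X Y n. X n - Y n"
  using null_chain_diff by (fastforce intro: cauchy_chain_diff simp: algebra_simps)
lift_definition uminus_C_cyc :: "C_cyc \<Rightarrow> C_cyc" is "\<lambda>X n. - X n"
  using null_chain_uminus by (fastforce intro: cauchy_chain_uminus)
instance
  by standard
    (transfer; simp add: algebra_simps cauchy_chain_add cauchy_chain_diff cauchy_chain_uminus
      cauchy_chain_0 null_chain_0)+
end

text \<open>Below, $|sa| = |a| - 1$ and \<open>sdeg [a_l, \<dots>, a_i]\<close> is $\epsilon_i$.\<close>

definition sdeg :: "letter list \<Rightarrow> int" where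
  "sdeg w = (\<Sum>x\<leftarrow>w. fst x - 1)"

fun t_word :: "letter list \<Rightarrow> chain" where
  "t_word [] = 0"
| "t_word (x # w) = frag_cmul (psign ((fst x - 1) * sdeg w)) (frag_of (w @ [x]))"

definition t_chain :: "chain \<Rightarrow> chain" where
  "t_chain = frag_extend t_word"

lemma t_chain_diff: "t_chain (x - y) = t_chain x - t_chain y"
  by (simp add: t_chain_def frag_extend_diff)

lemma t_chain_of: "t_chain (frag_of w) = t_word w"
  by (simp add: t_chain_def)

lemma t_word_chains: "w \<in> words \<Longrightarrow> t_word w \<in> word_chains"
  by (cases w) (auto simp: words_def word_chains_def)

lemma t_chain_chains: "x \<in> word_chains \<Longrightarrow> t_chain x \<in> word_chains"
proof -
  assume "x \<in> word_chains"
  then have "Poly_Mapping.keys x \<subseteq> words" by (simp add: word_chains_def)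
  then show ?thesis
    by (induction x rule: frag_induction)
      (simp_all add: t_chain_of t_word_chains t_chain_diff chains_diff, simp add: t_chain_def chains_0)
qed

lemma frag_cmul_diff: "frag_cmul k (x - y) = frag_cmul k x - frag_cmul k y"
  by (simp add: poly_mapping_eqI lookup_minus right_diff_distrib)

lemma psign_cmul_small:
  assumes "x \<in> small N"
  shows "frag_cmul (psign d) x \<in> small N"
  using assms small_uminus[OF assms] by (auto simp: psign_def)

lemma sdeg_simps [simp]: "sdeg [] = 0" "sdeg (x # w) = fst x - 1 + sdeg w" "sdeg (u @ v) = sdeg u + sdeg v"
  by (simp_all add: sdeg_def)

lemma words_rotate: "x # v \<in> words \<Longrightarrow> v @ [x] \<in> words"
  by (auto simp: words_def)

lemma t_chain_small: "x \<in> small N \<Longrightarrow> t_chain x \<in> small N"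
proof (induction rule: small.induct)
  case zero
  show ?case by (simp add: t_chain_def small.zero)
next
  case (diff x y)
  then show ?case by (simp add: t_chain_diff small.diff)
next
  case (short w)
  then obtain x v where w: "w = x # v" by (cases w) (auto simp: words_def)
  have "frag_of (v @ [x]) \<in> small N"
    using short by (intro small.short) (auto simp: w words_def word_val_def add.commute)
  then show ?case by (simp add: t_chain_of w psign_cmul_small)
next
  case (additive u d a v a')
  show ?case
  proof (cases u)
    case Nil
    have "frag_of (v @ (d, a + a') # []) - frag_of (v @ (d, a) # []) - frag_of (v @ (d, a') # []) \<in> small N"
      using additive words_rotate unfolding Nil by (intro small.additive) auto
    then show ?thesis
      using psign_cmul_small by (fastforce simp: Nil t_chain_diff t_chain_of simp flip: frag_cmul_diff)
  next
    case (Cons x u')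
    have "frag_of (u' @ (d, a + a') # (v @ [x])) - frag_of (u' @ (d, a) # (v @ [x]))
        - frag_of (u' @ (d, a') # (v @ [x])) \<in> small N"
      using additive words_rotate unfolding Cons by (intro small.additive) fastforce+
    then show ?thesis
      using psign_cmul_small by (fastforce simp: Cons t_chain_diff t_chain_of simp flip: frag_cmul_diff)
  qed
next
  case (balanced r e u d a v d' a' w)
  show ?case
  proof (cases u)
    case Nil
    have "frag_of (v @ (d' + e, Rs_id r * a') # w @ (d, a) # [])
        - frag_of (v @ (d', a') # w @ (d + e, Rs_id r * a) # []) \<in> small N"
      using balanced words_rotate unfolding Nil by (intro small.balanced) fastforce+
    then have *: "frag_of (v @ (d', a') # w @ (d + e, Rs_id r * a) # [])
        - frag_of (v @ (d' + e, Rs_id r * a') # w @ (d, a) # []) \<in> small N"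
      using small_uminus by fastforce
    have "psign ((d + e - 1) * (sdeg v + (d' - 1 + sdeg w)))
        = (psign ((d - 1) * (sdeg v + (d' + e - 1 + sdeg w))) :: int)"
      using \<open>even e\<close> by (simp add: psign_def)
    then show ?thesis
      using psign_cmul_small[OF *]
      by (simp add: Nil t_chain_diff t_chain_of flip: frag_cmul_diff)
  next
    case (Cons x u')
    have *: "frag_of (u' @ (d + e, Rs_id r * a) # v @ (d', a') # (w @ [x]))
        - frag_of (u' @ (d, a) # v @ (d' + e, Rs_id r * a') # (w @ [x])) \<in> small N"
      using balanced words_rotate unfolding Cons by (intro small.balanced) fastforce+
    have "psign ((fst x - 1) * (sdeg u' + (d + e - 1 + (sdeg v + (d' - 1 + sdeg w)))))
        = (psign ((fst x - 1) * (sdeg u' + (d - 1 + (sdeg v + (d' + e - 1 + sdeg w))))) :: int)"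
      using \<open>even e\<close> by (simp add: psign_def)
    then show ?thesis
      using psign_cmul_small[OF *]
      by (simp add: Cons t_chain_diff t_chain_of flip: frag_cmul_diff)
  qed
qed

lemma t_chain_cauchy: "cauchy_chain X \<Longrightarrow> cauchy_chain (\<lambda>n. t_chain (X n))"
  unfolding cauchy_chain_def by (metis t_chain_chains t_chain_diff t_chain_small)

lemma t_chain_null: "null_chain X \<Longrightarrow> null_chain (\<lambda>n. t_chain (X n))"
  unfolding null_chain_def by (metis t_chain_small)

lift_definition t_cyc :: "C_cyc \<Rightarrow> C_cyc" is "\<lambda>X n. t_chain (X n)"
  using t_chain_null by (fastforce simp: t_chain_cauchy t_chain_diff)

lemma t_cyc_diff: "t_cyc (x - y) = t_cyc x - t_cyc y"
  by transfer (simp add: t_chain_diff t_chain_cauchy cauchy_chain_diff null_chain_0)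

text \<open>$C^\lambda_* = C_*/\mathrm{Im}(\mathrm{id} - t)$\<close>

quotient_type C_lam = C_cyc / "\<lambda>x y. x - y \<in> range (\<lambda>z. z - t_cyc z)"
proof (rule equivpI)
  have diff: "x - y \<in> range (\<lambda>z. z - t_cyc z)"
    if x: "x \<in> range (\<lambda>z. z - t_cyc z)" and y: "y \<in> range (\<lambda>z. z - t_cyc z)" for x y
  proof -
    obtain p where "x = p - t_cyc p" using x by blast
    moreover obtain q where "y = q - t_cyc q" using y by blast
    ultimately have "x - y = (p - q) - t_cyc (p - q)" by (simp add: t_cyc_diff algebra_simps)
    then show ?thesis by blast
  qed
  have zero: "0 \<in> range (\<lambda>z. z - t_cyc z)"
    by (rule range_eqI[of _ _ 0]) (metis diff_self t_cyc_diff)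
  show "reflp (\<lambda>x y. x - y \<in> range (\<lambda>z. z - t_cyc z))"
    using zero by (auto intro: reflpI)
  show "symp (\<lambda>x y. x - y \<in> range (\<lambda>z. z - t_cyc z))"
    by (rule sympI) (metis diff zero diff_0 minus_diff_eq)
  show "transp (\<lambda>x y. x - y \<in> range (\<lambda>z. z - t_cyc z))"
  proof (rule transpI)
    fix x y z
    assume *: "x - y \<in> range (\<lambda>z. z - t_cyc z)" "y - z \<in> range (\<lambda>z. z - t_cyc z)"
    have "x - z = (x - y) - (0 - (y - z))" by simp
    then show "x - z \<in> range (\<lambda>z. z - t_cyc z)" using diff[OF *(1) diff[OF zero *(2)]] by metis
  qed
qed

lift_definition C_lam_diff :: "C_lam \<Rightarrow> C_lam \<Rightarrow> C_lam" is "(-)"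
proof -
  fix x y x' y'
  assume "x - y \<in> range (\<lambda>z. z - t_cyc z)" "x' - y' \<in> range (\<lambda>z. z - t_cyc z)"
  then obtain p q where *: "x - y = p - t_cyc p" "x' - y' = q - t_cyc q" by (elim rangeE) blast
  have "(x - x') - (y - y') = (x - y) - (x' - y')" by simp
  also have "\<dots> = (p - q) - t_cyc (p - q)" unfolding * by (simp add: t_cyc_diff algebra_simps)
  finally show "(x - x') - (y - y') \<in> range (\<lambda>z. z - t_cyc z)" by blast
qed

instantiation C_lam :: minus
begin
definition minus_C_lam :: "C_lam \<Rightarrow> C_lam \<Rightarrow> C_lam" where "minus_C_lam = C_lam_diff"
instance ..
end

text \<open>
  In the sums defining $d_{cc}$, the position \<open>p\<close> in the list carries the letter $a_{l-p}$, so that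
  \<open>sdeg (take p w)\<close> is $\epsilon_{l-p+1}$; for \<open>p = 0\<close> it vanishes.
\<close>

definition b_mu1 :: "letter list \<Rightarrow> chain" where
  "b_mu1 w = (\<Sum>p<length w. frag_cmul (psign (sdeg (take p w)))
     (frag_of (w[p := (fst (w ! p) + 1, delta (fst (w ! p)) (snd (w ! p)))])))"

definition letter_mult :: "letter \<Rightarrow> letter \<Rightarrow> letter" where
  "letter_mult x y = (fst x + fst y, snd x * snd y)"

definition b_mu2 :: "letter list \<Rightarrow> chain" where
  "b_mu2 w = (if length w < 2 then 0 else
     frag_cmul (psign (fst (w ! 0))) (frag_of (letter_mult (w ! 0) (w ! 1) # drop 2 w))
     - (\<Sum>p=1..<length w - 1. frag_cmul (psign (sdeg (take (p + 1) w)))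
         (frag_of (take p w @ letter_mult (w ! p) (w ! (p + 1)) # drop (p + 2) w)))
     - frag_cmul (psign ((fst (last w) - 1) * (sdeg (butlast w) + 1)))
         (frag_of (letter_mult (last w) (hd w) # tl (butlast w))))"

definition d_chain :: "chain \<Rightarrow> chain" where
  "d_chain = frag_extend (\<lambda>w. b_mu1 w + b_mu2 w)"

text \<open>
  Since $\nu(D) \ge 0$, the map \<^term>\<open>d_chain\<close> does not decrease valuations, and it preserves the
  image of $\mathrm{id}-t$; hence the following do not depend on representatives.
\<close>

definition d_cyc :: "C_cyc \<Rightarrow> C_cyc" where
  "d_cyc x = abs_C_cyc (\<lambda>n. d_chain (rep_C_cyc x n))"

definition d_cc :: "C_lam \<Rightarrow> C_lam" where
  "d_cc x = abs_C_lam (d_cyc (rep_C_lam x))"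

definition lam_of :: "(nat \<Rightarrow> chain) \<Rightarrow> C_lam" where
  "lam_of X = abs_C_lam (abs_C_cyc X)"

definition infinite_sums :: "letter list set \<Rightarrow> C_lam set" where
  "infinite_sums A = {lam_of (\<lambda>n. \<Sum>j<n. frag_of (w j)) | w.
     range w \<subseteq> A \<inter> words \<and> (\<lambda>j. word_val (w j)) \<longlonglongrightarrow> \<infinity>}"

definition R_lam :: "C_lam set" where
  "R_lam = infinite_sums {w. \<exists>x\<in>set w. snd x \<in> Rs_id ` Rs}"

definition C_lam_Rs :: "C_lam set" where
  "C_lam_Rs = infinite_sums {(d, Rs_id r) # replicate m (0, 1) | d r m. r \<in> Rs}"

definition exp_cc :: "End_M fps \<Rightarrow> C_lam" where
  "exp_cc b = lam_of (\<lambda>n. frag_of [(0, 1)]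
     + (\<Sum>k=1..n. frag_of ((1, Rs_id (fps_const (fls_const (1 / real k))) * b) # replicate (k - 1) (1, b))))"

definition exp_correction :: "End_M fps \<Rightarrow> C_lam \<Rightarrow> bool" where
  "exp_correction b y \<longleftrightarrow> y \<in> R_lam \<and> d_cc y - d_cc (exp_cc b) \<in> C_lam_Rs"


section \<open>The functional $\Theta$\<close>

text \<open>
  Residues at $x=\pm iT^{1/2}$ are taken over $R\otimes\mathbb C$: an element of $S$ is expanded at
  $z_1 = x + w$, $z_0 = T/z_1$ as a power series in $w$, where
  $z_0^i z_1^j = T^i (x+w)^{j-i} = \sum_m \binom{j-i}{m} T^i x^{j-i-m} w^m$.
\<close>

definition complexify :: "R \<Rightarrow> complex fls" where
  "complexify r = Abs_fls (\<lambda>n. complex_of_real (fls_nth r n))"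

definition S_expand :: "complex fls \<Rightarrow> S \<Rightarrow> complex fls fps" where
  "S_expand x F = Abs_fps (\<lambda>m. \<Sum>\<^sub>\<infinity>(i, j)\<in>UNIV.
     complexify (tate_coeff (S_normal F) i j * T ^ i)
     * fls_const (complex_of_int (int j - int i) gchoose m) * x powi (int j - int i - int m))"

definition crit_points :: "complex fls set" where
  "crit_points = {fls_const \<i> * fls_X, - fls_const \<i> * fls_X}"

text \<open>$\mathrm{Res}_{z_1=x}\; F\,(\partial_1W)^{-l}\,dz_1/z_1$\<close>

definition Res :: "complex fls \<Rightarrow> nat \<Rightarrow> S \<Rightarrow> complex fls" where
  "Res x l F = fls_residue (fps_to_fls (S_expand x F)
     / (fps_to_fls (S_expand x (S_d1 W)) ^ l * fps_to_fls (S_expand x z1)))"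

definition Ends_matrix :: "End_M fps \<Rightarrow> S fps ^ 2 ^ 2" where
  "Ends_matrix \<Phi> = (\<chi> i j. Abs_fps (\<lambda>k. matrix_of (fps_nth \<Phi> k) $ i $ j))"

definition d1_D :: "S fps ^ 2 ^ 2" where
  "d1_D = (\<chi> i j. fps_const (S_d1 (matrix_of D $ i $ j)))"

definition str :: "S fps ^ 2 ^ 2 \<Rightarrow> S fps" where
  "str A = A $ 1 $ 1 - A $ 2 $ 2"

text \<open>The sum of the residues at the two conjugate points lies in $R$.\<close>

definition Theta_word :: "letter list \<Rightarrow> R fps" where
  "Theta_word w = Abs_fps (\<lambda>k. THE r. complexify r =
     - (\<Sum>x\<in>crit_points. Res x (length w)
          (fps_nth (str (foldr (\<lambda>a A. Ends_matrix (snd a) ** d1_D ** A) w (mat 1))) k)))"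

definition Theta_chain :: "chain \<Rightarrow> R fps" where
  "Theta_chain x = (\<Sum>w\<in>Poly_Mapping.keys x. of_int (Poly_Mapping.lookup x w) * Theta_word w)"

text \<open>
  The continuous extension to completions; as $\Theta$ does not decrease valuations and vanishes on
  the image of $\mathrm{id}-t$, it does not depend on representatives.
\<close>

definition Theta_cyc :: "C_cyc \<Rightarrow> R fps" where
  "Theta_cyc x = (THE r. r \<in> Rs \<and> (\<lambda>n. Rs_val (Theta_chain (rep_C_cyc x n) - r)) \<longlonglongrightarrow> \<infinity>)"

definition Theta :: "C_lam \<Rightarrow> R fps" where
  "Theta x = Theta_cyc (rep_C_lam x)"

end

(* The sum of the residues at the critical points is the difference of the constant terms of two
   Laurent expansions of the integrand, one for each end of the annulus. For each expansion the
   functional on words extends to a polynomial in a parameter u, whose derivative is computed from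
   d_cc of the word up to cyclic rotation; hence for a chain with boundary in the span of the words
   in the identity, the values at u = 0 and u = 1 have the same constant term. At u = 1 the functional
   is a product over the letters of their lower left matrix entries. It vanishes if one letter is a
   scalar, so the correction y does not contribute, and on exp(b) it gives the sum of beta^m / m with
   beta = 1 - exp(-s), that is, s.

   A correction is explicit: exp(b) - y is id plus the sum of
   Cat(k_1) ... Cat(k_m) / m * c^(k_1 + ... + k_m) times the words b id^(2 k_1) ... b id^(2 k_m),
   and the recursion for the Catalan numbers makes its boundary telescope. *)
theory Submission
  imports Defs
begin


text \<open>Differentiating D^2 = W gives D theta + theta D = 1 for theta = d_1 D / d_1 W, the only
  form in which D enters the functional. Another solution is strictly upper triangular: its entry is
  the inverse of the lower left entry 1 - T^(-1/2) z_0 of D, and it turns the trace of a word into a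
  product. Neither exists over S, because d_1 W vanishes at the critical points and that entry at
  z_0 = z_1 = T^(1/2); both exist at the ends of the annulus. The segment between the two has
  derivative D psi - psi D for an explicit psi, and this makes the variation of the trace the trace
  of a boundary. The boundary is not zero but consists of words in identities. Their traces have
  positive order in the coordinate x at the end, hence no constant term. At the inner end the
  triangular solution has positive order as well, so the whole value comes from the outer end.
  Catalan numbers appear since an odd run of identities arises in two ways: from an even run that
  loses one identity, and from two even runs joined by a letter c id. Equating the coefficients
  gives the Catalan recursion.\<close>

unbundle fps_syntax
notation fls_nth (infixl \<open>$$\<close> 75)

section \<open>Embeddings of S into iterated Laurent series\<close>

section \<open>Laurent expansions of elements of $S$\<close>

lemma fls_mult_nth_superset:
  fixes f g :: "'a::semiring_0 fls"
  assumes "finite A" "\<And>i. f $$ i \<noteq> 0 \<Longrightarrow> g $$ (n - i) \<noteq> 0 \<Longrightarrow> i \<in> A"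
  shows "(f * g) $$ n = (\<Sum>i\<in>A. f $$ i * g $$ (n - i))"
proof -
  let ?B = "{fls_subdegree f..n - fls_subdegree g}"
  have "(\<Sum>i\<in>?B. f $$ i * g $$ (n - i)) = (\<Sum>i\<in>?B \<union> A. f $$ i * g $$ (n - i))"
  proof (rule sum.mono_neutral_left)
    show "\<forall>i\<in>?B \<union> A - ?B. f $$ i * g $$ (n - i) = 0"
    proof
      fix i assume "i \<in> ?B \<union> A - ?B"
      then have "i < fls_subdegree f \<or> n - i < fls_subdegree g" by auto
      then show "f $$ i * g $$ (n - i) = 0" by auto
    qed
  qed (use assms in auto)
  also have "\<dots> = (\<Sum>i\<in>A. f $$ i * g $$ (n - i))"
    by (rule sum.mono_neutral_right) (use assms in \<open>auto, metis mult_zero_left mult_zero_right\<close>)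
  finally show ?thesis by (simp add: fls_times_nth(2))
qed

lemma fls_mult_nth_nonzeroE:
  fixes f g :: "'a::semiring_0 fls"
  assumes "(f * g) $$ n \<noteq> 0"
  obtains i where "f $$ i \<noteq> 0" "g $$ (n - i) \<noteq> 0" "f $$ i * g $$ (n - i) \<noteq> 0"
proof -
  have "(\<Sum>i=fls_subdegree f..n - fls_subdegree g. f $$ i * g $$ (n - i)) \<noteq> 0"
    using assms by (simp add: fls_times_nth(2))
  then obtain i where "f $$ i * g $$ (n - i) \<noteq> 0" by (meson sum.neutral)
  then show thesis using that[of i] by (metis mult_zero_left mult_zero_right)
qed

definition fls_map :: "('a::zero \<Rightarrow> 'b::zero) \<Rightarrow> 'a fls \<Rightarrow> 'b fls" where
  "fls_map h r = Abs_fls (\<lambda>n. h (r $$ n))"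

lemma fls_map_nth: "h 0 = 0 \<Longrightarrow> fls_map h r $$ n = h (r $$ n)"
  unfolding fls_map_def by (rule nth_Abs_fls_ex_lower_bound) (metis fls_nth_vanishes_belowE)

lemma fls_map_mult:
  fixes h :: "'a::comm_ring_1 \<Rightarrow> 'b::comm_ring_1"
  assumes "h 0 = 0" "\<And>x y. h (x + y) = h x + h y" "\<And>x y. h (x * y) = h x * h y"
  shows "fls_map h (f * g) = fls_map h f * fls_map h g"
proof (rule fls_eqI)
  fix n
  let ?B = "{fls_subdegree f..n - fls_subdegree g}"
  have hsum: "h (sum F I) = (\<Sum>i\<in>I. h (F i))" for F :: "int \<Rightarrow> 'a" and I
    by (induction I rule: infinite_finite_induct) (simp_all add: assms)
  have "(fls_map h f * fls_map h g) $$ n = (\<Sum>i\<in>?B. fls_map h f $$ i * fls_map h g $$ (n - i))"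
  proof (rule fls_mult_nth_superset)
    fix i assume "fls_map h f $$ i \<noteq> 0" "fls_map h g $$ (n - i) \<noteq> 0"
    then have "f $$ i \<noteq> 0" "g $$ (n - i) \<noteq> 0" using assms(1) by (auto simp: fls_map_nth)
    then show "i \<in> ?B" using fls_subdegree_leI[of f i] fls_subdegree_leI[of g "n - i"] by auto
  qed simp
  then show "fls_map h (f * g) $$ n = (fls_map h f * fls_map h g) $$ n"
    by (simp add: fls_map_nth assms(1,3) hsum fls_times_nth(2))
qed

text \<open>The outer variable is T^(1/2), the inner one a coordinate x at an end of the annulus. In
  this order of the variables a T-adically convergent series of Laurent polynomials in x has a
  value, and nonzero elements are invertible.\<close>

type_synonym L = "real fls fls"

text \<open>The monomial with exponents \<open>k\<close> of $T^{1/2}$ and \<open>n\<close> of the inner variable.\<close>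

definition tx :: "int \<Rightarrow> int \<Rightarrow> L" where
  "tx k n = fls_shift (-k) (fls_const (fls_X_intpow n))"

lemma tx_nth: "tx k n $$ i = (if i = k then fls_X_intpow n else 0)"
  unfolding tx_def fls_shift_nth fls_const_nth by (rule if_cong) auto

lemma tx_conv: "tx k n = fls_const (fls_X_intpow n) * fls_X_intpow k"
  unfolding tx_def fls_X_intpow_times_conv_shift(2) ..

lemma fls_X_intpow_nth: "(fls_X_intpow n :: 'a::{zero,one} fls) $$ i = (if i = n then 1 else 0)"
  by simp

lemma tx_mult: "tx k n * tx k' n' = tx (k + k') (n + n')"
proof -
  have "tx k n * tx k' n' = fls_const (fls_X_intpow n * fls_X_intpow n') * (fls_X_intpow k * fls_X_intpow k')"
    by (simp only: tx_conv fls_const_mult_const[symmetric] mult_ac)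
  then show ?thesis by (simp only: fls_X_intpow_times_fls_X_intpow tx_conv)
qed

lemma tx_0_0 [simp]: "tx 0 0 = 1"
  by (simp add: tx_def)

lemma tx_power: "tx k n ^ m = tx (int m * k) (int m * n)"
  by (induction m) (simp_all add: tx_mult algebra_simps)

definition emb :: "R \<Rightarrow> L" where "emb = fls_map fls_const"

lemma emb_nth: "emb r $$ k = fls_const (r $$ k)"
  by (simp add: emb_def fls_map_nth)

lemma emb_hom:
  "emb 0 = 0" "emb 1 = 1" "emb (r + r') = emb r + emb r'" "emb (r - r') = emb r - emb r'"
  "emb (- r) = - emb r" "emb (r * r') = emb r * emb r'"
proof -
  show "emb (r * r') = emb r * emb r'"
    unfolding emb_def by (rule fls_map_mult) (simp_all add: fls_plus_const fls_const_mult_const)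
qed (rule fls_eqI, simp add: emb_nth fls_plus_const)+

lemma emb_power: "emb (r ^ n) = emb r ^ n"
  by (induction n) (simp_all add: emb_hom)

lemma emb_T_half: "emb T_half = tx 1 0"
  by (intro fls_eqI) (simp add: emb_nth tx_nth)

lemma emb_T: "emb T = tx 2 0"
  by (simp add: emb_power emb_T_half tx_power)

lemma emb_mult_tx_nth: "(emb r * tx k n) $$ i = fls_const (r $$ (i - k)) * fls_X_intpow n"
proof -
  have "(emb r * tx k n) $$ i = (\<Sum>a\<in>{i - k}. emb r $$ a * tx k n $$ (i - a))"
    by (rule fls_mult_nth_superset) (auto simp: tx_nth split: if_splits)
  then show ?thesis by (simp add: tx_nth emb_nth)
qed

lemma R_val_geI: "(\<And>n. r $$ n \<noteq> 0 \<Longrightarrow> N \<le> real_of_int n / 2) \<Longrightarrow> ereal N \<le> R_val r"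
  by (auto simp: R_val_def)

lemma R_val_geD: "ereal N \<le> R_val r \<Longrightarrow> r $$ n \<noteq> 0 \<Longrightarrow> N \<le> real_of_int n / 2"
  using fls_subdegree_leI[of r n] by (auto simp: R_val_def split: if_splits)

lemma tate_coeff_series: "tate_series (Rep_tate f)"
  using Rep_tate by blast

lemma tate_coeff_simps [simp]:
  "tate_coeff 0 i j = 0" "tate_coeff (f + g) i j = tate_coeff f i j + tate_coeff g i j"
  "tate_coeff (f - g) i j = tate_coeff f i j - tate_coeff g i j"
  "tate_coeff (- f) i j = - tate_coeff f i j"
  by (simp_all add: tate_coeff.rep_eq zero_tate.rep_eq plus_tate.rep_eq minus_tate.rep_eq uminus_tate.rep_eq)

lemma tate_coeff_sum: "tate_coeff (sum F I) i j = (\<Sum>x\<in>I. tate_coeff (F x) i j)"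
  by (induction I rule: infinite_finite_induct) simp_all

lemma tate_coeff_mult:
  "tate_coeff (f * g) i j = (\<Sum>k=0..i. \<Sum>l=0..j. tate_coeff f k l * tate_coeff g (i - k) (j - l))"
  by (simp add: tate_coeff.rep_eq times_tate.rep_eq coeff2_mult)

lemma tate_eqI: "(\<And>i j. tate_coeff f i j = tate_coeff g i j) \<Longrightarrow> f = g"
  by (simp add: tate_coeff.rep_eq coeff2_def Rep_tate_inject[symmetric] fps_eq_iff)

lemma tate_coeff_const: "tate_coeff (tate_const r) i j = (if i = 0 \<and> j = 0 then r else 0)"
  by (simp add: tate_coeff.rep_eq tate_const.rep_eq coeff2_const)

definition tmon :: "R \<Rightarrow> nat \<Rightarrow> nat \<Rightarrow> tate" where
  "tmon r i j = tate_const r * tate_z0 ^ i * tate_z1 ^ j"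

lemma tate_const_hom: "tate_const (r + r') = tate_const r + tate_const r'"
  by (rule tate_eqI) (simp add: tate_coeff_const)

lemma tate_z0_coeff: "tate_coeff tate_z0 i j = (if i = 1 \<and> j = 0 then 1 else 0)"
  by (auto simp: tate_coeff.rep_eq tate_z0.rep_eq coeff2_def fps_X_def)

lemma tate_z1_coeff: "tate_coeff tate_z1 i j = (if i = 0 \<and> j = 1 then 1 else 0)"
  by (auto simp: tate_coeff.rep_eq tate_z1.rep_eq coeff2_def fps_X_def)

lemma Rep_tmon: "Rep_tate (tmon r i j) = fps_const (fps_const r * fps_X ^ j) * fps_X ^ i"
proof -
  have "Rep_tate (f ^ n) = Rep_tate f ^ n" for f n
    by (induction n) (simp_all add: one_tate.rep_eq times_tate.rep_eq)
  then show ?thesis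
    by (simp add: tmon_def times_tate.rep_eq tate_const.rep_eq tate_z0.rep_eq tate_z1.rep_eq
        mult_ac flip: fps_const_mult fps_const_power)
qed

lemma tate_coeff_tmon: "tate_coeff (tmon r i j) a b = (if a = i \<and> b = j then r else 0)"
  by (auto simp: tate_coeff.rep_eq Rep_tmon coeff2_def fps_X_power_nth)

lemma tmon_mult: "tmon r i j * tmon r' i' j' = tmon (r * r') (i + i') (j + j')"
  by (simp add: tmon_def tate_const_mult[symmetric] power_add mult_ac)

lemma tate_truncate:
  assumes "finite F"
  shows "tate_coeff (\<Sum>(i, j)\<in>F. tmon (tate_coeff f i j) i j) a b
    = (if (a, b) \<in> F then tate_coeff f a b else 0)"
proof -
  have "tate_coeff (\<Sum>(i, j)\<in>F. tmon (tate_coeff f i j) i j) a b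
      = (\<Sum>x\<in>F. if x = (a, b) then tate_coeff f a b else 0)"
    unfolding tate_coeff_sum by (rule sum.cong) (auto simp: tate_coeff_tmon split: prod.split)
  then show ?thesis using assms by simp
qed

definition tate_ge :: "real \<Rightarrow> tate \<Rightarrow> bool" where
  "tate_ge N f \<longleftrightarrow> (\<forall>i j. ereal N \<le> R_val (tate_coeff f i j))"

lemma tate_ge_mult: "tate_ge N f \<Longrightarrow> tate_ge N' g \<Longrightarrow> tate_ge (N + N') (f * g)"
  unfolding tate_ge_def tate_coeff_mult
proof (intro allI R_val_sum)
  fix i j k l assume "\<forall>i j. ereal N \<le> R_val (tate_coeff f i j)" "\<forall>i j. ereal N' \<le> R_val (tate_coeff g i j)"
  then have "ereal N + ereal N' \<le> R_val (tate_coeff f k l) + R_val (tate_coeff g (i - k) (j - l))"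
    by (intro add_mono) auto
  then show "ereal (N + N') \<le> R_val (tate_coeff f k l * tate_coeff g (i - k) (j - l))"
    by (simp add: R_val_mult)
qed

lemma tate_geD: "tate_ge N f \<Longrightarrow> tate_coeff f i j $$ n \<noteq> 0 \<Longrightarrow> N \<le> real_of_int n / 2"
  unfolding tate_ge_def using R_val_geD by blast

lemma tate_ge_exists: "\<exists>N. tate_ge N f"
  using tate_series_bounded_below[OF tate_coeff_series[of f]] unfolding tate_ge_def tate_coeff.rep_eq
  by metis

text \<open>Polynomials are dense for the Gauss valuation, so additive continuous identities reduce
  to monomials. The last clause keeps the remainder in normal form when f is normal.\<close>

lemma tate_decompose:
  obtains F g where "finite F" "f = (\<Sum>(i, j)\<in>F. tmon (tate_coeff f i j) i j) + g" "tate_ge N g"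
    "\<And>i j. tate_coeff g i j \<noteq> 0 \<Longrightarrow> tate_coeff f i j \<noteq> 0"
proof -
  obtain F where F: "finite F" "\<And>i j. (i, j) \<notin> F \<Longrightarrow> ereal N \<le> R_val (tate_coeff f i j)"
    using tate_seriesD[OF tate_coeff_series[of f]] unfolding tate_coeff.rep_eq by metis
  define g where "g = f - (\<Sum>(i, j)\<in>F. tmon (tate_coeff f i j) i j)"
  show thesis
  proof (rule that[of F g])
    show "tate_ge N g"
      unfolding tate_ge_def g_def tate_coeff_simps tate_truncate[OF F(1)] using F(2) by auto
    show "tate_coeff f i j \<noteq> 0" if "tate_coeff g i j \<noteq> 0" for i j
      using that unfolding g_def tate_coeff_simps tate_truncate[OF F(1)] by (auto split: if_splits)
  qed (simp_all add: g_def F(1))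
qed

text \<open>
  The substitutions $z_0 = T^{p/2} x^e$, $z_1 = T^{q/2} x^{-e}$ with $p + q = 2$; for $e = 1$ the
  expansion is valid for large $z_1$, for $e = -1$ for small $z_1$.
\<close>

locale expansion =
  fixes p q :: nat and e :: int
  assumes pq: "p + q = 2" and e: "e = 1 \<or> e = - 1"
begin

text \<open>Exponents of T^(1/2) and, in \<open>ex\<close>, of x in the image of z_0^i z_1^j. Since
  \<open>wt\<close> is nonnegative, only finitely many monomials of a Tate series reach a given
  power of T^(1/2).\<close>

definition wt :: "nat \<Rightarrow> nat \<Rightarrow> int" where "wt i j = int (p * i + q * j)"
definition ex :: "nat \<Rightarrow> nat \<Rightarrow> int" where "ex i j = e * (int i - int j)"

definition supp :: "tate \<Rightarrow> int \<Rightarrow> (nat \<times> nat) set" where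
  "supp f k = {(i, j). tate_coeff f i j $$ (k - wt i j) \<noteq> 0}"

definition tiota :: "tate \<Rightarrow> L" where
  "tiota f = Abs_fls (\<lambda>k. \<Sum>(i, j)\<in>supp f k.
     fls_const (tate_coeff f i j $$ (k - wt i j)) * fls_X_intpow (ex i j))"

lemma finite_supp: "finite (supp f k)"
proof -
  obtain F where F: "finite F" "\<And>i j. (i, j) \<notin> F \<Longrightarrow> ereal (real_of_int k / 2 + 1) \<le> R_val (tate_coeff f i j)"
    using tate_seriesD[OF tate_coeff_series[of f]] unfolding tate_coeff.rep_eq by metis
  have "supp f k \<subseteq> F"
  proof
    fix x assume x: "x \<in> supp f k"
    obtain i j where ij: "x = (i, j)" by fastforce
    show "x \<in> F"
    proof (rule ccontr)
      assume "x \<notin> F"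
      with F(2) ij R_val_geD x have "real_of_int k / 2 + 1 \<le> real_of_int (k - wt i j) / 2"
        unfolding supp_def by blast
      moreover have "0 \<le> real_of_int (wt i j)" by (simp add: wt_def)
      ultimately show False by simp
    qed
  qed
  then show ?thesis using F(1) finite_subset by blast
qed

lemma tiota_nth: "tiota f $$ k = (\<Sum>(i, j)\<in>supp f k.
    fls_const (tate_coeff f i j $$ (k - wt i j)) * fls_X_intpow (ex i j))"
proof -
  obtain N where N: "tate_ge N f" using tate_ge_exists by blast
  have "supp f k = {}" if "k < floor (2 * N)" for k
  proof -
    have False if "(i, j) \<in> supp f k" for i j
    proof -
      have "N \<le> real_of_int (k - wt i j) / 2"
        by (rule tate_geD[OF N]) (use that in \<open>simp add: supp_def\<close>)
      moreover have "0 \<le> real_of_int (wt i j)" by (simp add: wt_def)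
      ultimately have "2 * N \<le> real_of_int k" by simp
      then show False using \<open>k < floor (2 * N)\<close> by linarith
    qed
    then show ?thesis by auto
  qed
  then show ?thesis unfolding tiota_def
    by (intro nth_Abs_fls_lower_bound[of "floor (2 * N)"]) simp
qed

lemma tiota_nth_superset: "finite A \<Longrightarrow> supp f k \<subseteq> A \<Longrightarrow> tiota f $$ k = (\<Sum>(i, j)\<in>A.
    fls_const (tate_coeff f i j $$ (k - wt i j)) * fls_X_intpow (ex i j))"
  unfolding tiota_nth by (rule sum.mono_neutral_left) (auto simp: supp_def)

lemma tiota_add: "tiota (f + g) = tiota f + tiota g"
proof (rule fls_eqI)
  fix k
  let ?A = "supp f k \<union> supp g k"
  have "supp (f + g) k \<subseteq> ?A" by (auto simp: supp_def)
  then have "tiota (f + g) $$ k = (\<Sum>(i, j)\<in>?A.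
      fls_const (tate_coeff (f + g) i j $$ (k - wt i j)) * fls_X_intpow (ex i j))"
    by (intro tiota_nth_superset) (simp_all add: finite_supp)
  also have "\<dots> = (tiota f + tiota g) $$ k"
    unfolding fls_plus_nth tiota_nth_superset[of ?A f, OF finite_UnI[OF finite_supp finite_supp] Un_upper1]
      tiota_nth_superset[of ?A g, OF finite_UnI[OF finite_supp finite_supp] Un_upper2]
    by (simp add: sum.distrib[symmetric] case_prod_unfold algebra_simps fls_plus_const[symmetric])
  finally show "tiota (f + g) $$ k = (tiota f + tiota g) $$ k" .
qed

lemma tiota_0: "tiota 0 = 0"
  using tiota_add[of 0 0] by simp

lemma tiota_minus: "tiota (- f) = - tiota f"
  using tiota_add[of f "- f"] by (simp add: tiota_0 eq_neg_iff_add_eq_0 add.commute)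

lemma tiota_diff: "tiota (f - g) = tiota f - tiota g"
  using tiota_add[of f "- g"] by (simp add: tiota_minus)

lemma tiota_sum: "tiota (sum F I) = (\<Sum>i\<in>I. tiota (F i))"
  by (induction I rule: infinite_finite_induct) (simp_all add: tiota_0 tiota_add)

lemma tiota_tmon: "tiota (tmon r i j) = emb r * tx (wt i j) (ex i j)"
proof (rule fls_eqI)
  fix k
  have "tiota (tmon r i j) $$ k = (\<Sum>(i', j')\<in>{(i, j)}.
      fls_const (tate_coeff (tmon r i j) i' j' $$ (k - wt i' j')) * fls_X_intpow (ex i' j'))"
    by (rule tiota_nth_superset) (auto simp: supp_def tate_coeff_tmon split: if_splits)
  then show "tiota (tmon r i j) $$ k = (emb r * tx (wt i j) (ex i j)) $$ k"
    by (simp add: tate_coeff_tmon emb_mult_tx_nth)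
qed

lemma tiota_ge: "tate_ge N f \<Longrightarrow> tiota f $$ k \<noteq> 0 \<Longrightarrow> N \<le> real_of_int k / 2"
proof -
  assume N: "tate_ge N f" and "tiota f $$ k \<noteq> 0"
  then have "supp f k \<noteq> {}" unfolding tiota_nth by auto
  then obtain i j where "tate_coeff f i j $$ (k - wt i j) \<noteq> 0" by (auto simp: supp_def)
  then have "N \<le> real_of_int (k - wt i j) / 2"
    using N tate_geD by blast
  moreover have "0 \<le> real_of_int (wt i j)" by (simp add: wt_def)
  ultimately show "N \<le> real_of_int k / 2" by simp
qed

text \<open>Both sides are T-adically continuous, so the monomial case suffices. For a fixed power
  T^(k/2) the tails \<open>f'\<close> and \<open>g'\<close> are taken so small that they cannot
  reach it; the threshold for \<open>g'\<close> depends on a lower bound for the polynomial part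
  \<open>f0\<close>, which is why f is truncated first.\<close>

lemma tiota_mult: "tiota (f * g) = tiota f * tiota g"
proof -
  have "(tiota (f * g) - tiota f * tiota g) $$ k = 0" for k
  proof -
    define N where "N = real_of_int k / 2 + 1"
    obtain C where C: "tate_ge C g" using tate_ge_exists by blast
    obtain F f' where F: "finite F" "f = (\<Sum>(i, j)\<in>F. tmon (tate_coeff f i j) i j) + f'" "tate_ge (N - C) f'"
      by (rule tate_decompose[of f "N - C"])
    define f0 where "f0 = (\<Sum>(i, j)\<in>F. tmon (tate_coeff f i j) i j)"
    obtain B where B: "tate_ge B f0" using tate_ge_exists by blast
    obtain G g' where G: "finite G" "g = (\<Sum>(i, j)\<in>G. tmon (tate_coeff g i j) i j) + g'" "tate_ge (N - B) g'"
      by (rule tate_decompose[of g "N - B"])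
    define g0 where "g0 = (\<Sum>(i, j)\<in>G. tmon (tate_coeff g i j) i j)"
    have fg: "f = f0 + f'" "g = g0 + g'" using F(2) G(2) by (simp_all add: f0_def g0_def)
    have "tiota (tmon r i j * tmon r' i' j') = tiota (tmon r i j) * tiota (tmon r' i' j')" for r i j r' i' j'
    proof -
      have "wt (i + i') (j + j') = wt i j + wt i' j'" "ex (i + i') (j + j') = ex i j + ex i' j'"
        by (simp_all add: wt_def ex_def algebra_simps)
      then have "tx (wt (i + i') (j + j')) (ex (i + i') (j + j')) = tx (wt i j) (ex i j) * tx (wt i' j') (ex i' j')"
        by (simp only: tx_mult)
      then show ?thesis unfolding tmon_mult tiota_tmon emb_hom by (simp only: mult_ac)
    qed
    then have 0: "tiota (f0 * g0) = tiota f0 * tiota g0"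
      unfolding f0_def g0_def by (simp add: sum_product tiota_sum case_prod_unfold)
    have "f * g = f0 * g0 + f0 * g' + f' * g" by (simp add: fg algebra_simps)
    then have "tiota (f * g) = tiota f0 * tiota g0 + tiota (f0 * g') + tiota (f' * g)"
      by (simp add: tiota_add 0)
    moreover have "tiota f * tiota g = tiota f0 * tiota g0 + tiota f0 * tiota g' + tiota f' * tiota g"
      unfolding fg(1) unfolding fg(2) by (simp add: tiota_add algebra_simps)
    moreover have "tate_ge N (f0 * g')" using tate_ge_mult[OF B G(3)] by simp
    then have "tiota (f0 * g') $$ k = 0" using tiota_ge[of N _ k] unfolding N_def by fastforce
    moreover have "tate_ge N (f' * g)" using tate_ge_mult[OF F(3) C] by simp
    then have "tiota (f' * g) $$ k = 0" using tiota_ge[of N _ k] unfolding N_def by fastforce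
    moreover have "(tiota u * tiota v) $$ k = 0" if "tate_ge M u" "tate_ge (N - M) v" for u v M
    proof (rule ccontr)
      assume "\<not> ?thesis"
      then obtain i where "tiota u $$ i \<noteq> 0" "tiota v $$ (k - i) \<noteq> 0" by (rule fls_mult_nth_nonzeroE)
      then have "M \<le> real_of_int i / 2" "N - M \<le> real_of_int (k - i) / 2" using that tiota_ge by blast+
      then show False by (simp add: N_def field_simps)
    qed
    note this[OF B G(3)] this[of "N - C" f' g]
    ultimately show ?thesis using F(3) C by simp
  qed
  then show ?thesis by (metis fls_eqI fls_minus_nth fls_zero_nth eq_iff_diff_eq_0)
qed

lemma tiota_const: "tiota (tate_const r) = emb r"
  using tiota_tmon[of r 0 0] by (simp add: tmon_def wt_def ex_def)

lemma tiota_1: "tiota 1 = 1"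
  using tiota_const[of 1] by (simp add: tate_const_1 emb_hom)

lemma tiota_z: "tiota tate_z0 = tx (int p) e" "tiota tate_z1 = tx (int q) (- e)"
  using tiota_tmon[of 1 1 0] tiota_tmon[of 1 0 1]
  by (simp_all add: tmon_def wt_def ex_def tate_const_1 emb_hom)

lemma tiota_rel: "tiota tate_rel = 0"
  using pq by (simp add: tiota_diff tiota_mult tiota_z tiota_const emb_T tx_mult flip: of_nat_add)

end


section \<open>Normal forms modulo z_0 z_1 - T, and valuations read off from expansions\<close>

lemma tate_coeff_tmon_mult:
  "tate_coeff (tmon r a b * f) i j = (if a \<le> i \<and> b \<le> j then r * tate_coeff f (i - a) (j - b) else 0)"
proof -
  have "Rep_tate (tmon r a b * f) = fps_const (fps_const r * fps_X ^ b) * (fps_X ^ a * Rep_tate f)"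
    by (simp add: times_tate.rep_eq Rep_tmon mult_ac)
  then show ?thesis
    by (auto simp: tate_coeff.rep_eq coeff2_def fps_X_power_mult_nth mult.assoc)
qed

lemma tate_rel_tmon: "tate_rel = tmon 1 1 1 - tmon T 0 0"
  by (simp add: tmon_def tate_const_1)

definition tate_normal :: "tate \<Rightarrow> bool" where
  "tate_normal f \<longleftrightarrow> (\<forall>i>0. \<forall>j>0. tate_coeff f i j = 0)"

text \<open>Replacing z_0 z_1 by T again and again determines the quotient: its coefficient at (i,
  j) is the sum over m of T^m times the coefficient of f at (i + 1 + m, j + 1 + m).
  \<open>hc\<close> is this sum at a fixed power of T^(1/2), where it is finite, and
  \<open>rec\<close> is the recursion that makes all mixed terms of the remainder vanish.\<close>

lemma tate_division: "\<exists>h. tate_normal (f - tate_rel * h)"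
proof -
  define hc where "hc i j k = (\<Sum>m\<in>{m. tate_coeff f (Suc (i + m)) (Suc (j + m)) $$ (k - 2 * int m) \<noteq> 0}.
      tate_coeff f (Suc (i + m)) (Suc (j + m)) $$ (k - 2 * int m))" for i j k
  obtain B where B: "tate_ge B f" using tate_ge_exists by blast
  have fin: "\<exists>A. \<forall>i j. i > A \<or> j > A \<longrightarrow> ereal N \<le> R_val (tate_coeff f i j)" for N
  proof -
    obtain F where F: "finite F" "\<And>i j. (i, j) \<notin> F \<Longrightarrow> ereal N \<le> R_val (tate_coeff f i j)"
      using tate_seriesD[OF tate_coeff_series[of f]] unfolding tate_coeff.rep_eq by metis
    define A where "A = Max (insert 0 (fst ` F \<union> snd ` F))"
    have le: "i \<le> A" if "i \<in> fst ` F \<union> snd ` F" for i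
      unfolding A_def using that F(1) by (intro Max_ge) auto
    have "(i, j) \<notin> F" if "i > A \<or> j > A" for i j
      using that le[of i] le[of j] by (force simp: not_le[symmetric])
    then show ?thesis using F(2) by blast
  qed
  have bound: "\<exists>M. \<forall>m\<ge>M. \<forall>i j. tate_coeff f (Suc (i + m)) (Suc (j + m)) $$ (k - 2 * int m) = 0" for k
  proof -
    obtain A where A: "\<And>i j. i > A \<or> j > A \<Longrightarrow> ereal (real_of_int k / 2 + 1) \<le> R_val (tate_coeff f i j)"
      using fin by blast
    have "tate_coeff f (Suc (i + m)) (Suc (j + m)) $$ (k - 2 * int m) = 0" if "m \<ge> A" for m i j
    proof (rule ccontr)
      assume "\<not> ?thesis"
      with A[of "Suc (i + m)" "Suc (j + m)"] that
      have "real_of_int k / 2 + 1 \<le> real_of_int (k - 2 * int m) / 2" by (intro R_val_geD) auto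
      then show False by simp
    qed
    then show ?thesis by blast
  qed
  have hc_sum: "\<exists>M. \<forall>i j. \<forall>M'\<ge>M. hc i j k = (\<Sum>m<M'. tate_coeff f (Suc (i + m)) (Suc (j + m)) $$ (k - 2 * int m))" for k
  proof -
    obtain M where M: "\<And>m i j. m \<ge> M \<Longrightarrow> tate_coeff f (Suc (i + m)) (Suc (j + m)) $$ (k - 2 * int m) = 0"
      using bound by blast
    show ?thesis
      unfolding hc_def
    proof (intro exI[of _ M] allI impI)
      fix i j M' assume MM: "M \<le> M'"
      have sub: "{m. tate_coeff f (Suc (i + m)) (Suc (j + m)) $$ (k - 2 * int m) \<noteq> 0} \<subseteq> {..<M'}"
      proof (intro subsetI, rule ccontr)
        fix m assume m: "m \<in> {m. tate_coeff f (Suc (i + m)) (Suc (j + m)) $$ (k - 2 * int m) \<noteq> 0}" "m \<notin> {..<M'}"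
        then have "M \<le> m" using MM by simp
        from M[OF this, of i j] m(1) show False by blast
      qed
      show "(\<Sum>m\<in>{m. tate_coeff f (Suc (i + m)) (Suc (j + m)) $$ (k - 2 * int m) \<noteq> 0}.
          tate_coeff f (Suc (i + m)) (Suc (j + m)) $$ (k - 2 * int m))
        = (\<Sum>m<M'. tate_coeff f (Suc (i + m)) (Suc (j + m)) $$ (k - 2 * int m))"
        by (rule sum.mono_neutral_left[OF _ sub]) simp_all
    qed
  qed
  define hf where "hf i j = Abs_fls (hc i j)" for i j
  have hc_ge: "N \<le> real_of_int k / 2"
    if "hc i j k \<noteq> 0" "\<And>m. ereal N \<le> R_val (tate_coeff f (Suc (i + m)) (Suc (j + m)))" for N i j k
  proof -
    obtain m where "tate_coeff f (Suc (i + m)) (Suc (j + m)) $$ (k - 2 * int m) \<noteq> 0"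
      using sum.not_neutral_contains_not_neutral[OF \<open>hc i j k \<noteq> 0\<close>[unfolded hc_def]] by blast
    then have "N \<le> real_of_int (k - 2 * int m) / 2" using R_val_geD[OF that(2)] by blast
    then show ?thesis by simp
  qed
  have hf_nth: "hf i j $$ k = hc i j k" for i j k
  proof -
    have "hc i j k = 0" if "k < floor (2 * B)" for k
    proof (rule ccontr)
      assume "hc i j k \<noteq> 0"
      then have "B \<le> real_of_int k / 2" by (rule hc_ge) (use B in \<open>auto simp: tate_ge_def\<close>)
      then show False using that by linarith
    qed
    then show ?thesis unfolding hf_def by (intro nth_Abs_fls_lower_bound[of "floor (2 * B)"]) blast
  qed
  have "tate_series (Abs_fps (\<lambda>i. Abs_fps (\<lambda>j. hf i j)))" (is "tate_series ?H")
  proof (rule tate_seriesI)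
    fix N
    obtain A where A: "\<And>i j. i > A \<or> j > A \<Longrightarrow> ereal N \<le> R_val (tate_coeff f i j)"
      using fin by blast
    have "ereal N \<le> R_val (coeff2 ?H i j)" if "(i, j) \<notin> {..A} \<times> {..A}" for i j
      unfolding coeff2_def fps_nth_Abs_fps
      by (rule R_val_geI, unfold hf_nth, rule hc_ge, assumption, rule A) (use that in auto)
    then show "\<exists>F. finite F \<and> (\<forall>i j. (i, j) \<notin> F \<longrightarrow> ereal N \<le> R_val (coeff2 ?H i j))"
      by (intro exI[of _ "{..A} \<times> {..A}"]) blast
  qed
  then have H: "tate_coeff (Abs_tate ?H) i j = hf i j" for i j
    by (simp add: tate_coeff.rep_eq Abs_tate_inverse coeff2_def)
  have rec: "hf i j = tate_coeff f (Suc i) (Suc j) + T * hf (Suc i) (Suc j)" for i j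
  proof (rule fls_eqI)
    fix k
    obtain M where M: "\<And>i j M'. M' \<ge> M \<Longrightarrow> hc i j k = (\<Sum>m<M'. tate_coeff f (Suc (i + m)) (Suc (j + m)) $$ (k - 2 * int m))"
      using hc_sum[of k] by blast
    obtain M2 where M2: "\<And>i j M'. M' \<ge> M2 \<Longrightarrow> hc i j (k - 2) = (\<Sum>m<M'. tate_coeff f (Suc (i + m)) (Suc (j + m)) $$ (k - 2 - 2 * int m))"
      using hc_sum[of "k - 2"] by blast
    have "hc i j k = (\<Sum>m<Suc (max M M2). tate_coeff f (Suc (i + m)) (Suc (j + m)) $$ (k - 2 * int m))"
      by (rule M) simp
    also have "\<dots> = tate_coeff f (Suc i) (Suc j) $$ k + hc (Suc i) (Suc j) (k - 2)"
      unfolding sum.lessThan_Suc_shift M2[OF max.cobounded2[of M2 M]] by (simp add: algebra_simps)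
    finally have "hf i j $$ k = tate_coeff f (Suc i) (Suc j) $$ k + hf (Suc i) (Suc j) $$ (k - 2)"
      by (simp add: hf_nth)
    moreover have "(T * hf (Suc i) (Suc j)) $$ k = hf (Suc i) (Suc j) $$ (k - 2)"
      by (simp only: power2_eq_square mult.assoc) (simp add: fls_X_times_conv_shift(1))
    ultimately show "hf i j $$ k = (tate_coeff f (Suc i) (Suc j) + T * hf (Suc i) (Suc j)) $$ k" by simp
  qed
  have "tate_normal (f - tate_rel * Abs_tate ?H)"
    unfolding tate_normal_def
  proof (intro allI impI)
    fix i j :: nat assume "i > 0" "j > 0"
    then obtain i' j' where "i = Suc i'" "j = Suc j'" using gr0_implies_Suc by metis
    then show "tate_coeff (f - tate_rel * Abs_tate ?H) i j = 0"
      by (simp add: tate_rel_tmon left_diff_distrib tate_coeff_tmon_mult H rec[of i' j'])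
  qed
  then show ?thesis by blast
qed

lemma abs_rep_S: "abs_S (rep_S F) = F"
  using Quotient3_abs_rep[OF Quotient3_S] .

context expansion begin

text \<open>Inverse of \<open>ex\<close> on monomials with one exponent zero: if i j = 0, then e n =
  i - j forces i and j to be the positive and the negative part of e n.\<close>

definition ei :: "int \<Rightarrow> nat" where "ei n = nat (e * n)"
definition ej :: "int \<Rightarrow> nat" where "ej n = nat (- (e * n))"

text \<open>Monomials in normal form have distinct exponents of x, so no two of them meet in the
  same coefficient. This makes the expansion injective on normal forms.\<close>

lemma tiota_normal_nth:
  assumes "tate_normal f"
  shows "tiota f $$ k $$ n = tate_coeff f (ei n) (ej n) $$ (k - wt (ei n) (ej n))"
proof -
  let ?A = "insert (ei n, ej n) (supp f k)"
  have ee: "e * e = 1" using e by auto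
  have "tiota f $$ k $$ n = (\<Sum>(i, j)\<in>?A. (fls_const (tate_coeff f i j $$ (k - wt i j)) * fls_X_intpow (ex i j)) $$ n)"
    by (subst tiota_nth_superset[of ?A]) (auto simp: finite_supp fls_nth_sum case_prod_unfold)
  also have "\<dots> = (\<Sum>(i, j)\<in>?A. if (i, j) = (ei n, ej n) then tate_coeff f i j $$ (k - wt i j) else 0)"
  proof (rule sum.cong, simp, clarify)
    fix i j
    have c: "(fls_const c * fls_X_intpow (ex i j)) $$ n = (if n = ex i j then c else 0)" for c :: real
      unfolding fls_X_intpow_times_conv_shift(2) by auto
    show "(fls_const (tate_coeff f i j $$ (k - wt i j)) * fls_X_intpow (ex i j)) $$ n
       = (if (i, j) = (ei n, ej n) then tate_coeff f i j $$ (k - wt i j) else 0)"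
    proof (cases "i > 0 \<and> j > 0")
      case True
      then show ?thesis using assms by (simp add: tate_normal_def)
    next
      case False
      have "n = ex i j \<longleftrightarrow> e * n = int i - int j"
        unfolding ex_def using ee by (metis mult.assoc mult_1)
      also have "\<dots> \<longleftrightarrow> (i, j) = (ei n, ej n)"
        using False by (auto simp: ei_def ej_def)
      finally show ?thesis unfolding c by auto
    qed
  qed
  also have "\<dots> = tate_coeff f (ei n) (ej n) $$ (k - wt (ei n) (ej n))"
  proof -
    have "(\<Sum>(i, j)\<in>?A. if (i, j) = (ei n, ej n) then tate_coeff f i j $$ (k - wt i j) else 0)
      = (\<Sum>x\<in>?A. if x = (ei n, ej n) then tate_coeff f (ei n) (ej n) $$ (k - wt (ei n) (ej n)) else 0)"
      by (rule sum.cong[OF refl]) (simp split: prod.split)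
    then show ?thesis by (simp add: finite_supp)
  qed
  finally show ?thesis .
qed

lemma e_ex: "e * (e * x) = (x::int)"
  using e by auto

lemma tiota_normal_eq0: "tate_normal f \<Longrightarrow> tiota f = 0 \<Longrightarrow> f = 0"
proof (rule tate_eqI)
  fix i j assume f: "tate_normal f" "tiota f = 0"
  show "tate_coeff f i j = tate_coeff 0 i j"
  proof (cases "i > 0 \<and> j > 0")
    case True
    then show ?thesis using f by (simp add: tate_normal_def)
  next
    case False
    have "ei (ex i j) = i" "ej (ex i j) = j" using False by (auto simp: ei_def ej_def ex_def e_ex)
    then have "tate_coeff f i j $$ k = 0" for k
      using tiota_normal_nth[OF f(1), of "k + wt i j" "ex i j"] f(2) by simp
    then show ?thesis by (simp add: fls_eq_iff)
  qed
qed

definition iota :: "S \<Rightarrow> L" where "iota F = tiota (rep_S F)"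

lemma tiota_cong: "tate_rel dvd f - g \<Longrightarrow> tiota f = tiota g"
  by (metis dvd_def eq_iff_diff_eq_0 mult_zero_left tiota_diff tiota_mult tiota_rel)

lemma iota_abs: "iota (abs_S f) = tiota f"
  unfolding iota_def by (rule tiota_cong) (simp add: abs_rep_S flip: S.abs_eq_iff)

end

text \<open>At the outer end x = 1/z_1 and z_0 = T x; at the inner end below, x = 1/z_0 and z_1 = T
  x.\<close>

interpretation outer: expansion 2 0 1
  by standard auto

interpretation inner: expansion 0 2 "- 1"
  by standard auto

text \<open>Existence is division by z_0 z_1 - T; uniqueness holds because an expansion kills the
  ideal and is injective on normal forms.\<close>

lemma ex1_normal: "\<exists>!f. abs_S f = F \<and> tate_normal f"
proof (rule ex_ex1I)
  obtain h where h: "tate_normal (rep_S F - tate_rel * h)" using tate_division by blast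
  have "abs_S (rep_S F - tate_rel * h) = F"
    using abs_rep_S[of F] by (metis S.abs_eq_iff add_diff_cancel_left' diff_add_cancel dvd_minus_iff dvd_triv_left minus_diff_eq)
  then show "\<exists>f. abs_S f = F \<and> tate_normal f" using h by blast
next
  fix f g assume fg: "abs_S f = F \<and> tate_normal f" "abs_S g = F \<and> tate_normal g"
  then have "abs_S f = abs_S g" by simp
  then have "outer.tiota (f - g) = 0" by (metis outer.iota_abs outer.tiota_diff right_minus_eq)
  moreover have "tate_normal (f - g)" using fg by (simp add: tate_normal_def)
  ultimately show "f = g" using outer.tiota_normal_eq0 by fastforce
qed

lemma S_normal: "abs_S (S_normal F) = F" "tate_normal (S_normal F)"
  using theI'[OF ex1_normal[of F]] unfolding S_normal_def tate_normal_def by auto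

lemma S_normal_eqI: "abs_S f = F \<Longrightarrow> tate_normal f \<Longrightarrow> S_normal F = f"
  using ex1_normal[of F] S_normal[of F] by blast

context expansion begin

lemma iota_normal: "iota F = tiota (S_normal F)"
  by (metis S_normal(1) iota_abs)

lemma iota_hom:
  "iota 0 = 0" "iota 1 = 1" "iota (F + G) = iota F + iota G" "iota (F - G) = iota F - iota G"
  "iota (- F) = - iota F" "iota (F * G) = iota F * iota G"
  by (metis iota_abs zero_S.abs_eq tiota_0, metis iota_abs one_S.abs_eq tiota_1,
      metis iota_abs abs_rep_S plus_S.abs_eq tiota_add, metis iota_abs abs_rep_S minus_S.abs_eq tiota_diff,
      metis iota_abs abs_rep_S uminus_S.abs_eq tiota_minus, metis iota_abs abs_rep_S times_S.abs_eq tiota_mult)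

lemma iota_gens:
  "iota (S_const r) = emb r" "iota z0 = tx (int p) e" "iota z1 = tx (int q) (- e)"
  by (simp_all add: S_const.abs_eq z0.abs_eq z1.abs_eq iota_abs tiota_const tiota_z)

lemma iota_power: "iota (F ^ n) = iota F ^ n"
  by (induction n) (simp_all add: iota_hom)

lemma iota_eq0: "iota F = 0 \<Longrightarrow> F = 0"
  by (metis S_normal iota_normal tiota_normal_eq0 zero_S.abs_eq)

text \<open>In an expansion the valuation becomes monomial: T^(1/2) weighs 1/2 and x weighs e
  (zeta_0 - p/2), that is, - zeta_1 at the outer and - zeta_0 at the inner end. Compatibility with
  sums and products then follows coefficientwise.\<close>

lemma S_val_ge_iff:
  assumes "fst \<zeta> + snd \<zeta> = 1"
  shows "ereal N \<le> S_val \<zeta> F \<longleftrightarrow>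
    (\<forall>k n. iota F $$ k $$ n \<noteq> 0 \<longrightarrow> N \<le> real_of_int k / 2 + real_of_int (e * n) * (fst \<zeta> - real p / 2))"
proof -
  let ?f = "S_normal F"
  have 1: "ereal N \<le> R_val r + ereal w \<longleftrightarrow> (\<forall>k. r $$ k \<noteq> 0 \<longrightarrow> N \<le> real_of_int k / 2 + w)" for r w
  proof -
    have "ereal N \<le> R_val r + ereal w \<longleftrightarrow> ereal (N - w) \<le> R_val r"
      by (cases "R_val r") auto
    also have "\<dots> \<longleftrightarrow> (\<forall>k. r $$ k \<noteq> 0 \<longrightarrow> N - w \<le> real_of_int k / 2)"
      using R_val_geI R_val_geD by blast
    finally show ?thesis by (simp only: diff_le_eq)
  qed
  have w: "real (ei n) * fst \<zeta> + real (ej n) * snd \<zeta> - real_of_int (wt (ei n) (ej n)) / 2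
      = real_of_int (e * n) * (fst \<zeta> - real p / 2)" for n
  proof -
    have "real (ei n) - real (ej n) = real_of_int (e * n)"
      unfolding ei_def ej_def by (cases "0 \<le> e * n") (simp_all del: of_int_mult)
    moreover have "real (p * ei n + q * ej n) = real p * real (ei n) + (2 - real p) * real (ej n)"
    proof -
      have "real q = 2 - real p" using arg_cong[OF pq, of real] by simp
      then show ?thesis by simp
    qed
    moreover have "snd \<zeta> = 1 - fst \<zeta>" using assms by simp
    moreover have "a * z + b * (1 - z) - (P * a + (2 - P) * b) / 2 = (a - b) * (z - P / 2)" for a b z P :: real
      by (simp add: field_simps)
    ultimately show ?thesis by (simp only: wt_def of_int_of_nat_eq)
  qed
  have "ereal N \<le> S_val \<zeta> F \<longleftrightarrow> (\<forall>i j k. tate_coeff ?f i j $$ k \<noteq> 0 \<longrightarrow>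
      N \<le> real_of_int k / 2 + (real i * fst \<zeta> + real j * snd \<zeta>))"
    unfolding S_val_def le_INF_iff by (auto simp: 1)
  also have "\<dots> \<longleftrightarrow> (\<forall>n k. tate_coeff ?f (ei n) (ej n) $$ k \<noteq> 0 \<longrightarrow>
      N \<le> real_of_int k / 2 + (real (ei n) * fst \<zeta> + real (ej n) * snd \<zeta>))" (is "?l \<longleftrightarrow> ?r")
  proof
    assume r: ?r
    show ?l
    proof (intro allI impI)
      fix i j k assume *: "tate_coeff ?f i j $$ k \<noteq> 0"
      have "\<not> (i > 0 \<and> j > 0)"
        using * S_normal(2)[of F] by (auto simp: tate_normal_def)
      then have "ei (ex i j) = i" "ej (ex i j) = j" by (auto simp: ei_def ej_def ex_def e_ex)
      then show "N \<le> real_of_int k / 2 + (real i * fst \<zeta> + real j * snd \<zeta>)" using r * by metis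
    qed
  qed blast
  also have "\<dots> \<longleftrightarrow> (\<forall>n k. tate_coeff ?f (ei n) (ej n) $$ (k - wt (ei n) (ej n)) \<noteq> 0 \<longrightarrow>
      N \<le> real_of_int (k - wt (ei n) (ej n)) / 2 + (real (ei n) * fst \<zeta> + real (ej n) * snd \<zeta>))"
    by (metis add_diff_cancel_right')
  also have "\<dots> \<longleftrightarrow> (\<forall>n k. iota F $$ k $$ n \<noteq> 0 \<longrightarrow>
      N \<le> real_of_int k / 2 + real_of_int (e * n) * (fst \<zeta> - real p / 2))"
    unfolding w[symmetric] iota_normal tiota_normal_nth[OF S_normal(2)]
    by (simp add: diff_divide_distrib algebra_simps)
  finally show ?thesis by blast
qed

end


lemma ereal_le_via_real: "(\<And>N::real. ereal N \<le> x \<Longrightarrow> ereal N \<le> y) \<Longrightarrow> x \<le> y"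
proof (cases x)
  assume *: "\<And>N::real. ereal N \<le> x \<Longrightarrow> ereal N \<le> y"
  { case (real r) then show ?thesis using *[of r] by simp }
  { case PInf then show ?thesis using * ereal_top[of y] by simp }
  { case MInf then show ?thesis by simp }
qed

lemma S_val_add:
  "fst \<zeta> + snd \<zeta> = 1 \<Longrightarrow> ereal N \<le> S_val \<zeta> F \<Longrightarrow> ereal N \<le> S_val \<zeta> G \<Longrightarrow> ereal N \<le> S_val \<zeta> (F + G)"
  unfolding outer.S_val_ge_iff outer.iota_hom by (auto, metis add.right_neutral)

lemma S_val_uminus: "fst \<zeta> + snd \<zeta> = 1 \<Longrightarrow> ereal N \<le> S_val \<zeta> F \<Longrightarrow> ereal N \<le> S_val \<zeta> (- F)"
  unfolding outer.S_val_ge_iff outer.iota_hom by auto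

lemma S_val_diff:
  "fst \<zeta> + snd \<zeta> = 1 \<Longrightarrow> ereal N \<le> S_val \<zeta> F \<Longrightarrow> ereal N \<le> S_val \<zeta> G \<Longrightarrow> ereal N \<le> S_val \<zeta> (F - G)"
  using S_val_add[of \<zeta> N F "- G"] S_val_uminus by simp

lemma S_val_mult:
  assumes "fst \<zeta> + snd \<zeta> = 1" "ereal N \<le> S_val \<zeta> F" "ereal N' \<le> S_val \<zeta> G"
  shows "ereal (N + N') \<le> S_val \<zeta> (F * G)"
  unfolding outer.S_val_ge_iff[OF assms(1)] outer.iota_hom
proof (intro allI impI)
  fix k n assume "(outer.iota F * outer.iota G) $$ k $$ n \<noteq> 0"
  then have "(\<Sum>i=fls_subdegree (outer.iota F)..k - fls_subdegree (outer.iota G). (outer.iota F $$ i * outer.iota G $$ (k - i)) $$ n) \<noteq> 0"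
    by (simp add: fls_times_nth(2)[of "outer.iota F"] fls_nth_sum)
  then obtain i where "(outer.iota F $$ i * outer.iota G $$ (k - i)) $$ n \<noteq> 0"
    by (rule sum.not_neutral_contains_not_neutral)
  then obtain j where "outer.iota F $$ i $$ j \<noteq> 0" "outer.iota G $$ (k - i) $$ (n - j) \<noteq> 0"
    by (rule fls_mult_nth_nonzeroE)
  then have "N \<le> real_of_int i / 2 + real_of_int (1 * j) * (fst \<zeta> - real 2 / 2)"
    "N' \<le> real_of_int (k - i) / 2 + real_of_int (1 * (n - j)) * (fst \<zeta> - real 2 / 2)"
    using assms(2,3) unfolding outer.S_val_ge_iff[OF assms(1)] by blast+
  then show "N + N' \<le> real_of_int k / 2 + real_of_int (1 * n) * (fst \<zeta> - real 2 / 2)"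
    by (simp add: algebra_simps diff_divide_distrib)
qed

lemma S_val_const:
  assumes "fst \<zeta> + snd \<zeta> = 1" "ereal N \<le> R_val r"
  shows "ereal N \<le> S_val \<zeta> (S_const r)"
  unfolding outer.S_val_ge_iff[OF assms(1)] outer.iota_gens emb_nth
  using R_val_geD[OF assms(2)] by (auto split: if_splits)

lemma S_val_z:
  assumes "fst \<zeta> + snd \<zeta> = 1"
  shows "ereal (fst \<zeta>) \<le> S_val \<zeta> z0" "ereal (snd \<zeta>) \<le> S_val \<zeta> z1"
proof -
  show "ereal (fst \<zeta>) \<le> S_val \<zeta> z0"
    unfolding outer.S_val_ge_iff[OF assms(1)] outer.iota_gens tx_nth
    by (auto split: if_splits)
  show "ereal (snd \<zeta>) \<le> S_val \<zeta> z1"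
    unfolding outer.S_val_ge_iff[OF assms(1)] outer.iota_gens tx_nth
  proof (intro allI impI)
    fix k n
    assume "(if k = int 0 then fls_X_intpow (- 1) else (0::real fls)) $$ n \<noteq> 0"
    then have "k = 0" "n = - 1" by (auto split: if_splits)
    then show "snd \<zeta> \<le> real_of_int k / 2 + real_of_int (1 * n) * (fst \<zeta> - real 2 / 2)"
      using assms by simp
  qed
qed

lemma S_val_0 [simp]: "S_val \<zeta> 0 = \<infinity>"
proof -
  have "S_normal 0 = 0" by (rule S_normal_eqI) (simp_all add: zero_S.abs_eq tate_normal_def)
  then show ?thesis by (simp add: S_val_def)
qed

lemma S_val_eq_infty:
  assumes "fst \<zeta> + snd \<zeta> = 1" "S_val \<zeta> F = \<infinity>"
  shows "F = 0"
proof (rule outer.iota_eq0, intro fls_eqI)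
  fix k n
  show "outer.iota F $$ k $$ n = 0 $$ k $$ n"
    using outer.S_val_ge_iff[OF assms(1), of "real_of_int k / 2 + real_of_int (1 * n) * (fst \<zeta> - real 2 / 2) + 1" F]
      assms(2) by force
qed

lemma S_val_bounded: "\<exists>N. \<forall>\<zeta>\<in>zetas. ereal N \<le> S_val \<zeta> F"
proof -
  obtain N where N: "tate_ge N (S_normal F)" using tate_ge_exists by blast
  have "ereal N \<le> S_val \<zeta> F" if "\<zeta> \<in> zetas" for \<zeta>
    unfolding S_val_def
  proof (rule INF_greatest, clarify)
    fix i j
    have "0 \<le> real i * fst \<zeta> + real j * snd \<zeta>" using that by (auto simp: zetas_def)
    moreover have "ereal N \<le> R_val (tate_coeff (S_normal F) i j)" using N by (simp add: tate_ge_def)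
    ultimately show "ereal N \<le> R_val (tate_coeff (S_normal F) i j) + ereal (real i * fst \<zeta> + real j * snd \<zeta>)"
      by (metis add.right_neutral add_mono ereal_less_eq(5) zero_ereal_def)
  qed
  then show ?thesis by blast
qed

lemma S_val_1: "fst \<zeta> + snd \<zeta> = 1 \<Longrightarrow> S_val \<zeta> 1 = 0"
proof (rule antisym)
  assume \<zeta>: "fst \<zeta> + snd \<zeta> = 1"
  show "S_val \<zeta> 1 \<le> 0"
  proof (rule ereal_le_via_real)
    fix N assume "ereal N \<le> S_val \<zeta> 1"
    then have "N \<le> real_of_int 0 / 2 + real_of_int (1 * 0) * (fst \<zeta> - real 2 / 2)"
      unfolding outer.S_val_ge_iff[OF \<zeta>] outer.iota_hom by (metis fls_one_nth zero_neq_one)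
    then show "ereal N \<le> 0" by (simp add: zero_ereal_def)
  qed
  have "S_const 1 = 1" by (simp add: S_const.abs_eq tate_const_1 one_S.abs_eq)
  then show "0 \<le> S_val \<zeta> 1"
    using S_val_const[OF \<zeta>, of 0 1] by (simp add: R_val_def zero_ereal_def)
qed

section \<open>Endomorphisms of M as 2 by 2 matrices over S\<close>

section \<open>Coordinates on $M$\<close>

lemma S_const_hom:
  "S_const 0 = 0" "S_const 1 = 1" "S_const (r + r') = S_const r + S_const r'"
  "S_const (r * r') = S_const r * S_const r'" "S_const (- r) = - S_const r"
  "S_const (r - r') = S_const r - S_const r'"
proof -
  have "tate_const 0 = 0" "tate_const (- r) = - tate_const r" "tate_const (r - r') = tate_const r - tate_const r'"
    by (rule tate_eqI, simp add: tate_coeff_const)+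
  then show "S_const 0 = 0" "S_const 1 = 1" "S_const (r + r') = S_const r + S_const r'"
    "S_const (r * r') = S_const r * S_const r'" "S_const (- r) = - S_const r"
    "S_const (r - r') = S_const r - S_const r'"
    by (simp_all add: S_const.abs_eq zero_S.abs_eq one_S.abs_eq plus_S.abs_eq times_S.abs_eq
        uminus_S.abs_eq minus_S.abs_eq tate_const_1 tate_const_hom tate_const_mult)
qed

lemma T_half_inverse: "S_const T_half * S_const (inverse T_half) = 1" "S_const (inverse T_half) * S_const T_half = 1"
  by (simp_all flip: S_const_hom)

lemma z0_z1_T_half: "z0 * z1 = S_const T_half * S_const T_half"
  by (simp add: z0_z1 power2_eq_square S_const_hom)

lemma Cl_rel_eq:
  assumes "x - y = u * Cl_rel"
  shows "cl_1 x - cl_1 y = S_const T_half * (S_const T_half * cl_e01 u - cl_1 u)"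
    "cl_e0 x - cl_e0 y = - z1 * cl_e1 u - S_const T_half * cl_e0 u"
    "cl_e1 x - cl_e1 y = - z0 * cl_e0 u - S_const T_half * cl_e1 u"
    "cl_e01 x - cl_e01 y = cl_1 u - S_const T_half * cl_e01 u"
proof -
  have "cl_1 (x - y) = cl_1 (u * Cl_rel)" "cl_e0 (x - y) = cl_e0 (u * Cl_rel)"
    "cl_e1 (x - y) = cl_e1 (u * Cl_rel)" "cl_e01 (x - y) = cl_e01 (u * Cl_rel)"
    using assms by simp_all
  then show "cl_1 x - cl_1 y = S_const T_half * (S_const T_half * cl_e01 u - cl_1 u)"
    "cl_e0 x - cl_e0 y = - z1 * cl_e1 u - S_const T_half * cl_e0 u"
    "cl_e1 x - cl_e1 y = - z0 * cl_e0 u - S_const T_half * cl_e1 u"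
    "cl_e01 x - cl_e01 y = cl_1 u - S_const T_half * cl_e01 u"
    by (simp_all add: Cl_defs e0_def e1_def Cl_S_def z0_z1_T_half algebra_simps)
qed

lift_definition co1 :: "M \<Rightarrow> S" is "\<lambda>x. cl_1 x + S_const T_half * cl_e01 x"
proof -
  fix x y assume "\<exists>u. x - y = u * Cl_rel"
  then obtain u where u: "x - y = u * Cl_rel" by blast
  have "cl_1 x + S_const T_half * cl_e01 x - (cl_1 y + S_const T_half * cl_e01 y)
     = (cl_1 x - cl_1 y) + S_const T_half * (cl_e01 x - cl_e01 y)"
    by (simp add: algebra_simps)
  also have "\<dots> = 0" unfolding Cl_rel_eq[OF u] by (simp add: algebra_simps)
  finally show "cl_1 x + S_const T_half * cl_e01 x = cl_1 y + S_const T_half * cl_e01 y" by simp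
qed

text \<open>In M the relation e_0 e_1 = T^(1/2), multiplied on the left by e_0, gives e_0 = -
  T^(-1/2) z_0 e_1.\<close>

lift_definition co2 :: "M \<Rightarrow> S" is "\<lambda>x. cl_e1 x - S_const (inverse T_half) * z0 * cl_e0 x"
proof -
  fix x y assume "\<exists>u. x - y = u * Cl_rel"
  then obtain u where u: "x - y = u * Cl_rel" by blast
  let ?i = "S_const (inverse T_half)"
  have "cl_e1 x - ?i * z0 * cl_e0 x - (cl_e1 y - ?i * z0 * cl_e0 y)
     = (cl_e1 x - cl_e1 y) - ?i * z0 * (cl_e0 x - cl_e0 y)"
    by (simp add: algebra_simps)
  also have "\<dots> = - z0 * cl_e0 u - S_const T_half * cl_e1 u + ?i * (z0 * z1) * cl_e1 u + (?i * S_const T_half) * z0 * cl_e0 u"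
    unfolding Cl_rel_eq[OF u] by (simp add: algebra_simps)
  also have "?i * (z0 * z1) = S_const T_half"
    unfolding z0_z1_T_half mult.assoc[symmetric] T_half_inverse by simp
  finally show "cl_e1 x - ?i * z0 * cl_e0 x = cl_e1 y - ?i * z0 * cl_e0 y"
    by (simp add: T_half_inverse)
qed

definition mc :: "S \<Rightarrow> S \<Rightarrow> M" where "mc a b = abs_M (Cl a 0 b 0)"

lemma co_abs: "co1 (abs_M x) = cl_1 x + S_const T_half * cl_e01 x"
  "co2 (abs_M x) = cl_e1 x - S_const (inverse T_half) * z0 * cl_e0 x"
  by (simp_all add: co1.abs_eq co2.abs_eq)

lemma co_mc [simp]: "co1 (mc a b) = a" "co2 (mc a b) = b"
  by (simp_all add: mc_def co_abs)

lemma T_half_cancel: "S_const T_half * (S_const (inverse T_half) * y) = y" "S_const (inverse T_half) * (S_const T_half * y) = y"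
  by (simp_all only: mult.assoc[symmetric] T_half_inverse mult_1)

lemma abs_rep_M: "abs_M (rep_M m) = m"
  using Quotient3_abs_rep[OF Quotient3_M] .

lemma mc_co [simp]: "mc (co1 m) (co2 m) = m"
proof -
  obtain a b c d where "rep_M m = Cl a b c d" by (cases "rep_M m")
  then have x: "m = abs_M (Cl a b c d)" using abs_rep_M[of m] by simp
  define t i where ti: "t = S_const T_half" "i = S_const (inverse T_half)"
  \<comment> \<open>Subtracting (d - T^(-1/2) b e_0) times the generator of the ideal clears the
    components along e_0 and e_0 e_1.\<close>
  have "Cl a b c d - Cl (a + t * d) 0 (c - i * z0 * b) 0 = Cl d (- i * b) 0 0 * (e0 * e1 - Cl_S t)"
    using T_half_cancel(1) unfolding ti[symmetric]
    by (simp add: Cl_defs e0_def e1_def Cl_S_def mult_ac)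
  then have "abs_M (Cl a b c d) = abs_M (Cl (co1 m) 0 (co2 m) 0)"
    unfolding M.abs_eq_iff x co_abs Cl.sel unfolding ti by blast
  then show ?thesis by (simp add: mc_def x)
qed

lemma M_eq_iff: "m = m' \<longleftrightarrow> co1 m = co1 m' \<and> co2 m = co2 m'"
  by (metis mc_co)

lemma co_hom: "co1 0 = 0" "co2 0 = 0" "co1 (m + m') = co1 m + co1 m'" "co2 (m + m') = co2 m + co2 m'"
  "co1 (m - m') = co1 m - co1 m'" "co2 (m - m') = co2 m - co2 m'" "co1 (- m) = - co1 m" "co2 (- m) = - co2 m"
proof -
  show 0: "co1 0 = 0" "co2 0 = 0" by (simp_all add: zero_M.abs_eq co_abs zero_Cl_def)
  show 1: "co1 (m + m') = co1 m + co1 m'" "co2 (m + m') = co2 m + co2 m'" for m m'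
    by (transfer, simp add: plus_Cl_def algebra_simps)+
  show 2: "co1 (- m) = - co1 m" "co2 (- m) = - co2 m" for m
    using 1[of m "- m"] by (simp_all add: 0 eq_neg_iff_add_eq_0 add.commute)
  show "co1 (m - m') = co1 m - co1 m'" "co2 (m - m') = co2 m - co2 m'"
    using 1[of m "- m'"] by (simp_all add: 2)
qed

lemma co_act:
  "co1 (M_act x m) = (cl_1 x + S_const T_half * cl_e01 x) * co1 m + (z1 * cl_e1 x + S_const T_half * cl_e0 x) * co2 m"
  "co2 (M_act x m) = (cl_e1 x - S_const (inverse T_half) * z0 * cl_e0 x) * co1 m
     + (cl_1 x - S_const T_half * cl_e01 x) * co2 m"
proof -
  have key: "S_const (inverse T_half) * z0 * z1 = S_const T_half"
    by (simp only: mult.assoc z0_z1_T_half T_half_cancel)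
  have "M_act x m = M_act x (abs_M (Cl (co1 m) 0 (co2 m) 0))" by (simp flip: mc_def)
  then have act: "M_act x m = abs_M (x * Cl (co1 m) 0 (co2 m) 0)" by (simp only: M_act.abs_eq)
  show "co1 (M_act x m) = (cl_1 x + S_const T_half * cl_e01 x) * co1 m + (z1 * cl_e1 x + S_const T_half * cl_e0 x) * co2 m"
    unfolding act co_abs by (simp add: times_Cl_def algebra_simps)
  have "co2 (M_act x m) = (cl_e1 x - S_const (inverse T_half) * z0 * cl_e0 x) * co1 m
     + (cl_1 x - (S_const (inverse T_half) * z0 * z1) * cl_e01 x) * co2 m"
    unfolding act co_abs by (simp add: times_Cl_def algebra_simps)
  then show "co2 (M_act x m) = (cl_e1 x - S_const (inverse T_half) * z0 * cl_e0 x) * co1 m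
     + (cl_1 x - S_const T_half * cl_e01 x) * co2 m"
    unfolding key .
qed

lemma co_scale: "co1 (M_scale F m) = F * co1 m" "co2 (M_scale F m) = F * co2 m"
  by (simp_all add: M_scale_def co_act Cl_S_def)

lemma M_basis_mc: "M_basis 1 = mc 1 0" "M_basis 2 = mc 0 1"
  by (simp_all add: M_basis_def mc_def one_Cl_def e1_def)

lemma M_coord_nth: "M_coord m $ 1 = co1 m" "M_coord m $ 2 = co2 m"
proof -
  have *: "m = (\<Sum>i\<in>UNIV. M_scale (v $ i) (M_basis i)) \<longleftrightarrow> v $ 1 = co1 m \<and> v $ 2 = co2 m" for v :: "S ^ 2"
    unfolding sum_2 M_eq_iff[of m] M_basis_mc co_hom co_scale by auto
  have "M_coord m = (\<chi> i. if i = 1 then co1 m else co2 m)"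
    unfolding M_coord_def
  proof (rule the_equality)
    fix v :: "S ^ 2" assume "m = (\<Sum>i\<in>UNIV. M_scale (v $ i) (M_basis i))"
    then have "v $ 1 = co1 m" "v $ 2 = co2 m" using * by blast+
    then show "v = (\<chi> i. if i = 1 then co1 m else co2 m)"
      by (simp add: vec_eq_iff forall_2)
  qed (subst *, simp)
  then show "M_coord m $ 1 = co1 m" "M_coord m $ 2 = co2 m" by simp_all
qed

text \<open>A separate type, so that the matrix product is the multiplication of a
  \<open>ring_1\<close>; on the vector type multiplication is componentwise.\<close>

datatype 'a m2 = M2 (m11: 'a) (m12: 'a) (m21: 'a) (m22: 'a)

instantiation m2 :: (comm_ring_1) ring_1
begin
definition "0 = M2 0 0 0 0"
definition "1 = M2 1 0 0 1"
definition "A + B = M2 (m11 A + m11 B) (m12 A + m12 B) (m21 A + m21 B) (m22 A + m22 B)"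
definition "A - B = M2 (m11 A - m11 B) (m12 A - m12 B) (m21 A - m21 B) (m22 A - m22 B)"
definition "- A = M2 (- m11 A) (- m12 A) (- m21 A) (- m22 A)"
definition "A * B = M2 (m11 A * m11 B + m12 A * m21 B) (m11 A * m12 B + m12 A * m22 B)
  (m21 A * m11 B + m22 A * m21 B) (m21 A * m12 B + m22 A * m22 B)"
instance
  by standard (simp_all add: zero_m2_def one_m2_def plus_m2_def minus_m2_def uminus_m2_def times_m2_def algebra_simps)
end

lemmas m2_defs = zero_m2_def one_m2_def plus_m2_def minus_m2_def uminus_m2_def times_m2_def

lemma m2_sel [simp]:
  "m11 0 = 0" "m12 0 = 0" "m21 0 = 0" "m22 0 = 0" "m11 1 = 1" "m12 1 = 0" "m21 1 = 0" "m22 1 = 1"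
  "m11 (A + B) = m11 A + m11 B" "m12 (A + B) = m12 A + m12 B" "m21 (A + B) = m21 A + m21 B" "m22 (A + B) = m22 A + m22 B"
  "m11 (A - B) = m11 A - m11 B" "m12 (A - B) = m12 A - m12 B" "m21 (A - B) = m21 A - m21 B" "m22 (A - B) = m22 A - m22 B"
  "m11 (- A) = - m11 A" "m12 (- A) = - m12 A" "m21 (- A) = - m21 A" "m22 (- A) = - m22 A"
  "m11 (A * B) = m11 A * m11 B + m12 A * m21 B" "m12 (A * B) = m11 A * m12 B + m12 A * m22 B"
  "m21 (A * B) = m21 A * m11 B + m22 A * m21 B" "m22 (A * B) = m21 A * m12 B + m22 A * m22 B"
  for A B :: "'a::comm_ring_1 m2"
  by (simp_all add: m2_defs)

lemma m2_eqI: "m11 A = m11 B \<Longrightarrow> m12 A = m12 B \<Longrightarrow> m21 A = m21 B \<Longrightarrow> m22 A = m22 B \<Longrightarrow> A = B"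
  by (cases A; cases B) simp

definition mx :: "End_M \<Rightarrow> S m2" where
  "mx \<Phi> = M2 (co1 (End_apply \<Phi> (mc 1 0))) (co1 (End_apply \<Phi> (mc 0 1)))
     (co2 (End_apply \<Phi> (mc 1 0))) (co2 (End_apply \<Phi> (mc 0 1)))"

lemma End_apply_hom:
  "End_apply \<Phi> (m + m') = End_apply \<Phi> m + End_apply \<Phi> m'"
  "End_apply \<Phi> (M_scale F m) = M_scale F (End_apply \<Phi> m)"
  using End_apply[of \<Phi>] by auto

lemma co_End_apply:
  "co1 (End_apply \<Phi> m) = m11 (mx \<Phi>) * co1 m + m12 (mx \<Phi>) * co2 m"
  "co2 (End_apply \<Phi> m) = m21 (mx \<Phi>) * co1 m + m22 (mx \<Phi>) * co2 m"
proof -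
  have "m = M_scale (co1 m) (mc 1 0) + M_scale (co2 m) (mc 0 1)"
    unfolding M_eq_iff co_hom co_scale by simp
  then have "End_apply \<Phi> m = M_scale (co1 m) (End_apply \<Phi> (mc 1 0)) + M_scale (co2 m) (End_apply \<Phi> (mc 0 1))"
    using End_apply_hom by metis
  then show "co1 (End_apply \<Phi> m) = m11 (mx \<Phi>) * co1 m + m12 (mx \<Phi>) * co2 m"
    "co2 (End_apply \<Phi> m) = m21 (mx \<Phi>) * co1 m + m22 (mx \<Phi>) * co2 m"
    by (simp_all add: co_hom co_scale mx_def mult.commute)
qed

lemma mx_inject: "mx \<Phi> = mx \<Psi> \<longleftrightarrow> \<Phi> = \<Psi>"
proof
  assume "mx \<Phi> = mx \<Psi>"
  then have "End_apply \<Phi> m = End_apply \<Psi> m" for m by (simp add: M_eq_iff[of "End_apply \<Phi> m"] co_End_apply)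
  then show "\<Phi> = \<Psi>" by (simp add: End_apply_inject[symmetric] fun_eq_iff)
qed simp

lemma mx_hom:
  "mx 0 = 0" "mx 1 = 1" "mx (\<Phi> + \<Psi>) = mx \<Phi> + mx \<Psi>" "mx (\<Phi> - \<Psi>) = mx \<Phi> - mx \<Psi>"
  "mx (- \<Phi>) = - mx \<Phi>" "mx (\<Phi> * \<Psi>) = mx \<Phi> * mx \<Psi>"
proof -
  show "mx (\<Phi> * \<Psi>) = mx \<Phi> * mx \<Psi>"
  proof -
    have sel: "m11 (mx X) = co1 (End_apply X (mc 1 0))" "m12 (mx X) = co1 (End_apply X (mc 0 1))"
      "m21 (mx X) = co2 (End_apply X (mc 1 0))" "m22 (mx X) = co2 (End_apply X (mc 0 1))" for X
      by (simp_all add: mx_def)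
    show ?thesis
      by (rule m2_eqI; simp only: sel[of "\<Phi> * \<Psi>"] times_End_M.rep_eq m2_sel co_End_apply[of \<Phi>] sel[of \<Psi>, symmetric])
  qed
qed (rule m2_eqI; simp add: mx_def zero_End_M.rep_eq one_End_M.rep_eq plus_End_M.rep_eq minus_End_M.rep_eq
      uminus_End_M.rep_eq co_hom)+

lemma mx_sum: "mx (sum F I) = (\<Sum>i\<in>I. mx (F i))"
  by (induction I rule: infinite_finite_induct) (simp_all add: mx_hom)

lemma mx_act: "mx (End_act x) = M2 (cl_1 x + S_const T_half * cl_e01 x) (z1 * cl_e1 x + S_const T_half * cl_e0 x)
    (cl_e1 x - S_const (inverse T_half) * z0 * cl_e0 x) (cl_1 x - S_const T_half * cl_e01 x)"
  by (simp add: mx_def End_act.rep_eq co_act)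

lemma mx_const: "mx (End_const r) = M2 (S_const r) 0 0 (S_const r)"
  by (simp add: End_const_def mx_act Cl_S_def)

text \<open>The two off-diagonal entries multiply to z_1 - z_0, so D is the matrix factorization of
  W into z_1 + T^(1/2) and 1 - T^(-1/2) z_0.\<close>

lemma mx_D: "mx D = M2 0 (z1 + S_const T_half) (1 - S_const (inverse T_half) * z0) 0"
  by (simp add: D_def mx_act e0_def e1_def plus_Cl_def)

lemma matrix_of_mx: "matrix_of \<Phi> $ 1 $ 1 = m11 (mx \<Phi>)" "matrix_of \<Phi> $ 1 $ 2 = m12 (mx \<Phi>)"
  "matrix_of \<Phi> $ 2 $ 1 = m21 (mx \<Phi>)" "matrix_of \<Phi> $ 2 $ 2 = m22 (mx \<Phi>)"
  by (simp_all add: matrix_of_def M_coord_nth M_basis_mc mx_def)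


section \<open>Valuations and degrees in terms of matrix entries\<close>

section \<open>Valuations and degrees of endomorphisms\<close>

lemma ereal_le_add_iff: "ereal N \<le> x + ereal w \<longleftrightarrow> ereal (N - w) \<le> x"
  "ereal N \<le> ereal w + x \<longleftrightarrow> ereal (N - w) \<le> x"
  by (cases x; auto)+

lemma ereal_eq_via_real: "(\<And>N::real. ereal N \<le> x \<longleftrightarrow> ereal N \<le> y) \<Longrightarrow> x = y"
  by (rule antisym; rule ereal_le_via_real; blast)

lemma ereal_add_le_via_real:
  assumes "x \<noteq> - \<infinity>" "y \<noteq> - \<infinity>" "\<And>N N'. ereal N \<le> x \<Longrightarrow> ereal N' \<le> y \<Longrightarrow> ereal (N + N') \<le> z"
  shows "x + y \<le> z"
proof (rule ereal_le_via_real)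
  fix B assume B: "ereal B \<le> x + y"
  show "ereal B \<le> z"
  proof (cases x)
    case (real r)
    then show ?thesis using B assms(3)[of r "B - r"] by (cases y) auto
  next
    case PInf
    obtain b where "ereal b \<le> y" using assms(2) by (cases y) auto
    then show ?thesis using assms(3)[of "B - b" b] PInf by simp
  qed (use assms(1) in simp)
qed

lemma inverse_T_half_nth: "inverse T_half $$ n = (if n = - 1 then 1 else 0)"
proof -
  have "inverse T_half = fls_X_intpow (- 1)" unfolding fls_X_conv_shift_1 by (rule fls_inverse_X_intpow)
  then show ?thesis by simp
qed

lemma R_val_T_half: "ereal (1 / 2) \<le> R_val T_half" "ereal (- 1 / 2) \<le> R_val (inverse T_half)"
  by (rule R_val_geI, simp add: inverse_T_half_nth split: if_splits)+

lemma zetas_sum: "\<zeta> \<in> zetas \<Longrightarrow> fst \<zeta> + snd \<zeta> = 1"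
  by (auto simp: zetas_def)

text \<open>The supremum is attained at the representative a + b e_1. Reducing any other one costs
  nothing: T^(1/2) weighs as much as e_0 e_1, and T^(-1/2) z_0 e_1 as much as e_0, because zeta_0 +
  zeta_1 = 1.\<close>

lemma M_val_ge_iff:
  assumes \<zeta>: "fst \<zeta> + snd \<zeta> = 1"
  shows "ereal N \<le> M_val \<zeta> m \<longleftrightarrow> ereal N \<le> S_val \<zeta> (co1 m) \<and> ereal (N - snd \<zeta> / 2) \<le> S_val \<zeta> (co2 m)"
proof -
  have Cl: "ereal N \<le> Cl_val \<zeta> x \<longleftrightarrow> ereal N \<le> S_val \<zeta> (cl_1 x) \<and> ereal (N - fst \<zeta> / 2) \<le> S_val \<zeta> (cl_e0 x)
    \<and> ereal (N - snd \<zeta> / 2) \<le> S_val \<zeta> (cl_e1 x) \<and> ereal (N - 1 / 2) \<le> S_val \<zeta> (cl_e01 x)" for N x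
  proof -
    have "fst \<zeta> / 2 + snd \<zeta> / 2 = 1 / 2" using \<zeta> by (simp flip: add_divide_distrib)
    then show ?thesis by (simp only: Cl_val_def Min_ge_iff finite.intros insert_not_empty ball_simps ereal_le_add_iff)
        (simp add: ereal_le_add_iff)
  qed
  have "M_val \<zeta> m = Cl_val \<zeta> (Cl (co1 m) 0 (co2 m) 0)"
    unfolding M_val_def
  proof (rule antisym)
    show "Cl_val \<zeta> (Cl (co1 m) 0 (co2 m) 0) \<le> (SUP x\<in>{x. abs_M x = m}. Cl_val \<zeta> x)"
      by (rule SUP_upper) (simp flip: mc_def)
    show "(SUP x\<in>{x. abs_M x = m}. Cl_val \<zeta> x) \<le> Cl_val \<zeta> (Cl (co1 m) 0 (co2 m) 0)"
    proof (rule SUP_least, rule ereal_le_via_real)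
      fix x N assume x: "x \<in> {x. abs_M x = m}" and "ereal N \<le> Cl_val \<zeta> x"
      then have N: "ereal N \<le> S_val \<zeta> (cl_1 x)" "ereal (N - fst \<zeta> / 2) \<le> S_val \<zeta> (cl_e0 x)"
        "ereal (N - snd \<zeta> / 2) \<le> S_val \<zeta> (cl_e1 x)" "ereal (N - 1 / 2) \<le> S_val \<zeta> (cl_e01 x)"
        unfolding Cl by blast+
      have co: "co1 m = cl_1 x + S_const T_half * cl_e01 x"
        "co2 m = cl_e1 x - S_const (inverse T_half) * z0 * cl_e0 x"
        using x by (auto simp: co_abs)
      note t = S_val_const[OF \<zeta> R_val_T_half(1)] S_val_const[OF \<zeta> R_val_T_half(2)]
      have "ereal (1 / 2 + (N - 1 / 2)) \<le> S_val \<zeta> (S_const T_half * cl_e01 x)"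
        by (rule S_val_mult[OF \<zeta> t(1) N(4)])
      then have "ereal N \<le> S_val \<zeta> (co1 m)" unfolding co using N(1) by (intro S_val_add[OF \<zeta>]) simp_all
      moreover have e: "(- 1 / 2 + fst \<zeta>) + (N - fst \<zeta> / 2) = N - snd \<zeta> / 2" using \<zeta> by (simp add: field_simps)
      have "ereal ((- 1 / 2 + fst \<zeta>) + (N - fst \<zeta> / 2)) \<le> S_val \<zeta> (S_const (inverse T_half) * z0 * cl_e0 x)"
        by (intro S_val_mult[OF \<zeta>] t(2) S_val_z(1)[OF \<zeta>] N(2))
      then have "ereal (N - snd \<zeta> / 2) \<le> S_val \<zeta> (co2 m)"
        unfolding e co by (intro S_val_diff[OF \<zeta>] N(3))
      ultimately show "ereal N \<le> Cl_val \<zeta> (Cl (co1 m) 0 (co2 m) 0)"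
        unfolding Cl by simp
    qed
  qed
  then show ?thesis by (simp add: Cl)
qed

lemma M_val_real:
  assumes "\<zeta> \<in> zetas" "m \<noteq> 0"
  obtains r where "M_val \<zeta> m = ereal r"
proof (cases "M_val \<zeta> m")
  case PInf
  then have "ereal N \<le> S_val \<zeta> (co1 m) \<and> ereal (N - snd \<zeta> / 2) \<le> S_val \<zeta> (co2 m)" for N
    using M_val_ge_iff[OF zetas_sum[OF assms(1)], of N m] by simp
  then have "ereal N \<le> S_val \<zeta> (co1 m)" "ereal N \<le> S_val \<zeta> (co2 m)" for N
    by (blast, metis add_diff_cancel_right')
  then have "S_val \<zeta> (co1 m) = \<infinity>" "S_val \<zeta> (co2 m) = \<infinity>" by (simp_all add: ereal_top)
  then have "co1 m = 0" "co2 m = 0" using S_val_eq_infty zetas_sum[OF assms(1)] by blast+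
  then show thesis using assms(2) by (simp add: M_eq_iff[of m] co_hom)
next
  case MInf
  obtain N N' where "ereal N \<le> S_val \<zeta> (co1 m)" "ereal N' \<le> S_val \<zeta> (co2 m)"
    using S_val_bounded assms(1) by metis
  note N = this
  define B where "B = min N N'"
  have "B \<le> N" "B - snd \<zeta> / 2 \<le> N'" using assms(1) by (auto simp: zetas_def B_def)
  then have "ereal B \<le> S_val \<zeta> (co1 m)" "ereal (B - snd \<zeta> / 2) \<le> S_val \<zeta> (co2 m)"
    using N by (meson ereal_less_eq(3) order_trans)+
  then have "ereal B \<le> M_val \<zeta> m"
    by (simp only: M_val_ge_iff[OF zetas_sum[OF assms(1)]])
  then show thesis using MInf by simp
qed

text \<open>The shifts compare the weight 0 of the basis vector 1 with the weight zeta_1/2 of e_1: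
  an entry moving e_1 to 1 has to make up zeta_1/2, the opposite one may lose it.\<close>

definition mx_ge :: "real \<times> real \<Rightarrow> real \<Rightarrow> S m2 \<Rightarrow> bool" where
  "mx_ge \<zeta> N A \<longleftrightarrow> ereal N \<le> S_val \<zeta> (m11 A) \<and> ereal (N + snd \<zeta> / 2) \<le> S_val \<zeta> (m12 A)
    \<and> ereal (N - snd \<zeta> / 2) \<le> S_val \<zeta> (m21 A) \<and> ereal N \<le> S_val \<zeta> (m22 A)"

text \<open>Necessity is seen on the basis vectors 1 and e_1; for sufficiency the basis is
  orthogonal, so a bound on each summand of each coordinate is enough.\<close>

lemma End_val_ge_iff: "ereal N \<le> End_val \<Phi> \<longleftrightarrow> (\<forall>\<zeta>\<in>zetas. mx_ge \<zeta> N (mx \<Phi>))"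
proof
  assume "ereal N \<le> End_val \<Phi>"
  then have N: "ereal N \<le> M_val \<zeta> (End_apply \<Phi> m) - M_val \<zeta> m" if "\<zeta> \<in> zetas" "m \<noteq> 0" for \<zeta> m
    using that unfolding End_val_def le_INF_iff by blast
  show "\<forall>\<zeta>\<in>zetas. mx_ge \<zeta> N (mx \<Phi>)"
  proof
    fix \<zeta> assume \<zeta>: "\<zeta> \<in> zetas"
    note s = zetas_sum[OF \<zeta>]
    have "ereal N \<le> M_val \<zeta> (mc 1 0) \<longleftrightarrow> ereal N \<le> 0" "ereal N \<le> M_val \<zeta> (mc 0 1) \<longleftrightarrow> ereal N \<le> ereal (snd \<zeta> / 2)" for N
      unfolding M_val_ge_iff[OF s] by (simp_all add: S_val_1[OF s] zero_ereal_def)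
    then have M: "M_val \<zeta> (mc 1 0) = 0" "M_val \<zeta> (mc 0 1) = ereal (snd \<zeta> / 2)"
      by - (rule ereal_eq_via_real, blast)+
    have ne: "mc 1 0 \<noteq> 0" "mc 0 1 \<noteq> 0" by (simp_all add: M_eq_iff[of _ 0] co_hom)
    have "ereal N \<le> M_val \<zeta> (End_apply \<Phi> (mc 1 0))" using N[OF \<zeta> ne(1)] by (simp add: M)
    moreover have "ereal (N + snd \<zeta> / 2) \<le> M_val \<zeta> (End_apply \<Phi> (mc 0 1))"
      using N[OF \<zeta> ne(2)] unfolding M by (cases "M_val \<zeta> (End_apply \<Phi> (mc 0 1))") auto
    ultimately show "mx_ge \<zeta> N (mx \<Phi>)"
      unfolding M_val_ge_iff[OF s] by (simp add: mx_ge_def co_End_apply)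
  qed
next
  assume N: "\<forall>\<zeta>\<in>zetas. mx_ge \<zeta> N (mx \<Phi>)"
  show "ereal N \<le> End_val \<Phi>"
    unfolding End_val_def le_INF_iff
  proof (intro ballI)
    fix \<zeta> m assume \<zeta>: "\<zeta> \<in> zetas" and m: "m \<in> - {0::M}"
    note s = zetas_sum[OF \<zeta>]
    obtain r where r: "M_val \<zeta> m = ereal r" using M_val_real[OF \<zeta>] m by blast
    then have rm: "ereal r \<le> S_val \<zeta> (co1 m)" "ereal (r - snd \<zeta> / 2) \<le> S_val \<zeta> (co2 m)"
      using M_val_ge_iff[OF s, of r m] by simp_all
    have A: "ereal N \<le> S_val \<zeta> (m11 (mx \<Phi>))" "ereal (N + snd \<zeta> / 2) \<le> S_val \<zeta> (m12 (mx \<Phi>))"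
      "ereal (N - snd \<zeta> / 2) \<le> S_val \<zeta> (m21 (mx \<Phi>))" "ereal N \<le> S_val \<zeta> (m22 (mx \<Phi>))"
      using N \<zeta> by (simp_all add: mx_ge_def)
    have "ereal (N + r) \<le> S_val \<zeta> (co1 (End_apply \<Phi> m))"
      unfolding co_End_apply
      using S_val_mult[OF s A(1) rm(1)] S_val_mult[OF s A(2) rm(2)] by (intro S_val_add[OF s]) simp_all
    moreover have "ereal (N + r - snd \<zeta> / 2) \<le> S_val \<zeta> (co2 (End_apply \<Phi> m))"
      unfolding co_End_apply
      using S_val_mult[OF s A(3) rm(1)] S_val_mult[OF s A(4) rm(2)]
      by (intro S_val_add[OF s]) (simp_all add: algebra_simps)
    ultimately have "ereal (N + r) \<le> M_val \<zeta> (End_apply \<Phi> m)" unfolding M_val_ge_iff[OF s] by blast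
    then show "ereal N \<le> M_val \<zeta> (End_apply \<Phi> m) - M_val \<zeta> m"
      unfolding r by (cases "M_val \<zeta> (End_apply \<Phi> m)") auto
  qed
qed

lemma End_val_bounded: "\<exists>N. ereal N \<le> End_val \<Phi>"
proof -
  obtain a b c d where "\<forall>\<zeta>\<in>zetas. ereal a \<le> S_val \<zeta> (m11 (mx \<Phi>))" "\<forall>\<zeta>\<in>zetas. ereal b \<le> S_val \<zeta> (m12 (mx \<Phi>))"
    "\<forall>\<zeta>\<in>zetas. ereal c \<le> S_val \<zeta> (m21 (mx \<Phi>))" "\<forall>\<zeta>\<in>zetas. ereal d \<le> S_val \<zeta> (m22 (mx \<Phi>))"
    using S_val_bounded by metis
  note abcd = this
  \<comment> \<open>The extra 1 absorbs the shifts by zeta_1/2, which stay below 1/2.\<close>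
  define N where "N = min (min a b) (min c d) - 1"
  have "mx_ge \<zeta> N (mx \<Phi>)" if \<zeta>: "\<zeta> \<in> zetas" for \<zeta>
  proof -
    have *: "0 < snd \<zeta>" "snd \<zeta> < 1" using \<zeta> by (auto simp: zetas_def)
    have "N \<le> a" "N + snd \<zeta> / 2 \<le> b" "N - snd \<zeta> / 2 \<le> c" "N \<le> d"
      unfolding N_def min_def using * by auto
    then show ?thesis
      unfolding mx_ge_def using bspec[OF abcd(1) \<zeta>] bspec[OF abcd(2) \<zeta>] bspec[OF abcd(3) \<zeta>] bspec[OF abcd(4) \<zeta>]
      by (meson ereal_less_eq(3) order_trans)
  qed
  then show ?thesis unfolding End_val_ge_iff by blast
qed

lemma End_val_MInf: "End_val \<Phi> \<noteq> - \<infinity>"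
  using End_val_bounded[of \<Phi>] by auto

lemma End_val_mult: "ereal N \<le> End_val \<Phi> \<Longrightarrow> ereal N' \<le> End_val \<Psi> \<Longrightarrow> ereal (N + N') \<le> End_val (\<Phi> * \<Psi>)"
  unfolding End_val_ge_iff
proof
  fix \<zeta> assume *: "\<forall>\<zeta>\<in>zetas. mx_ge \<zeta> N (mx \<Phi>)" "\<forall>\<zeta>\<in>zetas. mx_ge \<zeta> N' (mx \<Psi>)" "\<zeta> \<in> zetas"
  note s = zetas_sum[OF *(3)]
  have A: "ereal N \<le> S_val \<zeta> (m11 (mx \<Phi>))" "ereal (N + snd \<zeta> / 2) \<le> S_val \<zeta> (m12 (mx \<Phi>))"
      "ereal (N - snd \<zeta> / 2) \<le> S_val \<zeta> (m21 (mx \<Phi>))" "ereal N \<le> S_val \<zeta> (m22 (mx \<Phi>))"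
    and B: "ereal N' \<le> S_val \<zeta> (m11 (mx \<Psi>))" "ereal (N' + snd \<zeta> / 2) \<le> S_val \<zeta> (m12 (mx \<Psi>))"
      "ereal (N' - snd \<zeta> / 2) \<le> S_val \<zeta> (m21 (mx \<Psi>))" "ereal N' \<le> S_val \<zeta> (m22 (mx \<Psi>))"
    using * by (auto simp: mx_ge_def)
  show "mx_ge \<zeta> (N + N') (mx (\<Phi> * \<Psi>))"
    unfolding mx_ge_def mx_hom m2_sel
    using S_val_mult[OF s A(1) B(1)] S_val_mult[OF s A(2) B(3)] S_val_mult[OF s A(1) B(2)] S_val_mult[OF s A(2) B(4)]
      S_val_mult[OF s A(3) B(1)] S_val_mult[OF s A(4) B(3)] S_val_mult[OF s A(3) B(2)] S_val_mult[OF s A(4) B(4)]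
    by (intro conjI S_val_add[OF s]) (simp_all add: algebra_simps)
qed

lemma End_val_add: "ereal N \<le> End_val \<Phi> \<Longrightarrow> ereal N \<le> End_val \<Psi> \<Longrightarrow> ereal N \<le> End_val (\<Phi> + \<Psi>)"
  unfolding End_val_ge_iff mx_ge_def mx_hom m2_sel using S_val_add[OF zetas_sum] by blast

lemma End_val_uminus: "ereal N \<le> End_val \<Phi> \<Longrightarrow> ereal N \<le> End_val (- \<Phi>)"
  unfolding End_val_ge_iff mx_ge_def mx_hom m2_sel using S_val_uminus[OF zetas_sum] by blast

lemma End_val_0: "ereal N \<le> End_val 0"
  by (simp add: End_val_ge_iff mx_ge_def mx_hom)

lemma End_val_sum: "(\<And>i. i \<in> I \<Longrightarrow> ereal N \<le> End_val (F i)) \<Longrightarrow> ereal N \<le> End_val (sum F I)"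
  by (induction I rule: infinite_finite_induct) (auto simp: End_val_0 End_val_add)

lemma End_val_const: "ereal N \<le> R_val r \<Longrightarrow> ereal N \<le> End_val (End_const r)"
  unfolding End_val_ge_iff mx_ge_def mx_const using S_val_const[OF zetas_sum] by auto

lemma End_val_D: "ereal 0 \<le> End_val D"
  unfolding End_val_ge_iff
proof
  fix \<zeta> assume \<zeta>: "\<zeta> \<in> zetas"
  note s = zetas_sum[OF \<zeta>]
  have *: "0 < snd \<zeta>" "snd \<zeta> < 1" "fst \<zeta> = 1 - snd \<zeta>" using \<zeta> by (auto simp: zetas_def)
  have "ereal (snd \<zeta> / 2) \<le> S_val \<zeta> z1" by (rule order_trans[OF _ S_val_z(2)[OF s]]) (use * in simp)
  moreover have "ereal (snd \<zeta> / 2) \<le> S_val \<zeta> (S_const T_half)"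
    by (rule order_trans[OF _ S_val_const[OF s R_val_T_half(1)]]) (use * in simp)
  moreover have "ereal (- snd \<zeta> / 2) \<le> S_val \<zeta> 1" unfolding S_val_1[OF s] zero_ereal_def using * by simp
  moreover have "ereal (- snd \<zeta> / 2) \<le> S_val \<zeta> (S_const (inverse T_half) * z0)"
    by (rule order_trans[OF _ S_val_mult[OF s S_val_const[OF s R_val_T_half(2)] S_val_z(1)[OF s]]])
      (use * in \<open>simp add: field_simps\<close>)
  ultimately show "mx_ge \<zeta> 0 (mx D)"
    unfolding mx_ge_def mx_D using S_val_add[OF s] S_val_diff[OF s] by simp
qed

lemma Ends_val_ge_iff: "ereal N \<le> Ends_val \<Phi> \<longleftrightarrow> (\<forall>i. ereal (N - real i) \<le> End_val (fps_nth \<Phi> i))"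
  by (simp add: Ends_val_def le_INF_iff ereal_le_add_iff)

lemma Ends_iff: "\<Phi> \<in> Ends \<longleftrightarrow> (\<forall>N. \<exists>i0. \<forall>i\<ge>i0. ereal (N - real i) \<le> End_val (fps_nth \<Phi> i))"
  by (simp add: Ends_def Lim_PInfty ereal_le_add_iff)

lemma Ends_val_bounded:
  assumes "\<Phi> \<in> Ends"
  shows "\<exists>N. ereal N \<le> Ends_val \<Phi>"
proof -
  obtain i0 where i0: "\<And>i. i \<ge> i0 \<Longrightarrow> ereal (0 - real i) \<le> End_val (fps_nth \<Phi> i)"
    using assms unfolding Ends_iff by blast
  define g where "g i = (SOME N. ereal N \<le> End_val (fps_nth \<Phi> i))" for i
  have g: "ereal (g i) \<le> End_val (fps_nth \<Phi> i)" for i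
    unfolding g_def by (rule someI_ex) (rule End_val_bounded)
  define N where "N = Min (insert 0 (g ` {..<i0}))"
  have "ereal (N - real i) \<le> End_val (fps_nth \<Phi> i)" for i
  proof (cases "i < i0")
    case True
    then have "N \<le> g i" unfolding N_def by (intro Min_le) auto
    then have "ereal (N - real i) \<le> ereal (g i)" by simp
    then show ?thesis using g[of i] by (rule order_trans)
  next
    case False
    have "N \<le> 0" unfolding N_def by (intro Min_le) auto
    then have "ereal (N - real i) \<le> ereal (0 - real i)" by simp
    moreover have "ereal (0 - real i) \<le> End_val (fps_nth \<Phi> i)" using i0[of i] False by simp
    ultimately show ?thesis by (rule order_trans)
  qed
  then show ?thesis unfolding Ends_val_ge_iff by blast
qed

lemma Ends_val_MInf: "\<Phi> \<in> Ends \<Longrightarrow> Ends_val \<Phi> \<noteq> - \<infinity>"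
  using Ends_val_bounded by force

lemma Ends_add: "\<Phi> \<in> Ends \<Longrightarrow> \<Psi> \<in> Ends \<Longrightarrow> \<Phi> + \<Psi> \<in> Ends"
  unfolding Ends_iff fps_add_nth
proof
  fix N assume "\<forall>N. \<exists>i0. \<forall>i\<ge>i0. ereal (N - real i) \<le> End_val (fps_nth \<Phi> i)"
    "\<forall>N. \<exists>i0. \<forall>i\<ge>i0. ereal (N - real i) \<le> End_val (fps_nth \<Psi> i)"
  then obtain i j where "\<forall>k\<ge>i. ereal (N - real k) \<le> End_val (fps_nth \<Phi> k)"
    "\<forall>k\<ge>j. ereal (N - real k) \<le> End_val (fps_nth \<Psi> k)" by meson
  then show "\<exists>i0. \<forall>i\<ge>i0. ereal (N - real i) \<le> End_val (fps_nth \<Phi> i + fps_nth \<Psi> i)"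
    by (intro exI[of _ "max i j"]) (auto intro: End_val_add)
qed

lemma Ends_uminus: "\<Phi> \<in> Ends \<Longrightarrow> - \<Phi> \<in> Ends"
  unfolding Ends_iff fps_neg_nth by (meson End_val_uminus)

lemma Ends_diff: "\<Phi> \<in> Ends \<Longrightarrow> \<Psi> \<in> Ends \<Longrightarrow> \<Phi> - \<Psi> \<in> Ends"
  using Ends_add[of \<Phi> "- \<Psi>"] Ends_uminus by simp

lemma Ends_mult:
  assumes "\<Phi> \<in> Ends" "\<Psi> \<in> Ends"
  shows "\<Phi> * \<Psi> \<in> Ends"
  unfolding Ends_iff
proof
  fix N
  obtain A B where A: "ereal A \<le> Ends_val \<Phi>" and B: "ereal B \<le> Ends_val \<Psi>"
    using assms Ends_val_bounded by blast
  obtain p q where p: "\<And>i. i \<ge> p \<Longrightarrow> ereal (N - B - real i) \<le> End_val (fps_nth \<Phi> i)"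
    and q: "\<And>i. i \<ge> q \<Longrightarrow> ereal (N - A - real i) \<le> End_val (fps_nth \<Psi> i)"
    using assms unfolding Ends_iff by meson
  have "ereal (N - real i) \<le> End_val (fps_nth (\<Phi> * \<Psi>) i)" if "i \<ge> p + q" for i
    unfolding fps_mult_nth
  proof (rule End_val_sum)
    fix j assume j: "j \<in> {0..i}"
    then have *: "real (i - j) = real i - real j" by (simp add: of_nat_diff)
    show "ereal (N - real i) \<le> End_val (fps_nth \<Phi> j * fps_nth \<Psi> (i - j))"
    proof (cases "j \<ge> p")
      case True
      have "ereal (B - real (i - j)) \<le> End_val (fps_nth \<Psi> (i - j))" using B unfolding Ends_val_ge_iff by blast
      from End_val_mult[OF p[OF True] this] show ?thesis by (simp add: *)
    next
      case False
      then have "i - j \<ge> q" using that by simp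
      have "ereal (A - real j) \<le> End_val (fps_nth \<Phi> j)" using A unfolding Ends_val_ge_iff by blast
      from End_val_mult[OF this q[OF \<open>i - j \<ge> q\<close>]] show ?thesis by (simp add: *)
    qed
  qed
  then show "\<exists>i0. \<forall>i\<ge>i0. ereal (N - real i) \<le> End_val (fps_nth (\<Phi> * \<Psi>) i)" by blast
qed

lemma Ends_val_mult_ge:
  assumes "ereal N \<le> Ends_val \<Phi>" "ereal N' \<le> Ends_val \<Psi>"
  shows "ereal (N + N') \<le> Ends_val (\<Phi> * \<Psi>)"
  unfolding Ends_val_ge_iff fps_mult_nth
proof (intro allI End_val_sum)
  fix i j :: nat assume "j \<in> {0..i}"
  then have "N + N' - real i = (N - real j) + (N' - real (i - j))" by (simp add: of_nat_diff)
  then show "ereal (N + N' - real i) \<le> End_val (fps_nth \<Phi> j * fps_nth \<Psi> (i - j))"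
    using assms End_val_mult unfolding Ends_val_ge_iff by metis
qed

lemma Ends_val_mult: "\<Phi> \<in> Ends \<Longrightarrow> \<Psi> \<in> Ends \<Longrightarrow> Ends_val \<Phi> + Ends_val \<Psi> \<le> Ends_val (\<Phi> * \<Psi>)"
  by (rule ereal_add_le_via_real[OF Ends_val_MInf Ends_val_MInf Ends_val_mult_ge])

lemma Ends_val_add_ge: "ereal N \<le> Ends_val \<Phi> \<Longrightarrow> ereal N \<le> Ends_val \<Psi> \<Longrightarrow> ereal N \<le> Ends_val (\<Phi> + \<Psi>)"
  by (simp add: Ends_val_ge_iff End_val_add)

lemma Ends_val_uminus_ge: "ereal N \<le> Ends_val \<Phi> \<Longrightarrow> ereal N \<le> Ends_val (- \<Phi>)"
  by (simp add: Ends_val_ge_iff End_val_uminus)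

lemma Ends_val_diff_ge: "ereal N \<le> Ends_val \<Phi> \<Longrightarrow> ereal N \<le> Ends_val \<Psi> \<Longrightarrow> ereal N \<le> Ends_val (\<Phi> - \<Psi>)"
  using Ends_val_add_ge[of N \<Phi> "- \<Psi>"] Ends_val_uminus_ge by simp

lemma Ends_const: "fps_const \<Phi> \<in> Ends"
  unfolding Ends_iff by (intro allI exI[of _ 1]) (auto simp: End_val_0)

lemma Ends_val_const_ge: "ereal N \<le> End_val \<Phi> \<Longrightarrow> ereal N \<le> Ends_val (fps_const \<Phi>)"
  unfolding Ends_val_ge_iff
proof
  fix i assume "ereal N \<le> End_val \<Phi>"
  then show "ereal (N - real i) \<le> End_val (fps_nth (fps_const \<Phi>) i)" by (auto simp: End_val_0)
qed

lemma psign_mult_cases: "psign d * x = x \<or> psign d * x = - (x::'a::ring_1)"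
  by (simp add: psign_def)

lemma delta_Ends: "a \<in> Ends \<Longrightarrow> delta d a \<in> Ends"
proof -
  assume a: "a \<in> Ends"
  have "psign d * a \<in> Ends"
    using psign_mult_cases[of d a] a by (elim disjE) (simp_all only: Ends_uminus)
  then show ?thesis
    unfolding delta_def by (rule Ends_diff[OF Ends_mult[OF Ends_const a] Ends_mult[OF _ Ends_const]])
qed

lemma Ends_val_delta:
  assumes "a \<in> Ends"
  shows "Ends_val a \<le> Ends_val (delta d a)"
proof (rule ereal_le_via_real)
  fix N assume N: "ereal N \<le> Ends_val a"
  then have "ereal N \<le> Ends_val (psign d * a)"
    using psign_mult_cases[of d a] Ends_val_uminus_ge by metis
  then show "ereal N \<le> Ends_val (delta d a)"
    unfolding delta_def
    using Ends_val_mult_ge[OF Ends_val_const_ge[OF End_val_D] N] Ends_val_mult_ge[OF _ Ends_val_const_ge[OF End_val_D], of N]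
    by (intro Ends_val_diff_ge) simp_all
qed

lemma R_deg_add: "R_deg d r \<Longrightarrow> R_deg d r' \<Longrightarrow> R_deg d (r + r')"
  unfolding R_deg_def fls_plus_nth by (metis add.right_neutral)

lemma R_deg_uminus: "R_deg d r \<Longrightarrow> R_deg d (- r)"
  by (simp add: R_deg_def)

lemma R_deg_0: "R_deg d 0"
  by (simp add: R_deg_def)

lemma R_deg_mult:
  assumes "R_deg d r" "R_deg d' r'"
  shows "R_deg (d + d') (r * r')"
  unfolding R_deg_def
proof (intro allI impI)
  fix n assume "(r * r') $$ n \<noteq> 0"
  then obtain i where "r $$ i \<noteq> 0" "r' $$ (n - i) \<noteq> 0" by (rule fls_mult_nth_nonzeroE)
  then have "2 * i = d" "2 * (n - i) = d'" using assms unfolding R_deg_def by blast+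
  then show "2 * n = d + d'" by simp
qed

lemma R_deg_sum: "(\<And>i. i \<in> I \<Longrightarrow> R_deg d (F i)) \<Longrightarrow> R_deg d (sum F I)"
  by (induction I rule: infinite_finite_induct) (auto simp: R_deg_0 R_deg_add)

lemma S_deg_0: "S_deg d 0"
  unfolding S_deg_def by (intro exI[of _ 0]) (simp add: tate_deg_def R_deg_0 zero_S.abs_eq)

lemma S_deg_add: "S_deg d F \<Longrightarrow> S_deg d G \<Longrightarrow> S_deg d (F + G)"
  unfolding S_deg_def tate_deg_def by (metis R_deg_add tate_coeff_simps(2) plus_S.abs_eq)

lemma S_deg_uminus: "S_deg d F \<Longrightarrow> S_deg d (- F)"
  unfolding S_deg_def tate_deg_def by (metis R_deg_uminus tate_coeff_simps(4) uminus_S.abs_eq)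

lemma S_deg_diff: "S_deg d F \<Longrightarrow> S_deg d G \<Longrightarrow> S_deg d (F - G)"
  using S_deg_add[of d F "- G"] S_deg_uminus by simp

lemma tate_deg_mult:
  assumes "tate_deg d f" "tate_deg d' g"
  shows "tate_deg (d + d') (f * g)"
  unfolding tate_deg_def tate_coeff_mult
proof (intro allI R_deg_sum)
  fix i j k l :: nat assume "k \<in> {0..i}" "l \<in> {0..j}"
  then have "(d - 2 * int k - 2 * int l) + (d' - 2 * int (i - k) - 2 * int (j - l)) = d + d' - 2 * int i - 2 * int j"
    by (simp add: of_nat_diff)
  then show "R_deg (d + d' - 2 * int i - 2 * int j) (tate_coeff f k l * tate_coeff g (i - k) (j - l))"
    using assms R_deg_mult unfolding tate_deg_def by metis
qed

lemma S_deg_mult: "S_deg d F \<Longrightarrow> S_deg d' G \<Longrightarrow> S_deg (d + d') (F * G)"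
  unfolding S_deg_def by (metis tate_deg_mult times_S.abs_eq)

lemma S_deg_gens: "R_deg d r \<Longrightarrow> S_deg d (S_const r)" "S_deg 2 z0" "S_deg 2 z1"
proof -
  show "S_deg d (S_const r)" if "R_deg d r"
    unfolding S_deg_def by (intro exI[of _ "tate_const r"])
      (use that in \<open>auto simp: tate_deg_def tate_coeff_const R_deg_0 S_const.abs_eq\<close>)
  show "S_deg 2 z0"
    unfolding S_deg_def by (intro exI[of _ tate_z0]) (auto simp: tate_deg_def tate_z0_coeff R_deg_def z0.abs_eq)
  show "S_deg 2 z1"
    unfolding S_deg_def by (intro exI[of _ tate_z1]) (auto simp: tate_deg_def tate_z1_coeff R_deg_def z1.abs_eq)
qed

lemma R_deg_T_half: "R_deg 2 T_half" "R_deg (- 2) (inverse T_half)" "R_deg 0 1"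
  by (auto simp: R_deg_def inverse_T_half_nth split: if_splits)

text \<open>The generators T^(1/2), z_0, z_1 all have even degree. Hence homogeneous endomorphisms
  of even degree have diagonal matrices and those of odd degree off-diagonal ones, which ties the
  signs of the complex to matrix parity.\<close>

lemma S_deg_odd: "S_deg d F \<Longrightarrow> odd d \<Longrightarrow> F = 0"
proof -
  assume "S_deg d F" and d: "odd d"
  then obtain f where f: "tate_deg d f" "abs_S f = F" unfolding S_deg_def by blast
  have "tate_coeff f i j $$ n = 0" for i j n
  proof (rule ccontr)
    assume "tate_coeff f i j $$ n \<noteq> 0"
    then have "2 * n = d - 2 * int i - 2 * int j" using f unfolding tate_deg_def R_deg_def by blast
    then have "d = 2 * (n + int i + int j)" by simp
    then show False using d by simp
  qed
  then have "f = 0" by (intro tate_eqI fls_eqI) simp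
  then show "F = 0" using f(2) by (simp add: zero_S.abs_eq)
qed

lemma M_deg_iff: "M_deg k m \<longleftrightarrow> S_deg k (co1 m) \<and> S_deg (k - 1) (co2 m)"
proof
  assume "M_deg k m"
  then obtain x where x: "Cl_deg k x" "abs_M x = m" unfolding M_deg_def by blast
  have "S_deg (2 + (k - 2)) (S_const T_half * cl_e01 x)" "S_deg ((- 2 + 2) + (k - 1)) (S_const (inverse T_half) * z0 * cl_e0 x)"
    using x(1) unfolding Cl_deg_def by (intro S_deg_mult S_deg_gens R_deg_T_half; simp)+
  then show "S_deg k (co1 m) \<and> S_deg (k - 1) (co2 m)"
    unfolding x(2)[symmetric] co_abs using x(1) unfolding Cl_deg_def by (simp add: S_deg_add S_deg_diff)
next
  assume "S_deg k (co1 m) \<and> S_deg (k - 1) (co2 m)"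
  then show "M_deg k m"
    unfolding M_deg_def by (intro exI[of _ "Cl (co1 m) 0 (co2 m) 0"]) (simp add: Cl_deg_def S_deg_0 flip: mc_def)
qed

lemma End_deg_iff: "End_deg d \<Phi> \<longleftrightarrow> S_deg d (m11 (mx \<Phi>)) \<and> S_deg (d + 1) (m12 (mx \<Phi>))
    \<and> S_deg (d - 1) (m21 (mx \<Phi>)) \<and> S_deg d (m22 (mx \<Phi>))"
proof
  assume d: "End_deg d \<Phi>"
  have "S_deg 0 1" using S_deg_gens(1)[OF R_deg_T_half(3)] by (simp add: S_const_hom)
  then have "M_deg 0 (mc 1 0)" "M_deg 1 (mc 0 1)" by (simp_all add: M_deg_iff S_deg_0)
  then have "M_deg (0 + d) (End_apply \<Phi> (mc 1 0))" "M_deg (1 + d) (End_apply \<Phi> (mc 0 1))"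
    using d unfolding End_deg_def by blast+
  then show "S_deg d (m11 (mx \<Phi>)) \<and> S_deg (d + 1) (m12 (mx \<Phi>))
    \<and> S_deg (d - 1) (m21 (mx \<Phi>)) \<and> S_deg d (m22 (mx \<Phi>))"
    by (simp add: M_deg_iff co_End_apply add.commute)
next
  assume d: "S_deg d (m11 (mx \<Phi>)) \<and> S_deg (d + 1) (m12 (mx \<Phi>))
    \<and> S_deg (d - 1) (m21 (mx \<Phi>)) \<and> S_deg d (m22 (mx \<Phi>))"
  show "End_deg d \<Phi>"
    unfolding End_deg_def M_deg_iff co_End_apply
  proof (intro allI impI)
    fix k m assume m: "S_deg k (co1 m) \<and> S_deg (k - 1) (co2 m)"
    have "S_deg (d + k) (m11 (mx \<Phi>) * co1 m)" "S_deg ((d + 1) + (k - 1)) (m12 (mx \<Phi>) * co2 m)"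
      "S_deg ((d - 1) + k) (m21 (mx \<Phi>) * co1 m)" "S_deg (d + (k - 1)) (m22 (mx \<Phi>) * co2 m)"
      using d m by (blast intro: S_deg_mult)+
    then show "S_deg (k + d) (m11 (mx \<Phi>) * co1 m + m12 (mx \<Phi>) * co2 m)
      \<and> S_deg (k + d - 1) (m21 (mx \<Phi>) * co1 m + m22 (mx \<Phi>) * co2 m)"
      by (simp add: S_deg_add algebra_simps)
  qed
qed

lemma End_deg_mult:
  assumes "End_deg d \<Phi>" "End_deg d' \<Psi>"
  shows "End_deg (d + d') (\<Phi> * \<Psi>)"
  unfolding End_deg_def times_End_M.rep_eq
proof (intro allI impI)
  fix k m assume "M_deg k m"
  then have "M_deg (k + d' + d) (End_apply \<Phi> (End_apply \<Psi> m))" using assms unfolding End_deg_def by blast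
  then show "M_deg (k + (d + d')) (End_apply \<Phi> (End_apply \<Psi> m))" by (simp add: algebra_simps)
qed

lemma End_deg_add: "End_deg d \<Phi> \<Longrightarrow> End_deg d \<Psi> \<Longrightarrow> End_deg d (\<Phi> + \<Psi>)"
  by (simp add: End_deg_iff mx_hom S_deg_add)

lemma End_deg_uminus: "End_deg d \<Phi> \<Longrightarrow> End_deg d (- \<Phi>)"
  by (simp add: End_deg_iff mx_hom S_deg_uminus)

lemma End_deg_0: "End_deg d 0"
  by (simp add: End_deg_iff mx_hom S_deg_0)

lemma End_deg_sum: "(\<And>i. i \<in> I \<Longrightarrow> End_deg d (F i)) \<Longrightarrow> End_deg d (sum F I)"
  by (induction I rule: infinite_finite_induct) (auto simp: End_deg_0 End_deg_add)

lemma End_deg_const: "R_deg e r \<Longrightarrow> End_deg e (End_const r)"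
  by (simp add: End_deg_iff mx_const S_deg_0 S_deg_gens)

lemma End_deg_D: "End_deg 1 D"
proof -
  have "S_deg (- 2 + 2) (S_const (inverse T_half) * z0)" by (intro S_deg_mult S_deg_gens R_deg_T_half)
  moreover have "S_deg 0 1" using S_deg_gens(1)[OF R_deg_T_half(3)] by (simp add: S_const_hom)
  ultimately show ?thesis
    by (simp add: End_deg_iff mx_D S_deg_0 S_deg_add S_deg_diff S_deg_gens R_deg_T_half)
qed

lemma Ends_deg_mult: "Ends_deg d \<Phi> \<Longrightarrow> Ends_deg d' \<Psi> \<Longrightarrow> Ends_deg (d + d') (\<Phi> * \<Psi>)"
  unfolding Ends_deg_def fps_mult_nth by (intro allI End_deg_sum End_deg_mult) blast+

lemma Ends_deg_add: "Ends_deg d \<Phi> \<Longrightarrow> Ends_deg d \<Psi> \<Longrightarrow> Ends_deg d (\<Phi> + \<Psi>)"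
  by (simp add: Ends_deg_def End_deg_add)

lemma Ends_deg_uminus: "Ends_deg d \<Phi> \<Longrightarrow> Ends_deg d (- \<Phi>)"
  by (simp add: Ends_deg_def End_deg_uminus)

lemma Ends_deg_diff: "Ends_deg d \<Phi> \<Longrightarrow> Ends_deg d \<Psi> \<Longrightarrow> Ends_deg d (\<Phi> - \<Psi>)"
  using Ends_deg_add[of d \<Phi> "- \<Psi>"] Ends_deg_uminus by simp

lemma Ends_deg_const: "End_deg d \<Phi> \<Longrightarrow> Ends_deg d (fps_const \<Phi>)"
  by (simp add: Ends_deg_def End_deg_0)

lemma Ends_deg_psign: "Ends_deg d \<Phi> \<Longrightarrow> Ends_deg d (psign k * \<Phi>)"
  using psign_mult_cases[of k \<Phi>] Ends_deg_uminus by metis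

lemma delta_letter: "(d, a) \<in> letters \<Longrightarrow> (d + 1, delta d a) \<in> letters"
  unfolding letters_def delta_def
  using delta_Ends[of a d] Ends_deg_mult[OF Ends_deg_const[OF End_deg_D], of d a]
    Ends_deg_mult[OF Ends_deg_psign Ends_deg_const[OF End_deg_D], of d a d]
  by (auto simp: delta_def add.commute intro: Ends_deg_diff)

lemma mult_letter: "x \<in> letters \<Longrightarrow> y \<in> letters \<Longrightarrow> letter_mult x y \<in> letters"
  by (auto simp: letters_def letter_mult_def Ends_mult Ends_deg_mult)

lemma Rs_id_nth [simp]: "fps_nth (Rs_id r) i = End_const (fps_nth r i)"
  by (simp add: Rs_id_def)

lemma End_const_hom: "End_const 0 = 0" "End_const 1 = 1" "End_const (r + r') = End_const r + End_const r'"
  "End_const (r * r') = End_const r * End_const r'" "End_const (- r) = - End_const r"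
  "End_const (r - r') = End_const r - End_const r'" "End_const r * \<Phi> = \<Phi> * End_const r"
  by (simp_all only: mx_inject[symmetric]) (rule m2_eqI; simp add: mx_const mx_hom S_const_hom mult.commute)+

lemma End_const_sum: "End_const (sum F I) = (\<Sum>i\<in>I. End_const (F i))"
  by (induction I rule: infinite_finite_induct) (simp_all add: End_const_hom)

lemma Rs_id_hom: "Rs_id 0 = 0" "Rs_id 1 = 1" "Rs_id (r + r') = Rs_id r + Rs_id r'"
  "Rs_id (r * r') = Rs_id r * Rs_id r'" "Rs_id (- r) = - Rs_id r" "Rs_id (r - r') = Rs_id r - Rs_id r'"
  by (rule fps_ext, simp add: End_const_hom(1-6) End_const_sum fps_mult_nth)+

lemma fps_mult_nth': "fps_nth (f * g) n = (\<Sum>i=0..n. fps_nth f (n - i) * fps_nth g i)"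
  unfolding fps_mult_nth by (rule sum.reindex_bij_witness[of _ "\<lambda>i. n - i" "\<lambda>i. n - i"]) auto

lemma Rs_id_commute: "Rs_id r * \<Phi> = \<Phi> * Rs_id r"
proof (rule fps_ext)
  fix n
  show "fps_nth (Rs_id r * \<Phi>) n = fps_nth (\<Phi> * Rs_id r) n"
    unfolding fps_mult_nth[of "Rs_id r"] fps_mult_nth'[of \<Phi>] Rs_id_nth
    by (rule sum.cong[OF refl]) (rule End_const_hom(7))
qed

lemma Rs_iff: "r \<in> Rs \<longleftrightarrow> (\<forall>N. \<exists>i0. \<forall>i\<ge>i0. ereal (N - real i) \<le> R_val (fps_nth r i))"
  by (simp add: Rs_def Lim_PInfty ereal_le_add_iff)

lemma Rs_id_Ends: "r \<in> Rs \<Longrightarrow> Rs_id r \<in> Ends"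
  unfolding Rs_iff Ends_iff Rs_id_nth using End_val_const by blast

lemma Rs_val_ge_iff: "ereal N \<le> Rs_val r \<longleftrightarrow> (\<forall>i. ereal (N - real i) \<le> R_val (fps_nth r i))"
  by (simp add: Rs_val_def le_INF_iff ereal_le_add_iff)

lemma Ends_val_Rs_id_ge: "ereal N \<le> Rs_val r \<Longrightarrow> ereal N \<le> Ends_val (Rs_id r)"
  unfolding Rs_val_ge_iff Ends_val_ge_iff by (simp add: End_val_const)

lemma Rs_letter: "r \<in> Rs \<Longrightarrow> Rs_deg e r \<Longrightarrow> (d, a) \<in> letters \<Longrightarrow> (d + e, Rs_id r * a) \<in> letters"
  unfolding letters_def using Ends_deg_mult[of e "Rs_id r" d a]
  by (auto simp: Ends_mult Rs_id_Ends Ends_deg_def[of e] Rs_deg_def End_deg_const add.commute)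


section \<open>The differential through rotations, and its continuity\<close>

section \<open>The cyclic complex\<close>

lemma psign_add: "psign (a + b) = psign a * psign b"
  by (simp add: psign_def)

lemma psign_cong: "even (a - b) \<Longrightarrow> psign a = psign b"
  by (simp add: psign_def)

lemma psign_square [simp]: "psign a * psign a = 1" "psign a * (psign a * x) = x"
  by (simp_all add: psign_def)

text \<open>\<open>mu1\<close> and \<open>mu2\<close> touch only the front of a word. All terms of
  the differential come from rotating a letter to the front, applying one of them and rotating back,
  so continuity and signs need only be checked for these two operators and
  \<open>t_chain\<close>.\<close>

definition mu1 :: "letter list \<Rightarrow> chain" where
  "mu1 w = (case w of [] \<Rightarrow> 0 | x # w \<Rightarrow> frag_of ((fst x + 1, delta (fst x) (snd x)) # w))"

definition mu2 :: "letter list \<Rightarrow> chain" where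
  "mu2 w = (case w of x # y # w \<Rightarrow> frag_cmul (psign (fst x)) (frag_of (letter_mult x y # w)) | _ \<Rightarrow> 0)"

lemma mu1_Cons [simp]: "mu1 (x # w) = frag_of ((fst x + 1, delta (fst x) (snd x)) # w)"
  by (simp add: mu1_def)

lemma mu2_simps [simp]: "mu2 (x # y # w) = frag_cmul (psign (fst x)) (frag_of (letter_mult x y # w))" "mu2 [x] = 0"
  by (simp_all add: mu2_def)

abbreviation tpow :: "nat \<Rightarrow> chain \<Rightarrow> chain" where "tpow p \<equiv> t_chain ^^ p"
abbreviation Mu1 :: "chain \<Rightarrow> chain" where "Mu1 \<equiv> frag_extend mu1"
abbreviation Mu2 :: "chain \<Rightarrow> chain" where "Mu2 \<equiv> frag_extend mu2"

lemma t_chain_lin: "t_chain (x + y) = t_chain x + t_chain y" "t_chain (x - y) = t_chain x - t_chain y"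
  "t_chain (frag_cmul k x) = frag_cmul k (t_chain x)" "t_chain 0 = 0" "t_chain (- x) = - t_chain x"
  by (simp_all add: t_chain_def frag_extend_add frag_extend_diff frag_extend_cmul frag_extend_minus)

lemma tpow_lin: "tpow p (x + y) = tpow p x + tpow p y" "tpow p (x - y) = tpow p x - tpow p y"
  "tpow p (frag_cmul k x) = frag_cmul k (tpow p x)" "tpow p 0 = 0"
  by (induction p) (simp_all add: t_chain_lin)

lemma t_chain_sum: "t_chain (sum F I) = (\<Sum>i\<in>I. t_chain (F i))"
  by (induction I rule: infinite_finite_induct) (simp_all add: t_chain_lin)

lemma tpow_frag_of:
  "tpow (length u) (frag_of (u @ v)) = frag_cmul (psign (sdeg u * sdeg v)) (frag_of (v @ u))"
proof (induction u arbitrary: v rule: rev_induct)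
  case (snoc x u)
  have "tpow (length (u @ [x])) (frag_of ((u @ [x]) @ v)) = t_chain (tpow (length u) (frag_of (u @ x # v)))"
    by simp
  also have "\<dots> = frag_cmul (psign (sdeg u * sdeg (x # v)) * psign ((fst x - 1) * sdeg (v @ u))) (frag_of (v @ u @ [x]))"
    unfolding snoc.IH by (simp add: t_chain_lin t_chain_of)
  also have "psign (sdeg u * sdeg (x # v)) * psign ((fst x - 1) * sdeg (v @ u)) = (psign (sdeg (u @ [x]) * sdeg v) :: int)"
    unfolding psign_add[symmetric] by (rule psign_cong) (simp add: algebra_simps)
  finally show ?case by simp
qed (simp add: psign_def)

lemma tpow_frag_of': "length u = p \<Longrightarrow> tpow p (frag_of (u @ v)) = frag_cmul (psign (sdeg u * sdeg v)) (frag_of (v @ u))"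
  using tpow_frag_of by blast

lemma tpow_length: "tpow (length w) (frag_of w) = frag_of w"
  using tpow_frag_of[of w "[]"] by (simp add: psign_def)

lemma split_at:
  assumes "p < length w"
  obtains u x v where "w = u @ x # v" "length u = p"
  using assms by (metis id_take_nth_drop length_take less_or_eq_imp_le min.absorb2)

text \<open>The signs of the rotation forth and back differ by the sign of \<open>sdeg u\<close>,
  since \<open>delta\<close> raises the degree of one letter by one; what is left is the sign in the
  definition.\<close>

lemma b_mu1_rotations: "b_mu1 w = (\<Sum>p<length w. tpow (length w - p) (Mu1 (tpow p (frag_of w))))"
  unfolding b_mu1_def
proof (rule sum.cong[OF refl])
  fix p assume "p \<in> {..<length w}"
  then obtain u x v where w: "w = u @ x # v" "length u = p" using split_at by (metis lessThan_iff)
  let ?x = "(fst x + 1, delta (fst x) (snd x))"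
  have "Mu1 (tpow p (frag_of w)) = frag_cmul (psign (sdeg u * sdeg (x # v))) (frag_of ((?x # v) @ u))"
    unfolding w(1) tpow_frag_of'[OF w(2)] by (simp add: frag_extend_cmul)
  also have "tpow (length w - p) \<dots> = frag_cmul (psign (sdeg u * sdeg (x # v)) * psign (sdeg (?x # v) * sdeg u)) (frag_of (u @ ?x # v))"
    unfolding tpow_lin by (subst tpow_frag_of') (simp_all add: w)
  also have "psign (sdeg u * sdeg (x # v)) * psign (sdeg (?x # v) * sdeg u) = (psign (sdeg u) :: int)"
    unfolding psign_add[symmetric] by (rule psign_cong) (simp add: algebra_simps)
  finally show "frag_cmul (psign (sdeg (take p w))) (frag_of (w[p := (fst (w ! p) + 1, delta (fst (w ! p)) (snd (w ! p)))]))
      = tpow (length w - p) (Mu1 (tpow p (frag_of w)))"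
    using w(2) by (simp add: w(1) nth_append list_update_append)
qed

text \<open>The product shortens the word, so only l - 1 - p rotations lead back. For p = l - 1
  there are none, and the last letter has met the first one: this is the wrap-around term a_1
  a_l.\<close>

lemma b_mu2_rotations: "b_mu2 w = (\<Sum>p<length w. tpow (length w - 1 - p) (Mu2 (tpow p (frag_of w))))"
proof (cases "length w < 2")
  case True
  then consider "w = []" | x where "w = [x]" by (cases w; cases "tl w") auto
  then show ?thesis by cases (simp_all add: b_mu2_def)
next
  case False
  let ?G = "\<lambda>p. tpow (length w - 1 - p) (Mu2 (tpow p (frag_of w)))"
  have inner: "?G p = frag_cmul (psign (sdeg (take p w) + fst (w ! p))) (frag_of (take p w @ letter_mult (w ! p) (w ! (p + 1)) # drop (p + 2) w))"
    if p: "p < length w - 1" for p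
  proof -
    obtain u x v' where w': "w = u @ x # v'" "length u = p" using split_at p by (metis less_imp_diff_less less_diff_conv add_lessD1)
    obtain y v where v': "v' = y # v" using p w' by (cases v') auto
    let ?z = "letter_mult x y"
    have w: "w = u @ (x # y # v)" using w' v' by simp
    have "Mu2 (tpow p (frag_of w)) = frag_cmul (psign (sdeg u * sdeg (x # y # v)) * psign (fst x)) (frag_of ((?z # v) @ u))"
      unfolding w tpow_frag_of'[OF w'(2)] by (simp add: frag_extend_cmul)
    also have "tpow (length w - 1 - p) \<dots> = frag_cmul (psign (sdeg u * sdeg (x # y # v)) * psign (fst x) * psign (sdeg (?z # v) * sdeg u)) (frag_of (u @ ?z # v))"
      unfolding tpow_lin by (subst tpow_frag_of') (simp_all add: w w'(2))
    also have "psign (sdeg u * sdeg (x # y # v)) * psign (fst x) * psign (sdeg (?z # v) * sdeg u) = (psign (sdeg u + fst x) :: int)"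
      unfolding psign_add[symmetric] by (rule psign_cong) (simp add: letter_mult_def algebra_simps)
    finally show ?thesis using w'(2) by (simp add: w nth_append)
  qed
  have "w \<noteq> []" using False by auto
  then obtain u x where w: "w = u @ [x]" by (metis append_butlast_last_id)
  obtain y v where u: "u = y # v" using False w by (cases u) auto
  have "?G (length w - 1) = Mu2 (tpow (length u) (frag_of (u @ [x])))" by (simp add: w)
  also have "\<dots> = frag_cmul (psign (sdeg u * (fst x - 1)) * psign (fst x)) (frag_of (letter_mult x y # v))"
    unfolding tpow_frag_of by (simp add: frag_extend_cmul u)
  also have "psign (sdeg u * (fst x - 1)) * psign (fst x) = (- psign ((fst x - 1) * (sdeg u + 1)) :: int)"
    by (simp add: psign_add[symmetric] distrib_left) (simp add: psign_def mult.commute)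
  finally have last: "?G (length w - 1) = - frag_cmul (psign ((fst (last w) - 1) * (sdeg (butlast w) + 1)))
         (frag_of (letter_mult (last w) (hd w) # tl (butlast w)))"
    by (simp add: w u)
  define n where "n = length w - 1"
  have n: "length w = Suc n" "n > 0" using False by (simp_all add: n_def)
  have "(\<Sum>p<length w. ?G p) = (\<Sum>p<n. ?G p) + ?G n" by (simp add: n)
  also have "(\<Sum>p<n. ?G p) = ?G 0 + (\<Sum>p=1..<n. ?G p)"
    using n(2) by (simp add: lessThan_atLeast0 sum.atLeast_Suc_lessThan)
  also have "(\<Sum>p=1..<n. ?G p) = (\<Sum>p=1..<n. - frag_cmul (psign (sdeg (take (p + 1) w)))
         (frag_of (take p w @ letter_mult (w ! p) (w ! (p + 1)) # drop (p + 2) w)))"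
  proof (rule sum.cong[OF refl])
    fix p assume "p \<in> {1..<n}"
    then have p: "p < length w - 1" "p < length w" by (auto simp: n)
    have "psign (sdeg (take p w) + fst (w ! p)) = (- psign (sdeg (take (p + 1) w)) :: int)"
      using p(2) by (simp add: take_Suc_conv_app_nth) (simp add: psign_def)
    then show "?G p = - frag_cmul (psign (sdeg (take (p + 1) w)))
         (frag_of (take p w @ letter_mult (w ! p) (w ! (p + 1)) # drop (p + 2) w))"
      unfolding inner[OF p(1)] by simp
  qed
  also have "?G 0 = frag_cmul (psign (fst (w ! 0))) (frag_of (letter_mult (w ! 0) (w ! 1) # drop 2 w))"
    using inner[of 0] n by (simp add: numeral_2_eq_2)
  also have "?G n = - frag_cmul (psign ((fst (last w) - 1) * (sdeg (butlast w) + 1)))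
         (frag_of (letter_mult (last w) (hd w) # tl (butlast w)))"
    using last by (simp add: n_def)
  finally show ?thesis
    using False unfolding b_mu2_def n_def by (simp add: sum_negf del: minus_frag_cmul)
qed

text \<open>The differential on words of length \<open>l\<close>, as a sum over rotations.\<close>

definition d_len :: "nat \<Rightarrow> chain \<Rightarrow> chain" where
  "d_len l x = (\<Sum>p<l. tpow (l - p) (Mu1 (tpow p x))) + (\<Sum>p<l. tpow (l - 1 - p) (Mu2 (tpow p x)))"

lemma d_chain_of: "d_chain (frag_of w) = d_len (length w) (frag_of w)"
  by (simp add: d_chain_def d_len_def b_mu1_rotations b_mu2_rotations)

lemma d_chain_lin: "d_chain (x + y) = d_chain x + d_chain y" "d_chain (x - y) = d_chain x - d_chain y"
  "d_chain (frag_cmul k x) = frag_cmul k (d_chain x)" "d_chain 0 = 0" "d_chain (- x) = - d_chain x"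
  by (simp_all add: d_chain_def frag_extend_add frag_extend_diff frag_extend_cmul frag_extend_minus)

lemma d_chain_sum: "d_chain (sum F I) = (\<Sum>i\<in>I. d_chain (F i))"
  by (induction I rule: infinite_finite_induct) (simp_all add: d_chain_lin)

lemma d_len_diff: "d_len l (x - y) = d_len l x - d_len l y"
  by (simp add: d_len_def tpow_lin frag_extend_diff sum_subtractf)

lemma small_sum: "(\<And>i. i \<in> I \<Longrightarrow> F i \<in> small N) \<Longrightarrow> sum F I \<in> small N"
  by (induction I rule: infinite_finite_induct) (auto intro: small.zero small_add)

lemma words_Cons: "x # w \<in> words \<longleftrightarrow> x \<in> letters \<and> set w \<subseteq> letters"
  by (auto simp: words_def)

lemma words_append_Cons: "u @ x # w \<in> words \<longleftrightarrow> x \<in> letters \<and> set u \<subseteq> letters \<and> set w \<subseteq> letters"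
  by (auto simp: words_def)

lemma letters_Ends: "x \<in> letters \<Longrightarrow> snd x \<in> Ends"
  by (auto simp: letters_def)

lemma word_val_simps: "word_val [] = 0" "word_val (x # w) = Ends_val (snd x) + word_val w"
  "word_val (u @ v) = word_val u + word_val v"
  by (simp_all add: word_val_def)

lemma delta_add: "delta d (a + a') = delta d a + delta d a'"
  by (simp add: delta_def algebra_simps)

lemma delta_Rs_id:
  assumes "even e"
  shows "delta (d + e) (Rs_id r * a) = Rs_id r * delta d a"
proof -
  have "psign (d + e) = (psign d :: End_M fps)" using assms by (simp add: psign_def)
  moreover have "fps_const D * (Rs_id r * a) = Rs_id r * (fps_const D * a)"
    by (metis Rs_id_commute mult.assoc)
  moreover have "psign d * (Rs_id r * a) = Rs_id r * (psign d * a)"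
    by (simp add: psign_def)
  ultimately show ?thesis by (simp add: delta_def right_diff_distrib mult.assoc)
qed

lemma tpow_small: "x \<in> small N \<Longrightarrow> tpow p x \<in> small N"
  by (induction p) (simp_all add: t_chain_small)

text \<open>Checked on the generators of \<open>small\<close>: nonnegativity of the valuation of D
  handles the short words, additivity of \<open>delta\<close> and its linearity over scalars of even
  degree handle the tensor relations.\<close>

lemma Mu1_small: "x \<in> small N \<Longrightarrow> Mu1 x \<in> small N"
proof (induction rule: small.induct)
  case zero
  then show ?case by (simp add: small.zero)
next
  case (diff x y)
  then show ?case by (simp add: frag_extend_diff small.diff)
next
  case (short w)
  then obtain x v where w: "w = x # v" by (cases w) (auto simp: words_def)
  have x: "x \<in> letters" using short by (simp add: w words_Cons)
  have "Ends_val (snd x) + word_val v \<le> Ends_val (delta (fst x) (snd x)) + word_val v"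
    by (intro add_right_mono Ends_val_delta letters_Ends x)
  then have "ereal N \<le> word_val ((fst x + 1, delta (fst x) (snd x)) # v)"
    using short(2) unfolding w word_val_simps by (simp add: order_trans)
  then show ?case
    using short(1) x delta_letter[of "fst x" "snd x"] by (auto simp: w words_Cons intro!: small.short)
next
  case (additive u d a v a')
  show ?case
  proof (cases u)
    case Nil
    have "frag_of ([] @ (d + 1, delta d a + delta d a') # v) - frag_of ([] @ (d + 1, delta d a) # v) - frag_of ([] @ (d + 1, delta d a') # v) \<in> small N"
      by (rule small.additive)
        (use additive delta_letter[of d a] delta_letter[of d a'] delta_letter[of d "a + a'"] in \<open>auto simp: Nil words_Cons delta_add\<close>)
    then show ?thesis by (simp add: Nil frag_extend_diff delta_add)
  next
    case (Cons x u')
    let ?x = "(fst x + 1, delta (fst x) (snd x))"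
    have "frag_of ((?x # u') @ (d, a + a') # v) - frag_of ((?x # u') @ (d, a) # v) - frag_of ((?x # u') @ (d, a') # v) \<in> small N"
      by (rule small.additive)
        (use additive delta_letter[of "fst x" "snd x"] in \<open>auto simp: Cons words_Cons\<close>)
    then show ?thesis by (simp add: Cons frag_extend_diff)
  qed
next
  case (balanced r e u d a v d' a' w)
  show ?case
  proof (cases u)
    case Nil
    have "frag_of ([] @ ((d + 1) + e, Rs_id r * delta d a) # v @ (d', a') # w)
      - frag_of ([] @ (d + 1, delta d a) # v @ (d' + e, Rs_id r * a') # w) \<in> small N"
      by (rule small.balanced[OF balanced(1-3)])
        (use balanced delta_letter[of d a] delta_letter[of "d + e" "Rs_id r * a"] in
          \<open>auto simp: Nil words_Cons delta_Rs_id algebra_simps\<close>)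
    then show ?thesis using balanced(3) by (simp add: Nil frag_extend_diff delta_Rs_id algebra_simps)
  next
    case (Cons x u')
    let ?x = "(fst x + 1, delta (fst x) (snd x))"
    have "frag_of ((?x # u') @ (d + e, Rs_id r * a) # v @ (d', a') # w)
      - frag_of ((?x # u') @ (d, a) # v @ (d' + e, Rs_id r * a') # w) \<in> small N"
      by (rule small.balanced[OF balanced(1-3)])
        (use balanced delta_letter[of "fst x" "snd x"] in \<open>auto simp: Cons words_Cons\<close>)
    then show ?thesis by (simp add: Cons frag_extend_diff)
  qed
qed


lemma Mu2_small: "x \<in> small N \<Longrightarrow> Mu2 x \<in> small N"
proof (induction rule: small.induct)
  case zero
  then show ?case by (simp add: small.zero)
next
  case (diff x y)
  then show ?case by (simp add: frag_extend_diff small.diff)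
next
  case (short w)
  then obtain x v' where w: "w = x # v'" by (cases w) (auto simp: words_def)
  show ?case
  proof (cases v')
    case Nil
    then show ?thesis by (simp add: w small.zero)
  next
    case (Cons y v)
    have xy: "x \<in> letters" "y \<in> letters" using short by (auto simp: w Cons words_Cons)
    have "Ends_val (snd x) + Ends_val (snd y) + word_val v \<le> Ends_val (snd (letter_mult x y)) + word_val v"
      unfolding letter_mult_def using xy by (auto intro!: add_right_mono Ends_val_mult letters_Ends)
    then have "ereal N \<le> word_val (letter_mult x y # v)"
      using short(2) unfolding w Cons word_val_simps by (simp add: add.assoc order_trans)
    then have "frag_of (letter_mult x y # v) \<in> small N"
      using short(1) mult_letter[OF xy] by (auto simp: w Cons words_Cons intro!: small.short)
    then show ?thesis by (simp add: w Cons psign_cmul_small)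
  qed
next
  case (additive u d a v a')
  show ?case
  proof (cases u)
    case Nil
    show ?thesis
    proof (cases v)
      case Nil
      then show ?thesis by (simp add: \<open>u = []\<close> frag_extend_diff small.zero)
    next
      case (Cons y v')
      have "frag_of ([] @ (d + fst y, a * snd y + a' * snd y) # v') - frag_of ([] @ (d + fst y, a * snd y) # v')
          - frag_of ([] @ (d + fst y, a' * snd y) # v') \<in> small N"
        by (rule small.additive)
          (use additive mult_letter[of "(d, a)" y] mult_letter[of "(d, a')" y] mult_letter[of "(d, a + a')" y] in
            \<open>auto simp: Nil Cons words_Cons letter_mult_def distrib_right\<close>)
      then show ?thesis
        using psign_cmul_small by (fastforce simp: Nil Cons frag_extend_diff letter_mult_def distrib_right simp flip: frag_cmul_diff)
    qed
  next
    case (Cons x u'')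
    note x = this
    show ?thesis
    proof (cases u'')
      case Nil
      have "frag_of ([] @ (fst x + d, snd x * a + snd x * a') # v) - frag_of ([] @ (fst x + d, snd x * a) # v)
          - frag_of ([] @ (fst x + d, snd x * a') # v) \<in> small N"
        by (rule small.additive)
          (use additive mult_letter[of x "(d, a)"] mult_letter[of x "(d, a')"] mult_letter[of x "(d, a + a')"] in
            \<open>auto simp: Nil x words_Cons letter_mult_def distrib_left\<close>)
      then show ?thesis
        using psign_cmul_small by (fastforce simp: Nil x frag_extend_diff letter_mult_def distrib_left simp flip: frag_cmul_diff)
    next
      case (Cons y u')
      have "frag_of ((letter_mult x y # u') @ (d, a + a') # v) - frag_of ((letter_mult x y # u') @ (d, a) # v)
          - frag_of ((letter_mult x y # u') @ (d, a') # v) \<in> small N"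
        by (rule small.additive) (use additive mult_letter[of x y] in \<open>auto simp: Cons x words_Cons\<close>)
      then show ?thesis
        using psign_cmul_small by (fastforce simp: Cons x frag_extend_diff simp flip: frag_cmul_diff)
    qed
  qed
next
  case (balanced r e u d a v d' a' w)
  have p: "psign (d + e) = (psign d :: int)" using balanced(3) by (simp add: psign_def)
  have r: "Rs_id r * (f * g) = f * (Rs_id r * g)" for f g
    by (metis Rs_id_commute mult.assoc)
  show ?case
  proof (cases u)
    case Nil
    show ?thesis
    proof (cases v)
      case Nil
      then show ?thesis
        using r[of a a'] by (simp add: \<open>u = []\<close> frag_extend_diff p letter_mult_def mult.assoc small.zero algebra_simps)
    next
      case (Cons y v')
      have "frag_of ([] @ ((d + fst y) + e, Rs_id r * (a * snd y)) # v' @ (d', a') # w)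
          - frag_of ([] @ (d + fst y, a * snd y) # v' @ (d' + e, Rs_id r * a') # w) \<in> small N"
        by (rule small.balanced[OF balanced(1-3)])
          (use balanced mult_letter[of "(d + e, Rs_id r * a)" y] mult_letter[of "(d, a)" y] in
            \<open>auto simp: Nil Cons words_Cons letter_mult_def mult.assoc algebra_simps\<close>)
      then show ?thesis
        using psign_cmul_small[of _ N d]
        by (fastforce simp: Nil Cons frag_extend_diff letter_mult_def p mult.assoc add_ac simp flip: frag_cmul_diff)
    qed
  next
    case (Cons x u'')
    note x = this
    show ?thesis
    proof (cases u'')
      case Nil
      have "frag_of ([] @ ((fst x + d) + e, Rs_id r * (snd x * a)) # v @ (d', a') # w)
          - frag_of ([] @ (fst x + d, snd x * a) # v @ (d' + e, Rs_id r * a') # w) \<in> small N"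
        by (rule small.balanced[OF balanced(1-3)])
          (use balanced mult_letter[of x "(d + e, Rs_id r * a)"] mult_letter[of x "(d, a)"] in
            \<open>auto simp: Nil x words_Cons letter_mult_def r add_ac\<close>)
      then show ?thesis
        using psign_cmul_small[of _ N "fst x"]
        by (fastforce simp: Nil x frag_extend_diff letter_mult_def r add_ac simp flip: frag_cmul_diff)
    next
      case (Cons y u')
      have "frag_of ((letter_mult x y # u') @ (d + e, Rs_id r * a) # v @ (d', a') # w)
          - frag_of ((letter_mult x y # u') @ (d, a) # v @ (d' + e, Rs_id r * a') # w) \<in> small N"
        by (rule small.balanced[OF balanced(1-3)])
          (use balanced mult_letter[of x y] in \<open>auto simp: Cons x words_Cons\<close>)
      then show ?thesis
        using psign_cmul_small[of _ N "fst x"] by (fastforce simp: Cons x frag_extend_diff simp flip: frag_cmul_diff)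
    qed
  qed
qed

lemma d_len_small: "x \<in> small N \<Longrightarrow> d_len l x \<in> small N"
  unfolding d_len_def by (intro small_add small_sum tpow_small Mu1_small Mu2_small)

lemma d_chain_small: "x \<in> small N \<Longrightarrow> d_chain x \<in> small N"
proof (induction rule: small.induct)
  case zero
  then show ?case by (simp add: d_chain_lin small.zero)
next
  case (diff x y)
  then show ?case by (simp add: d_chain_lin small.diff)
next
  case (short w)
  then show ?case by (simp add: d_chain_of d_len_small small.short)
next
  case (additive u d a v a')
  have "d_chain (frag_of (u @ (d, a + a') # v) - frag_of (u @ (d, a) # v) - frag_of (u @ (d, a') # v))
    = d_len (length u + Suc (length v)) (frag_of (u @ (d, a + a') # v) - frag_of (u @ (d, a) # v) - frag_of (u @ (d, a') # v))"
    by (simp add: d_chain_lin d_chain_of d_len_diff)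
  then show ?case using d_len_small[OF small.additive[OF additive]] by simp
next
  case (balanced r e u d a v d' a' w)
  have "d_chain (frag_of (u @ (d + e, Rs_id r * a) # v @ (d', a') # w) - frag_of (u @ (d, a) # v @ (d' + e, Rs_id r * a') # w))
    = d_len (length u + Suc (length v + Suc (length w)))
       (frag_of (u @ (d + e, Rs_id r * a) # v @ (d', a') # w) - frag_of (u @ (d, a) # v @ (d' + e, Rs_id r * a') # w))"
    by (simp add: d_chain_lin d_chain_of d_len_diff)
  then show ?case using d_len_small[OF small.balanced[OF balanced]] by simp
qed

lemma chains_induct [consumes 1, case_names zero word diff]:
  assumes "x \<in> word_chains" "P 0" "\<And>w. w \<in> words \<Longrightarrow> P (frag_of w)" "\<And>x y. P x \<Longrightarrow> P y \<Longrightarrow> P (x - y)"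
  shows "P x"
proof -
  have "Poly_Mapping.keys x \<subseteq> words" using assms(1) by (simp add: word_chains_def)
  then show ?thesis by (rule frag_induction) (use assms in auto)
qed

lemma chains_uminus: "x \<in> word_chains \<Longrightarrow> - x \<in> word_chains"
  using chains_diff[OF chains_0] by fastforce

lemma chains_add: "x \<in> word_chains \<Longrightarrow> y \<in> word_chains \<Longrightarrow> x + y \<in> word_chains"
  using chains_diff[of x "- y"] chains_uminus by fastforce

lemma chains_of: "w \<in> words \<Longrightarrow> frag_of w \<in> word_chains"
  by (simp add: word_chains_def)

lemma chains_psign: "x \<in> word_chains \<Longrightarrow> frag_cmul (psign d) x \<in> word_chains"
  using chains_uminus by (auto simp: psign_def)

lemma chains_sum: "(\<And>i. i \<in> I \<Longrightarrow> F i \<in> word_chains) \<Longrightarrow> sum F I \<in> word_chains"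
  by (induction I rule: infinite_finite_induct) (auto intro: chains_0 chains_add)

lemma Mu_chains: assumes "x \<in> word_chains" shows "Mu1 x \<in> word_chains" "Mu2 x \<in> word_chains"
  using assms
proof (induction rule: chains_induct)
  case zero
  { case 1 then show ?case by (simp add: chains_0) }
  { case 2 then show ?case by (simp add: chains_0) }
next
  case (word w)
  then obtain x v where w: "w = x # v" by (cases w) (auto simp: words_def)
  { case 1
    then show ?case using word delta_letter[of "fst x" "snd x"] by (auto simp: w words_Cons intro!: chains_of) }
  { case 2
    then show ?case using word mult_letter[of x]
      by (cases v) (auto simp: w words_Cons chains_0 intro!: chains_of chains_psign) }
next
  case (diff x y)
  { case 1 show ?case using diff by (simp add: frag_extend_diff chains_diff) }
  { case 2 show ?case using diff by (simp add: frag_extend_diff chains_diff) }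
qed

lemma tpow_chains: "x \<in> word_chains \<Longrightarrow> tpow p x \<in> word_chains"
  by (induction p) (simp_all add: t_chain_chains)

lemma d_chain_chains: "x \<in> word_chains \<Longrightarrow> d_chain x \<in> word_chains"
proof (induction rule: chains_induct)
  case (word w)
  then show ?case
    unfolding d_chain_of d_len_def by (intro chains_add chains_sum tpow_chains Mu_chains chains_of)
qed (simp_all add: d_chain_lin chains_0 chains_diff)

lemma words_Nil: "[] \<notin> words"
  by (simp add: words_def)

text \<open>$d(1-t) = (1-t)b'$, where $b'$ omits the product of the first two letters.\<close>

lemma d_chain_one_minus_t:
  assumes "x \<in> word_chains"
  shows "d_chain (x - t_chain x) = (d_chain x - Mu2 x) - t_chain (d_chain x - Mu2 x)"
  using assms
proof (induction rule: chains_induct)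
  case (word w)
  define l where "l = length w"
  let ?x = "frag_of w"
  have l: "l > 0" using word words_Nil by (auto simp: l_def)
  obtain y v where w: "w = y # v" using l by (cases w) (auto simp: l_def)
  have tx: "tpow l ?x = ?x" by (simp add: l_def tpow_length)
  have t1: "tpow l (Mu1 ?x) = Mu1 ?x"
    using tpow_length[of "(fst y + 1, delta (fst y) (snd y)) # v"] by (simp add: l_def w)
  have t2: "tpow (l - 1) (Mu2 ?x) = Mu2 ?x"
    using tpow_length[of "letter_mult y (hd v) # tl v"] by (cases v) (simp_all add: l_def w tpow_lin t_chain_lin)
  have "t_chain ?x = frag_cmul (psign ((fst y - 1) * sdeg v)) (frag_of (v @ [y]))" by (simp add: w t_chain_of)
  then have dt: "d_chain (t_chain ?x) = d_len l (t_chain ?x)"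
    by (simp add: d_chain_lin d_chain_of l_def w d_len_def tpow_lin frag_extend_cmul frag_cmul_sum frag_cmul_distrib2 t_chain_lin)
  let ?A = "\<lambda>p. tpow (l - p) (Mu1 (tpow p ?x))"
  let ?B = "\<lambda>p. tpow (l - p) (Mu2 (tpow p ?x))"
  \<comment> \<open>Replacing x by t x shifts p by one. The end terms p = 0 and p = l agree, as a
    full rotation is the identity with sign +.\<close>
  have 1: "(\<Sum>p<l. tpow (l - p) (Mu1 (tpow p (t_chain ?x)))) = t_chain (\<Sum>p<l. ?A p)"
  proof -
    have "(\<Sum>p<l. tpow (l - p) (Mu1 (tpow p (t_chain ?x)))) = (\<Sum>p<l. t_chain (?A (Suc p)))"
    proof (rule sum.cong[OF refl])
      fix p assume "p \<in> {..<l}"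
      then have "l - p = Suc (l - Suc p)" by auto
      then show "tpow (l - p) (Mu1 (tpow p (t_chain ?x))) = t_chain (?A (Suc p))"
        by (simp add: funpow_swap1)
    qed
    also have "\<dots> = t_chain ((\<Sum>p<Suc l. ?A p) - ?A 0)"
      by (simp only: t_chain_sum[symmetric] sum.lessThan_Suc_shift) simp
    also have "(\<Sum>p<Suc l. ?A p) - ?A 0 = (\<Sum>p<l. ?A p)" using t1 by (simp add: tx)
    finally show ?thesis .
  qed
  \<comment> \<open>Here the shift leaves an error: shortened words return after l - 1 rotations, so
    the end terms p = l and p = 0 are the head product of x and its image under t, and they do not
    cancel.\<close>
  have 2: "(\<Sum>p<l. tpow (l - 1 - p) (Mu2 (tpow p (t_chain ?x)))) = t_chain (\<Sum>p<l. tpow (l - 1 - p) (Mu2 (tpow p ?x)))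
      + Mu2 ?x - t_chain (Mu2 ?x)"
  proof -
    have "(\<Sum>p<l. tpow (l - 1 - p) (Mu2 (tpow p (t_chain ?x)))) = (\<Sum>p<l. ?B (Suc p))"
      by (rule sum.cong[OF refl]) (simp add: funpow_swap1)
    also have "\<dots> = (\<Sum>p<Suc l. ?B p) - ?B 0" by (simp only: sum.lessThan_Suc_shift) simp
    also have "\<dots> = (\<Sum>p<l. ?B p) + Mu2 ?x - ?B 0" by (simp add: tx)
    also have "(\<Sum>p<l. ?B p) = (\<Sum>p<l. t_chain (tpow (l - 1 - p) (Mu2 (tpow p ?x))))"
    proof (rule sum.cong[OF refl])
      fix p assume "p \<in> {..<l}"
      then have "l - p = Suc (l - 1 - p)" by auto
      then show "?B p = t_chain (tpow (l - 1 - p) (Mu2 (tpow p ?x)))" by simp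
    qed
    also have "?B 0 = t_chain (tpow (l - 1) (Mu2 ?x))" using l by (cases l) simp_all
    also have "tpow (l - 1) (Mu2 ?x) = Mu2 ?x" by (rule t2)
    finally show ?thesis by (simp add: t_chain_sum)
  qed
  show ?case
    unfolding d_chain_lin dt unfolding d_chain_of d_len_def 1 2 l_def[symmetric]
    by (simp add: t_chain_lin algebra_simps)
next
  case (diff x y)
  have "d_chain (x - y - t_chain (x - y)) = d_chain (x - t_chain x) - d_chain (y - t_chain y)"
    by (simp add: d_chain_lin t_chain_lin)
  then show ?case unfolding diff by (simp add: d_chain_lin t_chain_lin frag_extend_diff)
qed (simp add: d_chain_lin t_chain_lin)

lemma small_antimono:
  assumes "x \<in> small N'" "N \<le> N'"
  shows "x \<in> small N"
  using assms(1)
proof (induction rule: small.induct)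
  case (short w)
  moreover have "ereal N \<le> ereal N'" using assms(2) by simp
  ultimately show ?case by (intro small.short) (auto elim: order_trans[rotated])
next
  case (additive u d a v a')
  then show ?case by (intro small.additive)
next
  case (balanced r e u d a v d' a' w)
  then show ?case by (intro small.balanced)
qed (blast intro: small.intros)+

text \<open>Rotating back changes a chain only by some z - t z with z as small as the chain, so
  modulo the image of 1 - t the differential is the sum of the head operations over all rotations.
  The bound on z is kept for use in the completion.\<close>

lemma d_chain_mod_t:
  assumes "w \<in> words" "frag_of w \<in> small N"
  obtains z where "z \<in> word_chains" "z \<in> small N"
    "d_chain (frag_of w) = (\<Sum>p<length w. Mu1 (tpow p (frag_of w)) + Mu2 (tpow p (frag_of w))) + (z - t_chain z)"
proof -
  have tz: "\<exists>z\<in>word_chains \<inter> small N. tpow k y = y + (z - t_chain z)" if y: "y \<in> word_chains" "y \<in> small N" for k y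
  proof (induction k)
    case 0
    show ?case by (rule bexI[of _ 0]) (simp_all add: t_chain_lin chains_0 small.zero)
  next
    case (Suc k)
    then obtain z where z: "z \<in> word_chains" "z \<in> small N" "y + (z - t_chain z) = tpow k y" by (metis IntE)
    have "tpow (Suc k) y = (y + (z - t_chain z)) - tpow k y + t_chain (tpow k y)" unfolding z(3) by simp
    also have "\<dots> = y + ((z - tpow k y) - t_chain (z - tpow k y))" by (simp add: t_chain_lin)
    finally show ?case
      using chains_diff[OF z(1) tpow_chains[OF y(1)]] small.diff[OF z(2) tpow_small[OF y(2)]] by blast
  qed
  have sum: "\<exists>z\<in>word_chains \<inter> small N. (\<Sum>p<n. tpow (k p) (F p)) = (\<Sum>p<n. F p) + (z - t_chain z)"
    if F: "\<And>p. F p \<in> word_chains" "\<And>p. F p \<in> small N" for n :: nat and k F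
  proof (induction n)
    case 0
    show ?case by (rule bexI[of _ 0]) (simp_all add: t_chain_lin chains_0 small.zero)
  next
    case (Suc n)
    then obtain z where z: "z \<in> word_chains" "z \<in> small N" "(\<Sum>p<n. tpow (k p) (F p)) = (\<Sum>p<n. F p) + (z - t_chain z)" by blast
    obtain z' where z': "z' \<in> word_chains" "z' \<in> small N" "tpow (k n) (F n) = F n + (z' - t_chain z')"
      using tz[OF F] by blast
    have "(\<Sum>p<Suc n. tpow (k p) (F p)) = (\<Sum>p<Suc n. F p) + ((z + z') - t_chain (z + z'))"
      by (simp add: z(3) z'(3) t_chain_lin)
    then show ?case using chains_add[OF z(1) z'(1)] small_add[OF z(2) z'(2)] by blast
  qed
  have *: "Mu1 (tpow p (frag_of w)) \<in> word_chains" "Mu2 (tpow p (frag_of w)) \<in> word_chains"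
    "Mu1 (tpow p (frag_of w)) \<in> small N" "Mu2 (tpow p (frag_of w)) \<in> small N" for p
    by (intro Mu_chains tpow_chains chains_of assms Mu1_small Mu2_small tpow_small)+
  obtain z where z: "z \<in> word_chains" "z \<in> small N"
    "(\<Sum>p<length w. tpow (length w - p) (Mu1 (tpow p (frag_of w)))) = (\<Sum>p<length w. Mu1 (tpow p (frag_of w))) + (z - t_chain z)"
    using sum[of "\<lambda>p. Mu1 (tpow p (frag_of w))", OF *(1,3), where k = "\<lambda>p. length w - p" and n = "length w"] by blast
  obtain z' where z': "z' \<in> word_chains" "z' \<in> small N"
    "(\<Sum>p<length w. tpow (length w - 1 - p) (Mu2 (tpow p (frag_of w)))) = (\<Sum>p<length w. Mu2 (tpow p (frag_of w))) + (z' - t_chain z')"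
    using sum[of "\<lambda>p. Mu2 (tpow p (frag_of w))", OF *(2,4), where k = "\<lambda>p. length w - 1 - p" and n = "length w"] by blast
  show thesis
    by (rule that[of "z + z'"])
      (simp_all only: chains_add small_add z z' d_chain_of d_len_def sum.distrib t_chain_lin, simp)
qed

text \<open>The chains that vanish in $C^\lambda_*$, with a primitive under $\mathrm{id}-t$ of valuation at least $N$.\<close>

definition cyc_null :: "real \<Rightarrow> chain set" where
  "cyc_null N = {x. \<exists>z\<in>word_chains \<inter> small N. \<forall>M. x - (z - t_chain z) \<in> small M}"

lemma cyc_null_diff:
  assumes "x \<in> cyc_null N" "y \<in> cyc_null N"
  shows "x - y \<in> cyc_null N"
proof -
  obtain z where z: "z \<in> word_chains" "z \<in> small N" "\<And>M. x - (z - t_chain z) \<in> small M"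
    using assms(1) unfolding cyc_null_def by blast
  obtain z' where z': "z' \<in> word_chains" "z' \<in> small N" "\<And>M. y - (z' - t_chain z') \<in> small M"
    using assms(2) unfolding cyc_null_def by blast
  have "(x - (z - t_chain z)) - (y - (z' - t_chain z')) \<in> small M" for M by (rule small.diff[OF z(3) z'(3)])
  moreover have "x - y - ((z - z') - t_chain (z - z')) = (x - (z - t_chain z)) - (y - (z' - t_chain z'))"
    by (simp add: t_chain_lin)
  ultimately have "x - y - ((z - z') - t_chain (z - z')) \<in> small M" for M by (simp only:)
  then show ?thesis unfolding cyc_null_def using chains_diff[OF z(1) z'(1)] small.diff[OF z(2) z'(2)] by blast
qed

lemma cyc_null_small: "(\<And>M. x \<in> small M) \<Longrightarrow> x \<in> cyc_null N"
  unfolding cyc_null_def by (auto intro!: bexI[of _ 0] simp: t_chain_lin chains_0 small.zero)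

lemma cyc_null_t: "z \<in> word_chains \<Longrightarrow> z \<in> small N \<Longrightarrow> z - t_chain z \<in> cyc_null N"
  unfolding cyc_null_def by (auto intro!: bexI[of _ z] simp: small.zero)

lemma cyc_null_0: "0 \<in> cyc_null N"
  by (rule cyc_null_small) (rule small.zero)

lemma cyc_null_uminus: "x \<in> cyc_null N \<Longrightarrow> - x \<in> cyc_null N"
  using cyc_null_diff[OF cyc_null_0] by fastforce

lemma cyc_null_add: "x \<in> cyc_null N \<Longrightarrow> y \<in> cyc_null N \<Longrightarrow> x + y \<in> cyc_null N"
  using cyc_null_diff[of x N "- y"] cyc_null_uminus by fastforce

lemma cyc_null_sum: "(\<And>i. i \<in> I \<Longrightarrow> F i \<in> cyc_null N) \<Longrightarrow> sum F I \<in> cyc_null N"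
  by (induction I rule: infinite_finite_induct) (auto intro: cyc_null_0 cyc_null_add)

section \<open>Computing in the completed quotient\<close>

section \<open>Linear functionals on $C^\lambda_*$\<close>

lemma abs_cyc_eq_iff:
  "cauchy_chain X \<Longrightarrow> cauchy_chain Y \<Longrightarrow> abs_C_cyc X = abs_C_cyc Y \<longleftrightarrow> null_chain (\<lambda>n. X n - Y n)"
  using Quotient3_rel[OF Quotient3_C_cyc, of X Y] by (simp add: null_chain_0)

lemma cauchy_rep: "cauchy_chain (rep_C_cyc x)"
  using Quotient3_rep_reflp[OF Quotient3_C_cyc, of x] by simp

lemma abs_rep_cyc: "abs_C_cyc (rep_C_cyc x) = x"
  using Quotient3_abs_rep[OF Quotient3_C_cyc] .

lemma abs_rep_lam: "abs_C_lam (rep_C_lam x) = x"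
  using Quotient3_abs_rep[OF Quotient3_C_lam] .

lemma lam_of_rep: "lam_of (rep_C_cyc (rep_C_lam x)) = x"
  by (simp add: lam_of_def abs_rep_cyc abs_rep_lam)

lemma lam_of_diff:
  "cauchy_chain X \<Longrightarrow> cauchy_chain Y \<Longrightarrow> lam_of X - lam_of Y = lam_of (\<lambda>n. X n - Y n)"
  by (simp add: lam_of_def minus_C_lam_def C_lam_diff.abs_eq minus_C_cyc.abs_eq null_chain_0)

lemma lam_of_eq_iff:
  assumes "cauchy_chain X" "cauchy_chain Y"
  shows "lam_of X = lam_of Y \<longleftrightarrow>
    (\<exists>Z. cauchy_chain Z \<and> null_chain (\<lambda>n. X n - Y n - (Z n - t_chain (Z n))))"
proof -
  have *: "abs_C_cyc Z - t_cyc (abs_C_cyc Z) = abs_C_cyc (\<lambda>n. Z n - t_chain (Z n))" if "cauchy_chain Z" for Z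
    using that by (simp add: t_cyc.abs_eq minus_C_cyc.abs_eq t_chain_cauchy null_chain_0)
  have XY: "abs_C_cyc X - abs_C_cyc Y = abs_C_cyc (\<lambda>n. X n - Y n)"
    using assms by (simp add: minus_C_cyc.abs_eq null_chain_0)
  have eq: "abs_C_cyc X - abs_C_cyc Y = abs_C_cyc Z - t_cyc (abs_C_cyc Z)
      \<longleftrightarrow> null_chain (\<lambda>n. X n - Y n - (Z n - t_chain (Z n)))" if "cauchy_chain Z" for Z
    unfolding XY *[OF that]
    by (rule abs_cyc_eq_iff) (intro cauchy_chain_diff t_chain_cauchy assms that)+
  have "lam_of X = lam_of Y \<longleftrightarrow> (\<exists>z. abs_C_cyc X - abs_C_cyc Y = z - t_cyc z)"
    by (auto simp: lam_of_def C_lam.abs_eq_iff)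
  also have "\<dots> \<longleftrightarrow> (\<exists>Z. cauchy_chain Z \<and> abs_C_cyc X - abs_C_cyc Y = abs_C_cyc Z - t_cyc (abs_C_cyc Z))"
    using cauchy_rep abs_rep_cyc by metis
  also have "\<dots> \<longleftrightarrow> (\<exists>Z. cauchy_chain Z \<and> null_chain (\<lambda>n. X n - Y n - (Z n - t_chain (Z n))))"
    using eq by blast
  finally show ?thesis .
qed

lemma lam_of_eqD:
  assumes "cauchy_chain X" "cauchy_chain Y" "lam_of X = lam_of Y"
  shows "\<exists>n0. \<forall>n\<ge>n0. \<exists>z\<in>word_chains. X n - Y n - (z - t_chain z) \<in> small N"
  using assms(3) unfolding lam_of_eq_iff[OF assms(1,2)] null_chain_def cauchy_chain_def by blast

text \<open>The primitives of the increments are summed to a single primitive, which converges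
  because their valuations tend to infinity. This is why \<open>cyc_null\<close> records a bound for
  the primitive and not just its existence.\<close>

lemma lam_of_eqI:
  assumes "cauchy_chain X" "cauchy_chain Y" "X 0 - Y 0 \<in> cyc_null B"
    "\<And>n. (X (Suc n) - X n) - (Y (Suc n) - Y n) \<in> cyc_null (f n)" "\<And>N. \<exists>n0. \<forall>n\<ge>n0. N \<le> f n"
  shows "lam_of X = lam_of Y"
proof -
  obtain z0 where z0: "z0 \<in> word_chains" "\<And>M. X 0 - Y 0 - (z0 - t_chain z0) \<in> small M"
    using assms(3) unfolding cyc_null_def by blast
  have "\<forall>n. \<exists>z. z \<in> word_chains \<and> z \<in> small (f n) \<and> (\<forall>M. (X (Suc n) - X n) - (Y (Suc n) - Y n) - (z - t_chain z) \<in> small M)"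
    using assms(4) unfolding cyc_null_def by blast
  then obtain z where z: "\<And>n. z n \<in> word_chains" "\<And>n. z n \<in> small (f n)"
    "\<And>n M. (X (Suc n) - X n) - (Y (Suc n) - Y n) - (z n - t_chain (z n)) \<in> small M"
    by (auto dest!: choice)
  define Z where "Z n = z0 + (\<Sum>k<n. z k)" for n
  have ZM: "X n - Y n - (Z n - t_chain (Z n)) \<in> small M" for n M
  proof (induction n)
    case 0
    then show ?case using z0 by (simp add: Z_def)
  next
    case (Suc n)
    have eq: "X (Suc n) - Y (Suc n) - (Z (Suc n) - t_chain (Z (Suc n)))
        = (X n - Y n - (Z n - t_chain (Z n))) + ((X (Suc n) - X n) - (Y (Suc n) - Y n) - (z n - t_chain (z n)))"
      by (simp add: Z_def t_chain_lin)
    show ?case unfolding eq by (rule small_add[OF Suc z(3)])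
  qed
  have "cauchy_chain Z"
    unfolding cauchy_chain_def
  proof (intro conjI allI)
    show "Z n \<in> word_chains" for n unfolding Z_def by (intro chains_add chains_sum z0 z)
    fix N
    obtain n0 where n0: "\<And>n. n \<ge> n0 \<Longrightarrow> N \<le> f n" using assms(5) by blast
    have "Z (n0 + k) - Z n0 \<in> small N" for k
    proof (induction k)
      case (Suc k)
      have "z (n0 + k) \<in> small N" by (rule small_antimono[OF z(2) n0]) simp
      moreover have eq: "Z (n0 + Suc k) - Z n0 = (Z (n0 + k) - Z n0) + z (n0 + k)" by (simp add: Z_def)
      ultimately show ?case unfolding eq using Suc by (intro small_add)
    qed (simp add: small.zero)
    then have *: "Z m - Z n0 \<in> small N" if "m \<ge> n0" for m using that by (metis le_add_diff_inverse)
    have "Z m - Z n \<in> small N" if "m \<ge> n0" "n \<ge> n0" for m n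
      using small.diff[OF *[OF that(1)] *[OF that(2)]] by simp
    then show "\<exists>n0. \<forall>m\<ge>n0. \<forall>n\<ge>n0. Z m - Z n \<in> small N" by blast
  qed
  moreover have "null_chain (\<lambda>n. X n - Y n - (Z n - t_chain (Z n)))"
    unfolding null_chain_def using ZM by blast
  ultimately show ?thesis unfolding lam_of_eq_iff[OF assms(1,2)] by blast
qed

lemma d_chain_cauchy: "cauchy_chain X \<Longrightarrow> cauchy_chain (\<lambda>n. d_chain (X n))"
  unfolding cauchy_chain_def d_chain_lin(2)[symmetric] using d_chain_chains d_chain_small by blast

lemma Mu2_cauchy: "cauchy_chain X \<Longrightarrow> cauchy_chain (\<lambda>n. Mu2 (X n))"
  unfolding cauchy_chain_def
proof (intro conjI allI)
  assume X: "(\<forall>n. X n \<in> word_chains) \<and> (\<forall>N. \<exists>n0. \<forall>m\<ge>n0. \<forall>n\<ge>n0. X m - X n \<in> small N)"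
  show "Mu2 (X n) \<in> word_chains" for n using X Mu_chains by blast
  fix N
  obtain n0 where "\<And>m n. m \<ge> n0 \<Longrightarrow> n \<ge> n0 \<Longrightarrow> X m - X n \<in> small N" using X by blast
  then have "\<And>m n. m \<ge> n0 \<Longrightarrow> n \<ge> n0 \<Longrightarrow> Mu2 (X m - X n) \<in> small N" by (rule Mu2_small)
  then show "\<exists>n0. \<forall>m\<ge>n0. \<forall>n\<ge>n0. Mu2 (X m) - Mu2 (X n) \<in> small N"
    unfolding frag_extend_diff by blast
qed

text \<open>The representative chosen by the quotient differs from X by a null sequence and by some
  Z - t Z. Continuity of d handles the former, \<open>d_chain_one_minus_t\<close> the
  latter.\<close>

lemma d_cc_lam_of:
  assumes X: "cauchy_chain X"
  shows "d_cc (lam_of X) = lam_of (\<lambda>n. d_chain (X n))"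
proof -
  define X' where "X' = rep_C_cyc (rep_C_lam (lam_of X))"
  have X': "cauchy_chain X'" "lam_of X' = lam_of X" by (simp_all add: X'_def cauchy_rep lam_of_rep)
  then obtain Z where Z: "cauchy_chain Z" "null_chain (\<lambda>n. X' n - X n - (Z n - t_chain (Z n)))"
    unfolding lam_of_eq_iff[OF X'(1) X] by blast
  have eq: "d_chain (X' n) - d_chain (X n) - ((d_chain (Z n) - Mu2 (Z n)) - t_chain (d_chain (Z n) - Mu2 (Z n)))
      = d_chain (X' n - X n - (Z n - t_chain (Z n)))" for n
    using Z(1) by (simp add: cauchy_chain_def d_chain_lin(2) flip: d_chain_one_minus_t)
  have "null_chain (\<lambda>n. d_chain (X' n) - d_chain (X n)
      - ((d_chain (Z n) - Mu2 (Z n)) - t_chain (d_chain (Z n) - Mu2 (Z n))))"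
    unfolding eq using Z(2) d_chain_small unfolding null_chain_def by blast
  then have "lam_of (\<lambda>n. d_chain (X' n)) = lam_of (\<lambda>n. d_chain (X n))"
    unfolding lam_of_eq_iff[OF d_chain_cauchy[OF X'(1)] d_chain_cauchy[OF X]]
    using cauchy_chain_diff[OF d_chain_cauchy[OF Z(1)] Mu2_cauchy[OF Z(1)]] by blast
  moreover have "d_cc (lam_of X) = lam_of (\<lambda>n. d_chain (X' n))"
    by (simp add: d_cc_def d_cyc_def X'_def lam_of_def)
  ultimately show ?thesis by simp
qed

lemma sum_words_cauchy:
  assumes "\<And>j. w j \<in> words" "(\<lambda>j. word_val (w j)) \<longlonglongrightarrow> \<infinity>"
  shows "cauchy_chain (\<lambda>n. \<Sum>j<n. frag_of (w j))"
  unfolding cauchy_chain_def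
proof (intro conjI allI)
  show "(\<Sum>j<n. frag_of (w j)) \<in> word_chains" for n by (intro chains_sum chains_of assms)
  fix N
  obtain n0 where n0: "\<And>n. n \<ge> n0 \<Longrightarrow> ereal N \<le> word_val (w n)"
    using assms(2) unfolding Lim_PInfty by blast
  have *: "(\<Sum>j<m. frag_of (w j)) - (\<Sum>j<n0. frag_of (w j)) \<in> small N" if "m \<ge> n0" for m
  proof -
    have eq: "(\<Sum>j<m. frag_of (w j)) - (\<Sum>j<n0. frag_of (w j)) = (\<Sum>j=n0..<m. frag_of (w j))"
      using sum_diff_nat_ivl[of 0 n0 m "\<lambda>j. frag_of (w j)"] that by (simp only: lessThan_atLeast0)
    show ?thesis unfolding eq by (rule small_sum) (rule small.short[OF assms(1) n0], simp)
  qed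
  have "(\<Sum>j<m. frag_of (w j)) - (\<Sum>j<n. frag_of (w j)) \<in> small N" if "m \<ge> n0" "n \<ge> n0" for m n
    using small.diff[OF *[OF that(1)] *[OF that(2)]] by simp
  then show "\<exists>n0. \<forall>m\<ge>n0. \<forall>n\<ge>n0. (\<Sum>j<m. frag_of (w j)) - (\<Sum>j<n. frag_of (w j)) \<in> small N" by blast
qed

definition lin :: "(letter list \<Rightarrow> 'a::ring_1) \<Rightarrow> chain \<Rightarrow> 'a" where
  "lin f x = (\<Sum>w\<in>Poly_Mapping.keys x. of_int (Poly_Mapping.lookup x w) * f w)"

lemma lin_superset:
  "finite A \<Longrightarrow> Poly_Mapping.keys x \<subseteq> A \<Longrightarrow> lin f x = (\<Sum>w\<in>A. of_int (Poly_Mapping.lookup x w) * f w)"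
  unfolding lin_def by (rule sum.mono_neutral_left) (auto simp: in_keys_iff)

lemma lin_of [simp]: "lin f (frag_of w) = f w"
  by (simp add: lin_def keys_frag_of)

lemma lin_0 [simp]: "lin f 0 = 0"
  by (simp add: lin_def)

lemma lin_diff: "lin f (x - y) = lin f x - lin f y"
proof -
  let ?A = "Poly_Mapping.keys x \<union> Poly_Mapping.keys y"
  have "lin f (x - y) = (\<Sum>w\<in>?A. of_int (Poly_Mapping.lookup (x - y) w) * f w)"
    by (rule lin_superset) (use keys_diff[of x y] in auto)
  also have "\<dots> = (\<Sum>w\<in>?A. of_int (Poly_Mapping.lookup x w) * f w) - (\<Sum>w\<in>?A. of_int (Poly_Mapping.lookup y w) * f w)"
    by (simp add: lookup_minus left_diff_distrib sum_subtractf)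
  also have "\<dots> = lin f x - lin f y" by (simp add: lin_superset[of ?A])
  finally show ?thesis .
qed

lemma lin_uminus: "lin f (- x) = - lin f x"
  using lin_diff[of f 0 x] by simp

lemma lin_add: "lin f (x + y) = lin f x + lin f y"
  using lin_diff[of f x "- y"] by (simp add: lin_uminus)

lemma lin_sum: "lin f (sum F I) = (\<Sum>i\<in>I. lin f (F i))"
  by (induction I rule: infinite_finite_induct) (simp_all add: lin_add)

lemma lin_psign: "lin f (frag_cmul (psign d) x) = psign d * lin f x"
  by (simp add: psign_def lin_uminus)

text \<open>A coefficient of s^i T^(k/2) is blind to chains of valuation above i + k/2 and to the
  image of 1 - t, so for large n the chosen representative and X have the same coefficient. Hence
  coefficientwise convergence along X is enough.\<close>

lemma Theta_lam_of:
  assumes X: "cauchy_chain X" and r: "r \<in> Rs"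
    and small: "\<And>N x i k. x \<in> small N \<Longrightarrow> real i + real_of_int k / 2 < N \<Longrightarrow> fps_nth (lin Theta_word x) i $$ k = 0"
    and cyc: "\<And>x. x \<in> word_chains \<Longrightarrow> lin Theta_word (t_chain x) = lin Theta_word x"
    and lim: "\<And>i k. \<exists>n0. \<forall>n\<ge>n0. fps_nth (lin Theta_word (X n)) i $$ k = fps_nth r i $$ k"
  shows "Theta (lam_of X) = r"
proof -
  define X' where "X' = rep_C_cyc (rep_C_lam (lam_of X))"
  have X': "cauchy_chain X'" "lam_of X' = lam_of X" by (simp_all add: X'_def cauchy_rep lam_of_rep)
  have Tc: "Theta_chain = lin Theta_word" by (simp add: fun_eq_iff lin_def Theta_chain_def)
  have conv: "(\<lambda>n. Rs_val (Theta_chain (X' n) - r)) \<longlonglongrightarrow> \<infinity>"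
    unfolding Lim_PInfty
  proof
    fix N
    obtain n1 where n1: "\<And>m n. m \<ge> n1 \<Longrightarrow> n \<ge> n1 \<Longrightarrow> X' m - X' n \<in> small N"
      using X'(1) unfolding cauchy_chain_def by blast
    have "fps_nth (lin Theta_word (X' n)) i $$ k = fps_nth r i $$ k"
      if n: "n \<ge> n1" and ik: "real i + real_of_int k / 2 < N" for n i k
    proof -
      obtain p where p: "\<And>n. n \<ge> p \<Longrightarrow> \<exists>z\<in>word_chains. X' n - X n - (z - t_chain z) \<in> small N"
        using lam_of_eqD[OF X'(1) X X'(2)] by blast
      obtain q where q: "\<And>n. n \<ge> q \<Longrightarrow> fps_nth (lin Theta_word (X n)) i $$ k = fps_nth r i $$ k"
        using lim by blast
      define m where "m = max n1 (max p q)"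
      have m: "m \<ge> n1" "m \<ge> p" "m \<ge> q" by (simp_all add: m_def)
      obtain z where z: "z \<in> word_chains" "X' m - X m - (z - t_chain z) \<in> small N"
        using p[OF m(2)] by blast
      have "fps_nth (lin Theta_word (X' m)) i $$ k = fps_nth (lin Theta_word (X m)) i $$ k"
        using small[OF z(2) ik] by (simp add: lin_diff cyc[OF z(1)])
      moreover have "fps_nth (lin Theta_word (X' m)) i $$ k = fps_nth (lin Theta_word (X' n)) i $$ k"
        using small[OF n1[OF m(1) n] ik] by (simp add: lin_diff)
      ultimately show ?thesis using q[OF m(3)] by simp
    qed
    then have "ereal N \<le> Rs_val (Theta_chain (X' n) - r)" if "n \<ge> n1" for n
      using that unfolding Rs_val_ge_iff Tc
      by (intro allI R_val_geI) (force simp: field_simps not_le[symmetric])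
    then show "\<exists>n0. \<forall>n\<ge>n0. ereal N \<le> Rs_val (Theta_chain (X' n) - r)" by blast
  qed
  have "(THE r. r \<in> Rs \<and> (\<lambda>n. Rs_val (Theta_chain (X' n) - r)) \<longlonglongrightarrow> \<infinity>) = r"
  proof (rule the_equality)
    fix r' assume r': "r' \<in> Rs \<and> (\<lambda>n. Rs_val (Theta_chain (X' n) - r')) \<longlonglongrightarrow> \<infinity>"
    show "r' = r"
    proof (rule fps_ext, rule fls_eqI)
      fix i k
      define N where "N = real i + real_of_int k / 2 + 1"
      obtain p q where p: "\<And>n. n \<ge> p \<Longrightarrow> ereal N \<le> Rs_val (Theta_chain (X' n) - r)"
        and q: "\<And>n. n \<ge> q \<Longrightarrow> ereal N \<le> Rs_val (Theta_chain (X' n) - r')"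
        using conv r' unfolding Lim_PInfty by meson
      define n where "n = max p q"
      have *: "fps_nth (Theta_chain (X' n)) i $$ k = fps_nth s i $$ k" if "ereal N \<le> Rs_val (Theta_chain (X' n) - s)" for s
      proof (rule ccontr)
        assume "\<not> ?thesis"
        then have "fps_nth (Theta_chain (X' n) - s) i $$ k \<noteq> 0" by simp
        moreover have "ereal (N - real i) \<le> R_val (fps_nth (Theta_chain (X' n) - s) i)"
          using that unfolding Rs_val_ge_iff by blast
        ultimately have "N - real i \<le> real_of_int k / 2" using R_val_geD by blast
        then show False by (simp add: N_def)
      qed
      show "fps_nth r' i $$ k = fps_nth r i $$ k"
        using *[OF p[of n]] *[OF q[of n]] by (simp add: n_def)
    qed
  qed (use r conv in blast)
  then show ?thesis by (simp add: Theta_def Theta_cyc_def X'_def)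
qed


section \<open>Superconnection calculus for words\<close>

section \<open>Graded traces and the homotopy formula\<close>

text \<open>Conjugation by diag(1, -1), the parity involution on matrices.\<close>

definition gam :: "'a::comm_ring_1 m2 \<Rightarrow> 'a m2" where
  "gam A = M2 (m11 A) (- m12 A) (- m21 A) (m22 A)"

definition st :: "'a::comm_ring_1 m2 \<Rightarrow> 'a" where "st A = m11 A - m22 A"

definition m2map :: "('a \<Rightarrow> 'b) \<Rightarrow> 'a m2 \<Rightarrow> 'b m2" where
  "m2map h A = M2 (h (m11 A)) (h (m12 A)) (h (m21 A)) (h (m22 A))"

lemma m2map_sel [simp]: "m11 (m2map h A) = h (m11 A)" "m12 (m2map h A) = h (m12 A)"
  "m21 (m2map h A) = h (m21 A)" "m22 (m2map h A) = h (m22 A)"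
  by (simp_all add: m2map_def)

lemma gam_sel [simp]: "m11 (gam A) = m11 A" "m12 (gam A) = - m12 A" "m21 (gam A) = - m21 A" "m22 (gam A) = m22 A"
  by (simp_all add: gam_def)

lemma gam_simps: "gam (A + B) = gam A + gam B" "gam (A - B) = gam A - gam B" "gam (- A) = - gam A"
  "gam (A * B) = gam A * gam B" "gam (gam A) = A" "gam 0 = 0" "gam 1 = 1"
  by (rule m2_eqI; simp)+

lemma st_simps: "st (A + B) = st A + st B" "st (A - B) = st A - st B" "st (- A) = - st A" "st 0 = 0"
  "st (gam A) = st A"
  by (simp_all add: st_def)

lemma st_mult_commute: "st (A * B) = st (gam B * A)"
  by (simp add: st_def algebra_simps)

text \<open>\<open>SM x y\<close> stands for $x + d\tau\, y$ with an odd parameter $d\tau$.\<close>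

datatype 'a sm = SM (body: "'a m2") (soul: "'a m2")

instantiation sm :: (comm_ring_1) ring_1
begin
definition "0 = SM 0 0"
definition "1 = SM 1 0"
definition "x + y = SM (body x + body y) (soul x + soul y)"
definition "x - y = SM (body x - body y) (soul x - soul y)"
definition "- x = SM (- body x) (- soul x)"
definition "x * y = SM (body x * body y) (soul x * body y + gam (body x) * soul y)"
instance
  by standard
    (simp_all add: zero_sm_def one_sm_def plus_sm_def minus_sm_def uminus_sm_def times_sm_def gam_simps algebra_simps)
end

lemma sm_sel [simp]:
  "body 0 = 0" "soul 0 = 0" "body 1 = 1" "soul 1 = 0" "body (x + y) = body x + body y" "soul (x + y) = soul x + soul y"
  "body (x - y) = body x - body y" "soul (x - y) = soul x - soul y" "body (- x) = - body x" "soul (- x) = - soul x"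
  "body (x * y) = body x * body y" "soul (x * y) = soul x * body y + gam (body x) * soul y"
  for x y :: "'a::comm_ring_1 sm"
  by (simp_all add: zero_sm_def one_sm_def plus_sm_def minus_sm_def uminus_sm_def times_sm_def)

lemma sm_eqI: "body x = body y \<Longrightarrow> soul x = soul y \<Longrightarrow> x = y"
  by (cases x; cases y) simp

definition gams :: "'a::comm_ring_1 sm \<Rightarrow> 'a sm" where
  "gams z = SM (gam (body z)) (- gam (soul z))"

lemma gams_sel [simp]: "body (gams z) = gam (body z)" "soul (gams z) = - gam (soul z)"
  by (simp_all add: gams_def)

lemma gams_simps: "gams (x + y) = gams x + gams y" "gams (x - y) = gams x - gams y" "gams (- x) = - gams x"
  "gams (x * y) = gams x * gams y" "gams (gams x) = x" "gams 0 = 0" "gams 1 = 1"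
  "gams (psign d * x) = psign d * gams x"
  by (rule sm_eqI; simp add: gam_simps psign_def algebra_simps)+

text \<open>\<open>sol\<close> and \<open>bod\<close> are the components of the supertrace along
  d\<tau> and along 1. As d\<tau> is odd, the first is symmetric without signs, while the second is
  graded symmetric.\<close>

definition sol :: "'a::comm_ring_1 sm \<Rightarrow> 'a" where "sol z = st (soul z)"
definition bod :: "'a::comm_ring_1 sm \<Rightarrow> 'a" where "bod z = st (body z)"

lemma sol_simps: "sol (x + y) = sol x + sol y" "sol (x - y) = sol x - sol y" "sol (- x) = - sol x" "sol 0 = 0"
  "sol (psign d * x) = psign d * sol x"
  by (simp_all add: sol_def st_simps psign_def gam_simps)

lemma bod_simps: "bod (x + y) = bod x + bod y" "bod (x - y) = bod x - bod y" "bod (- x) = - bod x" "bod 0 = 0"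
  "bod (psign d * x) = psign d * bod x"
  by (simp_all add: bod_def st_simps psign_def)

lemma sol_sum: "sol (sum F I) = (\<Sum>i\<in>I. sol (F i))"
  by (induction I rule: infinite_finite_induct) (simp_all add: sol_simps)

lemma sol_mult_commute: "sol (x * y) = sol (y * x)"
proof -
  have "st (gam (body x) * soul y) = st (gam (soul y) * gam (body x))" by (rule st_mult_commute)
  also have "\<dots> = st (soul y * body x)" unfolding gam_simps(4)[symmetric] st_simps ..
  finally show ?thesis
    unfolding sol_def sm_sel st_simps st_mult_commute[of "soul x" "body y"] by simp
qed

lemma bod_mult_commute: "bod (x * y) = bod (gams y * x)"
  by (simp add: bod_def st_mult_commute[of "body x" "body y"])

text \<open>An even element has an odd coefficient of d\<tau>, whose supertrace vanishes. This and
  \<open>bod_odd\<close> settle the cases in which Koszul signs seem to disagree.\<close>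

lemma sol_even: "gams z = z \<Longrightarrow> sol (z :: 'a::{idom, ring_char_0} sm) = 0"
proof -
  assume "gams z = z"
  then have "sol z = - sol z" by (metis gams_sel(2) sol_def st_simps(3,5))
  then have "2 * sol z = 0" by simp
  then show ?thesis by simp
qed

lemma bod_odd: "gams z = - z \<Longrightarrow> bod (z :: 'a::{idom, ring_char_0} sm) = 0"
proof -
  assume "gams z = - z"
  then have "bod z = - bod z" by (metis gams_sel(1) bod_def sm_sel(9) st_simps(3,5))
  then have "2 * bod z = 0" by simp
  then show ?thesis by simp
qed

lemma word_val_bounded: "set w \<subseteq> letters \<Longrightarrow> \<exists>N. ereal N \<le> word_val w"
proof (induction w)
  case Nil
  show ?case by (intro exI[of _ 0]) (simp add: word_val_simps)
next
  case (Cons x w)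
  then obtain N where "ereal N \<le> word_val w" by auto
  moreover obtain N' where "ereal N' \<le> Ends_val (snd x)"
    using Cons.prems Ends_val_bounded[of "snd x"] letters_Ends[of x] by auto
  ultimately have "ereal (N' + N) \<le> word_val (x # w)"
    unfolding word_val_simps plus_ereal.simps(1)[symmetric] by (intro add_mono)
  then show ?case by blast
qed

lemma D_letter: "(1, fps_const D) \<in> letters"
  by (simp add: letters_def Ends_const Ends_deg_const End_deg_D)

text \<open>The abstract setting of the homotopy. The polynomial variable is the parameter;
  \<open>rho\<close> is constant in it, and \<open>theta\<close>, \<open>psi\<close> are the
  components of a family of contractions of D. The last two assumptions together say that the
  differential \<open>del\<close> below sends theta + d\<tau> psi to 1.\<close>

locale cyc_rep =
  fixes rho :: "End_M fps \<Rightarrow> 'k::{idom, ring_char_0} poly m2" and theta psi :: "'k poly m2"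
  assumes rho_hom: "rho 1 = 1" "rho (a + b) = rho a + rho b" "rho (a * b) = rho a * rho b"
    and rho_parity: "(d, a) \<in> letters \<Longrightarrow> gam (rho a) = psign d * rho a"
    and rho_const: "m2map pderiv (rho a) = 0"
    and rho_scalar: "\<exists>s. rho (Rs_id r) = M2 s 0 0 s"
    and theta_odd: "gam theta = - theta" and psi_even: "gam psi = psi"
    and D_theta: "rho (fps_const D) * theta + theta * rho (fps_const D) = 1"
    and theta_deriv: "m2map pderiv theta = rho (fps_const D) * psi - psi * rho (fps_const D)"
begin

definition rr :: "letter \<Rightarrow> 'k poly sm" where "rr x = SM (rho (snd x)) 0"
definition Th :: "'k poly sm" where "Th = SM theta psi"
text \<open>With d_1 D / d_1 W in place of \<open>Th\<close> this is the matrix product inside the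
  definition of \<Theta>, the powers of d_1 W being distributed over the letters.\<close>

definition PP :: "letter list \<Rightarrow> 'k poly sm" where "PP w = foldr (\<lambda>x A. rr x * Th * A) w 1"

text \<open>The superconnection [D, -] + d\<tau> d/d\<tau>, an odd derivation for the grading by
  \<open>gams\<close>.\<close>

definition del :: "'k poly sm \<Rightarrow> 'k poly sm" where
  "del z = SM (rho (fps_const D)) 0 * z - gams z * SM (rho (fps_const D)) 0 + SM 0 (m2map pderiv (body z))"

lemma PP_simps [simp]: "PP [] = 1" "PP (x # w) = rr x * Th * PP w"
  by (simp_all add: PP_def)

lemma PP_append: "PP (u @ v) = PP u * PP v"
  by (induction u) (simp_all add: mult.assoc)

lemma gam_D: "gam (rho (fps_const D)) = - rho (fps_const D)"
  using rho_parity[OF D_letter] by (simp add: psign_def)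

lemma rho_uminus: "rho (- a) = - rho a" "rho 0 = 0" "rho (a - b) = rho a - rho b"
proof -
  show 0: "rho 0 = 0" using rho_hom(2)[of 0 0] by simp
  show u: "rho (- a) = - rho a" for a using rho_hom(2)[of a "- a"] by (simp add: 0 eq_neg_iff_add_eq_0 add.commute)
  show "rho (a - b) = rho a - rho b" using rho_hom(2)[of a "- b"] by (simp add: u)
qed

lemma m2map_pderiv_mult: "m2map pderiv (A * B) = m2map pderiv A * B + A * m2map pderiv B"
  by (rule m2_eqI; simp add: pderiv_mult pderiv_add algebra_simps)

lemma del_mult: "del (x * y) = del x * y + gams x * del y"
proof -
  let ?D = "SM (rho (fps_const D)) 0"
  have "SM 0 (m2map pderiv (body (x * y))) = SM 0 (m2map pderiv (body x)) * y + gams x * SM 0 (m2map pderiv (body y))"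
    by (rule sm_eqI) (simp_all add: m2map_pderiv_mult gam_simps)
  then show ?thesis by (simp add: del_def gams_simps algebra_simps)
qed

lemma gams_del: "gams (del x) = - del (gams x)"
proof -
  let ?D = "SM (rho (fps_const D)) 0"
  have "gams ?D = - ?D" by (rule sm_eqI) (simp_all add: gam_D gam_simps)
  moreover have "gams (SM 0 (m2map pderiv (body x))) = - SM 0 (m2map pderiv (body (gams x)))"
    by (intro sm_eqI m2_eqI) (simp_all add: gam_simps pderiv_minus)
  ultimately show ?thesis by (simp add: del_def gams_simps)
qed

lemma del_uminus: "del (- x) = - del x"
  by (intro sm_eqI m2_eqI) (simp_all add: del_def gams_simps pderiv_minus gam_simps)

lemma del_1: "del 1 = 0"
  by (intro sm_eqI m2_eqI) (simp_all add: del_def gam_simps)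

text \<open>Since \<open>Th\<close> has differential 1, applying \<open>del\<close> to a product of
  letters and copies of \<open>Th\<close> either differentiates a letter or removes a
  \<open>Th\<close> and so multiplies two neighbours. These are the two parts of d_cc.\<close>

lemma del_Th: "del Th = 1"
  using D_theta theta_deriv
  by (intro sm_eqI) (simp_all add: del_def Th_def theta_odd psi_even gam_D gam_simps)

lemma gams_Th: "gams Th = - Th"
  by (rule sm_eqI) (simp_all add: Th_def theta_odd psi_even)

lemma rr_letter:
  assumes "x \<in> letters"
  shows "gams (rr x) = psign (fst x) * rr x" "del (rr x) = rr (fst x + 1, delta (fst x) (snd x))"
proof -
  have p: "gam (rho (snd x)) = psign (fst x) * rho (snd x)" using rho_parity[of "fst x" "snd x"] assms by simp
  show g: "gams (rr x) = psign (fst x) * rr x"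
    by (rule sm_eqI) (simp_all add: rr_def p gam_simps psign_def)
  have "rho (delta (fst x) (snd x)) = rho (fps_const D) * rho (snd x) - psign (fst x) * rho (snd x) * rho (fps_const D)"
    by (auto simp: delta_def rho_hom rho_uminus psign_def)
  then show "del (rr x) = rr (fst x + 1, delta (fst x) (snd x))"
    by (intro sm_eqI) (simp_all add: del_def rr_def p rho_const gam_simps)
qed

lemma rr_mult: "rr (letter_mult x y) = rr x * rr y"
  by (rule sm_eqI) (simp_all add: rr_def letter_mult_def rho_hom gam_simps)

lemma gams_step: "x \<in> letters \<Longrightarrow> gams (rr x * Th) = psign (fst x - 1) * (rr x * Th)"
  by (simp add: gams_simps rr_letter gams_Th psign_def)

lemma gams_PP: "set w \<subseteq> letters \<Longrightarrow> gams (PP w) = psign (sdeg w) * PP w"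
proof (induction w)
  case (Cons x w)
  then have "gams (PP (x # w)) = (psign (fst x - 1) * (rr x * Th)) * (psign (sdeg w) * PP w)"
    by (simp only: PP_simps gams_simps(4)[of "rr x * Th"]) (simp add: gams_step)
  also have "\<dots> = psign (sdeg (x # w)) * PP (x # w)"
    by (simp add: psign_def)
  finally show ?case .
qed (simp add: gams_simps psign_def)

lemma del_step: "x \<in> letters \<Longrightarrow> del (rr x * Th) = rr (fst x + 1, delta (fst x) (snd x)) * Th + psign (fst x) * rr x"
  by (simp add: del_mult del_Th rr_letter)

lemma del_PP: "del (PP w) = (\<Sum>p<length w. gams (PP (take p w)) * (del (rr (w ! p) * Th) * PP (drop (Suc p) w)))"
proof (induction w)
  case (Cons x w)
  have "del (PP (x # w)) = del (rr x * Th) * PP w + gams (rr x * Th) * del (PP w)"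
    by (simp only: PP_simps del_mult)
  then show ?case
    unfolding length_Cons sum.lessThan_Suc_shift Cons.IH
    by (simp add: sum_distrib_left gams_simps mult.assoc)
qed (simp add: del_1)

text \<open>The supertrace kills the graded commutator with D and leaves the derivative in the
  parameter.\<close>

lemma sol_del: "sol (del z) = pderiv (bod z)"
proof -
  let ?D = "rho (fps_const D)"
  have "st (m2map pderiv (body z)) = pderiv (bod z)" by (simp add: st_def bod_def pderiv_diff)
  moreover have "st (?D * soul z) = st (gam (soul z) * ?D)" by (rule st_mult_commute)
  ultimately show ?thesis by (simp add: sol_def del_def st_simps gam_D)
qed

text \<open>The sign of t is the Koszul sign for the shifted degrees. It differs from the sign
  produced by the trace only in parities for which the trace vanishes.\<close>

lemma lin_PP_t:
  assumes "x \<in> word_chains"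
  shows "sol (lin PP (t_chain x)) = sol (lin PP x)" "bod (lin PP (t_chain x)) = bod (lin PP x)"
proof -
  have "sol (lin PP (t_chain x)) = sol (lin PP x) \<and> bod (lin PP (t_chain x)) = bod (lin PP x)"
    using assms
  proof (induction rule: chains_induct)
    case (word w)
    then obtain x v where w: "w = x # v" "x \<in> letters" "set v \<subseteq> letters" by (cases w) (auto simp: words_def)
    let ?z = "rr x * Th" and ?y = "PP v"
    let ?s = "\<lambda>k. psign k :: 'k poly sm"
    have gz: "gams ?z = psign (fst x - 1) * ?z" and gy: "gams ?y = psign (sdeg v) * ?y"
      by (simp_all add: gams_step gams_PP w)
    have gzy: "gams (?z * ?y) = psign (sdeg w) * (?z * ?y)"
      using gams_PP[of w] w by (simp add: mult.assoc)
    have t: "lin PP (t_chain (frag_of w)) = psign ((fst x - 1) * sdeg v) * (?y * ?z)"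
      by (simp add: w(1) t_chain_of lin_psign PP_append)
    have "psign ((fst x - 1) * sdeg v) * sol (?z * ?y) = sol (?z * ?y)"
    proof (cases "odd (fst x - 1) \<and> odd (sdeg v)")
      case True
      then have "gams (?z * ?y) = ?z * ?y" unfolding gzy w(1) by (simp add: psign_def)
      then show ?thesis by (simp add: sol_even)
    qed (auto simp: psign_def)
    moreover have "psign ((fst x - 1) * sdeg v) * (psign (fst x - 1) * bod (?z * ?y)) = bod (?z * ?y)"
    proof (cases "odd (fst x - 1) \<and> even (sdeg v)")
      case True
      then have "gams (?z * ?y) = - (?z * ?y)" unfolding gzy w(1) by (simp add: psign_def)
      then show ?thesis by (simp add: bod_odd)
    qed (auto simp: psign_def)
    ultimately show ?case
      unfolding t lin_of sol_simps bod_simps sol_mult_commute[of ?y] bod_mult_commute[of ?y] gz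
      by (simp add: w(1) mult.assoc bod_simps)
  qed (simp_all add: t_chain_lin lin_diff sol_simps bod_simps)
  then show "sol (lin PP (t_chain x)) = sol (lin PP x)" "bod (lin PP (t_chain x)) = bod (lin PP x)" by blast+
qed

text \<open>For a one-letter word the removed \<open>Th\<close> leaves a bare letter, which has no
  d\<tau>-component; this agrees with the absence of a product term.\<close>

lemma sol_Mu:
  assumes "x \<in> letters"
  shows "sol (lin PP (Mu1 (frag_of (x # v)) + Mu2 (frag_of (x # v)))) = sol (del (rr x * Th) * PP v)"
proof (cases v)
  case Nil
  have "sol (psign (fst x) * rr x) = 0" by (simp add: sol_simps) (simp add: sol_def rr_def st_simps)
  then show ?thesis by (simp add: Nil del_step assms sol_simps)
next
  case (Cons y v')
  have "lin PP (Mu1 (frag_of (x # v)) + Mu2 (frag_of (x # v))) =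
     rr (fst x + 1, delta (fst x) (snd x)) * Th * PP v + psign (fst x) * (rr x * rr y * Th * PP v')"
    by (simp add: Cons lin_add lin_psign rr_mult)
  also have "\<dots> = del (rr x * Th) * PP v" by (simp add: del_step assms Cons algebra_simps)
  finally show ?thesis by simp
qed

text \<open>Modulo the image of 1 - t the boundary of a word is the sum of the head operations over
  its rotations. Under \<open>sol\<close> these become the terms of the Leibniz expansion of
  \<open>del (PP w)\<close>, to which \<open>sol_del\<close> applies.\<close>

lemma lin_PP_d_word:
  assumes "w \<in> words"
  shows "sol (lin PP (d_chain (frag_of w))) = pderiv (bod (PP w))"
proof -
  have wl: "set w \<subseteq> letters" using assms by (auto simp: words_def)
  obtain N where N: "ereal N \<le> word_val w" using word_val_bounded[OF wl] by blast
  obtain z where z: "z \<in> word_chains" "z \<in> small N"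
    "d_chain (frag_of w) = (\<Sum>p<length w. Mu1 (tpow p (frag_of w)) + Mu2 (tpow p (frag_of w))) + (z - t_chain z)"
    by (rule d_chain_mod_t[OF assms small.short[OF assms N]])
  have "sol (lin PP (d_chain (frag_of w))) = (\<Sum>p<length w. sol (lin PP (Mu1 (tpow p (frag_of w)) + Mu2 (tpow p (frag_of w)))))"
    unfolding z(3) by (simp add: lin_add lin_diff lin_sum sol_simps sol_sum lin_PP_t z(1))
  also have "\<dots> = (\<Sum>p<length w. sol (gams (PP (take p w)) * (del (rr (w ! p) * Th) * PP (drop (Suc p) w))))"
  proof (rule sum.cong[OF refl])
    fix p assume "p \<in> {..<length w}"
    then obtain u x v where w: "w = u @ x # v" "length u = p" using split_at by (metis lessThan_iff)
    have l: "x \<in> letters" "set u \<subseteq> letters" "set v \<subseteq> letters" using wl w by auto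
    let ?E = "del (rr x * Th) * PP v"
    let ?k = "sdeg u * sdeg (x # v)"
    have "Mu1 (tpow p (frag_of w)) + Mu2 (tpow p (frag_of w))
      = frag_cmul (psign ?k) (Mu1 (frag_of (x # v @ u)) + Mu2 (frag_of (x # v @ u)))"
      unfolding w(1) tpow_frag_of'[OF w(2)] frag_extend_cmul by (simp add: frag_cmul_distrib2)
    then have 1: "sol (lin PP (Mu1 (tpow p (frag_of w)) + Mu2 (tpow p (frag_of w)))) = psign ?k * sol (?E * PP u)"
      unfolding lin_psign sol_simps by (simp only: lin_psign sol_simps sol_Mu[OF l(1)] PP_append mult.assoc)
    have 2: "sol (gams (PP u) * ?E) = psign (sdeg u) * sol (?E * PP u)"
      unfolding gams_PP[OF l(2)] mult.assoc sol_simps by (subst sol_mult_commute) (simp add: mult.assoc)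
    \<comment> \<open>The signs agree if the word has even shifted degree. Otherwise the argument of
      \<open>sol\<close> is even and both sides vanish.\<close>
    have "psign ?k * sol (?E * PP u) = psign (sdeg u) * sol (?E * PP u)"
    proof (cases "even (sdeg w)")
      case True
      then have "even (?k - sdeg u)" by (auto simp: w(1))
      then have "psign ?k = (psign (sdeg u) :: 'k poly)" by (rule psign_cong)
      then show ?thesis by simp
    next
      case False
      have "gams (?E * PP u) = - (del (gams (rr x * Th)) * gams (PP v) * gams (PP u))"
        by (simp add: gams_simps gams_del)
      also have "\<dots> = - (psign (fst x - 1) * (psign (sdeg v) * (psign (sdeg u) * (?E * PP u))))"
        unfolding gams_step[OF l(1)] gams_PP[OF l(2)] gams_PP[OF l(3)]
        by (simp add: psign_def del_uminus)
      also have "\<dots> = ?E * PP u" using False by (auto simp: w(1) psign_def)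
      finally show ?thesis by (simp add: sol_even)
    qed
    then show "sol (lin PP (Mu1 (tpow p (frag_of w)) + Mu2 (tpow p (frag_of w))))
       = sol (gams (PP (take p w)) * (del (rr (w ! p) * Th) * PP (drop (Suc p) w)))"
      unfolding 1 using 2 w by (simp add: nth_append)
  qed
  also have "\<dots> = sol (del (PP w))" by (simp add: del_PP sol_sum)
  finally show ?thesis by (simp add: sol_del)
qed

lemma lin_PP_d: "x \<in> word_chains \<Longrightarrow> sol (lin PP (d_chain x)) = pderiv (bod (lin PP x))"
  by (induction rule: chains_induct)
    (simp_all add: lin_PP_d_word d_chain_lin lin_diff sol_simps bod_simps pderiv_diff)

end


section \<open>Orders in s, T^(1/2) and x\<close>

section \<open>Filtrations\<close>

text \<open>
  Coefficients of $s^i T^{k/2} x^n$ have weight $\alpha i + \beta k + \gamma n$. The weight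
  \<open>wval\<close> is the valuation, \<open>wx\<close> the exponent of the inner variable.
\<close>

type_synonym weight = "real \<times> real \<times> real"

definition wt_of :: "weight \<Rightarrow> nat \<Rightarrow> int \<Rightarrow> int \<Rightarrow> real" where
  "wt_of w i k n = fst w * real i + fst (snd w) * real_of_int k + snd (snd w) * real_of_int n"

definition wval :: weight where "wval = (1, 1 / 2, 0)"
definition wx :: weight where "wx = (0, 0, 1)"

definition fil :: "weight \<Rightarrow> real \<Rightarrow> L fps \<Rightarrow> bool" where
  "fil w N F \<longleftrightarrow> (\<forall>i k n. fps_nth F i $$ k $$ n \<noteq> 0 \<longrightarrow> N \<le> wt_of w i k n)"

lemma fil_0: "fil w N 0"
  by (simp add: fil_def)

lemma fil_add: "fil w N F \<Longrightarrow> fil w N G \<Longrightarrow> fil w N (F + G)"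
  unfolding fil_def by (auto, metis add.right_neutral)

lemma fil_uminus: "fil w N F \<Longrightarrow> fil w N (- F)"
  by (simp add: fil_def)

lemma fil_diff: "fil w N F \<Longrightarrow> fil w N G \<Longrightarrow> fil w N (F - G)"
  using fil_add[of w N F "- G"] fil_uminus by simp

lemma fil_sum: "(\<And>i. i \<in> I \<Longrightarrow> fil w N (F i)) \<Longrightarrow> fil w N (sum F I)"
  by (induction I rule: infinite_finite_induct) (auto simp: fil_0 fil_add)

lemma fil_mono: "fil w N F \<Longrightarrow> N' \<le> N \<Longrightarrow> fil w N' F"
  unfolding fil_def by (meson order_trans)

lemma fil_mult:
  assumes "fil w N F" "fil w N' G"
  shows "fil w (N + N') (F * G)"
  unfolding fil_def
proof (intro allI impI)
  fix i k n assume "fps_nth (F * G) i $$ k $$ n \<noteq> 0"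
  then have "(\<Sum>j=0..i. (fps_nth F j * fps_nth G (i - j)) $$ k $$ n) \<noteq> 0"
    by (simp add: fps_mult_nth fls_nth_sum)
  then obtain j where j: "j \<in> {0..i}" "(fps_nth F j * fps_nth G (i - j)) $$ k $$ n \<noteq> 0"
    by (rule sum.not_neutral_contains_not_neutral)
  then have "(\<Sum>l=fls_subdegree (fps_nth F j)..k - fls_subdegree (fps_nth G (i - j)). (fps_nth F j $$ l * fps_nth G (i - j) $$ (k - l)) $$ n) \<noteq> 0"
    by (simp add: fls_times_nth(2)[of "fps_nth F j"] fls_nth_sum)
  then obtain l where "(fps_nth F j $$ l * fps_nth G (i - j) $$ (k - l)) $$ n \<noteq> 0"
    by (rule sum.not_neutral_contains_not_neutral)
  then obtain m where "fps_nth F j $$ l $$ m \<noteq> 0" "fps_nth G (i - j) $$ (k - l) $$ (n - m) \<noteq> 0"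
    by (rule fls_mult_nth_nonzeroE)
  then have "N \<le> wt_of w j l m" "N' \<le> wt_of w (i - j) (k - l) (n - m)"
    using assms unfolding fil_def by blast+
  then show "N + N' \<le> wt_of w i k n" using j(1) by (simp add: wt_of_def of_nat_diff algebra_simps)
qed

lemma fil_tx: "0 \<le> fst (snd w) * real_of_int k + snd (snd w) * real_of_int n - N \<Longrightarrow> fil w N (fps_const (tx k n))"
  unfolding fil_def by (auto simp: tx_nth wt_of_def split: if_splits)

lemma fil_1: "fil w 0 1"
  using fil_tx[of w 0 0 0] by simp

definition pfil :: "weight \<Rightarrow> real \<Rightarrow> L fps poly \<Rightarrow> bool" where
  "pfil w N p \<longleftrightarrow> (\<forall>j. fil w N (coeff p j))"

lemma pfil_0: "pfil w N 0"
  by (simp add: pfil_def fil_0)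

lemma pfil_add: "pfil w N p \<Longrightarrow> pfil w N q \<Longrightarrow> pfil w N (p + q)"
  by (simp add: pfil_def fil_add)

lemma pfil_diff: "pfil w N p \<Longrightarrow> pfil w N q \<Longrightarrow> pfil w N (p - q)"
  by (simp add: pfil_def fil_diff)

lemma pfil_uminus: "pfil w N p \<Longrightarrow> pfil w N (- p)"
  by (simp add: pfil_def fil_uminus)

lemma pfil_mult: "pfil w N p \<Longrightarrow> pfil w N' q \<Longrightarrow> pfil w (N + N') (p * q)"
  unfolding pfil_def coeff_mult by (auto intro!: fil_sum fil_mult)

lemma pfil_const: "fil w N F \<Longrightarrow> pfil w N [:F:]"
  by (auto simp: pfil_def coeff_pCons fil_0 split: nat.split)

lemma pfil_tau: "fil w N F \<Longrightarrow> pfil w N [:0, F:]"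
  by (auto simp: pfil_def coeff_pCons fil_0 split: nat.split)

lemma pfil_mono: "pfil w N p \<Longrightarrow> N' \<le> N \<Longrightarrow> pfil w N' p"
  unfolding pfil_def using fil_mono by blast

definition mfil :: "weight \<Rightarrow> real \<Rightarrow> L fps poly m2 \<Rightarrow> bool" where
  "mfil w N A \<longleftrightarrow> pfil w N (m11 A) \<and> pfil w N (m12 A) \<and> pfil w N (m21 A) \<and> pfil w N (m22 A)"

lemma mfil_mult: "mfil w N A \<Longrightarrow> mfil w N' B \<Longrightarrow> mfil w (N + N') (A * B)"
  unfolding mfil_def m2_sel by (intro conjI pfil_add pfil_mult) blast+

lemma mfil_simps: "mfil w N 0" "mfil w N A \<Longrightarrow> mfil w N B \<Longrightarrow> mfil w N (A + B)"
  "mfil w N A \<Longrightarrow> mfil w N B \<Longrightarrow> mfil w N (A - B)" "mfil w N A \<Longrightarrow> mfil w N (gam A)"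
  "mfil w 0 1"
  by (simp_all add: mfil_def pfil_0 pfil_add pfil_diff pfil_uminus pfil_const fil_1 one_pCons)

text \<open>Body and soul have separate bounds because, in the order in x, \<open>theta\<close>
  reaches only 0 but \<open>psi\<close> reaches 1.\<close>

definition sfil :: "weight \<Rightarrow> real \<Rightarrow> real \<Rightarrow> L fps poly sm \<Rightarrow> bool" where
  "sfil w N M z \<longleftrightarrow> mfil w N (body z) \<and> mfil w M (soul z)"

lemma sfil_mult: "sfil w N M z \<Longrightarrow> sfil w N' M' y \<Longrightarrow> M + N' = K \<Longrightarrow> N + M' = K \<Longrightarrow> sfil w (N + N') K (z * y)"
  unfolding sfil_def sm_sel using mfil_mult mfil_simps(2,4) by metis

lemma sfil_1: "sfil w 0 M 1"
  by (simp add: sfil_def mfil_simps)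

lemma sfil_0: "sfil w N M 0"
  by (simp add: sfil_def mfil_simps)

lemma sfil_diff: "sfil w N M z \<Longrightarrow> sfil w N M y \<Longrightarrow> sfil w N M (z - y)"
  by (simp add: sfil_def mfil_simps)

lemma sfil_mono: "sfil w N M z \<Longrightarrow> N' \<le> N \<Longrightarrow> M' \<le> M \<Longrightarrow> sfil w N' M' z"
  unfolding sfil_def mfil_def using pfil_mono by blast

lemma sfil_sol: "sfil w N M z \<Longrightarrow> pfil w M (sol z)"
  by (simp add: sfil_def mfil_def sol_def st_def pfil_diff)

lemma sfil_bod: "sfil w N M z \<Longrightarrow> pfil w N (bod z)"
  by (simp add: sfil_def mfil_def bod_def st_def pfil_diff)

definition fps_map :: "('a \<Rightarrow> 'b) \<Rightarrow> 'a fps \<Rightarrow> 'b fps" where "fps_map h F = Abs_fps (\<lambda>i. h (fps_nth F i))"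

lemma fps_map_nth [simp]: "fps_nth (fps_map h F) i = h (fps_nth F i)"
  by (simp add: fps_map_def)

lemma tx_mult_nth: "(tx a b * X) $$ k = fls_X_intpow b * X $$ (k - a)"
proof -
  have "(tx a b * X) $$ k = (\<Sum>i\<in>{a}. tx a b $$ i * X $$ (k - i))"
    by (rule fls_mult_nth_superset) (auto simp: tx_nth split: if_splits)
  then show ?thesis by (simp add: tx_nth)
qed

text \<open>Carries bounds valid for every zeta in the open interval to the boundary weight zeta_0 =
  p/2, at which x weighs 0 and only powers of T^(1/2) count.\<close>

lemma linear_limit:
  fixes P :: real
  assumes "P = 0 \<or> P = 1" "\<And>z. 0 < z \<Longrightarrow> z < 1 \<Longrightarrow> 0 \<le> d + m * (z - P)"
  shows "0 \<le> d"
proof (rule ccontr)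
  assume d: "\<not> 0 \<le> d"
  define h where "h = min (1 / 2) (- d / (2 * (\<bar>m\<bar> + 1)))"
  have "0 < - d / (2 * (\<bar>m\<bar> + 1))" using d by (intro divide_pos_pos) auto
  then have h: "0 < h" "h < 1" unfolding h_def by linarith+
  have "\<bar>m\<bar> * h \<le> \<bar>m\<bar> * (- d / (2 * (\<bar>m\<bar> + 1)))" by (intro mult_left_mono) (simp_all add: h_def)
  also have "\<dots> \<le> (\<bar>m\<bar> + 1) * (- d / (2 * (\<bar>m\<bar> + 1)))"
    using \<open>0 < - d / (2 * (\<bar>m\<bar> + 1))\<close> by (intro mult_right_mono) linarith+
  also have "\<dots> = - d / 2" by (simp add: field_simps)
  finally have mh: "\<bar>m\<bar> * h \<le> - d / 2" .
  have "\<bar>m * h\<bar> = \<bar>m\<bar> * h" using h by (simp add: abs_mult)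
  then have "- (\<bar>m\<bar> * h) \<le> m * h" "m * h \<le> \<bar>m\<bar> * h" by linarith+
  moreover have "0 \<le> d + m * h \<or> 0 \<le> d - m * h" using assms(1)
  proof
    assume "P = 0" then show ?thesis using assms(2)[of h] h by simp
  next
    assume "P = 1" then show ?thesis using assms(2)[of "1 - h"] h by simp
  qed
  ultimately show False using mh d by linarith
qed

section \<open>The homotopy at one end of the annulus\<close>

section \<open>The two expansions of the functional\<close>

instance fps :: (ring_char_0) ring_char_0 ..

text \<open>\<open>Dp\<close> and \<open>Dq\<close> are the entries of D in a rescaled basis;
  \<open>Dq\<close> is a unit here although the corresponding entry is not one in S.
  \<open>al\<close> and \<open>be\<close> are the entries of a contraction, later identified with
  d_1 D / d_1 W, and \<open>fil_chi\<close> is the positive order in x that hides scalar words from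
  constant terms.\<close>

locale side = expansion +
  fixes c :: int and Dp Dq al be iq :: L
  assumes qc: "int q = 2 * c"
    and D12: "iota (m12 (mx D)) * tx (- c) 0 = Dp" and D21: "iota (m21 (mx D)) * tx c 0 = Dq"
    and abD: "al * Dq + Dp * be = 1" and iq: "Dq * iq = 1"
    and fils: "\<And>w. w = wval \<or> w = wx \<Longrightarrow> fil w 0 (fps_const al)"
      "\<And>w. w = wval \<or> w = wx \<Longrightarrow> fil w 0 (fps_const be)" "\<And>w. w = wval \<or> w = wx \<Longrightarrow> fil w 0 (fps_const iq)"
    and fil_chi: "fil wx 1 (fps_const (be * iq))"
begin

text \<open>The basis $1, T^{-c/2}e_1$ makes the weight of both basis elements \<open>0\<close> in the limit of $\zeta$.\<close>

definition rr11 :: "End_M fps \<Rightarrow> L fps" where "rr11 \<Phi> = fps_map (\<lambda>\<phi>. iota (m11 (mx \<phi>))) \<Phi>"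
definition rr12 :: "End_M fps \<Rightarrow> L fps" where "rr12 \<Phi> = fps_map (\<lambda>\<phi>. iota (m12 (mx \<phi>))) \<Phi> * fps_const (tx (- c) 0)"
definition rr21 :: "End_M fps \<Rightarrow> L fps" where "rr21 \<Phi> = fps_map (\<lambda>\<phi>. iota (m21 (mx \<phi>))) \<Phi> * fps_const (tx c 0)"
definition rr22 :: "End_M fps \<Rightarrow> L fps" where "rr22 \<Phi> = fps_map (\<lambda>\<phi>. iota (m22 (mx \<phi>))) \<Phi>"

definition rho :: "End_M fps \<Rightarrow> L fps poly m2" where
  "rho \<Phi> = M2 [:rr11 \<Phi>:] [:rr12 \<Phi>:] [:rr21 \<Phi>:] [:rr22 \<Phi>:]"

text \<open>The segment from the contraction with entries \<open>al\<close>, \<open>be\<close> at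
  parameter 0 to the strictly upper triangular one with entry \<open>iq\<close> at parameter 1. Both
  solve D theta + theta D = 1, and this equation is affine in theta.\<close>

definition theta :: "L fps poly m2" where
  "theta = M2 0 [:fps_const al, fps_const (iq - al):] [:fps_const be, fps_const (- be):] 0"

text \<open>For psi = diag(0, h) the commutator D psi - psi D has entries Dp h and - Dq h. The lower
  one has to be \<open>- be\<close>, so h = \<open>be * iq\<close>; the upper one is then
  \<open>iq - al\<close> by \<open>abD\<close>.\<close>

definition psi :: "L fps poly m2" where "psi = M2 0 0 0 [:fps_const (be * iq):]"

lemma iota_sum: "iota (sum F I) = (\<Sum>i\<in>I. iota (F i))"
  by (induction I rule: infinite_finite_induct) (simp_all add: iota_hom)

lemma txc: "fps_const (tx c 0) * fps_const (tx (- c) 0) = 1" "fps_const (tx (- c) 0) * fps_const (tx c 0) = 1"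
  by (simp_all add: fps_const_mult tx_mult)

lemma rr_mult_aux: "fps_map (\<lambda>\<phi>. iota (f \<phi>)) (\<Phi> * \<Psi>)
    = fps_map (\<lambda>\<phi>. iota (g1 \<phi>)) \<Phi> * fps_map (\<lambda>\<phi>. iota (h1 \<phi>)) \<Psi> + fps_map (\<lambda>\<phi>. iota (g2 \<phi>)) \<Phi> * fps_map (\<lambda>\<phi>. iota (h2 \<phi>)) \<Psi>"
  if "\<And>\<phi> \<psi> :: End_M. f (\<phi> * \<psi>) = g1 \<phi> * h1 \<psi> + g2 \<phi> * h2 \<psi>" "\<And>\<phi> \<psi>. f (\<phi> + \<psi>) = f \<phi> + f \<psi>" "f 0 = 0"
proof (rule fps_ext)
  fix n
  have "f (sum F I) = (\<Sum>i\<in>I. f (F i))" for F :: "nat \<Rightarrow> End_M" and I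
    by (induction I rule: infinite_finite_induct) (simp_all add: that)
  then show "fps_nth (fps_map (\<lambda>\<phi>. iota (f \<phi>)) (\<Phi> * \<Psi>)) n = fps_nth (fps_map (\<lambda>\<phi>. iota (g1 \<phi>)) \<Phi> * fps_map (\<lambda>\<phi>. iota (h1 \<phi>)) \<Psi>
      + fps_map (\<lambda>\<phi>. iota (g2 \<phi>)) \<Phi> * fps_map (\<lambda>\<phi>. iota (h2 \<phi>)) \<Psi>) n"
    by (simp add: fps_mult_nth iota_sum iota_hom that(1) sum.distrib)
qed

lemma rho_mult: "rho (\<Phi> * \<Psi>) = rho \<Phi> * rho \<Psi>"
proof -
  let ?t = "fps_const (tx c 0)" and ?i = "fps_const (tx (- c) 0)"
  have ti: "?t * (?i * X) = X" "?i * (?t * X) = X" for X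
    by (simp_all only: mult.assoc[symmetric] txc mult_1)
  have 11: "rr11 (\<Phi> * \<Psi>) = rr11 \<Phi> * rr11 \<Psi> + rr12 \<Phi> * rr21 \<Psi>"
    unfolding rr11_def rr12_def rr21_def
    by (subst rr_mult_aux[where f = "\<lambda>\<phi>. m11 (mx \<phi>)" and ?g1.0 = "\<lambda>\<phi>. m11 (mx \<phi>)"
        and ?h1.0 = "\<lambda>\<phi>. m11 (mx \<phi>)" and ?g2.0 = "\<lambda>\<phi>. m12 (mx \<phi>)" and ?h2.0 = "\<lambda>\<phi>. m21 (mx \<phi>)"]) (simp_all add: mx_hom ti mult_ac)
  have 12: "rr12 (\<Phi> * \<Psi>) = rr11 \<Phi> * rr12 \<Psi> + rr12 \<Phi> * rr22 \<Psi>"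
    unfolding rr11_def rr12_def rr22_def
    by (subst rr_mult_aux[where f = "\<lambda>\<phi>. m12 (mx \<phi>)" and ?g1.0 = "\<lambda>\<phi>. m11 (mx \<phi>)"
        and ?h1.0 = "\<lambda>\<phi>. m12 (mx \<phi>)" and ?g2.0 = "\<lambda>\<phi>. m12 (mx \<phi>)" and ?h2.0 = "\<lambda>\<phi>. m22 (mx \<phi>)"]) (simp_all add: mx_hom algebra_simps)
  have 21: "rr21 (\<Phi> * \<Psi>) = rr21 \<Phi> * rr11 \<Psi> + rr22 \<Phi> * rr21 \<Psi>"
    unfolding rr11_def rr21_def rr22_def
    by (subst rr_mult_aux[where f = "\<lambda>\<phi>. m21 (mx \<phi>)" and ?g1.0 = "\<lambda>\<phi>. m21 (mx \<phi>)"
        and ?h1.0 = "\<lambda>\<phi>. m11 (mx \<phi>)" and ?g2.0 = "\<lambda>\<phi>. m22 (mx \<phi>)" and ?h2.0 = "\<lambda>\<phi>. m21 (mx \<phi>)"]) (simp_all add: mx_hom algebra_simps)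
  have 22: "rr22 (\<Phi> * \<Psi>) = rr21 \<Phi> * rr12 \<Psi> + rr22 \<Phi> * rr22 \<Psi>"
    unfolding rr12_def rr21_def rr22_def
    by (subst rr_mult_aux[where f = "\<lambda>\<phi>. m22 (mx \<phi>)" and ?g1.0 = "\<lambda>\<phi>. m21 (mx \<phi>)"
        and ?h1.0 = "\<lambda>\<phi>. m12 (mx \<phi>)" and ?g2.0 = "\<lambda>\<phi>. m22 (mx \<phi>)" and ?h2.0 = "\<lambda>\<phi>. m22 (mx \<phi>)"]) (simp_all add: mx_hom ti mult_ac)
  show ?thesis by (rule m2_eqI) (simp_all add: rho_def 11 12 21 22)
qed

lemma rho_add: "rho (\<Phi> + \<Psi>) = rho \<Phi> + rho \<Psi>"
proof -
  have "fps_map (\<lambda>\<phi>. iota (f (mx \<phi>))) (\<Phi> + \<Psi>) = fps_map (\<lambda>\<phi>. iota (f (mx \<phi>))) \<Phi> + fps_map (\<lambda>\<phi>. iota (f (mx \<phi>))) \<Psi>"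
    if "\<And>x y. f (x + y) = f x + f y" for f
    by (rule fps_ext) (simp add: mx_hom iota_hom that)
  then show ?thesis
    by (intro m2_eqI) (simp_all add: rho_def rr11_def rr12_def rr21_def rr22_def algebra_simps)
qed

lemma rho_Rs: "rho (Rs_id r) = M2 [:fps_map emb r:] 0 0 [:fps_map emb r:]"
  by (intro m2_eqI) (auto simp: rho_def rr11_def rr12_def rr21_def rr22_def mx_const iota_gens iota_hom fps_eq_iff)

lemma rho_1: "rho 1 = 1"
proof -
  have "fps_map emb 1 = 1" by (rule fps_ext) (simp add: emb_hom)
  then show ?thesis using rho_Rs[of 1] by (simp add: Rs_id_hom one_m2_def one_pCons)
qed

lemma rho_D: "rho (fps_const D) = M2 0 [:fps_const Dp:] [:fps_const Dq:] 0"
proof -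
  have *: "fps_map h (fps_const \<phi>) = fps_const (h \<phi>)" if "h 0 = 0" for h :: "End_M \<Rightarrow> L" and \<phi>
    by (rule fps_ext) (simp add: that)
  have "m11 (mx D) = 0" "m22 (mx D) = 0" by (simp_all add: mx_D)
  then show ?thesis
    unfolding rho_def rr11_def rr12_def rr21_def rr22_def D12[symmetric] D21[symmetric]
    by (simp add: * mx_hom iota_hom fps_const_mult[symmetric] del: fps_const_mult)
qed

lemma rho_letter_parity:
  assumes "(d, a) \<in> letters"
  shows "gam (rho a) = psign d * rho a"
proof (cases "even d")
  case True
  have "End_deg d (fps_nth a i)" for i using assms by (simp add: letters_def Ends_deg_def)
  then have deg: "S_deg (d + 1) (m12 (mx (fps_nth a i)))" "S_deg (d - 1) (m21 (mx (fps_nth a i)))" for i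
    by (simp_all only: End_deg_iff)
  have "m12 (mx (fps_nth a i)) = 0" "m21 (mx (fps_nth a i)) = 0" for i
    by (rule S_deg_odd[OF deg(1)], use True in simp, rule S_deg_odd[OF deg(2)], use True in simp)
  then have "fps_map (\<lambda>\<phi>. iota (m12 (mx \<phi>))) a = 0" "fps_map (\<lambda>\<phi>. iota (m21 (mx \<phi>))) a = 0"
    by (auto simp: fps_eq_iff iota_hom)
  then show ?thesis using True by (intro m2_eqI) (simp_all add: rho_def rr12_def rr21_def psign_def)
next
  case False
  have "End_deg d (fps_nth a i)" for i using assms by (simp add: letters_def Ends_deg_def)
  then have deg: "S_deg d (m11 (mx (fps_nth a i)))" "S_deg d (m22 (mx (fps_nth a i)))" for i
    by (simp_all only: End_deg_iff)
  have "m11 (mx (fps_nth a i)) = 0" "m22 (mx (fps_nth a i)) = 0" for i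
    by (rule S_deg_odd[OF deg(1) False], rule S_deg_odd[OF deg(2) False])
  then have "fps_map (\<lambda>\<phi>. iota (m11 (mx \<phi>))) a = 0" "fps_map (\<lambda>\<phi>. iota (m22 (mx \<phi>))) a = 0"
    by (auto simp: fps_eq_iff iota_hom)
  then show ?thesis using False by (intro m2_eqI) (simp_all add: rho_def rr11_def rr22_def psign_def)
qed

sublocale cyc_rep rho theta psi
proof
  show "rho 1 = 1" by (rule rho_1)
  show "rho (a + b) = rho a + rho b" "rho (a * b) = rho a * rho b" for a b by (rule rho_add rho_mult)+
  show "gam (rho a) = psign d * rho a" if "(d, a) \<in> letters" for d a by (rule rho_letter_parity[OF that])
  show "m2map pderiv (rho a) = 0" for a by (rule m2_eqI) (simp_all add: rho_def pderiv_pCons)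
  show "\<exists>s. rho (Rs_id r) = M2 s 0 0 s" for r using rho_Rs by blast
  show "gam theta = - theta" "gam psi = psi" by (rule m2_eqI; simp add: theta_def psi_def)+
  have 1: "Dq * al + Dp * be = 1" "be * Dp + al * Dq = 1" using abD by (simp_all add: mult.commute add.commute)
  have 2: "Dp * (- be) + (iq - al) * Dq = 0" "Dq * (iq - al) + (- be) * Dp = 0"
    using 1 iq by (simp_all add: algebra_simps)
  show "rho (fps_const D) * theta + theta * rho (fps_const D) = 1"
    using 1 2 abD by (intro m2_eqI) (simp_all add: rho_D theta_def fps_const_mult fps_const_add one_pCons add.commute mult.commute)
  have "Dp * (be * iq) = iq - al"
  proof -
    have "Dp * be = 1 - al * Dq" using abD by (simp only: eq_diff_eq add.commute)
    then have "Dp * (be * iq) = (1 - al * Dq) * iq" by (simp only: mult.assoc[symmetric])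
    also have "\<dots> = iq - al * (Dq * iq)" by (simp only: left_diff_distrib mult.assoc mult_1)
    finally show ?thesis by (simp add: iq)
  qed
  moreover have "be * iq * Dq = be"
  proof -
    have "be * iq * Dq = be * (Dq * iq)" by (simp only: mult_ac)
    then show ?thesis by (simp add: iq)
  qed
  moreover have "be * iq * Dp = Dp * (be * iq)" "Dq * (be * iq) = be * iq * Dq" by (simp_all only: mult_ac)
  ultimately have "Dp * (be * iq) = iq - al" "be * iq * Dp = iq - al" "Dq * (be * iq) = be" "be * iq * Dq = be"
    by (simp_all only:)
  then show "m2map pderiv theta = rho (fps_const D) * psi - psi * rho (fps_const D)"
    by (intro m2_eqI) (simp_all add: rho_D theta_def psi_def pderiv_pCons fps_const_mult del: mult_cancel_left1 mult_cancel_right1)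
qed

end


definition ct :: "L fps \<Rightarrow> nat \<Rightarrow> int \<Rightarrow> real" where "ct F i k = fps_nth F i $$ k $$ 0"

lemma ct_simps: "ct (F + G) i k = ct F i k + ct G i k" "ct (F - G) i k = ct F i k - ct G i k" "ct (- F) i k = - ct F i k"
  "ct 0 i k = 0"
  by (simp_all add: ct_def)

lemma ct_sum: "ct (sum F I) i k = (\<Sum>j\<in>I. ct (F j) i k)"
  by (induction I rule: infinite_finite_induct) (simp_all add: ct_simps)

lemma ct_of_nat_mult: "ct (of_nat m * F) i k = real m * ct F i k"
  by (induction m) (simp_all add: ct_simps algebra_simps)

lemma ct_fil_val: "fil wval N F \<Longrightarrow> real i + real_of_int k / 2 < N \<Longrightarrow> ct F i k = 0"
  unfolding fil_def ct_def wval_def wt_of_def by force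

lemma ct_fil_x: "fil wx 1 F \<Longrightarrow> ct F i k = 0"
  unfolding fil_def ct_def wx_def wt_of_def by force

definition scalar_words :: "letter list set" where
  "scalar_words = {(d, Rs_id r) # replicate m (0, 1) | d r m. r \<in> Rs}"

definition vec_m2 :: "'a ^ 2 ^ 2 \<Rightarrow> 'a m2" where
  "vec_m2 A = M2 (A $ 1 $ 1) (A $ 1 $ 2) (A $ 2 $ 1) (A $ 2 $ 2)"

lemma vec_m2_mult: "vec_m2 (A ** B) = vec_m2 A * vec_m2 B"
  by (rule m2_eqI) (simp_all add: vec_m2_def matrix_matrix_mult_def sum_2)

lemma vec_m2_1: "vec_m2 (mat 1) = 1"
  by (rule m2_eqI) (simp_all add: vec_m2_def mat_def)

context side begin

text \<open>A bound with a shift proportional to zeta_1 is taken to the limit zeta_1 = c, where it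
  constrains the power of T^(1/2) alone.\<close>

lemma S_limit:
  assumes "\<And>\<zeta>. \<zeta> \<in> zetas \<Longrightarrow> ereal (M + \<kappa> * snd \<zeta>) \<le> S_val \<zeta> F" "iota F $$ k $$ n \<noteq> 0"
  shows "M + \<kappa> * real_of_int c \<le> real_of_int k / 2"
proof -
  have p: "p = 0 \<or> p = 2" using pq qc by presburger
  have cP: "real_of_int c = 1 - real p / 2" using pq qc p by auto
  have "0 \<le> (real_of_int k / 2 - M - \<kappa> * real_of_int c) + (real_of_int (e * n) + \<kappa>) * (z - real p / 2)"
    if z: "0 < z" "z < 1" for z
  proof -
    have "(z, 1 - z) \<in> zetas" using z by (simp add: zetas_def)
    then have "ereal (M + \<kappa> * (1 - z)) \<le> S_val (z, 1 - z) F" using assms(1)[of "(z, 1 - z)"] by simp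
    then have "M + \<kappa> * (1 - z) \<le> real_of_int k / 2 + real_of_int (e * n) * (z - real p / 2)"
      using assms(2) by (simp add: S_val_ge_iff)
    then show ?thesis unfolding cP by (simp only: algebra_simps)
  qed
  then have "0 \<le> real_of_int k / 2 - M - \<kappa> * real_of_int c"
    by (rule linear_limit[rotated]) (use p in auto)
  then show ?thesis by simp
qed

lemma mult_tx_nth: "(X * tx a 0) $$ k = X $$ (k - a)"
  unfolding mult.commute[of X] tx_mult_nth by simp

text \<open>In the basis 1, T^(-c/2) e_1 the shifts by zeta_1/2 in \<open>mx_ge\<close> disappear at
  the boundary weight, so that all four entries obey the same bound.\<close>

lemma rho_fil:
  assumes "ereal N \<le> Ends_val a"
  shows "mfil wval N (rho a)"
proof -
  have mx: "mx_ge \<zeta> (N - real i) (mx (fps_nth a i))" if "\<zeta> \<in> zetas" for \<zeta> i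
    using assms that unfolding Ends_val_ge_iff End_val_ge_iff by blast
  have w: "wt_of wval i k n = real i + real_of_int k / 2" for i k n by (simp add: wt_of_def wval_def)
  have "N \<le> real i + real_of_int k / 2" if "iota (m11 (mx (fps_nth a i))) $$ k $$ n \<noteq> 0" for i k n
    using S_limit[of "N - real i" 0 "m11 (mx (fps_nth a i))" k n] mx that by (simp add: mx_ge_def)
  moreover have "N \<le> real i + real_of_int k / 2" if "iota (m22 (mx (fps_nth a i))) $$ k $$ n \<noteq> 0" for i k n
    using S_limit[of "N - real i" 0 "m22 (mx (fps_nth a i))" k n] mx that by (simp add: mx_ge_def)
  moreover have "N \<le> real i + real_of_int k / 2" if "iota (m12 (mx (fps_nth a i))) $$ (k + c) $$ n \<noteq> 0" for i k n
    using S_limit[of "N - real i" "1 / 2" "m12 (mx (fps_nth a i))" "k + c" n] mx that by (simp add: mx_ge_def)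
  moreover have "N \<le> real i + real_of_int k / 2" if "iota (m21 (mx (fps_nth a i))) $$ (k - c) $$ n \<noteq> 0" for i k n
    using S_limit[of "N - real i" "- 1 / 2" "m21 (mx (fps_nth a i))" "k - c" n] mx that by (simp add: mx_ge_def)
  ultimately show ?thesis
    unfolding mfil_def rho_def m2.sel
    by (intro conjI pfil_const; unfold fil_def w rr11_def rr12_def rr21_def rr22_def; simp add: mult_tx_nth)
qed

lemma rr_fil: "ereal N \<le> Ends_val (snd x) \<Longrightarrow> sfil wval N M (rr x)"
  by (simp add: sfil_def rr_def rho_fil mfil_simps)

lemma theta_fil: "w = wval \<or> w = wx \<Longrightarrow> mfil w 0 theta"
proof -
  assume w: "w = wval \<or> w = wx"
  have *: "pfil w 0 [:F, G:]" if "fil w 0 F" "fil w 0 G" for F G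
    using that by (auto simp: pfil_def coeff_pCons fil_0 split: nat.split)
  have "fil w 0 (fps_const (iq - al))" "fil w 0 (fps_const (- be))"
    using fil_diff[OF fils(3)[OF w] fils(1)[OF w]] fil_uminus[OF fils(2)[OF w]] by simp_all
  then show ?thesis unfolding mfil_def theta_def m2.sel using fils[OF w] by (intro conjI * pfil_0)
qed

lemma Th_fil: "sfil wval 0 0 Th" "sfil wx 0 1 Th"
proof -
  have "fil wval (0 + 0) (fps_const be * fps_const iq)" by (intro fil_mult fils) simp_all
  then show "sfil wval 0 0 Th"
    unfolding sfil_def Th_def sm.sel
    by (intro conjI theta_fil) (simp_all add: mfil_def psi_def pfil_0 pfil_const)
  show "sfil wx 0 1 Th"
    unfolding sfil_def Th_def sm.sel
    using fil_chi by (intro conjI theta_fil) (simp_all add: mfil_def psi_def pfil_0 pfil_const)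
qed

lemma PP_fil: "set w \<subseteq> letters \<Longrightarrow> ereal N \<le> word_val w \<Longrightarrow> sfil wval N N (PP w)"
proof (induction w arbitrary: N)
  case Nil
  then show ?case using sfil_mono[OF sfil_1[of wval N]] by (simp add: word_val_simps zero_ereal_def)
next
  case (Cons x w)
  obtain r s where rs: "ereal r \<le> Ends_val (snd x)" "ereal s \<le> word_val w" "r + s = N"
  proof (cases "Ends_val (snd x)")
    case (real r)
    have "ereal (N - r) \<le> word_val w"
      using Cons.prems(2) unfolding word_val_simps real ereal_le_add_iff .
    then show thesis using that[of r "N - r"] real by simp
  next
    case PInf
    obtain s where "ereal s \<le> word_val w" using word_val_bounded[of w] Cons.prems(1) by auto
    then show thesis using that[of "N - s" s] PInf by simp
  next
    case MInf
    then show thesis using Cons.prems(1) Ends_val_MInf letters_Ends by auto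
  qed
  have "sfil wval s s (PP w)" using Cons.IH[OF _ rs(2)] Cons.prems(1) by simp
  moreover have "sfil wval (r + 0) r (rr x * Th)"
    by (rule sfil_mult[OF rr_fil[OF rs(1), of r] Th_fil(1)]) simp_all
  ultimately have "sfil wval (r + 0 + s) (r + s) (rr x * Th * PP w)"
    by - (rule sfil_mult[of wval "r + 0" r _ s s], simp_all)
  then show ?case using rs(3) by simp
qed

lemma rr_add: "rr (d, a + a') = rr (d, a) + rr (d, a')"
  by (rule sm_eqI) (simp_all add: rr_def rho_add)

lemma rr_Rs: "rr (d + k, Rs_id r * a) = SM (rho (Rs_id r)) 0 * rr (d, a)"
  by (rule sm_eqI) (simp_all add: rr_def rho_mult)

lemma Rs_central: "SM (rho (Rs_id r)) 0 * z = z * SM (rho (Rs_id r)) 0"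
  by (intro sm_eqI m2_eqI) (simp_all add: rho_Rs algebra_simps)

text \<open>Scalars act by central matrices and \<open>rr\<close> is additive, so \<open>PP\<close>
  respects the tensor relations exactly; only short words need an estimate.\<close>

lemma lin_PP_small: "x \<in> small N \<Longrightarrow> sfil wval N N (lin PP x)"
proof (induction rule: small.induct)
  case zero
  then show ?case by (simp add: sfil_0)
next
  case (diff x y)
  then show ?case by (simp add: lin_diff sfil_diff)
next
  case (short w)
  then show ?case by (simp add: PP_fil words_def)
next
  case (additive u d a v a')
  then show ?case by (simp add: lin_diff PP_append rr_add distrib_left distrib_right mult.assoc sfil_0)
next
  case (balanced r e' u d a v d' a' w)
  let ?R = "SM (rho (Rs_id r)) 0"
  have "PP (u @ (d + e', Rs_id r * a) # v @ (d', a') # w) = ?R * (PP u * (rr (d, a) * Th * PP v * (rr (d', a') * Th * PP w)))"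
    unfolding PP_append PP_simps rr_Rs by (simp only: mult.assoc Rs_central[of r "PP u", symmetric]) (simp only: mult.assoc[symmetric] Rs_central[of r "PP u"])
  moreover have "PP (u @ (d, a) # v @ (d' + e', Rs_id r * a') # w) = ?R * (PP u * (rr (d, a) * Th * PP v * (rr (d', a') * Th * PP w)))"
  proof -
    have "PP (u @ (d, a) # v @ (d' + e', Rs_id r * a') # w) = (PP u * rr (d, a) * Th * PP v) * ?R * (rr (d', a') * Th * PP w)"
      unfolding PP_append PP_simps rr_Rs by (simp only: mult.assoc)
    then show ?thesis unfolding Rs_central[of r "PP u * rr (d, a) * Th * PP v", symmetric] by (simp only: mult.assoc)
  qed
  ultimately show ?case by (simp add: lin_diff sfil_0)
qed

lemma rr_scalar_fil: "sfil wx 0 1 (rr (d, Rs_id r))"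
proof -
  have "fil wx 0 (fps_map emb r)" unfolding fil_def by (auto simp: emb_nth wx_def wt_of_def)
  then show ?thesis by (simp add: sfil_def rr_def rho_Rs mfil_def pfil_const pfil_0)
qed

text \<open>Scalars are constant in x and the d\<tau>-part of \<open>Th\<close> has order 1, hence
  so has the d\<tau>-part of the product. Letters that are not scalar may have poles in x, so the
  argument is confined to these words.\<close>

lemma PP_scalar: "w \<in> scalar_words \<Longrightarrow> pfil wx 1 (sol (PP w))"
proof -
  assume "w \<in> scalar_words"
  then obtain d r m where w: "w = (d, Rs_id r) # replicate m (0, 1)" unfolding scalar_words_def by blast
  have mult: "sfil wx 0 1 (z * y)" if "sfil wx 0 1 z" "sfil wx 0 1 y" for z y
    using sfil_mult[OF that, of 1] by simp
  have "rr (0, 1) = rr (0, Rs_id 1)" by (simp add: Rs_id_hom)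
  then have "sfil wx 0 1 (rr (0, 1))" by (simp add: rr_scalar_fil)
  then have "sfil wx 0 1 (PP (replicate m (0, 1)))"
    by (induction m) (simp_all add: sfil_1 mult Th_fil)
  then have "sfil wx 0 1 (PP w)" unfolding w PP_simps by (intro mult rr_scalar_fil Th_fil)
  then show ?thesis by (rule sfil_sol)
qed

text \<open>The derivative of the trace polynomial is the \<open>sol\<close>-trace of the boundary,
  and its constant term at s^i T^(k/2) is zero: the small chain is excluded by valuation, the scalar
  words by the order in x, and z - t z by cyclic invariance. In characteristic 0 only the
  coefficient of degree 0 then survives.\<close>

theorem homotopy:
  assumes "x \<in> word_chains" "z \<in> word_chains" "\<And>j. j \<in> J \<Longrightarrow> w j \<in> scalar_words"
    and "d_chain x - (\<Sum>j\<in>J. frag_of (w j)) - (z - t_chain z) \<in> small N" "real i + real_of_int k / 2 < N"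
  shows "ct (coeff (bod (lin PP x)) 0) i k = ct (poly (bod (lin PP x)) 1) i k"
proof -
  let ?p = "bod (lin PP x)"
  define y where "y = d_chain x - (\<Sum>j\<in>J. frag_of (w j)) - (z - t_chain z)"
  have "d_chain x = y + (\<Sum>j\<in>J. frag_of (w j)) + (z - t_chain z)" by (simp add: y_def)
  then have "sol (lin PP (d_chain x)) = sol (lin PP y) + (\<Sum>j\<in>J. sol (PP (w j)))"
    by (simp only: lin_add lin_diff lin_sum sol_simps sol_sum lin_PP_t[OF assms(2)] lin_of) simp
  then have pd: "pderiv ?p = sol (lin PP y) + (\<Sum>j\<in>J. sol (PP (w j)))" by (simp only: lin_PP_d[OF assms(1)])
  have "ct (coeff (pderiv ?p) m) i k = 0" for m
  proof -
    have "pfil wval N (sol (lin PP y))" using sfil_sol[OF lin_PP_small[OF assms(4)]] by (simp only: y_def)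
    then have "ct (coeff (sol (lin PP y)) m) i k = 0" using ct_fil_val assms(5) unfolding pfil_def by blast
    moreover have "ct (coeff (sol (PP (w j))) m) i k = 0" if "j \<in> J" for j
      using ct_fil_x PP_scalar[OF assms(3)[OF that]] unfolding pfil_def by blast
    ultimately show ?thesis unfolding pd by (simp add: coeff_sum ct_simps ct_sum)
  qed
  then have 0: "ct (coeff ?p (Suc m)) i k = 0" for m
    unfolding coeff_pderiv ct_of_nat_mult by simp
  have "ct (poly ?p 1) i k = (\<Sum>m\<le>degree ?p. ct (coeff ?p m) i k)" by (simp add: poly_altdef ct_sum)
  also have "\<dots> = ct (coeff ?p 0) i k" by (simp add: sum.atMost_shift 0)
  finally show ?thesis by simp
qed

text \<open>At parameter 1 each letter times \<open>Th\<close> has vanishing first column, so the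
  lower right entries simply multiply. The sign is that of the second diagonal entry in the
  supertrace.\<close>

lemma poly1_bod_PP: "w \<noteq> [] \<Longrightarrow> poly (bod (PP w)) 1 = - prod_list (map (\<lambda>x. rr21 (snd x) * fps_const iq) w)"
proof -
  let ?E = "\<lambda>z. m2map (\<lambda>p. poly p 1) (body z)"
  have E: "?E (z * y) = ?E z * ?E y" for z y :: "L fps poly sm" by (rule m2_eqI) simp_all
  have T: "?E Th = M2 0 (fps_const iq) 0 0" unfolding Th_def sm.sel by (rule m2_eqI) (simp_all add: theta_def fps_const_add)
  have "w \<noteq> [] \<Longrightarrow> \<exists>y. ?E (PP w) = M2 0 y 0 (prod_list (map (\<lambda>x. rr21 (snd x) * fps_const iq) w))"
  proof (induction w)
    case (Cons x w)
    have x: "?E (rr x * Th) = M2 0 (rr11 (snd x) * fps_const iq) 0 (rr21 (snd x) * fps_const iq)"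
      unfolding E T by (rule m2_eqI) (simp_all add: rr_def rho_def)
    show ?case
    proof (cases "w = []")
      case True
      then show ?thesis using x by simp
    next
      case False
      then obtain y where "?E (PP w) = M2 0 y 0 (prod_list (map (\<lambda>x. rr21 (snd x) * fps_const iq) w))"
        using Cons.IH by blast
      then have "?E (PP (x # w)) = M2 0 (rr11 (snd x) * fps_const iq * prod_list (map (\<lambda>x. rr21 (snd x) * fps_const iq) w)) 0
          (rr21 (snd x) * fps_const iq * prod_list (map (\<lambda>x. rr21 (snd x) * fps_const iq) w))"
        unfolding PP_simps E[of "rr x * Th"] x by (intro m2_eqI) simp_all
      then show ?thesis unfolding list.map prod_list.Cons by (rule exI)
    qed
  qed simp
  moreover assume "w \<noteq> []"
  ultimately obtain y where y: "?E (PP w) = M2 0 y 0 (prod_list (map (\<lambda>x. rr21 (snd x) * fps_const iq) w))" by blast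
  have "poly (bod (PP w)) 1 = st (?E (PP w))" by (simp add: bod_def st_def)
  then show ?thesis unfolding y by (simp add: st_def)
qed

text \<open>At parameter 0 \<open>Th\<close> is d_1 D times a factor \<open>Wi\<close>, which will
  be the inverse of d_1 W. The rescaling of the basis is the conjugation in \<open>J\<close> and
  drops out of the supertrace.\<close>

lemma coeff0_bod_PP:
  assumes "al = iota (S_d1 (m12 (mx D))) * tx (- c) 0 * Wi" "be = iota (S_d1 (m21 (mx D))) * tx c 0 * Wi"
  shows "coeff (bod (PP w)) 0
    = fps_map iota (str (foldr (\<lambda>a A. Ends_matrix (snd a) ** d1_D ** A) w (mat 1))) * fps_const (Wi ^ length w)"
proof -
  let ?E = "\<lambda>z. m2map (\<lambda>p. coeff p 0) (body z)"
  let ?G = "foldr (\<lambda>a A. Ends_matrix (snd a) ** d1_D ** A) w (mat 1)"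
  have E: "?E (z * y) = ?E z * ?E y" for z y :: "L fps poly sm" by (rule m2_eqI) (simp_all add: coeff_mult_0)
  define J where "J A = M2 (fps_map iota (m11 A)) (fps_map iota (m12 A) * fps_const (tx (- c) 0))
      (fps_map iota (m21 A) * fps_const (tx c 0)) (fps_map iota (m22 A))" for A
  have h: "fps_map iota (F + G) = fps_map iota F + fps_map iota G" "fps_map iota (F * G) = fps_map iota F * fps_map iota G" for F G
    by (rule fps_ext, simp add: iota_hom iota_sum fps_mult_nth)+
  have ti: "fps_const (tx c 0) * (fps_const (tx (- c) 0) * X) = X" for X
    by (simp only: mult.assoc[symmetric] txc mult_1)
  have J: "J (A * B) = J A * J B" for A B
    by (rule m2_eqI) (simp_all add: J_def h ti algebra_simps)
  have J1: "J 1 = 1"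
    by (intro m2_eqI fps_ext) (simp_all add: J_def iota_hom)
  define sm where "sm r A = m2map ((*) r) A" for r :: "L fps" and A
  have sm: "sm r A * sm r' B = sm (r * r') (A * B)" for r r' A B
    by (rule m2_eqI) (simp_all add: sm_def algebra_simps)
  have rr: "?E (rr x) = J (vec_m2 (Ends_matrix (snd x)))" for x
    by (intro m2_eqI fps_ext) (simp_all add: rr_def rho_def J_def vec_m2_def Ends_matrix_def matrix_of_mx rr11_def rr12_def rr21_def rr22_def)
  have d0: "S_d1 0 = 0"
  proof -
    have "tate_d1 0 = 0" using tate_d1_diff[of 0 0] by simp
    then show ?thesis by (simp add: zero_S.abs_eq S_d1.abs_eq)
  qed
  have c: "fps_map iota (fps_const F) = fps_const (iota F)" for F by (rule fps_ext) (simp add: iota_hom)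
  have c0: "fps_map iota 0 = 0" by (rule fps_ext) (simp add: iota_hom)
  have "m11 (mx D) = 0" "m22 (mx D) = 0" by (simp_all add: mx_D)
  then have Th: "?E Th = sm (fps_const Wi) (J (vec_m2 d1_D))"
    unfolding Th_def unfolding sm.sel theta_def by (intro m2_eqI) (simp_all add: sm_def c0 J_def vec_m2_def d1_D_def matrix_of_mx d0 c iota_hom
        assms fps_const_mult mult.commute del: mult_cancel_left)
  have sm1: "A * sm r B = sm r (A * B)" "sm 1 A = A" for r A B
    by (rule m2_eqI; simp add: sm_def algebra_simps)+
  have sm2: "sm r A * B = sm r (A * B)" "sm r (sm r' A) = sm (r * r') A" for r r' A B
    by (rule m2_eqI; simp add: sm_def algebra_simps)+
  have "?E (PP w) = sm (fps_const Wi ^ length w) (J (vec_m2 ?G))"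
  proof (induction w)
    case Nil
    have "?E (PP []) = 1" by (rule m2_eqI) simp_all
    then show ?case by (simp add: vec_m2_1 J1 sm1)
  next
    case (Cons x w)
    show ?case
      unfolding PP_simps E[of "rr x * Th"] E[of "rr x"] rr Th Cons.IH foldr.simps o_apply vec_m2_mult J sm1 sm
      by (simp add: mult.assoc sm2 fps_const_mult power_commutes)
  qed
  moreover have "coeff (bod (PP w)) 0 = st (?E (PP w))" by (simp add: bod_def st_def)
  ultimately have "coeff (bod (PP w)) 0 = st (sm (fps_const Wi ^ length w) (J (vec_m2 ?G)))"
    by (simp only:)
  also have "\<dots> = fps_const Wi ^ length w * fps_map iota (str ?G)"
  proof -
    have "fps_map iota (F - G) = fps_map iota F - fps_map iota G" for F G
      by (rule fps_ext) (simp add: iota_hom)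
    then show ?thesis by (simp add: st_def sm_def J_def vec_m2_def str_def right_diff_distrib)
  qed
  finally show ?thesis by (simp add: mult.commute fps_const_power)
qed

end


section \<open>Explicit inverses at the outer and the inner end\<close>

definition diag :: "(nat \<Rightarrow> real) \<Rightarrow> L" where
  "diag f = Abs_fls (\<lambda>k. if 0 \<le> k then fls_const (f (nat k)) * fls_X_intpow k else 0)"

lemma diag_nth: "diag f $$ k = (if 0 \<le> k then fls_const (f (nat k)) * fls_X_intpow k else 0)"
  unfolding diag_def by (rule nth_Abs_fls_lower_bound[of 0]) simp

lemma const_X_nth: "(fls_const (a::real) * fls_X_intpow k) $$ n = (if n = k then a else 0)"
  unfolding fls_X_intpow_times_conv_shift(2) by auto

lemma diag_nth2: "diag f $$ k $$ n = (if 0 \<le> k \<and> n = k then f (nat k) else 0)"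
  by (simp add: diag_nth const_X_nth)

lemma tx_diag_nth: "(tx (int j) (int j) * diag f) $$ k $$ n = (if int j \<le> k \<and> n = k then f (nat k - j) else 0)"
proof -
  have "fls_X_intpow (int j) * (fls_const a * fls_X_intpow (k - int j)) = fls_const a * (fls_X_intpow k :: real fls)" for a
    by (simp only: mult.left_commute[of "fls_X_intpow (int j)"] fls_X_intpow_times_fls_X_intpow) simp
  then have "(tx (int j) (int j) * diag f) $$ k = (if int j \<le> k then fls_const (f (nat k - j)) * fls_X_intpow k else 0)"
    unfolding tx_mult_nth diag_nth by (auto simp: nat_diff_distrib)
  then show ?thesis by (simp add: const_X_nth)
qed

lemma fil_diag: "w = wval \<or> w = wx \<Longrightarrow> fil w 0 (fps_const (diag f))"
  unfolding fil_def by (auto simp: diag_nth2 wt_of_def wval_def wx_def split: if_splits)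

text \<open>The coefficient of y^k in (1 + y^2)^(-l); in \<open>diag\<close> the variable is y =
  T^(1/2) x.\<close>

definition binc :: "nat \<Rightarrow> nat \<Rightarrow> real" where
  "binc l k = (if even k then (- real l) gchoose (k div 2) else 0)"

lemma binc_Suc: "binc (Suc l) k + (if 2 \<le> k then binc (Suc l) (k - 2) else 0) = binc l k"
proof (cases "even k")
  case True
  then obtain m where m: "k = 2 * m" by (elim evenE)
  show ?thesis
  proof (cases m)
    case (Suc m')
    have "(- real (Suc l) + 1) gchoose Suc m' = (- real (Suc l) gchoose m') + (- real (Suc l) gchoose Suc m')"
      by (rule gbinomial_Suc_Suc)
    then show ?thesis using Suc m by (simp add: binc_def)
  qed (simp add: m binc_def)
qed (auto simp: binc_def)

lemma diag_binc_Suc: "(1 + tx 2 2) * diag (binc (Suc l)) = diag (binc l)"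
proof (intro fls_eqI)
  fix k n
  have "(tx 2 2 * diag (binc (Suc l))) $$ k $$ n = (if 2 \<le> k \<and> n = k then binc (Suc l) (nat k - 2) else 0)"
    using tx_diag_nth[of 2] by simp
  moreover have "2 \<le> nat k \<longleftrightarrow> 2 \<le> k" by arith
  ultimately show "((1 + tx 2 2) * diag (binc (Suc l))) $$ k $$ n = diag (binc l) $$ k $$ n"
    using binc_Suc[of l "nat k"] by (auto simp: distrib_right diag_nth2)
qed

lemma diag_binc_0: "diag (binc 0) = 1"
  by (intro fls_eqI) (auto simp: diag_nth2 binc_def gbinomial_0_left)

text \<open>\<open>Ai\<close> and \<open>Bi\<close> invert 1 + T x^2 and 1 - T^(1/2) x. Since d_1 W
  = 1 + T/z_1^2, its inverse is \<open>Ai\<close> at the outer end and T x^2 times \<open>Ai\<close>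
  at the inner end.\<close>

definition Ai :: L where "Ai = diag (binc 1)"
definition Bi :: L where "Bi = diag (\<lambda>_. 1)"

lemma Ai: "(1 + tx 2 2) * Ai = 1"
  using diag_binc_Suc[of 0] by (simp add: Ai_def diag_binc_0)

lemma Ai_power: "Ai ^ l = diag (binc l)"
proof (induction l)
  case (Suc l)
  have "Ai ^ Suc l = Ai * ((1 + tx 2 2) * diag (binc (Suc l)))" by (simp add: Suc diag_binc_Suc)
  also have "\<dots> = ((1 + tx 2 2) * Ai) * diag (binc (Suc l))" by (simp only: mult_ac)
  finally show ?case by (simp add: Ai)
qed (simp add: diag_binc_0)

lemma Bi: "(1 - tx 1 1) * Bi = 1"
proof (intro fls_eqI)
  fix k n
  have "(tx 1 1 * Bi) $$ k $$ n = (if 1 \<le> k \<and> n = k then 1 else 0)"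
    using tx_diag_nth[of 1] by (simp add: Bi_def)
  then show "((1 - tx 1 1) * Bi) $$ k $$ n = 1 $$ k $$ n"
    by (auto simp: left_diff_distrib Bi_def diag_nth2)
qed

lemma iota_T_half: "emb T_half = tx 1 0" "emb (inverse T_half) = tx (- 1) 0" "emb (inverse T) = tx (- 2) 0"
proof -
  show "emb T_half = tx 1 0" by (rule emb_T_half)
  show 2: "emb (inverse T_half) = tx (- 1) 0"
    by (intro fls_eqI) (simp add: emb_nth tx_nth inverse_T_half_nth)
  have "inverse T = inverse T_half * inverse T_half" by (simp add: power2_eq_square)
  then show "emb (inverse T) = tx (- 2) 0" by (simp only: emb_hom 2 tx_mult) simp
qed

lemma fil_const_mult: "fil w N (fps_const X) \<Longrightarrow> fil w N' (fps_const Y) \<Longrightarrow> fil w (N + N') (fps_const (X * Y))"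
  using fil_mult[of w N "fps_const X" N' "fps_const Y"] by (simp add: fps_const_mult)

lemma fil_tx_nonneg: "w = wval \<or> w = wx \<Longrightarrow> 0 \<le> k \<Longrightarrow> 0 \<le> n \<Longrightarrow> fil w 0 (fps_const (tx k n))"
  by (rule fil_tx) (auto simp: wval_def wx_def)

lemma fil_tx_x: "fil wx (real_of_int n) (fps_const (tx k n))"
  by (rule fil_tx) (simp add: wx_def)

lemma fil_AB: "w = wval \<or> w = wx \<Longrightarrow> fil w 0 (fps_const Ai)" "w = wval \<or> w = wx \<Longrightarrow> fil w 0 (fps_const Bi)"
  by (simp_all only: Ai_def Bi_def fil_diag)

text \<open>With z_1 = 1/x and z_0 = T x the entries of D are 1/x + T^(1/2) and 1 - T^(1/2) x. The
  inverse of the second one is 1 modulo x.\<close>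

interpretation out: side 2 0 1 0 "tx 1 0 + tx 0 (- 1)" "1 - tx 1 1" Ai "tx 1 2 * Ai" Bi
proof unfold_locales
  show "int 0 = 2 * 0" by simp
  show "outer.iota (m12 (mx D)) * tx (- 0) 0 = tx 1 0 + tx 0 (- 1)"
    by (simp add: mx_D outer.iota_hom outer.iota_gens iota_T_half)
  show "outer.iota (m21 (mx D)) * tx 0 0 = 1 - tx 1 1"
    by (simp add: mx_D outer.iota_hom outer.iota_gens iota_T_half tx_mult)
  have "Ai * (1 - tx 1 1) + (tx 1 0 + tx 0 (- 1)) * (tx 1 2 * Ai)
     = (1 - tx 1 1 + (tx 1 0 + tx 0 (- 1)) * tx 1 2) * Ai" by (simp only: distrib_left mult_ac)
  also have "1 - tx 1 1 + (tx 1 0 + tx 0 (- 1)) * tx 1 2 = 1 + tx 2 2" by (simp add: distrib_right tx_mult)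
  finally show "Ai * (1 - tx 1 1) + (tx 1 0 + tx 0 (- 1)) * (tx 1 2 * Ai) = 1" by (simp add: Ai)
  show "(1 - tx 1 1) * Bi = 1" by (rule Bi)
  show "fil w 0 (fps_const Ai)" "fil w 0 (fps_const Bi)" if "w = wval \<or> w = wx" for w
    using fil_AB that by blast+
  show "fil w 0 (fps_const (tx 1 2 * Ai))" if "w = wval \<or> w = wx" for w
    using fil_const_mult[OF fil_tx_nonneg[OF that] fil_AB(1)[OF that]] by simp
  have "fil wx (1 + 1 + 0 + 0) (fps_const (tx 1 2 * Ai * Bi))"
    using fil_tx_x[of 2 1] by (intro fil_const_mult fil_AB) simp_all
  then show "fil wx 1 (fps_const (tx 1 2 * Ai * Bi))" by (rule fil_mono) simp
qed

text \<open>With z_0 = 1/x, z_1 = T x and e_1 rescaled by T^(-1/2), the lower left entry of D is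
  T^(1/2) - 1/x. Its inverse is divisible by x, and for this reason the inner end will contribute
  nothing at parameter 1.\<close>

interpretation inn: side 0 2 "- 1" 1 "tx 1 1 + 1" "tx 1 0 - tx 0 (- 1)" "tx 1 2 * Ai" Ai "- (tx 0 1 * Bi)"
proof unfold_locales
  show "int 2 = 2 * 1" by simp
  show "inner.iota (m12 (mx D)) * tx (- 1) 0 = tx 1 1 + 1"
    by (simp add: mx_D inner.iota_hom inner.iota_gens iota_T_half distrib_right tx_mult)
  show "inner.iota (m21 (mx D)) * tx 1 0 = tx 1 0 - tx 0 (- 1)"
    by (simp add: mx_D inner.iota_hom inner.iota_gens iota_T_half left_diff_distrib tx_mult)
  have "tx 1 2 * Ai * (tx 1 0 - tx 0 (- 1)) + (tx 1 1 + 1) * Ai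
     = ((tx 1 0 - tx 0 (- 1)) * tx 1 2 + (tx 1 1 + 1)) * Ai" by (simp only: distrib_left mult_ac)
  also have "(tx 1 0 - tx 0 (- 1)) * tx 1 2 + (tx 1 1 + 1) = 1 + tx 2 2" by (simp add: left_diff_distrib tx_mult)
  finally show "tx 1 2 * Ai * (tx 1 0 - tx 0 (- 1)) + (tx 1 1 + 1) * Ai = 1" by (simp add: Ai)
  have "(tx 1 0 - tx 0 (- 1)) * - (tx 0 1 * Bi) = - ((tx 1 0 - tx 0 (- 1)) * tx 0 1) * Bi" by (simp only: mult_minus_left mult_minus_right mult.assoc)
  also have "- ((tx 1 0 - tx 0 (- 1)) * tx 0 1) = 1 - tx 1 1" by (simp add: left_diff_distrib tx_mult)
  finally show "(tx 1 0 - tx 0 (- 1)) * - (tx 0 1 * Bi) = 1" by (simp only: Bi)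
  show "fil w 0 (fps_const (tx 1 2 * Ai))" "fil w 0 (fps_const Ai)" if "w = wval \<or> w = wx" for w
    using fil_const_mult[OF fil_tx_nonneg[OF that] fil_AB(1)[OF that]] fil_AB(1)[OF that] by simp_all
  show "fil w 0 (fps_const (- (tx 0 1 * Bi)))" if "w = wval \<or> w = wx" for w
    using fil_uminus[OF fil_const_mult[OF fil_tx_nonneg[OF that, of 0 1] fil_AB(2)[OF that]]] by simp
  have "fil wx (0 + (1 + 0)) (fps_const (Ai * (tx 0 1 * Bi)))"
    using fil_tx_x[of 1 0] by (intro fil_const_mult fil_AB) simp_all
  then show "fil wx 1 (fps_const (Ai * - (tx 0 1 * Bi)))" using fil_uminus by fastforce
qed

lemma tate_coeff_d1_gens:
  "S_d1 (F + G) = S_d1 F + S_d1 G" "S_d1 (F - G) = S_d1 F - S_d1 G" "S_d1 (- F) = - S_d1 F"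
  "S_d1 (F * G) = F * S_d1 G + S_d1 F * G"
  "S_d1 (S_const r) = 0" "S_d1 1 = 0" "S_d1 z1 = 1" "S_d1 z0 = - (S_const (inverse T) * z0 * z0)"
proof -
  show diff: "S_d1 (F - G) = S_d1 F - S_d1 G" for F G
    using abs_rep_S[of F] abs_rep_S[of G] tate_d1_diff by (metis S_d1.abs_eq minus_S.abs_eq)
  have 0: "S_d1 0 = 0" using diff[of 0 0] by simp
  show u: "S_d1 (- F) = - S_d1 F" for F using diff[of 0 F] by (simp add: 0)
  show "S_d1 (F + G) = S_d1 F + S_d1 G" using diff[of F "- G"] by (simp add: u)
  show "S_d1 (F * G) = F * S_d1 G + S_d1 F * G"
    using abs_rep_S[of F] abs_rep_S[of G] tate_d1_mult by (metis S_d1.abs_eq times_S.abs_eq plus_S.abs_eq)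
  show c: "S_d1 (S_const r) = 0" for r
    by (simp add: S_const.abs_eq S_d1.abs_eq tate_d1_def tate_deriv_gens zero_S.abs_eq)
  show "S_d1 1 = 0" using c[of 1] by (simp add: S_const_hom)
  show "S_d1 z1 = 1" by (simp add: z1.abs_eq S_d1.abs_eq tate_d1_def tate_deriv_gens one_S.abs_eq)
  show "S_d1 z0 = - (S_const (inverse T) * z0 * z0)"
    by (simp add: z0.abs_eq S_const.abs_eq S_d1.abs_eq tate_d1_def tate_deriv_gens uminus_S.abs_eq times_S.abs_eq power2_eq_square mult.assoc)
qed

lemmas S_d1_simps = tate_coeff_d1_gens

lemma S_d1_D: "S_d1 (m12 (mx D)) = 1" "S_d1 (m21 (mx D)) = S_const (inverse T_half) * S_const (inverse T) * z0 * z0"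
  by (simp_all add: mx_D S_d1_simps mult.assoc)

lemma coeff0_out: "coeff (bod (out.PP w)) 0
    = fps_map outer.iota (str (foldr (\<lambda>a A. Ends_matrix (snd a) ** d1_D ** A) w (mat 1))) * fps_const (Ai ^ length w)"
  by (rule out.coeff0_bod_PP) (simp_all add: S_d1_D outer.iota_hom outer.iota_gens iota_T_half tx_mult)

lemma coeff0_inn: "coeff (bod (inn.PP w)) 0
    = fps_map inner.iota (str (foldr (\<lambda>a A. Ends_matrix (snd a) ** d1_D ** A) w (mat 1))) * fps_const ((tx 2 2 * Ai) ^ length w)"
  by (rule inn.coeff0_bod_PP)
    (simp_all add: S_d1_D inner.iota_hom inner.iota_gens iota_T_half tx_mult mult.assoc[symmetric])


section \<open>Residues at the critical points as a difference of constant terms\<close>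

section \<open>Residues\<close>

type_synonym C = "complex fls"

lemma complexify_nth: "complexify r $$ n = complex_of_real (r $$ n)"
proof -
  have "complexify r = fls_map complex_of_real r" by (simp add: complexify_def fls_map_def)
  then show ?thesis by (simp add: fls_map_nth)
qed

lemma complexify_mult: "complexify (r * r') = complexify r * complexify r'"
  using fls_map_mult[of complex_of_real r r'] by (simp add: complexify_def fls_map_def)

lemma complexify_inject: "complexify r = complexify r' \<longleftrightarrow> r = r'"
  by (simp add: fls_eq_iff complexify_nth)

text \<open>In the metric of formal Laurent series a family is summable as soon as only finitely
  many members are visible below each order. This evaluates the \<open>infsum\<close> in
  \<open>S_expand\<close> coefficientwise.\<close>

lemma fls_has_sum:
  fixes g :: "'i \<Rightarrow> 'a::ab_group_add fls"
  assumes fin: "\<And>k. finite {i. \<exists>k'\<le>k. g i $$ k' \<noteq> 0}"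
    and s: "\<And>k Z. finite Z \<Longrightarrow> {i. g i $$ k \<noteq> 0} \<subseteq> Z \<Longrightarrow> s $$ k = (\<Sum>i\<in>Z. g i $$ k)"
  shows "(g has_sum s) UNIV"
  unfolding has_sum_def tendsto_iff
proof (intro allI impI)
  fix r :: real assume "0 < r"
  then obtain n :: nat where n: "inverse (2 ^ n) < r"
    using real_arch_pow_inv[of r "1 / 2"] by (auto simp: power_one_over inverse_eq_divide)
  let ?F0 = "{i. \<exists>k'\<le>int n. g i $$ k' \<noteq> 0}"
  have "dist (sum g Z) s < r" if Z: "finite Z" "?F0 \<subseteq> Z" for Z
  proof (cases "sum g Z = s")
    case True
    then show ?thesis using \<open>0 < r\<close> by simp
  next
    case False
    have "(sum g Z - s) $$ k = 0" if "k < int n" for k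
    proof -
      have "{i. g i $$ k \<noteq> 0} \<subseteq> ?F0" using that by (intro Collect_mono impI exI[of _ k]) simp
      then have "{i. g i $$ k \<noteq> 0} \<subseteq> Z" using Z(2) by (rule order_trans)
      then show ?thesis using s[OF Z(1)] by (simp add: fls_nth_sum)
    qed
    then have sub: "int n \<le> fls_subdegree (sum g Z - s)" using False by (intro fls_subdegree_geI) auto
    then have "dist (sum g Z) s = inverse (2 ^ nat (fls_subdegree (sum g Z - s)))" using False by (simp add: dist_fls_def)
    also have "\<dots> \<le> inverse (2 ^ n)" using sub by (intro le_imp_inverse_le power_increasing) auto
    finally show ?thesis using n by simp
  qed
  then show "\<forall>\<^sub>F Z in finite_subsets_at_top UNIV. dist (sum g Z) s < r"
    unfolding eventually_finite_subsets_at_top using fin[of "int n"] by blast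
qed

lemma fls_infsum_nth:
  fixes g :: "'i \<Rightarrow> 'a::ab_group_add fls"
  assumes fin: "\<And>k. finite {i. \<exists>k'\<le>k. g i $$ k' \<noteq> 0}" and low: "\<And>i k. k < B \<Longrightarrow> g i $$ k = 0"
    and Z: "finite Z" "{i. g i $$ k \<noteq> 0} \<subseteq> Z"
  shows "infsum g UNIV $$ k = (\<Sum>i\<in>Z. g i $$ k)"
proof -
  define s where "s = Abs_fls (\<lambda>k. \<Sum>i\<in>{i. g i $$ k \<noteq> 0}. g i $$ k)"
  have sk: "s $$ k = (\<Sum>i\<in>{i. g i $$ k \<noteq> 0}. g i $$ k)" for k
    unfolding s_def by (rule nth_Abs_fls_lower_bound[of B]) (simp add: low)
  have s: "s $$ k = (\<Sum>i\<in>Z. g i $$ k)" if "finite Z" "{i. g i $$ k \<noteq> 0} \<subseteq> Z" for k Z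
    unfolding sk by (rule sum.mono_neutral_left) (use that in auto)
  have "infsum g UNIV = s" by (rule infsumI, rule fls_has_sum[OF fin s])
  then show ?thesis using s[OF Z] by simp
qed

text \<open>The expansion of $z_1^n$ at $z_1 = x + w$.\<close>

definition zpow :: "C \<Rightarrow> int \<Rightarrow> C fps" where
  "zpow x n = Abs_fps (\<lambda>m. fls_const (complex_of_int n gchoose m) * x powi (n - int m))"

definition zz :: "C \<Rightarrow> C fls" where "zz x = fls_const x + fls_X"

lemma zpow_0: "zpow x 0 = 1"
  by (rule fps_ext) (simp add: zpow_def gbinomial_0_left)

lemma fps_to_fls_X: "fps_to_fls (fps_const x + fps_X) = zz x"
  by (simp add: zz_def fls_plus_const fps_to_fls_plus)

lemma zpow_Suc: "x \<noteq> 0 \<Longrightarrow> zpow x (n + 1) = (fps_const x + fps_X) * zpow x n"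
proof (rule fps_ext)
  fix m assume x: "x \<noteq> 0"
  have p: "x powi (k + 1) = x * x powi k" for k using power_int_add_1'[of x k] x by blast
  show "fps_nth (zpow x (n + 1)) m = fps_nth ((fps_const x + fps_X) * zpow x n) m"
  proof (cases m)
    case 0
    then show ?thesis by (simp add: zpow_def distrib_right p)
  next
    case (Suc k)
    have "(complex_of_int n + 1) gchoose Suc k = (complex_of_int n gchoose k) + (complex_of_int n gchoose Suc k)"
      by (rule gbinomial_Suc_Suc)
    moreover have "x powi (n - int k) = x * x powi (n - int (Suc k))" using p[of "n - int (Suc k)"] by simp
    moreover have "x powi (n + 1 - int (Suc k)) = x * x powi (n - int (Suc k))"
      using p[of "n - int (Suc k)"] by (simp add: algebra_simps)
    ultimately show ?thesis
      unfolding Suc zpow_def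
      by (simp add: distrib_right distrib_left fls_plus_const[symmetric] mult_ac del: of_nat_Suc fls_plus_const)
  qed
qed

lemma zz_nonzero: "zz x \<noteq> 0"
proof
  assume "zz x = 0"
  then have "zz x $$ 1 = 0 $$ 1" by simp
  then show False by (simp add: zz_def)
qed

lemma fps_to_fls_zpow_Suc: "x \<noteq> 0 \<Longrightarrow> fps_to_fls (zpow x (n + 1)) = zz x * fps_to_fls (zpow x n)"
  by (subst zpow_Suc, assumption) (simp only: fls_times_fps_to_fls fps_to_fls_X)

lemma zz_powi_Suc: "zz x powi (n + 1) = zz x * zz x powi n"
  using power_int_add_1'[of "zz x" n] zz_nonzero by blast

lemma fps_to_fls_zpow:
  assumes x: "x \<noteq> 0"
  shows "fps_to_fls (zpow x n) = zz x powi n"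
proof (induction n rule: int_induct[of _ 0])
  case base
  show ?case by (simp add: zpow_0)
next
  case (step1 i)
  then show ?case by (simp only: fps_to_fls_zpow_Suc[OF x] zz_powi_Suc)
next
  case (step2 i)
  have "zz x * fps_to_fls (zpow x (i - 1)) = zz x powi i"
    using fps_to_fls_zpow_Suc[OF x, of "i - 1"] step2 by simp
  moreover have "zz x * zz x powi (i - 1) = zz x powi i" using zz_powi_Suc[of x "i - 1"] by simp
  ultimately have "zz x * fps_to_fls (zpow x (i - 1)) = zz x * zz x powi (i - 1)" by (simp only:)
  then show ?case using zz_nonzero by (simp only: mult_cancel_left) blast
qed

text \<open>The residue at z_1 = x of z_1^n (d_1 W)^(-l) dz_1/z_1, where d_1 W = 1 + T z_1^(-2) and
  T is the square of the series variable.\<close>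

definition rhor :: "C \<Rightarrow> nat \<Rightarrow> int \<Rightarrow> C" where
  "rhor x l n = fls_residue (zz x powi (n - 1) * inverse (1 + fls_const (fls_X\<^sup>2) * zz x powi (- 2)) ^ l)"

lemma fls_deriv_zz_powi: "fls_deriv (zz x powi n) = of_int n * zz x powi (n - 1)"
proof (induction n rule: int_induct[of _ 0])
  have d: "fls_deriv (zz x) = 1" by (simp add: zz_def)
  have p: "zz x powi (k + 1) = zz x * zz x powi k" for k using power_int_add_1'[of "zz x" k] zz_nonzero by blast
  {
    case base
    show ?case by simp
  next
    case (step1 i)
    have "fls_deriv (zz x powi (i + 1)) = zz x * (of_int i * zz x powi (i - 1)) + zz x powi i"
      unfolding p by (simp add: d step1)
    also have "zz x * (of_int i * zz x powi (i - 1)) = of_int i * zz x powi i"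
      using p[of "i - 1"] by (simp add: mult.left_commute)
    finally show ?case by (simp add: algebra_simps)
  next
    case (step2 i)
    have "of_int i * zz x powi (i - 1) = fls_deriv (zz x * zz x powi (i - 1))"
      using p[of "i - 1"] step2 by simp
    then have "zz x * fls_deriv (zz x powi (i - 1)) = of_int i * zz x powi (i - 1) - zz x powi (i - 1)"
      by (simp add: d algebra_simps)
    also have "\<dots> = zz x * (of_int (i - 1) * zz x powi (i - 1 - 1))"
      using p[of "i - 1 - 1"] by (simp add: algebra_simps)
    finally show ?case using zz_nonzero by (simp only: mult_cancel_left) blast
  }
qed

definition Vi :: "C \<Rightarrow> C fls" where "Vi x = inverse (1 + fls_const (fls_X\<^sup>2) * zz x powi (- 2))"

lemma rhor_Vi: "rhor x l n = fls_residue (zz x powi (n - 1) * Vi x ^ l)"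
  by (simp add: rhor_def Vi_def)

text \<open>Because x^2 = -T, in the local coordinate w = z_1 - x one has z_1^2 + T = w (2 x + w), a
  simple zero at w = 0.\<close>

lemma V_factor:
  assumes "x\<^sup>2 = - (fls_X\<^sup>2)"
  shows "1 + fls_const (fls_X\<^sup>2) * zz x powi (- 2) = fls_X * (fls_const (2 * x) + fls_X) * zz x powi (- 2)"
proof -
  have 2: "zz x * zz x * zz x powi (- 2) = 1"
    using zz_powi_Suc[of x "- 2"] zz_powi_Suc[of x "- 1"] by (simp add: mult.assoc)
  have x: "fls_const (fls_X\<^sup>2) = - (fls_const x * fls_const x)"
    using assms by (simp add: power2_eq_square fls_const_mult_const)
  have "zz x * zz x + fls_const (fls_X\<^sup>2) = fls_X * (fls_const (2 * x) + fls_X)"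
    unfolding x zz_def by (simp add: algebra_simps fls_const_mult_const[symmetric] del: fls_const_mult_const)
  then have "fls_X * (fls_const (2 * x) + fls_X) * zz x powi (- 2)
    = zz x * zz x * zz x powi (- 2) + fls_const (fls_X\<^sup>2) * zz x powi (- 2)"
    by (simp only: distrib_right[symmetric])
  then show ?thesis by (simp only: 2)
qed

lemma V_nonzero:
  assumes "x\<^sup>2 = - (fls_X\<^sup>2)"
  shows "1 + fls_const (fls_X\<^sup>2) * zz x powi (- 2) \<noteq> 0"
proof -
  have "(fls_const (2 * x) + fls_X) $$ 1 = 1" by simp
  then have "fls_const (2 * x) + fls_X \<noteq> 0" by force
  then show ?thesis unfolding V_factor[OF assms] using zz_nonzero by simp
qed

lemma deriv_Vi_power:
  assumes "x\<^sup>2 = - (fls_X\<^sup>2)"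
  shows "fls_deriv (Vi x ^ l) = of_nat l * Vi x ^ Suc l * (2 * fls_const (fls_X\<^sup>2) * zz x powi (- 3))"
proof -
  let ?V = "1 + fls_const (fls_X\<^sup>2) * zz x powi (- 2)"
  let ?k = "2 * fls_const (fls_X\<^sup>2) * zz x powi (- 3)"
  have UV: "Vi x * ?V = 1" unfolding Vi_def using V_nonzero[OF assms] by simp
  have dV: "fls_deriv ?V = - ?k" by (simp add: fls_deriv_zz_powi)
  have "fls_deriv (Vi x * ?V) = 0" unfolding UV by simp
  then have "fls_deriv (Vi x) * ?V = Vi x * ?k" unfolding fls_deriv_mult dV by (simp add: add_eq_0_iff)
  then have "Vi x * (fls_deriv (Vi x) * ?V) = Vi x * (Vi x * ?k)" by simp
  moreover have "Vi x * (fls_deriv (Vi x) * ?V) = fls_deriv (Vi x) * (Vi x * ?V)" by (simp only: mult_ac)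
  ultimately have dU: "fls_deriv (Vi x) = Vi x * (Vi x * ?k)" by (simp only: UV mult_1_right)
  show ?thesis
  proof (induction l)
    case (Suc l)
    have "fls_deriv (Vi x ^ Suc l) = Vi x * (of_nat l * Vi x ^ Suc l * ?k) + (Vi x * (Vi x * ?k)) * Vi x ^ l"
      by (simp only: power_Suc[of _ l] fls_deriv_mult Suc dU)
    also have "\<dots> = of_nat (Suc l) * Vi x ^ Suc (Suc l) * ?k" by (simp add: algebra_simps)
    finally show ?case .
  qed simp
qed

text \<open>The residue of the derivative of z_1^n (d_1 W)^(-l) vanishes, and this relation trades
  pole order l + 1 for l.\<close>

lemma rhor_rec:
  assumes "x\<^sup>2 = - (fls_X\<^sup>2)"
  shows "of_int n * rhor x l n + 2 * of_nat l * fls_X\<^sup>2 * rhor x (Suc l) (n - 2) = 0"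
proof -
  have p: "zz x powi n * zz x powi (- 3) = zz x powi (n - 2 - 1)"
    using power_int_add[of "zz x" n "- 3"] zz_nonzero by simp
  have "fls_deriv (zz x powi n * Vi x ^ l) = of_int n * (zz x powi (n - 1) * Vi x ^ l)
      + fls_const (2 * of_nat l * fls_X\<^sup>2) * ((zz x powi n * zz x powi (- 3)) * Vi x ^ Suc l)"
    by (simp add: fls_deriv_zz_powi deriv_Vi_power[OF assms] fls_const_mult_const[symmetric] fls_of_nat[symmetric] algebra_simps
        del: fls_const_mult_const)
  then have "0 = fls_residue (of_int n * (zz x powi (n - 1) * Vi x ^ l)
      + fls_const (2 * of_nat l * fls_X\<^sup>2) * (zz x powi (n - 2 - 1) * Vi x ^ Suc l))"
    unfolding p by (metis fls_residue_deriv)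
  then show ?thesis
    unfolding fls_residue_add fls_residue_of_int_times fls_residue_fls_const_times rhor_Vi by simp
qed

text \<open>For l = 1 the pole is simple: the integrand is z_1^(n+1) / (w (2 x + w)), with residue
  x^(n+1) / (2 x).\<close>

lemma rhor_1:
  assumes "x\<^sup>2 = - (fls_X\<^sup>2)" "x \<noteq> 0"
  shows "2 * rhor x 1 n = x powi n"
proof -
  let ?y = "fls_const (2 * x) + fls_X"
  let ?g = "zpow x (n + 1) * inverse (fps_const (2 * x) + fps_X)"
  have x2: "2 * x \<noteq> 0" using assms(2) by simp
  have inv: "(fps_const (2 * x) + fps_X) * inverse (fps_const (2 * x) + fps_X) = 1"
    using x2 by (intro inverse_mult_eq_1') simp
  have y: "fps_to_fls (fps_const (2 * x) + fps_X) = ?y" using fps_to_fls_X[of "2 * x"] by (simp only: zz_def)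
  have "?y * fps_to_fls (inverse (fps_const (2 * x) + fps_X)) = 1"
    unfolding y[symmetric] fls_times_fps_to_fls[symmetric] inv by simp
  then have iy: "inverse ?y = fps_to_fls (inverse (fps_const (2 * x) + fps_X))" by (rule inverse_unique)
  have p: "zz x powi (n - 1) * inverse (zz x powi (- 2)) = zz x powi (n + 1)"
    using power_int_add[of "zz x" "n - 1" 2] zz_nonzero by (simp add: power_int_minus add.commute)
  have "zz x powi (n - 1) * Vi x ^ 1 = fls_X_inv * ((zz x powi (n - 1) * inverse (zz x powi (- 2))) * inverse ?y)"
    unfolding Vi_def V_factor[OF assms(1)] by (simp add: fls_inverse_X mult_ac)
  also have "\<dots> = fls_X_inv * fps_to_fls ?g"
    unfolding p unfolding iy fps_to_fls_zpow[OF assms(2), symmetric] fls_times_fps_to_fls ..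
  finally have "rhor x 1 n = fps_nth ?g 0"
    by (simp only: rhor_Vi) (simp add: fls_X_inv_times_conv_shift)
  also have "\<dots> = x powi (n + 1) * inverse (2 * x)" by (simp add: zpow_def)
  also have "x powi (n + 1) = x powi n * x" using power_int_add_1[of x n] assms(2) by blast
  finally have "2 * rhor x 1 n = x powi n * ((2 * x) * inverse (2 * x))" by (simp only: mult_ac)
  then show ?thesis unfolding right_inverse[OF x2] by simp
qed


text \<open>The difference, outer minus inner, of the constant terms of z_1^n (1 + T z_1^(-2))^(-l),
  up to the factor T^(n/2). For l \<ge> 1 the outer expansion has one only if n \<ge> 0 and the
  inner one only if n \<le> -2 l.\<close>

definition kap :: "nat \<Rightarrow> int \<Rightarrow> real" where
  "kap l n = (if 0 \<le> n then binc l (nat n) else if n + 2 * int l \<le> 0 then - binc l (nat (- n - 2 * int l)) else 0)"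

definition xa :: "complex \<Rightarrow> C" where "xa a = fls_const a * fls_X"

lemma xa_powi: "xa a powi n = fls_const (a powi n) * fls_X_intpow n" if "a \<noteq> 0"
  by (simp add: xa_def power_int_mult_distrib fls_const_power_int)

lemma xa_props: "a\<^sup>2 = - 1 \<Longrightarrow> (xa a)\<^sup>2 = - (fls_X\<^sup>2)" "a\<^sup>2 = - 1 \<Longrightarrow> xa a \<noteq> 0"
proof -
  assume a: "a\<^sup>2 = - 1"
  have "fls_const a ^ 2 = fls_const (a\<^sup>2)" by (simp add: fls_const_power)
  also have "\<dots> = - 1" by (simp add: a)
  finally show "(xa a)\<^sup>2 = - (fls_X\<^sup>2)" by (simp add: xa_def power_mult_distrib)
  have "a \<noteq> 0" using a by auto
  then show "xa a \<noteq> 0" by (simp add: xa_def)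
qed

lemma crit_sum: "(\<Sum>x\<in>crit_points. F x) = F (xa \<i>) + F (xa (- \<i>))"
proof -
  have m: "- fls_const \<i> * fls_X = xa (- \<i>)" by (simp add: xa_def)
  have "xa \<i> $$ 1 \<noteq> xa (- \<i>) $$ 1" by (simp add: xa_def complex_eq_iff)
  then have "xa \<i> \<noteq> xa (- \<i>)" by metis
  then show ?thesis unfolding crit_points_def m by (simp add: xa_def[symmetric])
qed

lemma binc_1: "binc 1 (2 * m) = (- 1) ^ m"
proof -
  have "real (m choose m) = real m gchoose m" by (rule binomial_gbinomial)
  then show ?thesis using gbinomial_minus[of "1::real" m] by (simp add: binc_def)
qed

lemma binc_rec1: "k \<ge> 2 \<Longrightarrow> 2 * real l * binc (Suc l) (k - 2) = - real k * binc l k"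
proof (cases "even k")
  case True
  assume "k \<ge> 2"
  with True obtain m where k: "k = 2 * Suc m" by (metis Suc_pred dvd_mult_div_cancel gr0I mult_0_right not_numeral_le_zero)
  define G where "G = (- real l - 1) gchoose m"
  define H where "H = (- real l) gchoose Suc m"
  have GH: "real (Suc m) * H = - real l * G" unfolding G_def H_def by (rule gbinomial_absorption)
  have c: "- real (Suc l) = - real l - 1" by simp
  have "binc (Suc l) (k - 2) = G" unfolding binc_def G_def c k by simp
  moreover have "binc l k = H" unfolding binc_def H_def k by simp
  ultimately show ?thesis using GH by (simp add: k algebra_simps)
qed (auto simp: binc_def)

lemma binc_rec2: "2 * real l * binc (Suc l) k = (real k + 2 * real l) * binc l k"
proof (cases "even k")
  case True
  then obtain m where k: "k = 2 * m" by (elim evenE)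
  define G where "G = (- real l - 1) gchoose m"
  define H where "H = (- real l) gchoose m"
  have GH: "(- real l - real m) * H = - real l * G" unfolding G_def H_def by (rule gbinomial_absorb_comp)
  have c: "- real (Suc l) = - real l - 1" by simp
  have "binc (Suc l) k = G" unfolding binc_def G_def c k by simp
  moreover have "binc l k = H" unfolding binc_def H_def k by simp
  ultimately show ?thesis using GH by (simp add: k algebra_simps)
qed (auto simp: binc_def)

lemma kap_rec: "l \<ge> 1 \<Longrightarrow> 2 * real l * kap (Suc l) (n - 2) = - real_of_int n * kap l n"
proof -
  assume l: "l \<ge> 1"
  consider "n \<ge> 2" | "n = 0" | "n = 1" | "n < 0" "n + 2 * int l \<le> 0" | "n < 0" "n + 2 * int l > 0" by linarith
  then show ?thesis
  proof cases
    case 1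
    then have "nat (n - 2) = nat n - 2" by simp
    then show ?thesis using 1 binc_rec1[of "nat n" l] by (simp add: kap_def)
  next
    case 4
    then have e: "nat (- (n - 2) - 2 * int (Suc l)) = nat (- n - 2 * int l)" by simp
    have "real (nat (- n - 2 * int l)) = - real_of_int n - 2 * real l" using 4 by simp
    then show ?thesis using 4 binc_rec2[of l "nat (- n - 2 * int l)"] unfolding kap_def e by (simp add: algebra_simps)
  qed (use l in \<open>auto simp: kap_def binc_def\<close>)
qed

text \<open>Induction on l: residues and \<open>kap\<close> obey the same recursion, by
  \<open>rhor_rec\<close> and \<open>kap_rec\<close>, and the factor 2 l T can be cancelled. For l =
  1 half the sum of the n-th powers of i and -i is compared with the coefficients of a geometric
  series.\<close>

lemma sum_rhor:
  assumes "l \<ge> 1"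
  shows "rhor (xa \<i>) l n + rhor (xa (- \<i>)) l n = fls_const (complex_of_real (kap l n)) * fls_X_intpow n"
  using assms
proof (induction l arbitrary: n rule: dec_induct)
  case base
  have "2 * (rhor (xa \<i>) 1 n + rhor (xa (- \<i>)) 1 n) = xa \<i> powi n + xa (- \<i>) powi n"
    by (simp only: distrib_left rhor_1[OF xa_props[OF power2_i]] rhor_1[OF xa_props[of "- \<i>"]] power2_i power2_minus)
  also have "\<dots> = fls_const (\<i> powi n + (- \<i>) powi n) * fls_X_intpow n"
    by (simp add: xa_powi distrib_right fls_plus_const[symmetric] del: fls_plus_const)
  also have "\<i> powi n + (- \<i>) powi n = 2 * complex_of_real (kap 1 n)"
  proof (cases "even n")
    case True
    then obtain m where m: "n = 2 * m" by (elim evenE)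
    have "\<i> powi n = (\<i> powi 2) powi m" by (simp only: m power_int_mult)
    then have 1: "\<i> powi n = (- 1) powi m" by simp
    have "kap 1 n = (- 1) powi m"
    proof (cases "0 \<le> m")
      case True
      then have "nat n = 2 * nat m" by (simp add: m)
      then show ?thesis using True by (simp add: kap_def m binc_1[unfolded One_nat_def] power_int_def)
    next
      case False
      then have "nat (- n - 2 * int 1) = 2 * nat (- m - 1)" by (simp add: m)
      moreover have "nat (- m) = Suc (nat (- m - 1))" using False by simp
      ultimately show ?thesis using False by (simp add: kap_def m binc_1[unfolded One_nat_def] power_int_def power_inverse)
    qed
    moreover have "(- \<i>) powi n = \<i> powi n" using True by (rule power_int_minus_left_even)
    moreover have "complex_of_real ((- 1) powi m) = (- 1) powi m" by (simp add: of_real_power_int)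
    ultimately show ?thesis by (simp add: 1)
  next
    case False
    then have "(- \<i>) powi n = - (\<i> powi n)" by (rule power_int_minus_left_odd)
    moreover have "kap 1 n = 0" using False by (auto simp: kap_def binc_def even_nat_iff)
    ultimately show ?thesis by simp
  qed
  finally have "2 * (rhor (xa \<i>) 1 n + rhor (xa (- \<i>)) 1 n) = 2 * (fls_const (complex_of_real (kap 1 n)) * fls_X_intpow n)"
    by (simp only: fls_const_mult_const[symmetric]) (simp add: mult.assoc)
  moreover have "(2 :: C) \<noteq> 0" by simp
  ultimately show ?case by (simp only: mult_cancel_left simp_thms)
next
  case (step l)
  define s where "s = rhor (xa \<i>) (Suc l) n + rhor (xa (- \<i>)) (Suc l) n"
  have "of_int (n + 2) * (rhor (xa \<i>) l (n + 2) + rhor (xa (- \<i>)) l (n + 2)) + 2 * of_nat l * fls_X\<^sup>2 * s = 0"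
  proof -
    have n: "n + 2 - 2 = n" by simp
    have e: "of_int (n + 2) * rhor (xa \<i>) l (n + 2) + 2 * of_nat l * fls_X\<^sup>2 * rhor (xa \<i>) (Suc l) n = 0"
      "of_int (n + 2) * rhor (xa (- \<i>)) l (n + 2) + 2 * of_nat l * fls_X\<^sup>2 * rhor (xa (- \<i>)) (Suc l) n = 0"
      using rhor_rec[OF xa_props(1)[OF power2_i], of "n + 2" l] rhor_rec[OF xa_props(1), of "- \<i>" "n + 2" l]
      unfolding n by simp_all
    have "of_int (n + 2) * (rhor (xa \<i>) l (n + 2) + rhor (xa (- \<i>)) l (n + 2)) + 2 * of_nat l * fls_X\<^sup>2 * s
      = (of_int (n + 2) * rhor (xa \<i>) l (n + 2) + 2 * of_nat l * fls_X\<^sup>2 * rhor (xa \<i>) (Suc l) n)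
      + (of_int (n + 2) * rhor (xa (- \<i>)) l (n + 2) + 2 * of_nat l * fls_X\<^sup>2 * rhor (xa (- \<i>)) (Suc l) n)"
      unfolding s_def by (simp only: distrib_left add_ac)
    then show ?thesis unfolding e by simp
  qed
  then have 1: "2 * of_nat l * fls_X\<^sup>2 * s = - (of_int (n + 2) * (fls_const (complex_of_real (kap l (n + 2))) * fls_X_intpow (n + 2)))"
    unfolding step.IH by (simp add: add_eq_0_iff)
  have X: "fls_X_intpow (n + 2) = fls_X\<^sup>2 * (fls_X_intpow n :: C)"
    by (simp only: fls_X_power_conv_shift_1 fls_X_intpow_times_fls_X_intpow of_nat_numeral add.commute[of n])
  have "2 * real l * kap (Suc l) n = - real_of_int (n + 2) * kap l (n + 2)"
    using kap_rec[OF step.hyps(1), of "n + 2"] by simp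
  then have "complex_of_real (2 * real l * kap (Suc l) n) = complex_of_real (- real_of_int (n + 2) * kap l (n + 2))" by (simp only:)
  then have "of_nat l * 2 * complex_of_real (kap (Suc l) n) = - (of_int (n + 2) * complex_of_real (kap l (n + 2)))"
    by (simp add: algebra_simps)
  then have k: "fls_const (of_nat l * 2 * complex_of_real (kap (Suc l) n)) = - fls_const (of_int (n + 2) * complex_of_real (kap l (n + 2)))"
    by (simp only: fls_const_uminus)
  have "2 * of_nat l * fls_X\<^sup>2 * (fls_const (complex_of_real (kap (Suc l) n)) * fls_X_intpow n)
     = fls_const (of_nat l * 2 * complex_of_real (kap (Suc l) n)) * (fls_X\<^sup>2 * fls_X_intpow n)"
    by (simp only: fls_const_mult_const[symmetric] fls_of_nat[symmetric] fls_const_numeral) (simp only: mult_ac)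
  also have "\<dots> = - (of_int (n + 2) * (fls_const (complex_of_real (kap l (n + 2))) * fls_X_intpow (n + 2)))"
    unfolding k X by (simp only: fls_const_mult_const[symmetric] fls_of_int[symmetric] mult.assoc mult_minus_left)
  finally have "2 * of_nat l * fls_X\<^sup>2 * s = 2 * of_nat l * fls_X\<^sup>2 * (fls_const (complex_of_real (kap (Suc l) n)) * fls_X_intpow n)"
    using 1 by (simp only:)
  moreover have "2 * of_nat l * fls_X\<^sup>2 \<noteq> (0 :: C)" using step.hyps(1) by simp
  ultimately show ?case unfolding s_def[symmetric] by (simp only: mult_cancel_left) blast
qed


lemma S_normal_add: "S_normal (F + G) = S_normal F + S_normal G"
  by (rule S_normal_eqI) (use S_normal in \<open>auto simp: tate_normal_def simp flip: plus_S.abs_eq\<close>)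

lemma S_normal_tmon: "i = 0 \<or> j = 0 \<Longrightarrow> S_normal (abs_S (tmon r i j)) = tmon r i j"
  by (rule S_normal_eqI) (auto simp: tate_normal_def tate_coeff_tmon)

definition eterm :: "complex \<Rightarrow> nat \<Rightarrow> tate \<Rightarrow> nat \<times> nat \<Rightarrow> C" where
  "eterm a m f = (\<lambda>(i, j). complexify (tate_coeff f i j * T ^ i)
     * fls_const (complex_of_int (int j - int i) gchoose m) * xa a powi (int j - int i - int m))"

lemma S_expand_eterm: "fps_nth (S_expand (xa a) F) m = infsum (eterm a m (S_normal F)) UNIV"
  by (simp add: S_expand_def eterm_def)

lemma fls_const_mult_nth: "(fls_const a * X) $$ k = a * X $$ k" for X :: "'a::comm_ring_1 fls"
  by simp

lemma X_mult_nth: "(X * fls_X_intpow q) $$ k = X $$ (k - q)" for X :: "'a::comm_ring_1 fls"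
  unfolding fls_X_intpow_times_conv_shift(2) by simp

lemma complexify_1: "complexify 1 = 1"
  by (rule fls_eqI) (simp add: complexify_nth)

lemma T_power_nth: "(r * T ^ i) $$ k = r $$ (k - 2 * int i)"
proof -
  have "T ^ i = fls_X_intpow (2 * int i)"
    by (simp only: fls_X_power_conv_shift_1 of_nat_numeral fls_X_intpow_power) (simp add: mult.commute)
  then show ?thesis by (simp only: X_mult_nth)
qed

lemma eterm_nth:
  assumes "a \<noteq> 0"
  shows "eterm a m f (i, j) $$ k = (complex_of_int (int j - int i) gchoose m) * a powi (int j - int i - int m)
     * complex_of_real (tate_coeff f i j $$ (k + int m - int i - int j))"
proof -
  let ?q = "int j - int i - int m"
  have "eterm a m f (i, j) = fls_const ((complex_of_int (int j - int i) gchoose m) * a powi ?q)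
      * (complexify (tate_coeff f i j * T ^ i) * fls_X_intpow ?q)"
    by (simp add: eterm_def xa_powi[OF assms] fls_const_mult_const[symmetric] mult_ac del: fls_const_mult_const)
  moreover have "(complexify (tate_coeff f i j * T ^ i) * fls_X_intpow ?q) $$ k
      = complex_of_real (tate_coeff f i j $$ (k + int m - int i - int j))"
    by (simp only: X_mult_nth complexify_nth T_power_nth) (simp add: algebra_simps)
  ultimately show ?thesis by (simp only: fls_const_mult_nth) 
qed

lemma half_gap: "x / 2 + 1 \<le> y / 2 \<Longrightarrow> y \<le> x \<Longrightarrow> False" for x y :: real
  by linarith

lemma S_expand_nth:
  assumes a: "a \<noteq> 0" and Z: "finite Z" "{ij. eterm a m (S_normal F) ij $$ k \<noteq> 0} \<subseteq> Z"
  shows "fps_nth (S_expand (xa a) F) m $$ k = (\<Sum>ij\<in>Z. eterm a m (S_normal F) ij $$ k)"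
proof -
  let ?f = "S_normal F"
  obtain B where B: "tate_ge B ?f" using tate_ge_exists by blast
  show ?thesis
    unfolding S_expand_eterm
  proof (rule fls_infsum_nth[OF _ _ Z, where B = "floor (2 * B) - int m"])
  show "finite {ij. \<exists>k'\<le>k. eterm a m ?f ij $$ k' \<noteq> 0}" for k
  proof -
    obtain Z where Z: "finite Z" "\<And>i j. (i, j) \<notin> Z \<Longrightarrow> ereal (real_of_int (k + int m) / 2 + 1) \<le> R_val (tate_coeff ?f i j)"
      using tate_seriesD[OF tate_coeff_series[of ?f]] unfolding tate_coeff.rep_eq by metis
    have "ij \<in> Z" if "k' \<le> k" "eterm a m ?f ij $$ k' \<noteq> 0" for ij k'
    proof (rule ccontr)
      assume "ij \<notin> Z"
      obtain i j where ij: "ij = (i, j)" by fastforce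
      have "tate_coeff ?f i j $$ (k' + int m - int i - int j) \<noteq> 0"
        using that(2) by (auto simp: ij eterm_nth[OF a])
      then have "real_of_int (k + int m) / 2 + 1 \<le> real_of_int (k' + int m - int i - int j) / 2"
        using Z(2) \<open>ij \<notin> Z\<close> R_val_geD unfolding ij by blast
      moreover have "real_of_int (k' + int m - int i - int j) \<le> real_of_int (k + int m)"
        unfolding of_int_le_iff using that(1) by simp
      ultimately show False by (rule half_gap)
    qed
    then show ?thesis using Z(1) by (blast intro: finite_subset)
  qed
  show "eterm a m ?f ij $$ k = 0" if "k < floor (2 * B) - int m" for ij k
  proof (rule ccontr)
    assume n: "eterm a m ?f ij $$ k \<noteq> 0"
    obtain i j where ij: "ij = (i, j)" by fastforce
    have "tate_coeff ?f i j $$ (k + int m - int i - int j) \<noteq> 0"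
      using n by (auto simp: ij eterm_nth[OF a])
    then have "B \<le> real_of_int (k + int m - int i - int j) / 2" by (rule tate_geD[OF B])
    then have "2 * B \<le> real_of_int (k + int m)" by simp
    then show False using that by linarith
  qed
  qed
qed

lemma eterm_finite: "a \<noteq> 0 \<Longrightarrow> finite {ij. eterm a m f ij $$ k \<noteq> 0}"
proof -
  assume a: "a \<noteq> 0"
  obtain Z where Z: "finite Z" "\<And>i j. (i, j) \<notin> Z \<Longrightarrow> ereal (real_of_int (k + int m) / 2 + 1) \<le> R_val (tate_coeff f i j)"
    using tate_seriesD[OF tate_coeff_series[of f]] unfolding tate_coeff.rep_eq by metis
  have "ij \<in> Z" if "eterm a m f ij $$ k \<noteq> 0" for ij
  proof (rule ccontr)
    assume "ij \<notin> Z"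
    obtain i j where ij: "ij = (i, j)" by fastforce
    have "tate_coeff f i j $$ (k + int m - int i - int j) \<noteq> 0" using that by (auto simp: ij eterm_nth[OF a])
    then have "real_of_int (k + int m) / 2 + 1 \<le> real_of_int (k + int m - int i - int j) / 2"
      using Z(2) \<open>ij \<notin> Z\<close> R_val_geD unfolding ij by blast
    moreover have "real_of_int (k + int m - int i - int j) \<le> real_of_int (k + int m)"
      unfolding of_int_le_iff by simp
    ultimately show False by (rule half_gap)
  qed
  then show ?thesis using Z(1) by (blast intro: finite_subset)
qed

lemma S_expand_add: "a \<noteq> 0 \<Longrightarrow> S_expand (xa a) (F + G) = S_expand (xa a) F + S_expand (xa a) G"
proof (rule fps_ext, rule fls_eqI)
  fix m k assume a: "a \<noteq> 0"
  let ?e = "\<lambda>F ij. eterm a m (S_normal F) ij $$ k"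
  let ?Z = "{ij. ?e F ij \<noteq> 0} \<union> {ij. ?e G ij \<noteq> 0}"
  have e: "?e (F + G) ij = ?e F ij + ?e G ij" for ij
    by (cases ij) (simp add: eterm_nth[OF a] S_normal_add distrib_left)
  have Z: "finite ?Z" using eterm_finite[OF a] by blast
  have "{ij. ?e (F + G) ij \<noteq> 0} \<subseteq> ?Z" using e by auto
  then show "fps_nth (S_expand (xa a) (F + G)) m $$ k = fps_nth (S_expand (xa a) F + S_expand (xa a) G) m $$ k"
    using S_expand_nth[OF a Z, of m "F + G"] S_expand_nth[OF a Z, of m F] S_expand_nth[OF a Z, of m G]
    by (simp add: e sum.distrib)
qed

lemma S_expand_small:
  assumes "a \<noteq> 0" "tate_ge N (S_normal F)" "real_of_int (k + int m) < 2 * N"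
  shows "fps_nth (S_expand (xa a) F) m $$ k = 0"
proof -
  have "eterm a m (S_normal F) ij $$ k = 0" for ij
  proof (rule ccontr)
    assume n: "eterm a m (S_normal F) ij $$ k \<noteq> 0"
    obtain i j where ij: "ij = (i, j)" by fastforce
    have "tate_coeff (S_normal F) i j $$ (k + int m - int i - int j) \<noteq> 0"
      using n by (auto simp: ij eterm_nth[OF assms(1)])
    then have "N \<le> real_of_int (k + int m - int i - int j) / 2" by (rule tate_geD[OF assms(2)])
    then show False using assms(3) by simp
  qed
  then show ?thesis using S_expand_nth[OF assms(1), of "{}" m F k] by simp
qed

lemma S_expand_tmon:
  assumes "a \<noteq> 0" "i = 0 \<or> j = 0"
  shows "S_expand (xa a) (abs_S (tmon r i j)) = fps_const (complexify (r * T ^ i)) * zpow (xa a) (int j - int i)"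
proof (rule fps_ext, rule fls_eqI)
  fix m k
  let ?e = "eterm a m (tmon r i j)"
  have "{ij. ?e ij $$ k \<noteq> 0} \<subseteq> {(i, j)}"
    by (auto simp: eterm_nth[OF assms(1)] tate_coeff_tmon split: if_splits)
  then have "fps_nth (S_expand (xa a) (abs_S (tmon r i j))) m $$ k = ?e (i, j) $$ k"
    using S_expand_nth[OF assms(1), of "{(i, j)}" m "abs_S (tmon r i j)" k] by (simp add: S_normal_tmon[OF assms(2)])
  then show "fps_nth (S_expand (xa a) (abs_S (tmon r i j))) m $$ k
      = fps_nth (fps_const (complexify (r * T ^ i)) * zpow (xa a) (int j - int i)) m $$ k"
    by (simp add: eterm_def tate_coeff_tmon zpow_def mult.assoc)
qed

lemma S_d1_W: "S_d1 W = abs_S (tmon 1 0 0) + abs_S (tmon (inverse T) 2 0)"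
proof -
  have 1: "abs_S (tmon 1 0 0) = 1" by (simp add: tmon_def tate_const_1 one_S.abs_eq)
  have 2: "abs_S (tmon (inverse T) 2 0) = S_const (inverse T) * z0 * z0"
    by (simp add: tmon_def power2_eq_square S_const.abs_eq z0.abs_eq times_S.abs_eq mult.assoc)
  show ?thesis unfolding 1 2 W_def by (simp add: S_d1_simps)
qed

lemma Res_eq:
  assumes "a\<^sup>2 = - 1" "l \<ge> 1"
  shows "Res (xa a) l F = fls_residue (fps_to_fls (S_expand (xa a) F) * (inverse (zz (xa a)) * Vi (xa a) ^ l))"
proof -
  have a: "a \<noteq> 0" using assms by auto
  have x: "xa a \<noteq> 0" using xa_props assms by blast
  have "fps_to_fls (S_expand (xa a) z1) = zz (xa a)"
  proof -
    have "z1 = abs_S (tmon 1 0 1)" by (simp add: tmon_def tate_const_1 z1.abs_eq)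
    then show ?thesis
      using S_expand_tmon[OF a, of 0 1 1] fps_to_fls_zpow[OF x, of 1] by (simp add: complexify_1)
  qed
  moreover have "fps_to_fls (S_expand (xa a) (S_d1 W)) = 1 + fls_const (fls_X\<^sup>2) * zz (xa a) powi (- 2)"
  proof -
    have c2: "complexify (inverse T * T ^ 2) = fls_X\<^sup>2"
    proof -
      have "inverse T * T = 1" by (rule left_inverse) simp
      then have "inverse T * T ^ 2 = T" by (simp only: power2_eq_square[of T] mult.assoc[symmetric] mult_1)
      moreover have "complexify T = fls_X\<^sup>2"
        by (rule fls_eqI) (simp add: complexify_nth fls_X_power_conv_shift_1)
      ultimately show ?thesis by simp
    qed
    show ?thesis
      unfolding S_d1_W S_expand_add[OF a]
      using S_expand_tmon[OF a, of 0 0 1] S_expand_tmon[OF a, of 2 0 "inverse T"] fps_to_fls_zpow[OF x, of "- 2"]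
      by (simp only: c2) (simp add: complexify_1 zpow_0 fps_to_fls_plus fls_times_fps_to_fls)
  qed
  ultimately show ?thesis
    by (simp add: Res_def Vi_def divide_inverse power_inverse mult_ac)
qed

lemma Res_add:
  assumes "a\<^sup>2 = - 1" "l \<ge> 1"
  shows "Res (xa a) l (F + G) = Res (xa a) l F + Res (xa a) l G"
proof -
  have "a \<noteq> 0" using assms by auto
  then show ?thesis unfolding Res_eq[OF assms] by (simp add: S_expand_add fps_to_fls_plus distrib_right)
qed

text \<open>Only finitely many Taylor coefficients of F meet the polar part of the other factor, and
  each is T-adically small with F. Together with additivity this gives continuity of the
  residue.\<close>

lemma Res_small:
  assumes "a\<^sup>2 = - 1" "l \<ge> 1"
  shows "\<exists>N. \<forall>F. tate_ge N (S_normal F) \<longrightarrow> Res (xa a) l F $$ k = 0"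
proof -
  have a: "a \<noteq> 0" using assms by auto
  define H where "H = inverse (zz (xa a)) * Vi (xa a) ^ l"
  define M where "M = - 1 - fls_subdegree H"
  define h where "h = Min (insert 0 ((\<lambda>m. fls_subdegree (H $$ (- 1 - m))) ` {0..M}))"
  have h: "h \<le> fls_subdegree (H $$ (- 1 - m))" if "m \<in> {0..M}" for m
    unfolding h_def using that by (intro Min_le) auto
  define N where "N = real_of_int (k - h + max M 0) + 1"
  have "Res (xa a) l F $$ k = 0" if F: "tate_ge (max N 0) (S_normal F)" for F
  proof -
    let ?E = "fps_to_fls (S_expand (xa a) F)"
    have "(?E * H) $$ (- 1) = (\<Sum>m\<in>{0..M}. ?E $$ m * H $$ (- 1 - m))"
    proof (rule fls_mult_nth_superset)
      fix m assume "?E $$ m \<noteq> 0" "H $$ (- 1 - m) \<noteq> 0"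
      then have "0 \<le> m" "fls_subdegree H \<le> - 1 - m" by (auto split: if_splits intro: fls_subdegree_leI)
      then show "m \<in> {0..M}" by (simp add: M_def)
    qed simp
    moreover have "(?E $$ m * H $$ (- 1 - m)) $$ k = 0" if m: "m \<in> {0..M}" for m
    proof (rule ccontr)
      assume "\<not> ?thesis"
      then obtain i where i: "?E $$ m $$ i \<noteq> 0" "H $$ (- 1 - m) $$ (k - i) \<noteq> 0" by (rule fls_mult_nth_nonzeroE)
      have "h \<le> k - i" using h[OF m] fls_subdegree_leI[OF i(2)] by linarith
      then have "i + int (nat m) \<le> k - h + max M 0" using m by simp
      then have "real_of_int (i + int (nat m)) < N" unfolding N_def by linarith
      moreover have "N \<le> 2 * max N 0" by (simp add: max_def)
      ultimately have "real_of_int (i + int (nat m)) < 2 * max N 0" by linarith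
      then have "fps_nth (S_expand (xa a) F) (nat m) $$ i = 0" by (rule S_expand_small[OF a F])
      then show False using i(1) m by simp
    qed
    ultimately show ?thesis unfolding Res_eq[OF assms] H_def[symmetric] by (simp add: fls_nth_sum)
  qed
  then show ?thesis by blast
qed

lemma Res_tmon:
  assumes "a\<^sup>2 = - 1" "l \<ge> 1" "i = 0 \<or> j = 0"
  shows "Res (xa a) l (abs_S (tmon r i j)) = complexify (r * T ^ i) * rhor (xa a) l (int j - int i)"
proof -
  have a: "a \<noteq> 0" using assms by auto
  have x: "xa a \<noteq> 0" using xa_props assms by blast
  have p: "zz (xa a) powi n * inverse (zz (xa a)) = zz (xa a) powi (n - 1)" for n
    using power_int_add[of "zz (xa a)" n "- 1"] zz_nonzero by (simp add: power_int_minus)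
  have "fps_to_fls (S_expand (xa a) (abs_S (tmon r i j))) * (inverse (zz (xa a)) * Vi (xa a) ^ l)
     = fls_const (complexify (r * T ^ i)) * ((zz (xa a) powi (int j - int i) * inverse (zz (xa a))) * Vi (xa a) ^ l)"
    unfolding S_expand_tmon[OF a assms(3)] fls_times_fps_to_fls fps_to_fls_zpow[OF x] by (simp add: mult_ac)
  then show ?thesis unfolding Res_eq[OF assms(1,2)] p by (simp only: fls_residue_fls_const_times rhor_Vi)
qed

text \<open>\<open>Ai\<close> and T x^2 times \<open>Ai\<close> are the two expansions of 1/d_1 W,
  so this is the outer minus the inner constant term of the integrand.\<close>

definition RR :: "nat \<Rightarrow> S \<Rightarrow> int \<Rightarrow> real" where
  "RR l F k = (outer.iota F * Ai ^ l) $$ k $$ 0 - (inner.iota F * (tx 2 2 * Ai) ^ l) $$ k $$ 0"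

lemma RR_add: "RR l (F + G) k = RR l F k + RR l G k"
  by (simp add: RR_def outer.iota_hom inner.iota_hom distrib_right)

lemma emb_tx_diag: "(emb r * (tx p b * diag f)) $$ k $$ 0 = (if b \<le> 0 then r $$ (k - p + b) * f (nat (- b)) else 0)"
proof -
  have d: "(tx p b * diag f) $$ i $$ 0 = (if i = p - b \<and> b \<le> 0 then f (nat (- b)) else 0)" for i
  proof -
    have "(tx p b * diag f) $$ i $$ 0 = diag f $$ (i - p) $$ (- b)"
      unfolding tx_mult_nth fls_X_intpow_times_conv_shift(1) by simp
    then show ?thesis by (auto simp: diag_nth2)
  qed
  have "(emb r * (tx p b * diag f)) $$ k $$ 0 = (\<Sum>i=fls_subdegree (emb r)..k - fls_subdegree (tx p b * diag f).
      r $$ i * (tx p b * diag f) $$ (k - i) $$ 0)"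
    by (simp add: fls_times_nth(2)[of "emb r"] fls_nth_sum emb_nth)
  also have "\<dots> = (\<Sum>i\<in>{k - p + b}. r $$ i * (tx p b * diag f) $$ (k - i) $$ 0)"
  proof (rule sum.mono_neutral_cong)
    fix i assume "i \<in> {k - p + b} - {fls_subdegree (emb r)..k - fls_subdegree (tx p b * diag f)}"
    then have "i < fls_subdegree (emb r) \<or> k - i < fls_subdegree (tx p b * diag f)" by auto
    then have "emb r $$ i = 0 \<or> (tx p b * diag f) $$ (k - i) = 0" by auto
    moreover have "emb r $$ i = 0 \<Longrightarrow> r $$ i = 0" by (metis emb_nth fls_const_nonzero)
    ultimately show "r $$ i * (tx p b * diag f) $$ (k - i) $$ 0 = 0" by auto
  qed (auto simp: d)
  finally show ?thesis by (simp add: d)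
qed

lemma RR_tmon: "RR l (abs_S (tmon r i j)) k = r $$ (k - int i - int j) * kap l (int j - int i)" if "l \<ge> 1"
proof -
  have 1: "outer.iota (abs_S (tmon r i j)) * Ai ^ l = emb r * (tx (2 * int i) (int i - int j) * diag (binc l))"
    by (simp add: outer.iota_abs outer.tiota_tmon outer.wt_def outer.ex_def Ai_power mult.assoc)
  have 2: "inner.iota (abs_S (tmon r i j)) * (tx 2 2 * Ai) ^ l
      = emb r * (tx (2 * int j + 2 * int l) (int j - int i + 2 * int l) * diag (binc l))"
    by (simp add: inner.iota_abs inner.tiota_tmon inner.wt_def inner.ex_def power_mult_distrib Ai_power tx_power
        tx_mult mult.assoc[symmetric]) (simp add: mult.assoc tx_mult algebra_simps)
  have e: "nat (int i - int j) = i - j" by simp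
  show ?thesis
    unfolding RR_def 1 2 emb_tx_diag using that by (auto simp: kap_def algebra_simps)
qed

lemma RR_small:
  assumes "tate_ge N (S_normal F)" "real_of_int k < 2 * N"
  shows "RR l F k = 0"
proof -
  have "(X * Y) $$ k = 0" if "\<And>i. X $$ i \<noteq> 0 \<Longrightarrow> N \<le> real_of_int i / 2" "\<And>i. i < 0 \<Longrightarrow> Y $$ i = 0" for X Y :: L
  proof (rule ccontr)
    assume "\<not> ?thesis"
    then obtain i where "X $$ i \<noteq> 0" "Y $$ (k - i) \<noteq> 0" by (rule fls_mult_nth_nonzeroE)
    then have "N \<le> real_of_int i / 2" "\<not> k - i < 0" using that by blast+
    then show False using assms(2) by linarith
  qed
  note 0 = this
  have "(Ai ^ l) $$ i = 0" if "i < 0" for i using that by (simp add: Ai_power diag_nth)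
  moreover have "((tx 2 2 * Ai) ^ l) $$ i = 0" if "i < 0" for i
    using that by (simp add: power_mult_distrib tx_power tx_mult_nth Ai_power diag_nth)
  ultimately show ?thesis
    unfolding RR_def outer.iota_normal inner.iota_normal
    using 0[OF outer.tiota_ge[OF assms(1)]] 0[OF inner.tiota_ge[OF assms(1)]] by simp
qed

text \<open>Both sides are additive and continuous in F, so F may be taken to be a monomial in
  normal form, where the claim is \<open>sum_rhor\<close>.\<close>

theorem sum_Res:
  assumes l: "l \<ge> 1"
  shows "(\<Sum>x\<in>crit_points. Res x l F) $$ k = complex_of_real (RR l F k)"
proof -
  define Q where "Q F = (\<Sum>x\<in>crit_points. Res x l F) $$ k - complex_of_real (RR l F k)" for F
  have i: "\<i>\<^sup>2 = - 1" "(- \<i>)\<^sup>2 = - 1" by simp_all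
  have add: "Q (F + G) = Q F + Q G" for F G
    by (simp add: Q_def crit_sum Res_add[OF i(1) l] Res_add[OF i(2) l] RR_add)
  have 0: "Q 0 = 0" using add[of 0 0] by simp
  have mon: "Q (abs_S (tmon r i j)) = 0" if "i = 0 \<or> j = 0" for r i j
  proof -
    have "Res (xa \<i>) l (abs_S (tmon r i j)) + Res (xa (- \<i>)) l (abs_S (tmon r i j))
      = fls_const (complex_of_real (kap l (int j - int i))) * (complexify (r * T ^ i) * fls_X_intpow (int j - int i))"
      unfolding Res_tmon[OF i(1) l that] Res_tmon[OF i(2) l that] distrib_left[symmetric] sum_rhor[OF l]
      by (simp only: mult_ac)
    then show ?thesis
      unfolding Q_def crit_sum RR_tmon[OF l]
      by (simp only: fls_const_mult_nth X_mult_nth complexify_nth T_power_nth) (simp add: algebra_simps)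
  qed
  obtain N1 where N1: "\<And>F. tate_ge N1 (S_normal F) \<Longrightarrow> Res (xa \<i>) l F $$ k = 0" using Res_small[OF i(1) l] by blast
  obtain N2 where N2: "\<And>F. tate_ge N2 (S_normal F) \<Longrightarrow> Res (xa (- \<i>)) l F $$ k = 0" using Res_small[OF i(2) l] by blast
  define N where "N = max (max N1 N2) (real_of_int \<bar>k\<bar> + 1)"
  have ge: "tate_ge M f" if "tate_ge N f" "M \<le> N" for M f
    using that unfolding tate_ge_def by (meson ereal_less_eq(3) order_trans)
  obtain Z g where Z: "finite Z" "S_normal F = (\<Sum>(i, j)\<in>Z. tmon (tate_coeff (S_normal F) i j) i j) + g" "tate_ge N g"
    "\<And>i j. tate_coeff g i j \<noteq> 0 \<Longrightarrow> tate_coeff (S_normal F) i j \<noteq> 0"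
    using tate_decompose[of "S_normal F" N] by blast
  have "tate_normal g" using Z(4) S_normal(2)[of F] unfolding tate_normal_def by blast
  then have g: "S_normal (abs_S g) = g" by (intro S_normal_eqI) simp_all
  have Qg: "Q (abs_S g) = 0"
  proof -
    have "tate_ge N1 g" "tate_ge N2 g" by (rule ge[OF Z(3)], simp add: N_def)+
    moreover have "RR l (abs_S g) k = 0"
    proof (rule RR_small[of N])
      show "tate_ge N (S_normal (abs_S g))" using g Z(3) by simp
      have "real_of_int \<bar>k\<bar> + 1 \<le> N" by (simp add: N_def)
      then show "real_of_int k < 2 * N" by linarith
    qed
    ultimately show ?thesis using N1[of "abs_S g"] N2[of "abs_S g"] by (simp add: Q_def crit_sum g)
  qed
  have Qsum: "Q (abs_S (\<Sum>x\<in>Z'. f x)) = (\<Sum>x\<in>Z'. Q (abs_S (f x)))" for f :: "nat \<times> nat \<Rightarrow> tate" and Z'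
    by (induction Z' rule: infinite_finite_induct) (simp_all add: 0 add zero_S.abs_eq[symmetric] plus_S.abs_eq[symmetric])
  have "Q (abs_S (tmon (tate_coeff (S_normal F) i j) i j)) = 0" for i j
  proof (cases "i = 0 \<or> j = 0")
    case False
    then have "tate_coeff (S_normal F) i j = 0" using S_normal(2)[of F] by (simp add: tate_normal_def)
    moreover have "abs_S (tmon 0 i j) = 0"
      by (simp add: zero_S.abs_eq) (metis tate_coeff_tmon tate_coeff_simps(1) tate_eqI)
    ultimately show ?thesis by (simp add: 0)
  qed (rule mon)
  then have "Q (abs_S (\<Sum>(i, j)\<in>Z. tmon (tate_coeff (S_normal F) i j) i j)) = 0"
    unfolding Qsum by (simp add: case_prod_unfold)
  then have "Q (abs_S (S_normal F)) = 0"
    by (subst Z(2)) (simp add: plus_S.abs_eq[symmetric] add Qg)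
  then show ?thesis by (simp add: S_normal(1) Q_def)
qed

text \<open>The real Laurent series with coefficients \<open>- RR\<close> is the witness for the
  definite description: the sum over the two conjugate points is real, and \<open>complexify\<close>
  is injective.\<close>

lemma Theta_word_nth:
  assumes "w \<noteq> []"
  shows "fps_nth (Theta_word w) i $$ k = - (ct (coeff (bod (out.PP w)) 0) i k - ct (coeff (bod (inn.PP w)) 0) i k)"
proof -
  let ?F = "fps_nth (str (foldr (\<lambda>a A. Ends_matrix (snd a) ** d1_D ** A) w (mat 1))) i"
  have l: "length w \<ge> 1" using assms by (cases w) auto
  obtain B1 where "tate_ge B1 (S_normal ?F)" using tate_ge_exists by blast
  then have low: "RR (length w) ?F k = 0" if "k < floor (2 * B1)" for k
    using that by (intro RR_small) (assumption, linarith)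
  define r where "r = Abs_fls (\<lambda>k. - RR (length w) ?F k)"
  have r: "r $$ k = - RR (length w) ?F k" for k
    unfolding r_def by (rule nth_Abs_fls_lower_bound[of "floor (2 * B1)"]) (simp add: low)
  have "complexify r = - (\<Sum>x\<in>crit_points. Res x (length w) ?F)"
    by (rule fls_eqI) (simp add: complexify_nth r sum_Res[OF l])
  then have "fps_nth (Theta_word w) i = r"
    unfolding Theta_word_def fps_nth_Abs_fps by (intro the_equality) (metis complexify_inject)+
  then show ?thesis by (simp add: r RR_def coeff0_out coeff0_inn ct_def)
qed


section \<open>The Maurer-Cartan equation for b\<close>

section \<open>The bounding cochain\<close>

definition A_s :: "R fps" where "A_s = fps_exp (- 1) - fps_exp 1"
definition B_s :: "R fps" where "B_s = fps_exp (- 1) + fps_exp 1 - 2"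
definition X_b :: End_M where "X_b = End_act (Cl_S (S_const (1 / (2 * T_half)) * z1) * e0)"
definition Y_b :: End_M where "Y_b = End_act (Cl_S (S_const (1 / 2)) * e1)"
definition bb :: "End_M fps" where "bb = Rs_id A_s * fps_const X_b - Rs_id B_s * fps_const Y_b"
definition cc :: "R fps" where "cc = (fps_exp 1 - fps_exp (- 1)) * fps_const T_half"
text \<open>The lower left matrix entry of b, by \<open>m21_bb\<close>; it is the only one that
  matters at parameter 1.\<close>

definition be_s :: "R fps" where "be_s = 1 - fps_exp (- 1)"

lemma exp_exp: "fps_exp 1 * fps_exp (- 1) = (1 :: R fps)" "fps_exp (- 1) * fps_exp 1 = (1 :: R fps)"
  by (simp_all flip: fps_exp_add_mult)

definition hS :: S where "hS = S_const (1 / 2)"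

lemma half_R: "(1 / 2 :: R) = fls_const (1 / 2)" "(2 :: R) \<noteq> 0"
proof -
  have 1: "fls_const (1 / 2) * 2 = (1 :: R)"
    unfolding one_add_one[symmetric] distrib_left mult_1_right fls_plus_const by simp
  then show two: "(2 :: R) \<noteq> 0" by (metis mult_zero_right zero_neq_one)
  show "(1 / 2 :: R) = fls_const (1 / 2)" using 1 by (simp only: nonzero_divide_eq_eq[OF two])
qed

lemma quarter_R: "(1 / 4 :: R) = 1 / 2 * (1 / 2)" "(4 * (1 / 4) :: R) = 1" "(1 / 2 + 1 / 2 :: R) = 1"
proof -
  have four: "(4 :: R) = 2 * 2" by (simp only: numeral_times_numeral semiring_norm)
  then show "(1 / 4 :: R) = 1 / 2 * (1 / 2)" by (simp only: times_divide_times_eq mult_1)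
  have "(4 :: R) \<noteq> 0" unfolding four by (rule no_zero_divisors[OF half_R(2) half_R(2)])
  then show "(4 * (1 / 4) :: R) = 1" unfolding times_divide_eq_right mult_1_right by (rule divide_self)
  show "(1 / 2 + 1 / 2 :: R) = 1"
    by (simp only: add_divide_distrib[symmetric] one_add_one divide_self half_R(2) not_False_eq_True)
qed

lemma hS: "S_const (1 / (2 * T_half)) = S_const (inverse T_half) * hS" "hS + hS = 1"
proof -
  have "1 / (2 * T_half) = inverse T_half * (1 / 2)"
    by (simp only: divide_inverse mult_1 inverse_mult_distrib mult.commute)
  then show "S_const (1 / (2 * T_half)) = S_const (inverse T_half) * hS" by (simp only: S_const_hom hS_def)
  show "hS + hS = 1" by (simp only: S_const_hom(3)[symmetric] S_const_hom(2) hS_def quarter_R)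
qed

lemma mx_gens: "mx (End_act (Cl_S a * e0)) = M2 0 (S_const T_half * a) (- (S_const (inverse T_half) * z0 * a)) 0"
  "mx (End_act (Cl_S a * e1)) = M2 0 (z1 * a) a 0" "mx (End_act (Cl_S a)) = M2 a 0 0 a"
  by (simp_all add: mx_act Cl_S_def e0_def e1_def times_Cl_def)

lemma mx_XY: "mx X_b = M2 0 (hS * z1) (- hS) 0" "mx Y_b = M2 0 (hS * z1) hS 0"
proof -
  let ?t = "S_const T_half" and ?i = "S_const (inverse T_half)"
  have 1: "?t * (?i * hS * z1) = hS * z1" by (simp only: mult.assoc T_half_cancel)
  have "?i * z0 * (?i * hS * z1) = ?i * (?i * (z0 * z1)) * hS" by (simp only: mult_ac)
  also have "\<dots> = hS" by (simp only: z0_z1_T_half T_half_cancel T_half_inverse mult_1)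
  finally have 2: "?i * z0 * (?i * hS * z1) = hS" .
  show "mx X_b = M2 0 (hS * z1) (- hS) 0"
    by (simp only: X_b_def hS(1) mx_gens 1 2)
  show "mx Y_b = M2 0 (hS * z1) hS 0"
    by (simp only: Y_b_def hS_def[symmetric] mx_gens mult.commute)
qed

text \<open>The Clifford relations behind the Maurer-Cartan equation: for b = A X - B Y they give
  the linear part - A T^(1/2) - B z_1 and the square (B^2 - A^2) z_1 / 4.\<close>

lemma XY_relations:
  "X_b * X_b = - (End_const (1 / 4) * End_act (Cl_S z1))" "Y_b * Y_b = End_const (1 / 4) * End_act (Cl_S z1)"
  "X_b * Y_b + Y_b * X_b = 0" "D * X_b + X_b * D = - End_const T_half" "D * Y_b + Y_b * D = End_act (Cl_S z1)"
proof -
  have q: "S_const (1 / 4) = hS * hS" by (simp only: quarter_R(1) S_const_hom(4) hS_def)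
  note Z = mx_gens(3)[of z1]
  show "X_b * X_b = - (End_const (1 / 4) * End_act (Cl_S z1))" "Y_b * Y_b = End_const (1 / 4) * End_act (Cl_S z1)"
    "X_b * Y_b + Y_b * X_b = 0"
    unfolding mx_inject[symmetric] mx_hom mx_XY mx_const Z q by (rule m2_eqI; simp add: mult_ac)+
  let ?t = "S_const T_half" and ?i = "S_const (inverse T_half)"
  have zt: "?i * z0 * z1 = ?t" by (simp only: mult.assoc z0_z1_T_half T_half_cancel)
  have h: "(hS + hS) * x = x" for x by (simp add: hS)
  have e1: "(z1 + ?t) * - hS + hS * z1 * (1 - ?i * z0) = - ((hS + hS) * ?t)"
  proof -
    have "(z1 + ?t) * - hS + hS * z1 * (1 - ?i * z0) = - (?t * hS) - hS * (?i * z0 * z1)" by (simp add: algebra_simps)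
    also have "\<dots> = - ((hS + hS) * ?t)"
      by (simp only: zt distrib_right mult.commute[of ?t hS] minus_add_distrib diff_conv_add_uminus)
    finally show ?thesis .
  qed
  have e2: "(z1 + ?t) * hS + hS * z1 * (1 - ?i * z0) = (hS + hS) * z1"
  proof -
    have "(z1 + ?t) * hS + hS * z1 * (1 - ?i * z0) = z1 * hS + hS * z1 + ?t * hS - hS * (?i * z0 * z1)" by (simp add: algebra_simps)
    also have "\<dots> = (hS + hS) * z1"
      by (simp only: zt distrib_right mult.commute[of ?t hS] mult.commute[of z1 hS] add_diff_cancel_right')
    finally show ?thesis .
  qed
  have e3: "(1 - ?i * z0) * (hS * z1) + - hS * (z1 + ?t) = - ((hS + hS) * ?t)" using e1 by (simp only: mult.commute add.commute mult_minus_left mult_minus_right)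
  have e4: "(1 - ?i * z0) * (hS * z1) + hS * (z1 + ?t) = (hS + hS) * z1" using e2 by (simp only: mult.commute add.commute)
  show "D * X_b + X_b * D = - End_const T_half"
    unfolding mx_inject[symmetric] mx_hom mx_XY mx_const mx_D
    using e1 e3 unfolding h by (intro m2_eqI) simp_all
  show "D * Y_b + Y_b * D = End_act (Cl_S z1)"
    unfolding mx_inject[symmetric] mx_hom mx_XY Z mx_D
    using e2 e4 unfolding h by (intro m2_eqI) simp_all
qed

text \<open>B - A = 2 (e^s - 1) and B + A = 2 (e^(-s) - 1), with product 4 (2 - e^s - e^(-s)). This
  cancels the z_1-terms of the Maurer-Cartan equation and leaves - A T^(1/2), which is c.\<close>

lemma AB_s: "(B_s * B_s - A_s * A_s) * fps_const (1 / 4) = - B_s"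
proof -
  have "B_s * B_s - A_s * A_s = 4 * (fps_exp 1 * fps_exp (- 1)) - 4 * fps_exp (- 1) - 4 * fps_exp 1 + 4"
    by (simp add: A_s_def B_s_def algebra_simps)
  also have "\<dots> = - (B_s * 4)" unfolding exp_exp by (simp add: B_s_def)
  finally have "(B_s * B_s - A_s * A_s) * fps_const (1 / 4) = - (B_s * (4 * fps_const (1 / 4)))" by (simp add: mult.assoc)
  also have "4 * fps_const (1 / 4) = (1 :: R fps)"
    by (simp only: fps_numeral_fps_const fps_const_mult quarter_R(2) fps_const_1_eq_1)
  finally show ?thesis by simp
qed

lemma Rs_id_const: "Rs_id (fps_const r) = fps_const (End_const r)"
  by (rule fps_ext) (simp add: End_const_hom(1))

lemma bb_MC: "delta 1 bb - bb ^ 2 = Rs_id cc"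
proof -
  let ?D = "fps_const D" and ?X = "fps_const X_b" and ?Y = "fps_const Y_b" and ?Z = "fps_const (End_act (Cl_S z1))"
  let ?A = "Rs_id A_s" and ?B = "Rs_id B_s" and ?q = "Rs_id (fps_const (1 / 4))"
  have c: "u * (Rs_id r * v) = Rs_id r * (u * v)" for u v r
    by (simp only: mult.assoc[symmetric] Rs_id_commute[of r u])
  have comm: "d * (Rs_id r * x - Rs_id r' * y) + (Rs_id r * x - Rs_id r' * y) * d
      = Rs_id r * (d * x + x * d) - Rs_id r' * (d * y + y * d)" for d x y r r'
    unfolding left_diff_distrib right_diff_distrib distrib_left c[of d] mult.assoc by simp
  have prod: "(Rs_id r * x) * (Rs_id r' * y) = Rs_id (r * r') * (x * y)" for x y r r'
    unfolding Rs_id_hom mult.assoc c[of x] ..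
  have square: "(Rs_id r * x - Rs_id r' * y) * (Rs_id r * x - Rs_id r' * y)
      = Rs_id (r * r) * (x * x) + Rs_id (r' * r') * (y * y) - Rs_id (r * r') * (x * y + y * x)" for x y r r'
    unfolding left_diff_distrib right_diff_distrib distrib_left prod mult.commute[of r' r] by simp
  have f: "?X * ?X = - (?q * ?Z)" "?Y * ?Y = ?q * ?Z" "?X * ?Y + ?Y * ?X = 0"
    "?D * ?X + ?X * ?D = - Rs_id (fps_const T_half)" "?D * ?Y + ?Y * ?D = ?Z"
    using XY_relations by (simp_all add: Rs_id_const fps_const_mult)
  have "delta 1 bb = ?D * bb + bb * ?D" by (simp add: delta_def psign_def)
  also have "\<dots> = - (?A * Rs_id (fps_const T_half)) - ?B * ?Z" unfolding bb_def comm f by simp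
  finally have d: "delta 1 bb = - (?A * Rs_id (fps_const T_half)) - ?B * ?Z" .
  have "bb ^ 2 = Rs_id (A_s * A_s) * - (?q * ?Z) + Rs_id (B_s * B_s) * (?q * ?Z)"
    unfolding power2_eq_square bb_def square f by simp
  also have "\<dots> = Rs_id ((B_s * B_s - A_s * A_s) * fps_const (1 / 4)) * ?Z"
    by (simp add: Rs_id_hom left_diff_distrib mult.assoc)
  finally have "bb ^ 2 = - (?B * ?Z)" unfolding AB_s by (simp add: Rs_id_hom)
  then have "delta 1 bb - bb ^ 2 = Rs_id (- (A_s * fps_const T_half))" unfolding d by (simp add: Rs_id_hom)
  also have "- (A_s * fps_const T_half) = cc" by (simp add: A_s_def cc_def left_diff_distrib)
  finally show ?thesis .
qed

definition real_coeffs :: "R fps \<Rightarrow> bool" where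
  "real_coeffs r \<longleftrightarrow> (\<forall>i. \<exists>q. fps_nth r i = fls_const q)"

lemma real_coeffs_exp: "real_coeffs (fps_exp 1)" "real_coeffs (fps_exp (- 1))"
proof -
  have "fps_nth (fps_exp (fls_const a)) i = fls_const (a ^ i / fact i)" for a :: real and i
  proof -
    have "(fact i :: R) = fls_const (fact i)" using fls_of_nat[of "fact i", where 'a = real] by simp
    then have "fls_const (a ^ i / fact i) * (fact i :: R) = fls_const a ^ i"
      by (simp add: fls_const_mult_const fls_const_power)
    then have "fls_const a ^ i / fact i = fls_const (a ^ i / fact i)" by (simp add: nonzero_divide_eq_eq)
    then show ?thesis by simp
  qed
  from this[of 1] this[of "- 1"] show "real_coeffs (fps_exp 1)" "real_coeffs (fps_exp (- 1))"
    unfolding real_coeffs_def by (auto simp del: fps_exp_nth)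
qed

lemma real_coeffs_AB: "real_coeffs A_s" "real_coeffs B_s" "fps_nth A_s 0 = 0" "fps_nth B_s 0 = 0"
proof -
  have add: "real_coeffs (r + r')" and diff: "real_coeffs (r - r')" if rr': "real_coeffs r" "real_coeffs r'" for r r'
  
  proof -
    have "\<exists>q. fps_nth (r + r') i = fls_const q" "\<exists>q. fps_nth (r - r') i = fls_const q" for i
    proof -
      obtain p where "fps_nth r i = fls_const p" using rr'(1) unfolding real_coeffs_def by blast
      moreover obtain q where "fps_nth r' i = fls_const q" using rr'(2) unfolding real_coeffs_def by blast
      ultimately have "fps_nth (r + r') i = fls_const (p + q)" "fps_nth (r - r') i = fls_const (p - q)"
        by (simp_all only: fps_add_nth fps_sub_nth fls_plus_const fls_minus_const)
      then show "\<exists>q. fps_nth (r + r') i = fls_const q" "\<exists>q. fps_nth (r - r') i = fls_const q" by blast+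
    qed
    then show "real_coeffs (r + r')" "real_coeffs (r - r')" unfolding real_coeffs_def by blast+
  qed
  have "real_coeffs 2"
    unfolding real_coeffs_def
  proof
    fix i show "\<exists>q. fps_nth (2 :: R fps) i = fls_const q"
      by (cases "i = 0") (auto simp: fps_numeral_nth intro: exI[of _ 2] exI[of _ 0])
  qed
  then show "real_coeffs A_s" "real_coeffs B_s" unfolding A_s_def B_s_def by (intro add diff real_coeffs_exp)+
qed (simp_all add: A_s_def B_s_def fps_numeral_nth)

lemma fls_const_val: "ereal 0 \<le> R_val (fls_const q)" "R_deg 0 (fls_const q)"
  by (rule R_val_geI, simp split: if_splits) (auto simp: R_deg_def)

lemma Rs_of_nonneg:
  assumes "\<And>i. ereal 0 \<le> R_val (fps_nth r i)"
  shows "r \<in> Rs" "fps_nth r 0 = 0 \<Longrightarrow> ereal 1 \<le> Rs_val r"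
proof -
  have le: "ereal (N - real i) \<le> R_val (fps_nth r i)" if "N \<le> real i" for N i
    using that by (intro order_trans[OF _ assms]) simp
  show "r \<in> Rs"
    unfolding Rs_iff
  proof
    fix N :: real
    obtain n where "N \<le> real n" using real_arch_simple by blast
    then have "\<forall>i\<ge>n. ereal (N - real i) \<le> R_val (fps_nth r i)" by (intro allI impI le) simp
    then show "\<exists>n. \<forall>i\<ge>n. ereal (N - real i) \<le> R_val (fps_nth r i)" by blast
  qed
  show "ereal 1 \<le> Rs_val r" if "fps_nth r 0 = 0"
    unfolding Rs_val_ge_iff
  proof
    fix i show "ereal (1 - real i) \<le> R_val (fps_nth r i)" using that le[of 1 i] by (cases i) auto
  qed
qed

lemma real_coeffs_Rs: "real_coeffs r \<Longrightarrow> ereal 0 \<le> R_val (fps_nth r i)" "real_coeffs r \<Longrightarrow> Rs_deg 0 r"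
proof -
  have "ereal 0 \<le> R_val (fps_nth r i) \<and> R_deg 0 (fps_nth r i)" if rc: "real_coeffs r" for i
  proof -
    obtain q where "fps_nth r i = fls_const q" using rc unfolding real_coeffs_def by blast
    then show ?thesis by (simp only: fls_const_val simp_thms)
  qed
  then show "real_coeffs r \<Longrightarrow> ereal 0 \<le> R_val (fps_nth r i)" "real_coeffs r \<Longrightarrow> Rs_deg 0 r"
    unfolding Rs_deg_def by blast+
qed

lemma XY_val: "ereal 0 \<le> End_val X_b" "ereal 0 \<le> End_val Y_b" "End_deg 1 X_b" "End_deg 1 Y_b"
proof -
  note h = half_R(1)
  have "ereal (snd \<zeta> / 2) \<le> S_val \<zeta> (hS * z1) \<and> ereal (- snd \<zeta> / 2) \<le> S_val \<zeta> hS" if \<zeta>: "\<zeta> \<in> zetas" for \<zeta>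
  proof -
    note s = zetas_sum[OF \<zeta>]
    have pos: "0 < snd \<zeta>" using \<zeta> by (auto simp: zetas_def)
    have 1: "ereal 0 \<le> S_val \<zeta> hS" unfolding hS_def h by (rule S_val_const[OF s fls_const_val(1)])
    have "ereal (0 + snd \<zeta>) \<le> S_val \<zeta> (hS * z1)" by (rule S_val_mult[OF s 1 S_val_z(2)[OF s]])
    moreover have "ereal (snd \<zeta> / 2) \<le> ereal (0 + snd \<zeta>)" "ereal (- snd \<zeta> / 2) \<le> ereal 0" using pos by simp_all
    ultimately show ?thesis using 1 by (meson order_trans)
  qed
  then show "ereal 0 \<le> End_val X_b" "ereal 0 \<le> End_val Y_b"
    unfolding End_val_ge_iff mx_ge_def mx_XY using S_val_uminus[OF zetas_sum] by auto
  have "S_deg 0 hS" unfolding hS_def h by (rule S_deg_gens(1)[OF fls_const_val(2)])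
  moreover from this have "S_deg (0 + 2) (hS * z1)" by (rule S_deg_mult[OF _ S_deg_gens(3)])
  ultimately show "End_deg 1 X_b" "End_deg 1 Y_b"
    by (simp_all add: End_deg_iff mx_XY S_deg_0 S_deg_uminus)
qed

lemma bb_props: "bb \<in> Ends" "Ends_deg 1 bb" "ereal 1 \<le> Ends_val bb"
proof -
  have AB: "A_s \<in> Rs" "B_s \<in> Rs" "ereal 1 \<le> Rs_val A_s" "ereal 1 \<le> Rs_val B_s"
    using Rs_of_nonneg real_coeffs_Rs(1) real_coeffs_AB by blast+
  show "bb \<in> Ends" unfolding bb_def by (intro Ends_diff Ends_mult Rs_id_Ends AB Ends_const)
  have "Ends_deg (0 + 1) (Rs_id A_s * fps_const X_b)" "Ends_deg (0 + 1) (Rs_id B_s * fps_const Y_b)"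
    using real_coeffs_Rs(2) real_coeffs_AB
    by (intro Ends_deg_mult Ends_deg_const XY_val; simp add: Ends_deg_def Rs_deg_def End_deg_const)+
  then show "Ends_deg 1 bb" unfolding bb_def by (simp add: Ends_deg_diff)
  show "ereal 1 \<le> Ends_val bb"
    unfolding bb_def
    using Ends_val_mult_ge[OF Ends_val_Rs_id_ge[OF AB(3)] Ends_val_const_ge[OF XY_val(1)]]
      Ends_val_mult_ge[OF Ends_val_Rs_id_ge[OF AB(4)] Ends_val_const_ge[OF XY_val(2)]]
    by (intro Ends_val_diff_ge) simp_all
qed

lemma bb_letter: "(1, bb) \<in> letters"
  using bb_props by (simp add: letters_def)

lemma cc_props: "cc \<in> Rs" "Rs_deg 2 cc" "ereal 1 \<le> Rs_val cc"
proof -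
  have c: "fps_nth cc i = - (fps_nth A_s i * T_half)" for i by (simp add: cc_def A_s_def algebra_simps)
  have v: "ereal 0 \<le> R_val (fps_nth cc i)" for i
  proof -
    have "ereal 0 + ereal (1 / 2) \<le> R_val (fps_nth A_s i) + R_val T_half"
      by (intro add_mono real_coeffs_Rs real_coeffs_AB R_val_T_half)
    moreover have "ereal 0 \<le> ereal 0 + ereal (1 / 2)" by simp
    ultimately show ?thesis unfolding c R_val_uminus R_val_mult by (rule order_trans[rotated])
  qed
  show "cc \<in> Rs" "ereal 1 \<le> Rs_val cc"
    using Rs_of_nonneg[of cc, OF v] by (auto simp: c real_coeffs_AB)
  have "R_deg (0 + 2) (fps_nth A_s i * T_half)" for i
    using real_coeffs_Rs(2)[OF real_coeffs_AB(1)] by (intro R_deg_mult R_deg_T_half) (simp add: Rs_deg_def)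
  then show "Rs_deg 2 cc" unfolding Rs_deg_def c by (simp add: R_deg_uminus)
qed

theorem bb_MC_hat: "bb \<in> MC_hat cc"
proof -
  have "0 < ereal 1" by simp
  then have "0 < Rs_val cc" "0 < Ends_val bb" using cc_props(3) bb_props(3) by (blast intro: less_le_trans)+
  then show ?thesis using bb_props cc_props bb_MC by (simp add: MC_hat_def)
qed

text \<open>A word in an infinite sum carries no coefficient, so the factor 1/k sits in the head
  letter; \<open>ew 0\<close> is the summand id of exp(b).\<close>

definition ew :: "nat \<Rightarrow> letter list" where
  "ew k = (if k = 0 then [(0, 1)]
     else (1, Rs_id (fps_const (fls_const (1 / real k))) * bb) # replicate (k - 1) (1, bb))"

lemma one_letter: "(0, 1) \<in> letters"
proof -
  have "1 = fps_const (End_const 1)" by (simp add: End_const_hom)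
  then show ?thesis
    using Ends_const[of "End_const 1"] Ends_deg_const[OF End_deg_const[OF R_deg_T_half(3)]] by (simp add: letters_def)
qed

lemma const_Rs: "fps_const (fls_const q) \<in> Rs" "Rs_deg 0 (fps_const (fls_const q))" "ereal 0 \<le> Rs_val (fps_const (fls_const q))"
proof -
  have rc: "real_coeffs (fps_const (fls_const q))"
    unfolding real_coeffs_def by (auto intro: exI[of _ 0])
  show "fps_const (fls_const q) \<in> Rs" "Rs_deg 0 (fps_const (fls_const q))"
    using Rs_of_nonneg(1) real_coeffs_Rs[OF rc] by blast+
  show "ereal 0 \<le> Rs_val (fps_const (fls_const q))"
    unfolding Rs_val_ge_iff by (intro allI order_trans[OF _ real_coeffs_Rs(1)[OF rc]]) simp
qed

lemma word_val_ge: "(\<And>x. x \<in> set w \<Longrightarrow> ereal 1 \<le> Ends_val (snd x)) \<Longrightarrow> ereal (real (length w)) \<le> word_val w"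
proof (induction w)
  case (Cons x w)
  then have "ereal 1 + ereal (real (length w)) \<le> Ends_val (snd x) + word_val w" by (intro add_mono) auto
  then show ?case by (simp add: word_val_simps add.commute)
qed (simp add: word_val_simps zero_ereal_def)

lemma ew_words: "ew k \<in> words" "k \<noteq> 0 \<Longrightarrow> ereal (real k) \<le> word_val (ew k)"
proof -
  show "ew k \<in> words"
    using Rs_letter[OF const_Rs(1,2) bb_letter, of "1 / real k"] bb_letter one_letter
    by (auto simp: ew_def words_def)
  assume k: "k \<noteq> 0"
  have "ereal (0 + 1) \<le> Ends_val (Rs_id (fps_const (fls_const (1 / real k))) * bb)"
    by (rule Ends_val_mult_ge[OF Ends_val_Rs_id_ge[OF const_Rs(3)] bb_props(3)])
  then have "ereal 1 \<le> Ends_val (snd x)" if "x \<in> set (ew k)" for x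
    using that k bb_props(3) by (auto simp: ew_def split: if_splits)
  then have "ereal (real (length (ew k))) \<le> word_val (ew k)" by (rule word_val_ge)
  then show "ereal (real k) \<le> word_val (ew k)" using k by (simp add: ew_def)
qed

lemma tendsto_infty_nat: "(\<And>k. k \<ge> m \<Longrightarrow> ereal (real k) \<le> F k) \<Longrightarrow> F \<longlonglongrightarrow> \<infinity>"
  unfolding Lim_PInfty
proof
  fix r assume F: "\<And>k. k \<ge> m \<Longrightarrow> ereal (real k) \<le> F k"
  obtain n where "r \<le> real n" using real_arch_simple by blast
  then have "ereal r \<le> F k" if "k \<ge> max m n" for k
    using that by (intro order_trans[OF _ F]) auto
  then show "\<exists>N. \<forall>n\<ge>N. ereal r \<le> F n" by blast
qed

lemma ew_lim: "(\<lambda>k. word_val (ew k)) \<longlonglongrightarrow> \<infinity>"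
  by (rule tendsto_infty_nat[of 1]) (use ew_words(2) in auto)

definition En :: "nat \<Rightarrow> chain" where "En n = (\<Sum>j<Suc n. frag_of (ew j))"

lemma En_cauchy: "cauchy_chain En"
  using sum_words_cauchy[OF ew_words(1) ew_lim] unfolding cauchy_chain_def En_def
  by (meson Suc_le_mono le_SucI)

lemma exp_cc_En: "exp_cc bb = lam_of En"
proof -
  have "frag_of [(0, 1)] + (\<Sum>k=1..n. frag_of ((1, Rs_id (fps_const (fls_const (1 / real k))) * bb) # replicate (k - 1) (1, bb))) = En n" for n
    unfolding En_def sum.lessThan_Suc_shift by (simp add: ew_def sum.atLeast1_atMost_eq)
  then show ?thesis by (simp only: exp_cc_def)
qed


section \<open>Evaluation at parameter 1 and the logarithm series\<close>

section \<open>The value of \<open>\<Theta>\<close>\<close>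

context side
begin

lemma fps_map_emb_mult: "fps_map emb (F * G) = fps_map emb F * fps_map emb G"
proof (rule fps_ext)
  have s: "emb (sum f I) = (\<Sum>i\<in>I. emb (f i))" for f and I :: "nat set"
    by (induction I rule: infinite_finite_induct) (simp_all add: emb_hom)
  show "fps_nth (fps_map emb (F * G)) n = fps_nth (fps_map emb F * fps_map emb G) n" for n
    by (simp add: fps_mult_nth s emb_hom)
qed

lemma fps_map_emb_1: "fps_map emb 1 = 1"
  by (rule fps_ext) (simp add: emb_hom)

lemma rr21_Rs_id: "rr21 (Rs_id r) = 0"
  using arg_cong[OF rho_Rs[of r], of m21] by (simp add: rho_def)

lemma poly1_R: "w \<noteq> [] \<Longrightarrow> \<exists>x\<in>set w. snd x \<in> Rs_id ` Rs \<Longrightarrow> poly (bod (PP w)) 1 = 0"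
proof -
  assume w: "w \<noteq> []" and "\<exists>x\<in>set w. snd x \<in> Rs_id ` Rs"
  then obtain x r where x: "x \<in> set w" "snd x = Rs_id r" by blast
  have "0 \<in> (\<lambda>x. rr21 (snd x) * fps_const iq) ` set w"
    by (rule image_eqI[OF _ x(1)]) (simp add: x(2) rr21_Rs_id)
  then show "poly (bod (PP w)) 1 = 0" by (simp add: poly1_bod_PP[OF w] prod_list_zero_iff)
qed

lemma m21_bb: "m21 (mx (fps_nth bb i)) = S_const (fps_nth be_s i)"
proof -
  have be: "be_s = (- A_s - B_s) * fps_const (1 / 2)"
  proof -
    have "- A_s - B_s = (1 - fps_exp (- 1)) * 2" by (simp add: A_s_def B_s_def)
    moreover have "2 * fps_const (1 / 2) = (1 :: R fps)"
      by (simp only: fps_numeral_fps_const fps_const_mult times_divide_eq_right mult_1_right divide_self[OF half_R(2)] fps_const_1_eq_1)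
    ultimately show ?thesis by (simp only: be_s_def mult.assoc mult_1_right)
  qed
  have "fps_nth bb i = End_const (fps_nth A_s i) * X_b - End_const (fps_nth B_s i) * Y_b" by (simp add: bb_def)
  then have "m21 (mx (fps_nth bb i)) = S_const (fps_nth A_s i) * - hS - S_const (fps_nth B_s i) * hS"
    by (simp add: mx_hom mx_const mx_XY)
  also have "\<dots> = S_const ((- fps_nth A_s i - fps_nth B_s i) * (1 / 2))"
    by (simp only: S_const_hom hS_def mult_minus_right mult_minus_left left_diff_distrib)
  finally show ?thesis unfolding be by (simp only: fps_mult_right_const_nth fps_sub_nth fps_neg_nth)
qed

lemma rr21_bb: "rr21 (Rs_id (fps_const r) * bb) = fps_map emb (fps_const r * be_s) * fps_const (tx c 0)"
  unfolding rr21_def Rs_id_const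
  by (rule arg_cong[of _ _ "\<lambda>u. u * fps_const (tx c 0)"], rule fps_ext)
    (simp add: mx_hom mx_const m21_bb iota_hom iota_gens emb_hom)

lemma poly1_ew:
  assumes "m \<noteq> 0"
  shows "poly (bod (PP (ew m))) 1 = - (fps_map emb (fps_const (fls_const (1 / real m)) * be_s ^ m) * fps_const ((tx c 0 * iq) ^ m))"
proof -
  let ?z = "fps_const (tx c 0 * iq)"
  obtain l where m: "m = Suc l" using assms by (cases m) auto
  have k: "rr21 (Rs_id (fps_const r) * bb) * fps_const iq = fps_map emb (fps_const r * be_s) * ?z" for r
    by (simp only: rr21_bb mult.assoc fps_const_mult)
  have "Rs_id (fps_const 1) * bb = bb" by (simp add: Rs_id_hom)
  then have b: "rr21 bb * fps_const iq = fps_map emb be_s * ?z"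
    using k[of 1] by simp
  have p: "(fps_map emb be_s * ?z) ^ l = fps_map emb (be_s ^ l) * fps_const ((tx c 0 * iq) ^ l)" for l
    by (induction l) (simp_all add: fps_map_emb_1 fps_map_emb_mult fps_const_mult[symmetric] mult_ac del: fps_const_mult)
  have ne: "ew m \<noteq> []" by (simp add: ew_def)
  have "poly (bod (PP (ew m))) 1
      = - (fps_map emb (fps_const (fls_const (1 / real m)) * be_s) * ?z * (fps_map emb be_s * ?z) ^ l)"
    unfolding poly1_bod_PP[OF ne] by (simp add: ew_def m k b)
  then show ?thesis
    unfolding p unfolding m by (simp add: fps_map_emb_mult fps_const_mult[symmetric] mult_ac del: fps_const_mult)
qed

lemma poly1_lin_sum: "poly (bod (lin PP (\<Sum>j\<in>J. frag_of (w j)))) 1 = (\<Sum>j\<in>J. poly (bod (PP (w j))) 1)"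
  by (induction J rule: infinite_finite_induct) (simp_all add: lin_add bod_simps)

lemma poly1_chain:
  assumes "\<And>j. v j \<noteq> [] \<and> (\<exists>x\<in>set (v j). snd x \<in> Rs_id ` Rs)"
  shows "poly (bod (lin PP ((\<Sum>j<n. frag_of (v j)) - En n))) 1
    = (\<Sum>m=1..n. fps_map emb (fps_const (fls_const (1 / real m)) * be_s ^ m) * fps_const ((tx c 0 * iq) ^ m))"
proof -
  have "1 \<in> Rs" using const_Rs(1)[of 1] by simp
  then have "(1 :: End_M fps) \<in> Rs_id ` Rs" by (rule rev_image_eqI) (simp add: Rs_id_hom)
  then have "poly (bod (PP (ew 0))) 1 = 0" by (intro poly1_R) (simp_all add: ew_def)
  then have "poly (bod (lin PP (En n))) 1 = (\<Sum>m<n. poly (bod (PP (ew (Suc m)))) 1)"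
    unfolding En_def unfolding poly1_lin_sum unfolding sum.lessThan_Suc_shift by simp
  moreover have "poly (bod (lin PP (\<Sum>j<n. frag_of (v j)))) 1 = 0"
    unfolding poly1_lin_sum using poly1_R assms by (intro sum.neutral) blast
  ultimately show ?thesis
    unfolding lin_diff bod_simps poly_diff
    by (simp only: poly1_ew[OF nat.distinct(2)] sum_negf One_nat_def sum.atLeast1_atMost_eq diff_0 minus_minus)
qed

end

lemma fil_emb: "fil wx 0 (fps_map emb F)"
  unfolding fil_def by (auto simp: emb_nth wt_of_def wx_def split: if_splits)

lemma fil_const_power: "fil w 0 (fps_const X) \<Longrightarrow> fil w 0 (fps_const (X ^ m))"
proof (induction m)
  case (Suc m)
  then show ?case using fil_const_mult[of w 0 X 0 "X ^ m"] by simp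
qed (simp add: fil_1)

text \<open>At the inner end the factor per letter, T^(1/2) times the inverse entry of D, is
  divisible by x.\<close>

lemma ct_inner:
  assumes "m \<noteq> 0"
  shows "ct (fps_map emb F * fps_const ((tx 1 0 * - (tx 0 1 * Bi)) ^ m)) i k = 0"
proof -
  obtain l where m: "m = Suc l" using assms by (cases m) auto
  have B0: "fil wx 0 (fps_const Bi)" by (simp add: fil_AB)
  have e: "tx 1 0 * - (tx 0 1 * Bi) = - (tx 1 1 * Bi)"
    by (simp add: mult.assoc[symmetric] tx_mult)
  have "fil wx (1 + 0) (fps_const (tx 1 1 * Bi))"
    using fil_tx_x[of 1 1] by (intro fil_const_mult B0) simp
  then have 1: "fil wx 1 (fps_const (- (tx 1 1 * Bi)))" using fil_uminus by fastforce
  then have 0: "fil wx 0 (fps_const (- (tx 1 1 * Bi)))" by (rule fil_mono) simp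
  have "fil wx (0 + (1 + 0)) (fps_map emb F * fps_const (- (tx 1 1 * Bi) * (- (tx 1 1 * Bi)) ^ l))"
    by (intro fil_mult fil_emb fil_const_mult 1 fil_const_power 0)
  then show ?thesis unfolding m e by (intro ct_fil_x) (simp only: power_Suc, simp)
qed

text \<open>At the outer end the inverse entry of D is 1 modulo x, so all its powers have constant
  term 1.\<close>

lemma ct_outer: "ct (fps_map emb F * fps_const (Bi ^ m)) i k = fps_nth F i $$ k"
proof -
  have B0: "fil wx 0 (fps_const Bi)" by (simp add: fil_AB)
  have "Bi - tx 1 1 * Bi = 1" using Bi by (simp only: left_diff_distrib mult_1)
  moreover have "Bi - (Bi - tx 1 1 * Bi) = tx 1 1 * Bi" by simp
  ultimately have "Bi - 1 = tx 1 1 * Bi" by (simp only:)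
  then have B1: "fil wx (1 + 0) (fps_const (Bi - 1))"
    using fil_const_mult[OF _ B0, of 1 "tx 1 1"] fil_tx_x[of 1 1] by simp
  have "fil wx 1 (fps_const (Bi ^ m - 1))"
  proof (induction m)
    case (Suc m)
    have "Bi ^ Suc m - 1 = (Bi - 1) * Bi ^ m + (Bi ^ m - 1)" by (simp add: algebra_simps)
    then have e: "fps_const (Bi ^ Suc m - 1) = fps_const ((Bi - 1) * Bi ^ m) + fps_const (Bi ^ m - 1)" by simp
    have "fil wx (1 + 0 + 0) (fps_const ((Bi - 1) * Bi ^ m))" by (intro fil_const_mult B1 fil_const_power B0)
    then show ?case unfolding e using Suc by (intro fil_add) simp_all
  qed (simp add: fil_0)
  then have "fil wx (0 + 1) (fps_map emb F * fps_const (Bi ^ m - 1))" by (intro fil_mult fil_emb)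
  then have "ct (fps_map emb F * fps_const (Bi ^ m - 1)) i k = 0" by (intro ct_fil_x) simp
  moreover have "fps_map emb F * fps_const (Bi ^ m - 1) = fps_map emb F * fps_const (Bi ^ m) - fps_map emb F"
    by (simp add: right_diff_distrib flip: fps_const_sub)
  ultimately have "ct (fps_map emb F * fps_const (Bi ^ m)) i k = ct (fps_map emb F) i k" by (simp add: ct_simps)
  then show ?thesis by (simp add: ct_def emb_nth)
qed

lemma lin_Theta:
  assumes "x \<in> word_chains"
  shows "fps_nth (lin Theta_word x) i $$ k = - (ct (coeff (bod (lin out.PP x)) 0) i k - ct (coeff (bod (lin inn.PP x)) 0) i k)"
  using assms
proof (induction rule: chains_induct)
  case zero
  show ?case by (simp add: bod_simps ct_simps)
next
  case (word w)
  then have "w \<noteq> []" by (simp add: words_def)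
  then show ?case by (simp add: Theta_word_nth)
next
  case (diff x y)
  then show ?case by (simp add: lin_diff bod_simps ct_simps)
qed

lemma small_subset_chains: "x \<in> small N \<Longrightarrow> x \<in> word_chains"
proof (induction rule: small.induct)
  case (additive u d a v a')
  have "(d, a + a') \<in> letters" using additive by (auto simp: words_append_Cons letters_def Ends_add Ends_deg_add)
  then show ?case using additive by (intro chains_diff chains_of) (auto simp: words_append_Cons)
next
  case (balanced r e u d a v d' a' w)
  then have "(d + e, Rs_id r * a) \<in> letters" "(d' + e, Rs_id r * a') \<in> letters"
    by (auto intro!: Rs_letter simp: words_append_Cons)
  then show ?case using balanced by (intro chains_diff chains_of) (auto simp: words_append_Cons)
qed (auto intro: chains_0 chains_diff chains_of)

text \<open>These are partial sums of - log(1 - beta) with 1 - beta = exp(-s). As beta' = 1 - beta,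
  their derivative telescopes to 1 - beta^n, which agrees with 1 below order n.\<close>

lemma log_series:
  "i \<le> n \<Longrightarrow> fps_nth (\<Sum>m=1..n. fps_const (fls_const (1 / real m)) * be_s ^ m) i = fps_nth fps_X i"
proof -
  assume i: "i \<le> n"
  let ?L = "\<lambda>n. \<Sum>m=1..n. fps_const (fls_const (1 / real m)) * be_s ^ m"
  have b0: "fps_nth be_s 0 = 0" by (simp add: be_s_def)
  have "fps_const (- 1) = (- 1 :: R fps)" by (simp only: fps_const_neg[symmetric] fps_const_1_eq_1)
  then have db: "fps_deriv be_s = 1 - be_s"
    by (simp only: be_s_def fps_deriv_sub fps_deriv_1 fps_exp_deriv) simp
  have D: "fps_deriv (?L n) = 1 - be_s ^ n" for n
  proof (induction n)
    case (Suc n)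
    have "fls_const (1 / real (Suc n)) * of_nat (Suc n) = (1 :: R)"
      unfolding fls_of_nat fls_const_mult_const by (simp del: of_nat_Suc)
    then have c: "fps_const (fls_const (1 / real (Suc n))) * fps_const (of_nat (Suc n)) = (1 :: R fps)"
      by (simp only: fps_const_mult fps_const_1_eq_1)
    have "fps_deriv (fps_const (fls_const (1 / real (Suc n))) * be_s ^ Suc n)
      = (fps_const (fls_const (1 / real (Suc n))) * fps_const (of_nat (Suc n))) * ((1 - be_s) * be_s ^ n)"
      unfolding fps_deriv_mult_const_left fps_deriv_power db by (simp only: mult.assoc diff_Suc_1)
    also have "\<dots> = be_s ^ n - be_s ^ Suc n" unfolding c by (simp add: left_diff_distrib)
    finally show ?case using Suc.IH by (simp only: sum.cl_ivl_Suc) (simp add: fps_deriv_add)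
  qed simp
  show ?thesis
  proof (cases i)
    case 0
    have "fps_nth (be_s ^ m) 0 = 0" if "m \<ge> 1" for m using that b0 by (simp add: fps_nth_power_0 power_0_left)
    then have "fps_nth (fps_const (fls_const (1 / real m)) * be_s ^ m) 0 = 0" if "m \<in> {1..n}" for m
      using that by (simp only: fps_mult_left_const_nth atLeastAtMost_iff mult_zero_right)
    then have "(\<Sum>m=1..n. fps_nth (fps_const (fls_const (1 / real m)) * be_s ^ m) 0) = 0" by (intro sum.neutral ballI)
    then show ?thesis unfolding 0 fps_sum_nth by simp
  next
    case (Suc j)
    then have "fps_nth (be_s ^ n) j = 0" using startsby_zero_power_prefix[OF b0, of n] i by auto
    then have "of_nat (Suc j) * fps_nth (?L n) (Suc j) = fps_nth 1 j"
      using arg_cong[OF D[of n], of "\<lambda>F. fps_nth F j"] by (simp only: fps_deriv_nth fps_sub_nth diff_0_right Suc_eq_plus1)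
    then have "of_nat (Suc j) * fps_nth (?L n) (Suc j) = of_nat (Suc j) * fps_nth fps_X (Suc j)"
      by (cases j) (simp_all add: fps_X_nth del: fps_sum_nth of_nat_Suc)
    then show ?thesis unfolding Suc mult_cancel_left by (simp del: of_nat_Suc fps_sum_nth)
  qed
qed

theorem Theta_value:
  assumes "exp_correction bb y"
  shows "Theta (exp_cc bb - y) = fps_X"
proof -
  have "y \<in> R_lam" "d_cc y - d_cc (exp_cc bb) \<in> C_lam_Rs" using assms by (simp_all add: exp_correction_def)
  then obtain v u where y: "y = lam_of (\<lambda>n. \<Sum>j<n. frag_of (v j))"
    and v: "range v \<subseteq> {w. \<exists>x\<in>set w. snd x \<in> Rs_id ` Rs} \<inter> words" "(\<lambda>j. word_val (v j)) \<longlonglongrightarrow> \<infinity>"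
    and dy: "d_cc y - d_cc (exp_cc bb) = lam_of (\<lambda>n. \<Sum>j<n. frag_of (u j))"
    and u: "range u \<subseteq> scalar_words \<inter> words" "(\<lambda>j. word_val (u j)) \<longlonglongrightarrow> \<infinity>"
    unfolding R_lam_def C_lam_Rs_def infinite_sums_def scalar_words_def[symmetric] by blast
  let ?Y = "\<lambda>n. \<Sum>j<n. frag_of (v j)" and ?U = "\<lambda>n. \<Sum>j<n. frag_of (u j)"
  have "v j \<in> {w. \<exists>x\<in>set w. snd x \<in> Rs_id ` Rs} \<inter> words" for j using v(1) rangeI by (rule subsetD)
  then have vw: "v j \<in> words" "\<exists>x\<in>set (v j). snd x \<in> Rs_id ` Rs" for j by blast+
  have uw: "u j \<in> words" "u j \<in> scalar_words" for j using u(1) by auto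
  have Y: "cauchy_chain ?Y" and U: "cauchy_chain ?U"
    by (rule sum_words_cauchy[OF vw(1) v(2)], rule sum_words_cauchy[OF uw(1) u(2)])
  have "d_cc y - d_cc (exp_cc bb) = lam_of (\<lambda>n. d_chain (?Y n) - d_chain (En n))"
    unfolding y exp_cc_En d_cc_lam_of[OF Y] d_cc_lam_of[OF En_cauchy]
    by (rule lam_of_diff[OF d_chain_cauchy[OF Y] d_chain_cauchy[OF En_cauchy]])
  then have "lam_of (\<lambda>n. d_chain (?Y n) - d_chain (En n)) = lam_of ?U" using dy by (simp only:)
  note close = lam_of_eqD[OF cauchy_chain_diff[OF d_chain_cauchy[OF Y] d_chain_cauchy[OF En_cauchy]] U this]
  have chY: "?Y n \<in> word_chains" and chE: "En n \<in> word_chains" for n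
    using Y En_cauchy unfolding cauchy_chain_def by blast+
  have E: "exp_cc bb - y = lam_of (\<lambda>n. En n - ?Y n)"
    unfolding y exp_cc_En by (rule lam_of_diff[OF En_cauchy Y])
  have vR: "v j \<noteq> [] \<and> (\<exists>x\<in>set (v j). snd x \<in> Rs_id ` Rs)" for j using vw[of j] by (simp add: words_def)
  show ?thesis
    unfolding E
  proof (rule Theta_lam_of[OF cauchy_chain_diff[OF En_cauchy Y]])
    have "real_coeffs fps_X"
      unfolding real_coeffs_def by (auto simp: fps_X_nth intro: exI[of _ 1] exI[of _ 0])
    then show "fps_X \<in> Rs" using Rs_of_nonneg(1) real_coeffs_Rs(1) by blast
  next
    fix N x i and k :: int
    assume x: "x \<in> small N" and lt: "real i + real_of_int k / 2 < N"
    have "ct (coeff (bod (lin out.PP x)) 0) i k = 0" "ct (coeff (bod (lin inn.PP x)) 0) i k = 0"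
      using sfil_bod[OF out.lin_PP_small[OF x]] sfil_bod[OF inn.lin_PP_small[OF x]] ct_fil_val[OF _ lt]
      unfolding pfil_def by blast+
    then show "fps_nth (lin Theta_word x) i $$ k = 0"
      by (simp add: lin_Theta[OF small_subset_chains[OF x]])
  next
    fix x assume x: "x \<in> word_chains"
    show "lin Theta_word (t_chain x) = lin Theta_word x"
      by (intro fps_ext fls_eqI)
        (simp only: lin_Theta[OF x] lin_Theta[OF t_chain_chains[OF x]] out.lin_PP_t[OF x] inn.lin_PP_t[OF x])
  next
    fix i and k :: int
    define N where "N = real i + real_of_int k / 2 + 1"
    obtain n0 where n0: "\<And>n. n \<ge> n0 \<Longrightarrow> \<exists>z\<in>word_chains. d_chain (?Y n) - d_chain (En n) - ?U n - (z - t_chain z) \<in> small N"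
      using close[of N] by blast
    have "fps_nth (lin Theta_word (En n - ?Y n)) i $$ k = fps_nth fps_X i $$ k" if n: "n \<ge> max n0 i" for n
    proof -
      obtain z where z: "z \<in> word_chains" "d_chain (?Y n) - d_chain (En n) - ?U n - (z - t_chain z) \<in> small N"
        using n0[of n] n by auto
      \<comment> \<open>The order y minus exp(b) matches the boundary condition in
        \<open>exp_correction\<close>; the minus sign in \<Theta> restores the value.\<close>
      let ?x = "?Y n - En n"
      have x: "?x \<in> word_chains" by (rule chains_diff[OF chY chE])
      have dx: "d_chain ?x - ?U n - (z - t_chain z) \<in> small N" using z(2) by (simp only: d_chain_lin)
      have lt: "real i + real_of_int k / 2 < N" by (simp add: N_def)
      have "ct (coeff (bod (lin out.PP ?x)) 0) i k = ct (poly (bod (lin out.PP ?x)) 1) i k"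
        by (rule out.homotopy[OF x z(1) uw(2) dx lt])
      also have "\<dots> = fps_nth (\<Sum>m=1..n. fps_const (fls_const (1 / real m)) * be_s ^ m) i $$ k"
        unfolding out.poly1_chain[OF vR] ct_sum fps_sum_nth fls_nth_sum by (simp add: ct_outer)
      also have "\<dots> = fps_nth fps_X i $$ k" using log_series[of i n] n by simp
      finally have o: "ct (coeff (bod (lin out.PP ?x)) 0) i k = fps_nth fps_X i $$ k" .
      have "ct (coeff (bod (lin inn.PP ?x)) 0) i k = ct (poly (bod (lin inn.PP ?x)) 1) i k"
        by (rule inn.homotopy[OF x z(1) uw(2) dx lt])
      also have "\<dots> = 0"
        unfolding inn.poly1_chain[OF vR] ct_sum by (rule sum.neutral) (use ct_inner in auto)
      finally have i: "ct (coeff (bod (lin inn.PP ?x)) 0) i k = 0" .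
      have "lin Theta_word (En n - ?Y n) = - lin Theta_word ?x" by (simp add: lin_diff)
      then show ?thesis by (simp add: lin_Theta[OF x] o i)
    qed
    then show "\<exists>n0. \<forall>n\<ge>n0. fps_nth (lin Theta_word (En n - ?Y n)) i $$ k = fps_nth fps_X i $$ k" by blast
  qed
qed


section \<open>Boundaries of block words\<close>

section \<open>Words built from blocks\<close>

text \<open>The list \<open>[k_1, k_2, \<dots>]\<close> stands for the word $b\otimes\mathrm{id}^{\otimes 2k_1}\otimes b\otimes\mathrm{id}^{\otimes 2k_2}\otimes\cdots$\<close>

definition wd :: "nat list \<Rightarrow> letter list" where
  "wd ks = concat (map (\<lambda>k. (1, bb) # replicate (2 * k) (0, 1)) ks)"

lemma wd_simps: "wd [] = []" "wd (k # r) = (1, bb) # replicate (2 * k) (0, 1) @ wd r" "wd (r @ s) = wd r @ wd s"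
  by (simp_all add: wd_def)

lemma sdeg_replicate: "sdeg (replicate n (0, 1)) = - int n"
  by (induction n) simp_all

lemma even_sdeg_wd: "even (sdeg (wd r))"
  by (induction r) (simp_all add: wd_simps sdeg_replicate)

lemma block_letters: "set (wd r) \<subseteq> letters" "set (replicate n (0, 1 :: End_M fps)) \<subseteq> letters"
proof -
  show *: "set (replicate n (0, 1 :: End_M fps)) \<subseteq> letters" for n using one_letter by auto
  show "set (wd r) \<subseteq> letters"
    by (induction r) (use * bb_letter in \<open>auto simp: wd_simps\<close>)
qed

lemma word_val_append:
  "ereal a \<le> word_val u \<Longrightarrow> ereal b \<le> word_val v \<Longrightarrow> ereal (a + b) \<le> word_val (u @ v)"
proof -
  assume "ereal a \<le> word_val u" "ereal b \<le> word_val v"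
  then have "ereal a + ereal b \<le> word_val u + word_val v" by (rule add_mono)
  also have "word_val u + word_val v = word_val (u @ v)" by (simp add: word_val_def)
  finally show ?thesis by simp
qed

lemma word_val_Cons_ge:
  "ereal a \<le> Ends_val (snd x) \<Longrightarrow> ereal b \<le> word_val v \<Longrightarrow> ereal (a + b) \<le> word_val (x # v)"
  using word_val_append[of a "[x]" b v] by (simp add: word_val_simps)

lemma one_val: "ereal 0 \<le> Ends_val 1"
  using Ends_val_Rs_id_ge[OF const_Rs(3)[of 1]] by (simp add: Rs_id_hom)

lemma word_val_blocks: "ereal 0 \<le> word_val (replicate n (0, 1))" "ereal (real (length r)) \<le> word_val (wd r)"
proof -
  show *: "ereal 0 \<le> word_val (replicate n (0, 1))" for n
  proof (induction n)
    case (Suc n)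
    then show ?case using word_val_Cons_ge[of 0 "(0, 1)" 0, OF _ Suc.IH] one_val by simp
  qed (simp add: word_val_simps zero_ereal_def)
  show "ereal (real (length r)) \<le> word_val (wd r)"
  proof (induction r)
    case (Cons k r)
    have "ereal (1 + (0 + real (length r))) \<le> word_val ((1, bb) # replicate (2 * k) (0, 1) @ wd r)"
      by (intro word_val_Cons_ge word_val_append * Cons.IH) (simp add: bb_props)
    then show ?case by (simp add: wd_simps)
  qed (simp add: wd_simps word_val_simps zero_ereal_def)
qed

text \<open>The coefficient, a real multiple of a power of c, has to live inside a letter and is put
  into the leading b. The parameter \<open>d\<close> is the degree of \<open>g\<close>.\<close>

fun Hw :: "R fps \<Rightarrow> int \<Rightarrow> nat list \<Rightarrow> letter list" where
  "Hw g d [] = []"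
| "Hw g d (k # r) = (1 + d, Rs_id g * bb) # replicate (2 * k) (0, 1) @ wd r"

lemma Hw_append: "ks \<noteq> [] \<Longrightarrow> Hw g d (ks @ ls) = Hw g d ks @ wd ls"
  by (cases ks) (simp_all add: wd_simps)

lemma length_Hw: "length (Hw g d ks) = length (wd ks)"
  by (cases ks) (simp_all add: wd_simps)

lemma Hw_words: "g \<in> Rs \<Longrightarrow> Rs_deg d g \<Longrightarrow> ks \<noteq> [] \<Longrightarrow> Hw g d ks \<in> words"
  using Rs_letter[OF _ _ bb_letter, of g d] block_letters by (cases ks) (auto simp: words_Cons)

lemma Hw_val: "ereal a \<le> Rs_val g \<Longrightarrow> ks \<noteq> [] \<Longrightarrow> ereal (a + real (length ks)) \<le> word_val (Hw g d ks)"
proof (cases ks)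
  case (Cons k r)
  assume a: "ereal a \<le> Rs_val g"
  have "ereal (a + 1) \<le> Ends_val (Rs_id g * bb)"
    by (rule Ends_val_mult_ge[OF Ends_val_Rs_id_ge[OF a] bb_props(3)])
  then have "ereal ((a + 1) + (0 + real (length r))) \<le> word_val (Hw g d ks)"
    unfolding Cons Hw.simps by (intro word_val_Cons_ge word_val_append word_val_blocks) simp
  then show ?thesis by (simp add: Cons add.assoc)
qed simp

lemma small_cyc_null: "(\<And>M. x \<in> small M) \<Longrightarrow> y \<in> cyc_null N \<Longrightarrow> x + y \<in> cyc_null N"
  by (rule cyc_null_add[OF cyc_null_small])

lemma cyc_null_rotate: "x \<in> word_chains \<Longrightarrow> x \<in> small N \<Longrightarrow> x - tpow p x \<in> cyc_null N"
proof (induction p)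
  case (Suc p)
  have "x - tpow (Suc p) x = (x - tpow p x) + (tpow p x - t_chain (tpow p x))" by simp
  then show ?case
    using Suc cyc_null_add cyc_null_t[OF tpow_chains[OF Suc.prems(1)] tpow_small[OF Suc.prems(2)]] by metis
qed (simp add: cyc_null_0)

lemma sum_lessThan_split: "(\<Sum>p<a + b. F p) = (\<Sum>p<a. F p) + (\<Sum>q<b. F (a + q))" for a b :: nat and F :: "nat \<Rightarrow> chain"
  by (induction b) (simp_all add: add.assoc)

text \<open>Collects the rotations that start at the head or inside the first run of identities; the
  whole boundary is the sum of these chains over the rotations of \<open>ks\<close>.\<close>

definition Bs :: "R fps \<Rightarrow> int \<Rightarrow> nat list \<Rightarrow> chain" where
  "Bs g d ks = (\<Sum>q<Suc (2 * hd ks). Mu1 (tpow q (frag_of (Hw g d ks))) + Mu2 (tpow q (frag_of (Hw g d ks))))"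

lemma Mu_tpow_diff: "x - y \<in> small M \<Longrightarrow>
    (Mu1 (tpow q x) + Mu2 (tpow q x)) - (Mu1 (tpow q y) + Mu2 (tpow q y)) \<in> small M"
proof -
  assume "x - y \<in> small M"
  then have "Mu1 (tpow q (x - y)) + Mu2 (tpow q (x - y)) \<in> small M"
    by (intro small_add Mu1_small Mu2_small tpow_small)
  then show ?thesis by (simp add: tpow_lin frag_extend_diff algebra_simps)
qed

text \<open>Blocks have even shifted degree, so rotating them costs no sign. The scalar travels
  along with its letter and is returned to the new head by a balancing relation.\<close>

lemma rotate_block:
  assumes g: "g \<in> Rs" "Rs_deg d g" "even d" and i: "i < length ks"
  shows "tpow (length (wd (take i ks))) (frag_of (Hw g d ks)) - frag_of (Hw g d (drop i ks @ take i ks)) \<in> small M"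
proof (cases i)
  case 0
  then show ?thesis by (simp add: wd_simps small.zero)
next
  case (Suc j)
  have d: "drop i ks = ks ! i # drop (Suc i) ks" using Cons_nth_drop_Suc[OF i] by simp
  obtain k r where t: "take i ks = k # r" using i Suc by (cases "take i ks") auto
  have "Hw g d ks = Hw g d (take i ks) @ wd (drop i ks)"
    using Hw_append[of "take i ks" g d "drop i ks"] unfolding append_take_drop_id by (simp only: t list.distinct not_False_eq_True)
  moreover have "even (sdeg (wd (drop i ks)))" by (rule even_sdeg_wd)
  ultimately have 1: "tpow (length (wd (take i ks))) (frag_of (Hw g d ks)) = frag_of (wd (drop i ks) @ Hw g d (take i ks))"
    using tpow_frag_of'[OF length_Hw] by (simp add: psign_def)
  let ?v = "replicate (2 * (ks ! i)) (0, 1) @ wd (drop (Suc i) ks)" and ?w = "replicate (2 * k) (0, 1) @ wd r"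
  have l: "(1 + d, Rs_id g * bb) \<in> letters" by (rule Rs_letter[OF g(1,2) bb_letter])
  have "frag_of ([] @ (1 + d, Rs_id g * bb) # ?v @ (1, bb) # ?w) - frag_of ([] @ (1, bb) # ?v @ (1 + d, Rs_id g * bb) # ?w) \<in> small M"
    using l bb_letter block_letters by (intro small.balanced[OF g]) (auto simp: words_Cons)
  then have "- (frag_of ([] @ (1 + d, Rs_id g * bb) # ?v @ (1, bb) # ?w) - frag_of ([] @ (1, bb) # ?v @ (1 + d, Rs_id g * bb) # ?w)) \<in> small M"
    by (rule small_uminus)
  then show ?thesis unfolding 1 unfolding d t by (simp add: wd_simps)
qed

lemma d_Hw:
  assumes g: "g \<in> Rs" "Rs_deg d g" "even d" and ks: "ks \<noteq> []" and small: "frag_of (Hw g d ks) \<in> small N"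
  shows "d_chain (frag_of (Hw g d ks)) - (\<Sum>i<length ks. Bs g d (drop i ks @ take i ks)) \<in> cyc_null N"
proof -
  let ?h = "frag_of (Hw g d ks)" and ?l = "\<lambda>i. length (wd (take i ks))"
  let ?M = "\<lambda>x. Mu1 x + Mu2 x"
  have step: "(\<Sum>p<?l i. ?M (tpow p ?h)) - (\<Sum>j<i. Bs g d (drop j ks @ take j ks)) \<in> small M0" if "i \<le> length ks" for M0 i
    using that
  proof (induction i)
    case 0
    show ?case by (simp add: wd_simps small.zero)
  next
    case (Suc i)
    then have i: "i < length ks" by simp
    have l: "?l (Suc i) = ?l i + Suc (2 * (ks ! i))" using i by (simp add: take_Suc_conv_app_nth wd_simps)
    have hd: "hd (drop i ks @ take i ks) = ks ! i" using i by (simp add: hd_append hd_drop_conv_nth)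
    have "tpow (?l i + q) ?h = tpow q (tpow (?l i) ?h)" for q by (simp add: funpow_add add.commute)
    then have "(\<Sum>p<?l (Suc i). ?M (tpow p ?h)) = (\<Sum>p<?l i. ?M (tpow p ?h)) + (\<Sum>q<Suc (2 * (ks ! i)). ?M (tpow q (tpow (?l i) ?h)))"
      unfolding l sum_lessThan_split by simp
    moreover have "(\<Sum>q<Suc (2 * (ks ! i)). ?M (tpow q (tpow (?l i) ?h))) - Bs g d (drop i ks @ take i ks) \<in> small M0"
      unfolding Bs_def hd sum_subtractf[symmetric] by (intro small_sum Mu_tpow_diff rotate_block[OF g i])
    ultimately show ?case
      using small_add[OF Suc.IH] i by (fastforce simp: algebra_simps)
  qed
  obtain z where z: "z \<in> word_chains" "z \<in> small N"
    "d_chain ?h = (\<Sum>p<length (Hw g d ks). ?M (tpow p ?h)) + (z - t_chain z)"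
    by (rule d_chain_mod_t[OF Hw_words[OF g(1,2) ks] small])
  have D: "d_chain ?h - (\<Sum>i<length ks. Bs g d (drop i ks @ take i ks))
    = ((\<Sum>p<?l (length ks). ?M (tpow p ?h)) - (\<Sum>i<length ks. Bs g d (drop i ks @ take i ks))) + (z - t_chain z)"
    unfolding z(3) length_Hw by simp
  show ?thesis unfolding D by (rule small_cyc_null[OF step[OF order_refl] cyc_null_t[OF z(1,2)]])
qed

text \<open>The head contributes delta b = b^2 + c id and a product with its right neighbour.
  \<open>Pw\<close> and \<open>Qw\<close> are the two parts of the former; \<open>Nw\<close> is the
  latter up to sign, absorbing an identity or, if the run is empty, forming b^2 with the next
  block.\<close>

fun Pw :: "R fps \<Rightarrow> int \<Rightarrow> nat list \<Rightarrow> chain" where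
  "Pw g d [] = 0"
| "Pw g d (k # r) = frag_of ((2 + d, Rs_id g * (bb * bb)) # replicate (2 * k) (0, 1) @ wd r)"

fun Nw :: "R fps \<Rightarrow> int \<Rightarrow> nat list \<Rightarrow> chain" where
  "Nw g d [] = 0"
| "Nw g d (0 # r) = Pw g d r"
| "Nw g d (Suc k # r) = frag_of ((1 + d, Rs_id g * bb) # replicate (Suc (2 * k)) (0, 1) @ wd r)"

fun Qw :: "R fps \<Rightarrow> int \<Rightarrow> nat list \<Rightarrow> chain" where
  "Qw g d [] = 0"
| "Qw g d (k # r) = frag_of ((2 + d, Rs_id g * Rs_id cc) # replicate (2 * k) (0, 1) @ wd r)"

lemma special_letters: "(2, bb * bb) \<in> letters" "(2, Rs_id cc) \<in> letters"
  using mult_letter[OF bb_letter bb_letter] Rs_letter[OF cc_props(1,2) one_letter] by (simp_all add: letter_mult_def)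

lemma frag_neg: "frag_cmul (- 1) x = - x"
  by (simp add: poly_mapping_eqI)

text \<open>The rotations that start inside the run of identities cancel in pairs modulo $\mathrm{Im}(\mathrm{id}-t)$\<close>

lemma Bs_eq:
  assumes g: "g \<in> Rs" "Rs_deg d g" "even d" and val: "ereal a \<le> Rs_val g" "N = a + real (length ks)" and ks: "ks \<noteq> []"
  shows "Bs g d ks - (Pw g d ks + Qw g d ks - Nw g d ks) \<in> cyc_null N"
proof -
  obtain k r where kr: "ks = k # r" using ks by (cases ks) auto
  let ?x = "(1 + d, Rs_id g * bb)" and ?e = "\<lambda>n. replicate n (0, 1 :: End_M fps)"
  let ?h = "frag_of (?x # ?e (2 * k) @ wd r)" and ?M = "\<lambda>x. Mu1 x + Mu2 x"
  have x: "?x \<in> letters" by (rule Rs_letter[OF g(1,2) bb_letter])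
  have xv: "ereal (a + 1) \<le> Ends_val (snd ?x)"
    using Ends_val_mult_ge[OF Ends_val_Rs_id_ge[OF val(1)] bb_props(3)] by simp
  have dx: "delta (1 + d) (Rs_id g * bb) = Rs_id g * (bb * bb) + Rs_id g * Rs_id cc"
  proof -
    have "delta (1 + d) (Rs_id g * bb) = Rs_id g * delta 1 bb"
      by (simp add: delta_def psign_def g(3) distrib_left mult.assoc) (metis Rs_id_commute mult.assoc)
    also have "delta 1 bb = bb * bb + Rs_id cc" using bb_MC by (simp add: power2_eq_square algebra_simps)
    finally show ?thesis by (simp only: distrib_left)
  qed
  have l2: "(2 + d, Rs_id g * (bb * bb)) \<in> letters" "(2 + d, Rs_id g * Rs_id cc) \<in> letters"
    by (rule Rs_letter[OF g(1,2) special_letters(1)], rule Rs_letter[OF g(1,2) special_letters(2)])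
  have "(2 + d, Rs_id g * (bb * bb) + Rs_id g * Rs_id cc) \<in> letters"
    using delta_letter[OF x] unfolding dx by (simp add: add.commute add.left_commute)
  then have "frag_of ([] @ (2 + d, Rs_id g * (bb * bb) + Rs_id g * Rs_id cc) # ?e (2 * k) @ wd r)
      - frag_of ([] @ (2 + d, Rs_id g * (bb * bb)) # ?e (2 * k) @ wd r)
      - frag_of ([] @ (2 + d, Rs_id g * Rs_id cc) # ?e (2 * k) @ wd r) \<in> small M" for M
    using l2 block_letters by (intro small.additive) (auto simp: words_Cons)
  moreover have "Mu1 ?h = frag_of ((2 + d, Rs_id g * (bb * bb) + Rs_id g * Rs_id cc) # ?e (2 * k) @ wd r)"
    by (simp add: dx)
  ultimately have 1: "Mu1 ?h - Pw g d ks - Qw g d ks \<in> small M" for M by (simp add: kr)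
  have 2: "Mu2 ?h = - Nw g d ks"
  proof (cases k)
    case 0
    show ?thesis
      by (cases r) (simp_all add: 0 kr wd_simps letter_mult_def psign_def g(3) frag_neg mult.assoc add.commute)
  next
    case (Suc l)
    then show ?thesis by (simp add: kr letter_mult_def psign_def g(3) frag_neg)
  qed
  \<comment> \<open>Two consecutive rotations put an identity in front with opposite signs, and
    delta id = 0. Multiplying the identity away leaves a word and its image under t.\<close>
  have pair: "?M (tpow (Suc (2 * j)) ?h) + ?M (tpow (Suc (Suc (2 * j))) ?h) \<in> cyc_null N" if j: "j < k" for j
  proof -
    define m where "m = 2 * k - 2 - 2 * j"
    let ?V = "?e m @ wd r @ ?x # ?e (2 * j)"
    have ev: "even m" using j by (simp add: m_def)
    have e1: "frag_of (?x # ?e (2 * k) @ wd r) = frag_of ((?x # ?e (2 * j)) @ ((0, 1) # (0, 1) # ?e m @ wd r))"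
    proof -
      have "2 * k = 2 * j + Suc (Suc m)" using j by (simp add: m_def)
      then show ?thesis by (simp only: replicate_add replicate_Suc append_Cons append_assoc)
    qed
    have e2: "frag_of (?x # ?e (2 * k) @ wd r) = frag_of ((?x # ?e (Suc (2 * j))) @ ((0, 1) # ?e m @ wd r))"
      unfolding e1 by (simp add: replicate_append_same[symmetric])
    have t1: "tpow (Suc (2 * j)) ?h = frag_of ((0, 1) # (0, 1) # ?V)"
      unfolding e1 by (subst tpow_frag_of') (simp_all add: psign_def sdeg_replicate g(3))
    have t2: "tpow (Suc (Suc (2 * j))) ?h = - frag_of ((0, 1) # ?V @ [(0, 1)])"
      unfolding e2 using even_sdeg_wd[of r] ev g(3)
      by (subst tpow_frag_of') (simp_all add: psign_def sdeg_replicate frag_neg replicate_append_same)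
    have d1: "delta 0 1 = 0" by (simp add: delta_def psign_def)
    have e: "(1, 0) \<in> letters" using delta_letter[OF one_letter] by (simp add: d1)
    have z: "frag_of ((1, 0) # v) \<in> small M" if v: "set v \<subseteq> letters" for v M
    proof (rule small.short)
      show "(1, 0) # v \<in> words" using e v by (simp add: words_Cons)
      obtain B where B: "ereal B \<le> word_val v" using word_val_bounded[OF v] by blast
      have "ereal (M - B) \<le> Ends_val 0" using Ends_val_Rs_id_ge[of "M - B" 0] by (simp add: Rs_id_hom Rs_val_ge_iff)
      then have "ereal ((M - B) + B) \<le> word_val ((1, 0) # v)" by (intro word_val_Cons_ge B) simp
      then show "ereal M \<le> word_val ((1, 0) # v)" by simp
    qed
    have V: "set ?V \<subseteq> letters" using x block_letters by auto
    have "frag_of ((1, 0) # (0, 1) # ?V) - frag_of ((1, 0) # ?V @ [(0, 1)]) \<in> small M" for M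
      using V one_letter by (intro small.diff z) auto
    moreover have "frag_of ((0, 1) # ?V) - t_chain (frag_of ((0, 1) # ?V)) \<in> cyc_null N"
    proof (rule cyc_null_t)
      have w: "(0, 1) # ?V \<in> words" using V one_letter by (simp add: words_Cons)
      then show "frag_of ((0, 1) # ?V) \<in> word_chains" by (rule chains_of)
      have "ereal (0 + (0 + (real (length r) + ((a + 1) + 0)))) \<le> word_val ((0, 1) # ?V)"
        using one_val xv by (intro word_val_Cons_ge word_val_append word_val_blocks) simp_all
      then show "frag_of ((0, 1) # ?V) \<in> small N" using w val(2) kr by (intro small.short) (simp_all add: add_ac)
    qed
    moreover have "t_chain (frag_of ((0, 1) # ?V)) = frag_of (?V @ [(0, 1)])"
      using even_sdeg_wd[of r] ev g(3) by (simp add: t_chain_of psign_def sdeg_replicate)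
    moreover have "?M (tpow (Suc (2 * j)) ?h) + ?M (tpow (Suc (Suc (2 * j))) ?h)
        = (frag_of ((1, 0) # (0, 1) # ?V) - frag_of ((1, 0) # ?V @ [(0, 1)])) + (frag_of ((0, 1) # ?V) - frag_of (?V @ [(0, 1)]))"
    proof -
      have "Mu2 (frag_of ((0, 1) # v)) = frag_of v" if "v \<noteq> []" for v
        using that by (cases v) (simp_all add: letter_mult_def psign_def)
      from this[of "(0, 1) # ?V"] this[of "?V @ [(0, 1)]"] show ?thesis
        unfolding t1 t2 by (simp add: frag_extend_minus d1)
    qed
    ultimately show ?thesis using small_cyc_null by simp
  qed
  have rest: "(\<Sum>q<Suc (2 * l). ?M (tpow q ?h)) - ?M ?h \<in> cyc_null N" if "l \<le> k" for l
    using that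
  proof (induction l)
    case 0
    show ?case by (simp add: cyc_null_0)
  next
    case (Suc l)
    have *: "(\<Sum>q<Suc (2 * Suc l). F q) - c = ((\<Sum>q<Suc (2 * l). F q) - c) + (F (Suc (2 * l)) + F (Suc (Suc (2 * l))))"
      for F :: "nat \<Rightarrow> chain" and c by simp
    have "l < k" "l \<le> k" using Suc.prems by simp_all
    then show ?case unfolding * by (intro cyc_null_add Suc.IH pair)
  qed
  have B: "Bs g d ks = (\<Sum>q<Suc (2 * k). ?M (tpow q ?h))" by (simp only: Bs_def kr list.sel Hw.simps)
  have *: "B - (p + q - n) \<in> X" if "(y - p - q) + (B - (y + y')) \<in> X" "y' = - n" for B p q n y y' :: chain and X
  proof -
    have "B - (p + q - n) = (y - p - q) + (B - (y + y'))" using that(2) by simp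
    then show ?thesis using that(1) by (simp only:)
  qed
  show ?thesis unfolding B by (rule *[OF small_cyc_null[OF 1 rest[OF order_refl]] 2])
qed


section \<open>Existence of a correction with Catalan coefficients\<close>

section \<open>The correction term\<close>

definition sc :: "real \<Rightarrow> nat \<Rightarrow> R fps" where "sc q k = fps_const (fls_const q) * cc ^ k"

lemma Rs_val_mult_ge:
  assumes "ereal a \<le> Rs_val r" "ereal b \<le> Rs_val r'"
  shows "ereal (a + b) \<le> Rs_val (r * r')"
  unfolding Rs_val_ge_iff fps_mult_nth
proof (intro allI R_val_sum)
  fix i j :: nat
  assume j: "j \<in> {0..i}"
  have "ereal (a - real j) + ereal (b - real (i - j)) \<le> R_val (fps_nth r j) + R_val (fps_nth r' (i - j))"
    using assms unfolding Rs_val_ge_iff by (intro add_mono) auto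
  then show "ereal (a + b - real i) \<le> R_val (fps_nth r j * fps_nth r' (i - j))"
    using j by (simp add: R_val_mult of_nat_diff add_diff_eq)
qed

lemma nonneg_mult_nth:
  assumes "\<And>i. ereal 0 \<le> R_val (fps_nth r i)" "\<And>i. ereal 0 \<le> R_val (fps_nth r' i)"
  shows "ereal 0 \<le> R_val (fps_nth (r * r') i)"
  unfolding fps_mult_nth
proof (intro R_val_sum)
  fix j :: nat
  have "ereal 0 + ereal 0 \<le> R_val (fps_nth r j) + R_val (fps_nth r' (i - j))" by (intro add_mono assms)
  then show "ereal 0 \<le> R_val (fps_nth r j * fps_nth r' (i - j))" by (simp add: R_val_mult)
qed

lemma Rs_deg_mult: "Rs_deg d r \<Longrightarrow> Rs_deg d' r' \<Longrightarrow> Rs_deg (d + d') (r * r')"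
  unfolding Rs_deg_def fps_mult_nth by (intro allI R_deg_sum R_deg_mult) auto

lemma sc_props: "sc q k \<in> Rs" "Rs_deg (2 * int k) (sc q k)" "ereal (real k) \<le> Rs_val (sc q k)"
proof -
  have cc0: "ereal 0 \<le> R_val (fps_nth cc i)" for i
  proof -
    have "fps_nth cc i = - (fps_nth A_s i * T_half)" by (simp add: cc_def A_s_def algebra_simps)
    moreover have "ereal 0 + ereal (1 / 2) \<le> R_val (fps_nth A_s i) + R_val T_half"
      by (intro add_mono real_coeffs_Rs real_coeffs_AB R_val_T_half)
    moreover have "ereal 0 \<le> ereal 0 + ereal (1 / 2)" by simp
    ultimately show ?thesis by (metis R_val_mult R_val_uminus order_trans)
  qed
  have "(\<forall>i. ereal 0 \<le> R_val (fps_nth (sc q k) i)) \<and> Rs_deg (2 * int k) (sc q k) \<and> ereal (real k) \<le> Rs_val (sc q k)"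
  proof (induction k)
    case 0
    have "real_coeffs (fps_const (fls_const q))"
      unfolding real_coeffs_def by (auto intro: exI[of _ 0])
    then have "ereal 0 \<le> R_val (fps_nth (fps_const (fls_const q)) i)" for i by (rule real_coeffs_Rs(1))
    then show ?case using const_Rs[of q] by (simp add: sc_def)
  next
    case (Suc k)
    have e: "sc q (Suc k) = cc * sc q k" by (simp add: sc_def mult_ac)
    show ?case
      unfolding e
      using nonneg_mult_nth[OF cc0, of "sc q k"] Suc Rs_deg_mult[OF cc_props(2), of "2 * int k" "sc q k"]
        Rs_val_mult_ge[OF cc_props(3), of "real k" "sc q k"] by simp
  qed
  then show "sc q k \<in> Rs" "Rs_deg (2 * int k) (sc q k)" "ereal (real k) \<le> Rs_val (sc q k)"
    using Rs_of_nonneg(1)[of "sc q k"] by blast+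
qed

lemma sc_hom: "sc (q + q') k = sc q k + sc q' k" "sc 0 k = 0" "sc q k * cc = sc q (Suc k)"
proof -
  have "fls_const (q + q') = fls_const q + (fls_const q' :: R)" by (simp only: fls_plus_const)
  then show "sc (q + q') k = sc q k + sc q' k"
    unfolding sc_def by (simp only: distrib_right flip: fps_const_add)
  show "sc 0 k = 0" "sc q k * cc = sc q (Suc k)" by (simp_all add: sc_def mult_ac)
qed

lemma zero_small: "(d, a) \<in> letters \<Longrightarrow> set v \<subseteq> letters \<Longrightarrow> frag_of ((d, 0) # v) \<in> small M"
proof (rule small.short)
  assume d: "(d, a) \<in> letters" and v: "set v \<subseteq> letters"
  have "(d, 0) \<in> letters" using Rs_letter[OF sc_props(1)[of 0 0] _ d, of 0] sc_props(2)[of 0 0] by (simp add: sc_hom Rs_id_hom)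
  then show "(d, 0) # v \<in> words" using v by (simp add: words_Cons)
  obtain B where B: "ereal B \<le> word_val v" using word_val_bounded[OF v] by blast
  have "ereal (M - B) \<le> Ends_val 0" using Ends_val_Rs_id_ge[of "M - B" 0] by (simp add: Rs_id_hom Rs_val_ge_iff)
  then have "ereal ((M - B) + B) \<le> word_val ((d, 0) # v)" by (intro word_val_Cons_ge B) simp
  then show "ereal M \<le> word_val ((d, 0) # v)" by simp
qed

lemma sc_letter: "(d, a) \<in> letters \<Longrightarrow> (d + 2 * int k, Rs_id (sc q k) * a) \<in> letters"
  by (rule Rs_letter[OF sc_props(1,2)])

text \<open>Coefficients are added inside a letter, which agrees with adding words only through the
  tensor relations. Hence the form of the claim: the difference lies in \<open>small M\<close> for
  every M.\<close>

lemma sc_additive: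
  assumes a: "(d, a) \<in> letters" and v: "set v \<subseteq> letters" and "finite I"
  shows "frag_of ((d + 2 * int k, Rs_id (sc (\<Sum>i\<in>I. q i) k) * a) # v) - (\<Sum>i\<in>I. frag_of ((d + 2 * int k, Rs_id (sc (q i) k) * a) # v)) \<in> small M"
  using assms(3)
proof (induction I)
  case empty
  have "(d + 2 * int k, Rs_id (sc 0 k) * a) \<in> letters" by (rule sc_letter[OF a])
  from zero_small[OF this v] show ?case by (simp add: sc_hom Rs_id_hom)
next
  case (insert x I)
  let ?w = "\<lambda>q. (d + 2 * int k, Rs_id (sc q k) * a) # v"
  have l: "?w q \<in> words" for q using sc_letter[OF a] v by (simp add: words_Cons)
  have e: "Rs_id (sc (q x + sum q I) k) * a = Rs_id (sc (q x) k) * a + Rs_id (sc (sum q I) k) * a"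
    by (simp only: sc_hom Rs_id_hom distrib_right)
  have "frag_of (?w (q x + sum q I)) - frag_of (?w (q x)) - frag_of (?w (sum q I)) \<in> small M"
    using small.additive[of "[]" "d + 2 * int k" "Rs_id (sc (q x) k) * a" v "Rs_id (sc (sum q I) k) * a" M] l
    unfolding e[symmetric] append_Nil by blast
  from small_add[OF this insert.IH] show ?case using insert.hyps by (simp add: algebra_simps)
qed

lemma sc_neg:
  assumes "(d, a) \<in> letters" "set v \<subseteq> letters"
  shows "frag_of ((d + 2 * int k, Rs_id (sc q k) * a) # v) + frag_of ((d + 2 * int k, Rs_id (sc (- q) k) * a) # v) \<in> small M"
proof -
  have "frag_of ((d + 2 * int k, Rs_id (sc (\<Sum>i\<in>{True, False}. if i then q else - q) k) * a) # v)
    - (\<Sum>i\<in>{True, False}. frag_of ((d + 2 * int k, Rs_id (sc (if i then q else - q) k) * a) # v)) \<in> small M"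
    by (rule sc_additive[OF assms]) simp
  then have 1: "frag_of ((d + 2 * int k, Rs_id (sc 0 k) * a) # v)
    - (frag_of ((d + 2 * int k, Rs_id (sc q k) * a) # v) + frag_of ((d + 2 * int k, Rs_id (sc (- q) k) * a) # v)) \<in> small M"
    by simp
  have "frag_of ((d + 2 * int k, Rs_id (sc 0 k) * a) # v) \<in> small M"
    using zero_small[OF sc_letter[OF assms(1), of k 0] assms(2)] by (simp add: sc_hom Rs_id_hom)
  from small.diff[OF this 1] show ?thesis by (simp add: add.commute)
qed

fun cat :: "nat \<Rightarrow> nat" where
  "cat 0 = 1"
| "cat (Suc n) = (\<Sum>i\<le>n. cat i * cat (n - i))"

definition pc :: "nat list \<Rightarrow> real" where "pc ks = prod_list (map (\<lambda>k. real (cat k)) ks)"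

lemma pc_simps: "pc [] = 1" "pc (k # r) = real (cat k) * pc r" "pc (r @ s) = pc r * pc s"
  by (simp_all add: pc_def)

text \<open>The level of a block word counts its letters b and its factors c, all of valuation at
  least 1. Each level is finite and its words have valuation at least n.\<close>

definition compo :: "nat \<Rightarrow> nat list set" where "compo n = {ks. length ks + sum_list ks = n}"

lemma compo_0: "compo 0 = {[]}"
  by (auto simp: compo_def)

lemma finite_size: "finite {ks. length ks + sum_list ks \<le> n}"
proof (rule finite_subset)
  show "{ks. length ks + sum_list ks \<le> n} \<subseteq> {ks. set ks \<subseteq> {..n} \<and> length ks \<le> n}"
    using member_le_sum_list by fastforce
  show "finite {ks. set ks \<subseteq> {..n} \<and> length ks \<le> n}" by (rule finite_lists_length_le) simp
qed

lemma finite_compo [simp]: "finite (compo n)"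
  by (rule finite_subset[OF _ finite_size[of n]]) (auto simp: compo_def)

lemma sum_compo_Suc:
  fixes F :: "nat list \<Rightarrow> chain"
  shows "(\<Sum>ks\<in>compo (Suc m). F ks) = (\<Sum>k\<le>m. \<Sum>r\<in>compo (m - k). F (k # r))"
    "(\<Sum>ks\<in>compo (Suc m). F ks) = (\<Sum>k\<le>m. \<Sum>r\<in>compo (m - k). F (r @ [k]))"
proof -
  let ?S = "SIGMA k:{..m}. compo (m - k)"
  have "ks \<in> (\<lambda>(k, r). k # r) ` ?S" if "ks \<in> compo (Suc m)" for ks
    using that by (cases ks) (auto simp: compo_def intro!: image_eqI[where x = "(hd ks, tl ks)"])
  then have 1: "compo (Suc m) = (\<lambda>(k, r). k # r) ` ?S" by (auto simp: compo_def)
  have "ks \<in> (\<lambda>(k, r). r @ [k]) ` ?S" if "ks \<in> compo (Suc m)" for ks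
    using that by (cases ks rule: rev_cases) (auto simp: compo_def intro!: image_eqI[where x = "(last ks, butlast ks)"])
  then have 2: "compo (Suc m) = (\<lambda>(k, r). r @ [k]) ` ?S" by (auto simp: compo_def)
  have "(\<Sum>ks\<in>compo (Suc m). F ks) = (\<Sum>(k, r)\<in>?S. F (k # r))"
    unfolding 1 by (subst sum.reindex) (auto simp: inj_on_def intro: sum.cong)
  then show "(\<Sum>ks\<in>compo (Suc m). F ks) = (\<Sum>k\<le>m. \<Sum>r\<in>compo (m - k). F (k # r))"
    by (subst sum.Sigma) simp_all
  have "(\<Sum>ks\<in>compo (Suc m). F ks) = (\<Sum>(k, r)\<in>?S. F (r @ [k]))"
    unfolding 2 by (subst sum.reindex) (auto simp: inj_on_def intro: sum.cong)
  then show "(\<Sum>ks\<in>compo (Suc m). F ks) = (\<Sum>k\<le>m. \<Sum>r\<in>compo (m - k). F (r @ [k]))"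
    by (subst sum.Sigma) simp_all
qed

lemma rotate_inv:
  "pc (drop i ks @ take i ks) = pc ks" "sum_list (drop i ks @ take i ks) = sum_list ks"
  "length (drop i ks @ take i ks) = length ks"
proof -
  have "pc (drop i ks @ take i ks) = pc (take i ks @ drop i ks)" "sum_list (drop i ks @ take i ks) = sum_list (take i ks @ drop i ks)"
    by (simp_all only: pc_simps sum_list_append mult.commute add.commute)
  then show "pc (drop i ks @ take i ks) = pc ks" "sum_list (drop i ks @ take i ks) = sum_list ks"
    by (simp_all only: append_take_drop_id)
qed simp

text \<open>Rotation permutes each level. In the boundary this uses up the weight 1/m of a word with
  m blocks, since each word is reached once for each of its m rotations.\<close>

lemma sum_rotations:
  fixes G :: "nat list \<Rightarrow> chain"
  shows "(\<Sum>ks\<in>compo n. \<Sum>i<length ks. G (drop i ks @ take i ks)) = (\<Sum>ks\<in>compo n. \<Sum>i<length ks. G ks)"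
proof -
  let ?S = "SIGMA ks:compo n. {..<length ks}"
  have rot: "rotate i ks = drop i ks @ take i ks" if "i < length ks" for i and ks :: "nat list"
    using that by (simp add: rotate_drop_take)
  have s: "sum_list (rotate i ks) = sum_list ks" for i and ks :: "nat list"
    using rotate_inv(2)[of "i mod length ks" ks] by (simp add: rotate_drop_take)
  have "(\<Sum>(ks, i)\<in>?S. G (drop i ks @ take i ks)) = (\<Sum>(ks, i)\<in>?S. G ks)"
  proof (rule sum.reindex_bij_witness[where i = "\<lambda>(ks, i). (rotate (length ks - i) ks, i)" and j = "\<lambda>(ks, i). (rotate i ks, i)"])
    fix p assume "p \<in> ?S"
    then obtain ks i where p: "p = (ks, i)" "ks \<in> compo n" "i < length ks" by auto
    show "(\<lambda>(ks, i). (rotate (length ks - i) ks, i)) ((\<lambda>(ks, i). (rotate i ks, i)) p) = p"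
      "(\<lambda>(ks, i). (rotate i ks, i)) ((\<lambda>(ks, i). (rotate (length ks - i) ks, i)) p) = p"
      using p by (simp_all add: rotate_rotate rotate_id)
    show "(\<lambda>(ks, i). (rotate i ks, i)) p \<in> ?S" "(\<lambda>(ks, i). (rotate (length ks - i) ks, i)) p \<in> ?S"
      using p by (simp_all add: compo_def s)
    show "(case (\<lambda>(ks, i). (rotate i ks, i)) p of (ks, i) \<Rightarrow> G ks) = (case p of (ks, i) \<Rightarrow> G (drop i ks @ take i ks))"
      using p by (simp add: rot)
  qed
  then show ?thesis by (simp add: sum.Sigma)
qed

abbreviation Z :: "real \<Rightarrow> nat list \<Rightarrow> letter list" where
  "Z q ks \<equiv> Hw (sc q (sum_list ks)) (2 * int (sum_list ks)) ks"
abbreviation PP' :: "real \<Rightarrow> nat list \<Rightarrow> chain" where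
  "PP' q ks \<equiv> Pw (sc q (sum_list ks)) (2 * int (sum_list ks)) ks"
abbreviation NN' :: "real \<Rightarrow> nat list \<Rightarrow> chain" where
  "NN' q ks \<equiv> Nw (sc q (sum_list ks)) (2 * int (sum_list ks)) ks"
abbreviation QQ' :: "real \<Rightarrow> nat list \<Rightarrow> chain" where
  "QQ' q ks \<equiv> Qw (sc q (sum_list ks)) (2 * int (sum_list ks)) ks"

lemma sc_additive':
  assumes "finite I"
  shows "PP' (\<Sum>i\<in>I. q i) ks - (\<Sum>i\<in>I. PP' (q i) ks) \<in> small M"
    "QQ' (\<Sum>i\<in>I. q i) ks - (\<Sum>i\<in>I. QQ' (q i) ks) \<in> small M"
    "NN' (\<Sum>i\<in>I. q i) ks - (\<Sum>i\<in>I. NN' (q i) ks) \<in> small M"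
proof -
  have v: "set (replicate n (0, 1) @ wd r) \<subseteq> letters" for n r using block_letters by simp
  have P: "Pw (sc (\<Sum>i\<in>I. q i) s) (2 * int s) ls - (\<Sum>i\<in>I. Pw (sc (q i) s) (2 * int s) ls) \<in> small M" for s ls
    using sc_additive[OF special_letters(1) v assms] by (cases ls) (simp_all add: small.zero)
  then show "PP' (\<Sum>i\<in>I. q i) ks - (\<Sum>i\<in>I. PP' (q i) ks) \<in> small M" .
  have "Qw (sc (\<Sum>i\<in>I. q i) s) (2 * int s) ls - (\<Sum>i\<in>I. Qw (sc (q i) s) (2 * int s) ls) \<in> small M" for s ls
    using sc_additive[OF special_letters(2) v assms] by (cases ls) (simp_all add: small.zero)
  then show "QQ' (\<Sum>i\<in>I. q i) ks - (\<Sum>i\<in>I. QQ' (q i) ks) \<in> small M" .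
  show "NN' (\<Sum>i\<in>I. q i) ks - (\<Sum>i\<in>I. NN' (q i) ks) \<in> small M"
  proof (cases ks)
    case (Cons k r)
    show ?thesis
    proof (cases k)
      case 0
      then show ?thesis using P by (simp add: Cons)
    next
      case (Suc l)
      show ?thesis unfolding Cons Suc Nw.simps by (rule sc_additive[OF bb_letter v assms])
    qed
  qed (simp add: small.zero)
qed

text \<open>The words with head b^2 at level n. They arise from delta b at level n and again, with
  opposite sign, at level n + 1 from a leading b whose run is empty: this is the telescoping
  term.\<close>

definition Tn :: "nat \<Rightarrow> chain" where "Tn n = (\<Sum>ks\<in>compo n. PP' (pc ks) ks)"

text \<open>The part of the boundary that does not cancel: a single block whose b has been replaced
  by c. These are the words of identities allowed by \<open>exp_correction\<close>.\<close>

definition un :: "nat \<Rightarrow> letter list" where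
  "un n = (2 * int (Suc n), Rs_id (sc (- real (cat n)) (Suc n))) # replicate (2 * n) (0, 1)"

text \<open>The common shape of the two kinds of words that cancel in \<open>sum_Q_N\<close>: b
  followed by an odd run of identities, made of runs of length 2 i and 2 j and one further
  identity.\<close>

definition Hn :: "nat \<Rightarrow> nat \<Rightarrow> nat list \<Rightarrow> chain" where
  "Hn i j r = (let s = Suc (i + j + sum_list r) in
     frag_of ((1 + 2 * int s, Rs_id (sc (real (cat i) * real (cat j) * pc r) s) * bb) # replicate (Suc (2 * (i + j))) (0, 1) @ wd r))"

text \<open>The scalar c is moved from the head to the last b, which leaves an identity at the head,
  and the word is rotated so that this b leads. Its run of 2 j identities then joins the 1 + 2 i
  identities that opened the word.\<close>

lemma QQ'_snoc:
  assumes r: "length r + (i + j + sum_list r) + 2 = n"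
  shows "QQ' (pc (i # r @ [j])) (i # r @ [j]) - Hn i j r \<in> cyc_null (real n)"
proof -
  let ?s = "i + j + sum_list r" and ?q = "pc (i # r @ [j])"
  let ?e = "\<lambda>n. replicate n (0, 1 :: End_M fps)" and ?S = "Rs_id (sc ?q (Suc ?s))"
  let ?d = "2 * int (Suc ?s)"
  have q: "?q = real (cat i) * real (cat j) * pc r" by (simp add: pc_simps)
  have S: "Rs_id (sc ?q ?s) * Rs_id cc = ?S" unfolding sc_hom(3)[symmetric] Rs_id_hom ..
  have sum: "sum_list (i # r @ [j]) = ?s" by simp
  have d: "2 + 2 * int ?s = 0 + ?d" by simp
  have Q: "QQ' ?q (i # r @ [j]) = frag_of ([] @ (0 + ?d, ?S * 1) # (?e (2 * i) @ wd r) @ (1, bb) # ?e (2 * j))"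
    unfolding sum Qw.simps S d by (simp add: wd_simps)
  let ?u = "?e (Suc (2 * i)) @ wd r" and ?v = "(1 + ?d, ?S * bb) # ?e (2 * j)"
  have l: "(0 + ?d, ?S * 1) \<in> letters" "(1 + ?d, ?S * bb) \<in> letters"
    by (rule sc_letter[OF one_letter], rule sc_letter[OF bb_letter])
  have "frag_of ([] @ (0 + ?d, ?S * 1) # (?e (2 * i) @ wd r) @ (1, bb) # ?e (2 * j))
      - frag_of ([] @ (0, 1) # (?e (2 * i) @ wd r) @ (1 + ?d, ?S * bb) # ?e (2 * j)) \<in> small M" for M
    using l bb_letter one_letter block_letters
    by (intro small.balanced[OF sc_props(1,2)]) (auto simp: words_Cons)
  then have 1: "QQ' ?q (i # r @ [j]) - frag_of (?u @ ?v) \<in> small M" for M unfolding Q by simp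
  have w: "?u @ ?v \<in> words" using l(2) one_letter block_letters by (auto simp: words_def)
  have "ereal (real (Suc ?s) + 1) \<le> Ends_val (?S * bb)"
    by (rule Ends_val_mult_ge[OF Ends_val_Rs_id_ge[OF sc_props(3)] bb_props(3)])
  then have val: "ereal ((0 + real (length r)) + ((real (Suc ?s) + 1) + 0)) \<le> word_val (?u @ ?v)"
    by (intro word_val_append word_val_Cons_ge word_val_blocks) simp
  have n: "real n = (0 + real (length r)) + ((real (Suc ?s) + 1) + 0)" unfolding r[symmetric] by simp
  have sm: "frag_of (?u @ ?v) \<in> small (real n)" unfolding n by (rule small.short[OF w val])
  have "tpow (length ?u) (frag_of (?u @ ?v)) = frag_of (?v @ ?u)"
    unfolding tpow_frag_of by (simp add: psign_def sdeg_replicate)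
  moreover have "2 * j + Suc (2 * i) = Suc (2 * (i + j))" by simp
  then have rep: "?e (2 * j) @ ?e (Suc (2 * i)) = ?e (Suc (2 * (i + j)))" by (simp only: replicate_add[symmetric])
  have "frag_of (?v @ ?u) = Hn i j r"
    unfolding Hn_def Let_def q[symmetric] rep[symmetric] by (simp only: append_Cons append_assoc)
  ultimately have "frag_of (?u @ ?v) - Hn i j r \<in> cyc_null (real n)"
    using cyc_null_rotate[OF chains_of[OF w] sm, of "length ?u"] by simp
  from small_cyc_null[OF 1 this] show ?thesis by simp
qed

text \<open>Absorbing one of 2 (k + 1) identities leaves a run of 2 k + 1. The recursion for Cat(k +
  1) distributes the coefficient over all pairs i + j = k.\<close>

lemma NN'_Suc: "NN' (pc (Suc k # r)) (Suc k # r) - (\<Sum>i\<le>k. Hn i (k - i) r) \<in> small M"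
proof -
  have v: "set (replicate n (0, 1) @ wd r) \<subseteq> letters" for n r using block_letters by simp
  have q: "pc (Suc k # r) = (\<Sum>i\<le>k. real (cat i) * real (cat (k - i)) * pc r)"
    by (simp add: pc_simps sum_distrib_right)
  have H: "Hn i (k - i) r = frag_of ((1 + 2 * int (sum_list (Suc k # r)), Rs_id (sc (real (cat i) * real (cat (k - i)) * pc r) (sum_list (Suc k # r))) * bb)
     # replicate (Suc (2 * k)) (0, 1) @ wd r)" if "i \<in> {..k}" for i
    using that by (simp add: Hn_def Let_def)
  have HS: "(\<Sum>i\<le>k. Hn i (k - i) r) = (\<Sum>i\<le>k. frag_of ((1 + 2 * int (sum_list (Suc k # r)), Rs_id (sc (real (cat i) * real (cat (k - i)) * pc r) (sum_list (Suc k # r))) * bb)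
     # replicate (Suc (2 * k)) (0, 1) @ wd r))"
    by (intro sum.cong refl H)
  show ?thesis
    unfolding q Nw.simps HS by (rule sc_additive[OF bb_letter v]) simp
qed

lemma sum_triangle:
  fixes F :: "nat \<Rightarrow> nat \<Rightarrow> chain"
  shows "(\<Sum>i<m. \<Sum>j\<le>m - Suc i. F i j) = (\<Sum>k<m. \<Sum>i\<le>k. F i (k - i))"
proof -
  have "(\<Sum>i<m. \<Sum>j\<le>m - Suc i. F i j) = (\<Sum>(i, j)\<in>(SIGMA i:{..<m}. {..m - Suc i}). F i j)" by (simp add: sum.Sigma)
  also have "(SIGMA i:{..<m}. {..m - Suc i}) = {(i, j). i + j < m}" by auto
  also have "(\<Sum>(i, j)\<in>{(i, j). i + j < m}. F i j) = (\<Sum>k<m. \<Sum>i\<le>k. F i (k - i))" by (rule sum.triangle_reindex)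
  finally show ?thesis .
qed

text \<open>Words with c and at least two blocks cancel those in which an identity was absorbed.
  What remains is \<open>Tn m\<close>, from an empty first run, and the one-block word with c, which
  is the negative of \<open>un m\<close>.\<close>

lemma sum_Q_N:
  "(\<Sum>ks\<in>compo (Suc m). QQ' (pc ks) ks) - (\<Sum>ks\<in>compo (Suc m). NN' (pc ks) ks) + Tn m + frag_of (un m) \<in> cyc_null (real (Suc m))"
proof -
  let ?N = "real (Suc m)"
  have N: "(\<Sum>ks\<in>compo (Suc m). NN' (pc ks) ks) = Tn m + (\<Sum>k<m. \<Sum>r\<in>compo (m - Suc k). NN' (pc (Suc k # r)) (Suc k # r))"
    unfolding sum_compo_Suc(1) sum.atMost_shift Tn_def by (simp add: pc_simps)
  have "(\<Sum>k<m. \<Sum>r\<in>compo (m - Suc k). NN' (pc (Suc k # r)) (Suc k # r)) - (\<Sum>k<m. \<Sum>r\<in>compo (m - Suc k). \<Sum>i\<le>k. Hn i (k - i) r) \<in> small M" for M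
    unfolding sum_subtractf[symmetric] by (intro small_sum NN'_Suc)
  moreover have "(\<Sum>k<m. \<Sum>r\<in>compo (m - Suc k). \<Sum>i\<le>k. Hn i (k - i) r) = (\<Sum>i<m. \<Sum>j\<le>m - Suc i. \<Sum>r\<in>compo (m - Suc i - j). Hn i j r)"
    unfolding sum_triangle by (intro sum.cong refl) (subst sum.swap, intro sum.cong refl, simp)
  ultimately have N': "(\<Sum>ks\<in>compo (Suc m). NN' (pc ks) ks) - Tn m - (\<Sum>i<m. \<Sum>j\<le>m - Suc i. \<Sum>r\<in>compo (m - Suc i - j). Hn i j r) \<in> small M" for M
    unfolding N by simp
  have "(\<Sum>r\<in>compo (m - i). QQ' (pc (i # r)) (i # r)) = (\<Sum>j\<le>m - Suc i. \<Sum>r\<in>compo (m - Suc i - j). QQ' (pc (i # r @ [j])) (i # r @ [j]))" if "i < m" for i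
  proof -
    have "m - i = Suc (m - Suc i)" using that by simp
    then show ?thesis by (simp only: sum_compo_Suc(2))
  qed
  then have Q: "(\<Sum>ks\<in>compo (Suc m). QQ' (pc ks) ks)
    = (\<Sum>i<m. \<Sum>j\<le>m - Suc i. \<Sum>r\<in>compo (m - Suc i - j). QQ' (pc (i # r @ [j])) (i # r @ [j])) + QQ' (pc [m]) [m]"
    unfolding sum_compo_Suc(1) lessThan_Suc_atMost[symmetric] sum.lessThan_Suc diff_self_eq_0 compo_0
    by (simp del: Qw.simps sum_list.Cons)
  have "(\<Sum>i<m. \<Sum>j\<le>m - Suc i. \<Sum>r\<in>compo (m - Suc i - j). QQ' (pc (i # r @ [j])) (i # r @ [j]))
      - (\<Sum>i<m. \<Sum>j\<le>m - Suc i. \<Sum>r\<in>compo (m - Suc i - j). Hn i j r) \<in> cyc_null ?N"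
    unfolding sum_subtractf[symmetric] by (intro cyc_null_sum QQ'_snoc) (auto simp: compo_def)
  moreover have "QQ' (pc [m]) [m] + frag_of (un m) \<in> small M" for M
  proof -
    have s: "pc [m] = real (cat m)" "sum_list [m] = m" by (simp_all add: pc_simps)
    have "Rs_id (sc (real (cat m)) m) * Rs_id cc = Rs_id (sc (real (cat m)) (Suc m)) * 1"
      unfolding sc_hom(3)[symmetric] Rs_id_hom mult_1_right ..
    moreover have "2 + 2 * int m = 0 + 2 * int (Suc m)" by simp
    ultimately have "QQ' (pc [m]) [m] = frag_of ((0 + 2 * int (Suc m), Rs_id (sc (real (cat m)) (Suc m)) * 1) # replicate (2 * m) (0, 1))"
      unfolding s Qw.simps by (simp only: wd_simps append_Nil2)
    moreover have "un m = (0 + 2 * int (Suc m), Rs_id (sc (- real (cat m)) (Suc m)) * 1) # replicate (2 * m) (0, 1)"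
      by (simp add: un_def)
    ultimately show ?thesis using sc_neg[OF one_letter block_letters(2)] by (simp only:)
  qed
  ultimately have "(\<Sum>ks\<in>compo (Suc m). QQ' (pc ks) ks) + frag_of (un m) - (\<Sum>i<m. \<Sum>j\<le>m - Suc i. \<Sum>r\<in>compo (m - Suc i - j). Hn i j r) \<in> cyc_null ?N"
    unfolding Q using small_cyc_null[of "QQ' (pc [m]) [m] + frag_of (un m)"] by (fastforce simp del: Qw.simps simp: algebra_simps)
  from cyc_null_diff[OF this cyc_null_small[OF N']] show ?thesis by (simp del: Qw.simps Nw.simps add: algebra_simps)
qed

text \<open>Within one level the factors 1/(number of blocks) are consumed by the rotations;
  \<open>sum_Q_N\<close> then leaves only two consecutive telescoping terms and a scalar
  word.\<close>

lemma d_level: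
  "(\<Sum>ks\<in>compo (Suc m). d_chain (frag_of (Z (pc ks / real (length ks)) ks))) - (Tn (Suc m) - Tn m) + frag_of (un m) \<in> cyc_null (real (Suc m))"
proof -
  let ?N = "real (Suc m)" and ?G = "\<lambda>ks q. PP' q ks + QQ' q ks - NN' q ks" and ?g = "\<lambda>ks. pc ks / real (length ks)"
  have "d_chain (frag_of (Z (?g ks) ks)) - (\<Sum>i<length ks. ?G (drop i ks @ take i ks) (?g (drop i ks @ take i ks))) \<in> cyc_null ?N"
    if ks: "ks \<in> compo (Suc m)" for ks
  proof -
    let ?s = "sum_list ks" and ?r = "\<lambda>i. drop i ks @ take i ks"
    have ne: "ks \<noteq> []" and n: "?N = real ?s + real (length ks)" using ks by (auto simp: compo_def)
    have ev: "even (2 * int ?s)" by simp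
    have sm: "frag_of (Z (?g ks) ks) \<in> small ?N"
      using Hw_words[OF sc_props(1,2) ne] Hw_val[OF sc_props(3) ne] unfolding n by (intro small.short) blast+
    have B: "(\<Sum>i<length ks. Bs (sc (?g ks) ?s) (2 * int ?s) (?r i))
       - (\<Sum>i<length ks. ?G (?r i) (?g (?r i))) \<in> cyc_null ?N"
      unfolding sum_subtractf[symmetric] rotate_inv
    proof (rule cyc_null_sum)
      fix i
      have "length (?r i) \<noteq> 0" unfolding rotate_inv using ne by simp
      then have 2: "?r i \<noteq> []" by (simp only: length_0_conv not_False_eq_True)
      have 1: "?N = real ?s + real (length (?r i))" by (simp only: rotate_inv n)
      from Bs_eq[OF sc_props(1,2) ev sc_props(3) 1 2]
      show "Bs (sc (?g ks) ?s) (2 * int ?s) (?r i) - (Pw (sc (?g ks) ?s) (2 * int ?s) (?r i) + Qw (sc (?g ks) ?s) (2 * int ?s) (?r i)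
        - Nw (sc (?g ks) ?s) (2 * int ?s) (?r i)) \<in> cyc_null ?N" .
    qed
    show ?thesis using cyc_null_add[OF d_Hw[OF sc_props(1,2) ev ne sm] B] by simp
  qed
  then have "(\<Sum>ks\<in>compo (Suc m). d_chain (frag_of (Z (?g ks) ks)))
      - (\<Sum>ks\<in>compo (Suc m). \<Sum>i<length ks. ?G (drop i ks @ take i ks) (?g (drop i ks @ take i ks))) \<in> cyc_null ?N"
    unfolding sum_subtractf[symmetric] by (rule cyc_null_sum)
  then have 1: "(\<Sum>ks\<in>compo (Suc m). d_chain (frag_of (Z (?g ks) ks)))
      - (\<Sum>ks\<in>compo (Suc m). \<Sum>i<length ks. ?G ks (?g ks)) \<in> cyc_null ?N"
    unfolding sum_rotations[of "\<lambda>ks. ?G ks (?g ks)"] .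
  have 2: "?G ks (pc ks) - (\<Sum>i<length ks. ?G ks (?g ks)) \<in> small M" if "ks \<in> compo (Suc m)" for ks M
  proof -
    have "(\<Sum>i<length ks. ?g ks) = pc ks" using that by (cases "length ks = 0") (simp_all add: compo_def)
    then have a: "PP' (pc ks) ks - (\<Sum>i<length ks. PP' (?g ks) ks) \<in> small M"
      "QQ' (pc ks) ks - (\<Sum>i<length ks. QQ' (?g ks) ks) \<in> small M"
      "NN' (pc ks) ks - (\<Sum>i<length ks. NN' (?g ks) ks) \<in> small M"
      using sc_additive'[of "{..<length ks}" "\<lambda>_. ?g ks" ks M] by simp_all
    have *: "p + q - n - (p' + q' - n') = (p - p') + (q - q') - (n - n')" for p q n p' q' n' :: chain by simp
    show ?thesis unfolding sum_subtractf sum.distrib * by (intro small.diff small_add a)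
  qed
  have "(\<Sum>ks\<in>compo (Suc m). ?G ks (pc ks)) - (\<Sum>ks\<in>compo (Suc m). \<Sum>i<length ks. ?G ks (?g ks)) \<in> small M" for M
    unfolding sum_subtractf[symmetric] by (intro small_sum 2)
  then have 3: "(\<Sum>ks\<in>compo (Suc m). ?G ks (pc ks)) - (\<Sum>ks\<in>compo (Suc m). \<Sum>i<length ks. ?G ks (?g ks)) \<in> cyc_null ?N"
    by (rule cyc_null_small)
  have e: "(\<Sum>ks\<in>compo (Suc m). ?G ks (pc ks)) = Tn (Suc m) + (\<Sum>ks\<in>compo (Suc m). QQ' (pc ks) ks) - (\<Sum>ks\<in>compo (Suc m). NN' (pc ks) ks)"
    by (simp only: sum_subtractf sum.distrib Tn_def)
  have *: "a - g \<in> X \<Longrightarrow> gp - g \<in> X \<Longrightarrow> gp = t + q - n \<Longrightarrow> q - n + t' + u \<in> X \<Longrightarrow>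
      (a - g) - (gp - g) + (q - n + t' + u) = a - (t - t') + u" for a g gp t q n t' u :: chain and X by simp
  show ?thesis
    unfolding *[OF 1 3 e sum_Q_N, symmetric] by (intro cyc_null_add cyc_null_diff 1 3 sum_Q_N)
qed


text \<open>A nonempty list of zeros names a word of exp(b) itself, which must not occur in y. It is
  replaced by the zero letter, as is the empty list, so that every list still names a word
  containing a scalar letter.\<close>

definition fw :: "nat list \<Rightarrow> letter list" where
  "fw ks = (if \<forall>k\<in>set ks. k = 0 then [(0, 0)] else Z (- (pc ks / real (length ks))) ks)"

lemma zero_letter: "(0, 0) \<in> letters"
  using sc_letter[OF one_letter, of 0 0] by (simp add: sc_hom Rs_id_hom)

lemma fw_words: "fw ks \<in> words"
proof (cases "\<forall>k\<in>set ks. k = 0")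
  case True
  then show ?thesis using zero_letter by (simp add: fw_def words_def)
next
  case False
  then have "ks \<noteq> []" by auto
  then show ?thesis unfolding fw_def using Hw_words[OF sc_props(1,2)] False by (simp only: if_False)
qed

lemma fw_R: "\<exists>x\<in>set (fw ks). snd x \<in> Rs_id ` Rs"
proof (cases "\<forall>k\<in>set ks. k = 0")
  case True
  have "(0 :: R fps) \<in> Rs" using sc_props(1)[of 0 0] by (simp only: sc_hom)
  then have "(0 :: End_M fps) \<in> Rs_id ` Rs" by (rule rev_image_eqI) (simp add: Rs_id_hom)
  then show ?thesis using True by (simp add: fw_def)
next
  case False
  have wd: "(0, 1) \<in> set (wd r)" if "\<exists>k\<in>set r. k \<noteq> 0" for r
    using that by (induction r) (auto simp: wd_simps)
  obtain k r where ks: "ks = k # r" using False by (cases ks) auto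
  have "(0, 1) \<in> set (Hw g d ks)" for g d using False wd[of r] by (auto simp: ks)
  then have e: "(0, 1) \<in> set (fw ks)" using False by (simp only: fw_def if_False)
  have "1 \<in> Rs" using const_Rs(1)[of 1] by simp
  then have "(1 :: End_M fps) \<in> Rs_id ` Rs" by (rule rev_image_eqI) (simp add: Rs_id_hom)
  then show ?thesis by (intro bexI[OF _ e]) simp
qed

lemma fw_val: "ereal (real (length ks + sum_list ks)) \<le> word_val (fw ks)"
proof (cases "\<forall>k\<in>set ks. k = 0")
  case True
  have "ereal M \<le> Ends_val 0" for M using Ends_val_Rs_id_ge[of M 0] by (simp add: Rs_id_hom Rs_val_ge_iff)
  then show ?thesis using True by (simp add: fw_def word_val_simps)
next
  case False
  then have "ks \<noteq> []" by auto
  from Hw_val[OF sc_props(3) this] show ?thesis using False by (simp only: fw_def if_False of_nat_add add.commute)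
qed

lemma fw_small: "N \<le> real (length ks + sum_list ks) \<Longrightarrow> frag_of (fw ks) \<in> small N"
  by (rule small.short[OF fw_words order_trans[OF _ fw_val]]) simp

definition Yn :: "nat \<Rightarrow> chain" where "Yn n = (\<Sum>ks | length ks + sum_list ks \<le> n. frag_of (fw ks))"

lemma sum_tail_small:
  assumes "finite B" "{ks. length ks + sum_list ks \<le> L} \<subseteq> B" "N \<le> real L"
  shows "(\<Sum>ks\<in>B. frag_of (fw ks)) - Yn L \<in> small N"
proof -
  have "(\<Sum>ks\<in>B. frag_of (fw ks)) - Yn L = (\<Sum>ks\<in>B - {ks. length ks + sum_list ks \<le> L}. frag_of (fw ks))"
    unfolding Yn_def sum.subset_diff[OF assms(2,1)] by simp
  also have "\<dots> \<in> small N" by (intro small_sum fw_small) (use assms(3) in auto)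
  finally show ?thesis .
qed

lemma Yn_tail: "N \<le> real L \<Longrightarrow> L \<le> n \<Longrightarrow> Yn n - Yn L \<in> small N"
  unfolding Yn_def[of n] by (rule sum_tail_small[OF finite_size]) auto

lemma Yn_cauchy: "cauchy_chain Yn"
  unfolding cauchy_chain_def
proof (intro conjI allI)
  show "Yn n \<in> word_chains" for n unfolding Yn_def by (intro chains_sum chains_of fw_words)
  fix N
  obtain L where L: "N \<le> real L" using real_arch_simple by blast
  have "Yn m - Yn n \<in> small N" if "m \<ge> L" "n \<ge> L" for m n
    using small.diff[OF Yn_tail[OF L that(1)] Yn_tail[OF L that(2)]] by simp
  then show "\<exists>n0. \<forall>m\<ge>n0. \<forall>n\<ge>n0. Yn m - Yn n \<in> small N" by blast
qed

lemma codes: "\<exists>n0. \<forall>n\<ge>n0. {ks. length ks + sum_list ks \<le> L} \<subseteq> list_decode ` {..<n}"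
proof -
  have "finite (list_encode ` {ks. length ks + sum_list ks \<le> L})" by (intro finite_imageI finite_size)
  then obtain n0 where n0': "\<forall>i\<in>list_encode ` {ks. length ks + sum_list ks \<le> L}. i < n0"
    unfolding finite_nat_set_iff_bounded by (rule exE)
  have n0: "list_encode ks < n0" if "length ks + sum_list ks \<le> L" for ks
    by (rule bspec[OF n0'], rule imageI) (simp only: mem_Collect_eq that)
  have "ks \<in> list_decode ` {..<n}" if "n \<ge> n0" "length ks + sum_list ks \<le> L" for n ks
  proof (rule image_eqI)
    show "ks = list_decode (list_encode ks)" by simp
    show "list_encode ks \<in> {..<n}" using n0[OF that(2)] that(1) by simp
  qed
  then show ?thesis by blast
qed

lemma infinite_sumsI:
  assumes "range w \<subseteq> A \<inter> words" "(\<lambda>j. word_val (w j)) \<longlonglongrightarrow> \<infinity>"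
  shows "lam_of (\<lambda>n. \<Sum>j<n. frag_of (w j)) \<in> infinite_sums A"
  unfolding infinite_sums_def by (rule CollectI) (rule exI[of _ w], rule conjI[OF refl conjI[OF assms]])

text \<open>\<open>R_lam\<close> asks for a sequence of words, whereas \<open>Yn\<close> sums by
  level. Enumerating lists with \<open>list_decode\<close> gives partial sums that differ from
  \<open>Yn\<close> by a null sequence, since every level is exhausted eventually.\<close>

lemma Yn_R_lam: "lam_of Yn \<in> R_lam"
proof -
  let ?v = "\<lambda>j. fw (list_decode j)"
  have lim: "(\<lambda>j. word_val (?v j)) \<longlonglongrightarrow> \<infinity>"
    unfolding Lim_PInfty
  proof
    fix r
    obtain L where L: "r \<le> real L" using real_arch_simple by blast
    obtain n0 where n0: "{ks. length ks + sum_list ks \<le> L} \<subseteq> list_decode ` {..<n0}" using codes by blast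
    have "ereal r \<le> word_val (?v j)" if "j \<ge> n0" for j
    proof -
      have "list_decode j \<notin> list_decode ` {..<n0}"
      proof
        assume "list_decode j \<in> list_decode ` {..<n0}"
        then obtain x where "x < n0" "list_decode j = list_decode x" by auto
        then have "j < n0" by (metis list_decode_inverse)
        then show False using that by simp
      qed
      then have "\<not> length (list_decode j) + sum_list (list_decode j) \<le> L" using n0 by blast
      then show ?thesis using L by (intro order_trans[OF _ fw_val]) simp
    qed
    then show "\<exists>N. \<forall>n\<ge>N. ereal r \<le> word_val (?v n)" by blast
  qed
  have V: "cauchy_chain (\<lambda>n. \<Sum>j<n. frag_of (?v j))" by (rule sum_words_cauchy[OF fw_words lim])
  have "null_chain (\<lambda>n. Yn n - (\<Sum>j<n. frag_of (?v j)))"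
    unfolding null_chain_def
  proof
    fix N
    obtain L where L: "N \<le> real L" using real_arch_simple by blast
    obtain n0 where n0: "\<And>n. n \<ge> n0 \<Longrightarrow> {ks. length ks + sum_list ks \<le> L} \<subseteq> list_decode ` {..<n}" using codes by blast
    have "Yn n - (\<Sum>j<n. frag_of (?v j)) \<in> small N" if n: "n \<ge> max n0 L" for n
    proof -
      have "(\<Sum>j<n. frag_of (?v j)) = (\<Sum>ks\<in>list_decode ` {..<n}. frag_of (fw ks))"
        by (subst sum.reindex) (auto intro: inj_on_subset[OF inj_list_decode])
      then have "(\<Sum>j<n. frag_of (?v j)) - Yn L \<in> small N"
        using sum_tail_small[OF _ n0 L] n by simp
      from small.diff[OF Yn_tail[OF L] this] show ?thesis using n by simp
    qed
    then show "\<exists>n0. \<forall>n\<ge>n0. Yn n - (\<Sum>j<n. frag_of (?v j)) \<in> small N" by blast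
  qed
  then have "null_chain (\<lambda>n. Yn n - (\<Sum>j<n. frag_of (?v j)) - (0 - t_chain 0))" by (simp add: t_chain_lin)
  then have eq: "lam_of Yn = lam_of (\<lambda>n. \<Sum>j<n. frag_of (?v j))"
    unfolding lam_of_eq_iff[OF Yn_cauchy V] by (intro exI[of _ "\<lambda>n. 0"] conjI cauchy_chain_0)
  have "range ?v \<subseteq> {w. \<exists>x\<in>set w. snd x \<in> Rs_id ` Rs} \<inter> words"
    by (rule image_subsetI, rule IntI, rule CollectI, rule fw_R, rule fw_words)
  then show ?thesis unfolding eq R_lam_def by (rule infinite_sumsI[OF _ lim])
qed

lemma un_words: "un n \<in> words" "ereal (real n) \<le> word_val (un n)" "un n \<in> scalar_words"
proof -
  let ?s = "sc (- real (cat n)) (Suc n)"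
  have "(0 + 2 * int (Suc n), Rs_id ?s * 1) \<in> letters" by (rule sc_letter[OF one_letter])
  then show "un n \<in> words" using block_letters by (simp add: un_def words_Cons)
  have v: "ereal (real (Suc n)) \<le> Ends_val (Rs_id ?s)" by (rule Ends_val_Rs_id_ge[OF sc_props(3)])
  have "ereal (real (Suc n) + 0) \<le> word_val (un n)"
    unfolding un_def by (rule word_val_Cons_ge[OF _ word_val_blocks(1)]) (unfold snd_conv, rule v)
  then show "ereal (real n) \<le> word_val (un n)" by (rule order_trans[rotated]) simp
  show "un n \<in> scalar_words" unfolding scalar_words_def un_def using sc_props(1) by blast
qed

lemma Tn_small: "Tn n \<in> small (real n)" "Tn n \<in> word_chains"
proof -
  have "Pw (sc q (sum_list ks)) (2 * int (sum_list ks)) ks \<in> small (real n)" if "ks \<in> compo n" for q ks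
  proof (cases ks)
    case (Cons k r)
    let ?s = "sum_list ks"
    have "ereal (1 + 1) \<le> Ends_val (bb * bb)" by (rule Ends_val_mult_ge[OF bb_props(3,3)])
    then have "ereal (real ?s + (1 + 1)) \<le> Ends_val (Rs_id (sc q ?s) * (bb * bb))"
      by (rule Ends_val_mult_ge[OF Ends_val_Rs_id_ge[OF sc_props(3)]])
    then have v: "ereal ((real ?s + (1 + 1)) + (0 + real (length r)))
      \<le> word_val ((2 + 2 * int ?s, Rs_id (sc q ?s) * (bb * bb)) # replicate (2 * k) (0, 1) @ wd r)"
      by (intro word_val_Cons_ge word_val_append word_val_blocks) simp
    have w: "(2 + 2 * int ?s, Rs_id (sc q ?s) * (bb * bb)) # replicate (2 * k) (0, 1) @ wd r \<in> words"
      using sc_letter[OF special_letters(1)] block_letters by (simp add: words_Cons)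
    have n: "real n \<le> (real ?s + (1 + 1)) + (0 + real (length r))" using that by (auto simp: compo_def Cons)
    have "ereal (real n) \<le> ereal ((real ?s + (1 + 1)) + (0 + real (length r)))" using n by simp
    from small.short[OF w order_trans[OF this v]] show ?thesis by (simp add: Cons)
  qed (simp add: small.zero)
  then show *: "Tn n \<in> small (real n)" unfolding Tn_def by (intro small_sum)
  then show "Tn n \<in> word_chains" by (rule small_subset_chains)
qed

lemma Hw_replicate_0: "Z (pc (replicate (Suc n) 0) / real (length (replicate (Suc n) 0))) (replicate (Suc n) (0 :: nat)) = ew (Suc n)"
proof -
  have w: "wd (replicate m 0) = replicate m (1, bb)" for m by (induction m) (simp_all add: wd_simps)
  have p: "pc (replicate m 0) = 1" for m by (induction m) (simp_all add: pc_simps)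
  have s: "sum_list (replicate m (0 :: nat)) = 0" for m by simp
  show ?thesis unfolding p s by (simp add: ew_def sc_def w del: of_nat_Suc)
qed

text \<open>Each word of y is the negative of the corresponding \<open>Z\<close>-word, except for
  the list of zeros, whose \<open>Z\<close>-word is the summand of exp(b).\<close>

lemma level_small: "(\<Sum>ks\<in>compo (Suc n). frag_of (fw ks) + frag_of (Z (pc ks / real (length ks)) ks)) - frag_of (ew (Suc n)) \<in> small M"
proof -
  let ?F = "\<lambda>ks. frag_of (fw ks) + frag_of (Z (pc ks / real (length ks)) ks)" and ?o = "replicate (Suc n) (0 :: nat)"
  have o: "?o \<in> compo (Suc n)" by (simp add: compo_def)
  have z: "ks = ?o" if ks: "ks \<in> compo (Suc n)" "\<forall>k\<in>set ks. k = 0" for ks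
  proof -
    have "sum_list ks = 0" using ks(2) by simp
    then have l: "length ks = Suc n" using ks(1) by (simp only: compo_def mem_Collect_eq add_0_right)
    then show ?thesis using ks(2) by (intro replicate_eqI) auto
  qed
  have "?F ks \<in> small M" if ks: "ks \<in> compo (Suc n) - {?o}" for ks
  proof -
    have nz: "\<not> (\<forall>k\<in>set ks. k = 0)" using z ks by blast
    then obtain k r where kr: "ks = k # r" by (cases ks) auto
    let ?g = "pc ks / real (length ks)" and ?s = "sum_list ks"
    have v: "set (replicate (2 * k) (0, 1) @ wd r) \<subseteq> letters" using block_letters by simp
    have "frag_of (Z ?g ks) + frag_of (Z (- ?g) ks) \<in> small M"
      unfolding kr Hw.simps by (rule sc_neg[OF bb_letter v[unfolded]])
    then show ?thesis unfolding fw_def using nz by (simp only: if_False add.commute)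
  qed
  then have 1: "(\<Sum>ks\<in>compo (Suc n) - {?o}. ?F ks) \<in> small M" by (rule small_sum)
  have 2: "frag_of (fw ?o) \<in> small M" using zero_small[OF zero_letter, of "[]" M] by (simp add: fw_def)
  have "(\<Sum>ks\<in>compo (Suc n). ?F ks) = ?F ?o + (\<Sum>ks\<in>compo (Suc n) - {?o}. ?F ks)" by (rule sum.remove[OF finite_compo o])
  then have "(\<Sum>ks\<in>compo (Suc n). ?F ks) - frag_of (ew (Suc n)) = frag_of (fw ?o) + (\<Sum>ks\<in>compo (Suc n) - {?o}. ?F ks)"
    unfolding Hw_replicate_0 by simp
  then show ?thesis using small_add[OF 2 1] by simp
qed

theorem exp_correction_exists: "\<exists>y. exp_correction bb y"
proof
  let ?X = "\<lambda>n. d_chain (Yn n) - d_chain (En n)" and ?U = "\<lambda>n. \<Sum>j<n. frag_of (un j)"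
  have ulim: "(\<lambda>j. word_val (un j)) \<longlonglongrightarrow> \<infinity>" by (rule tendsto_infty_nat[of 0]) (rule un_words(2))
  have U: "cauchy_chain ?U" by (rule sum_words_cauchy[OF un_words(1) ulim])
  have Tsmall: "\<exists>n0. \<forall>n\<ge>n0. Tn n \<in> small N" for N
  proof -
    obtain L where L: "N \<le> real L" using real_arch_simple by blast
    have "Tn n \<in> small N" if "n \<ge> L" for n using small_antimono[OF Tn_small(1)[of n], of N] L that by simp
    then show ?thesis by blast
  qed
  have T: "cauchy_chain Tn"
    unfolding cauchy_chain_def
  proof (intro conjI allI Tn_small(2))
    fix N
    obtain n0 where "\<And>n. n \<ge> n0 \<Longrightarrow> Tn n \<in> small N" using Tsmall[of N] by blast
    then have "Tn m - Tn n \<in> small N" if "m \<ge> n0" "n \<ge> n0" for m n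
      using that by (intro small.diff)
    then show "\<exists>n0. \<forall>m\<ge>n0. \<forall>n\<ge>n0. Tn m - Tn n \<in> small N" by blast
  qed
  have UT: "cauchy_chain (\<lambda>n. ?U n - Tn n)" by (rule cauchy_chain_diff[OF U T])
  have X: "cauchy_chain ?X" by (rule cauchy_chain_diff[OF d_chain_cauchy[OF Yn_cauchy] d_chain_cauchy[OF En_cauchy]])
  have d1: "delta 0 1 = 0" by (simp add: delta_def psign_def)
  \<comment> \<open>The increments are compared level by level. The primitives at level n + 1 have
    valuation at least n + 1, so \<open>lam_of_eqI\<close> can sum them.\<close>
  have "lam_of ?X = lam_of (\<lambda>n. ?U n - Tn n)"
  proof (rule lam_of_eqI[OF X UT, where B = 0 and f = "\<lambda>n. real (Suc n)"])
    have "{ks. length ks + sum_list ks \<le> 0} = {[]}" by auto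
    then have Y0: "Yn 0 = frag_of [(0, 0)]" unfolding Yn_def by (simp only:) (simp add: fw_def)
    have T0: "Tn 0 = 0" by (simp add: Tn_def compo_0)
    have "d_chain (En 0) = frag_of [(1, 0)]"
    proof -
      have "En 0 = frag_of [(0, 1)]" by (simp add: En_def ew_def)
      then show ?thesis by (simp add: d_chain_def b_mu1_def b_mu2_def d1 psign_def)
    qed
    moreover have "frag_of [(1, 0)] \<in> small M" for M using zero_small[of 1 bb "[]"] bb_letter by simp
    moreover have "d_chain (Yn 0) \<in> small M" for M
      unfolding Y0 using d_chain_small zero_small[OF zero_letter, of "[]"] by simp
    ultimately show "?X 0 - (?U 0 - Tn 0) \<in> cyc_null 0"
      by (intro cyc_null_small) (simp add: T0 small.diff)
  next
    fix n
    let ?S = "\<Sum>ks\<in>compo (Suc n). d_chain (frag_of (Z (pc ks / real (length ks)) ks))"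
    have "{ks. length ks + sum_list ks \<le> Suc n} = {ks. length ks + sum_list ks \<le> n} \<union> compo (Suc n)" by (auto simp: compo_def)
    moreover have "{ks. length ks + sum_list ks \<le> n} \<inter> compo (Suc n) = {}" by (auto simp: compo_def)
    ultimately have Y: "Yn (Suc n) = Yn n + (\<Sum>ks\<in>compo (Suc n). frag_of (fw ks))"
      unfolding Yn_def by (simp add: sum.union_disjoint finite_size)
    have E: "En (Suc n) = En n + frag_of (ew (Suc n))" by (simp add: En_def)
    have "d_chain ((\<Sum>ks\<in>compo (Suc n). frag_of (fw ks) + frag_of (Z (pc ks / real (length ks)) ks)) - frag_of (ew (Suc n))) \<in> small M" for M
      by (rule d_chain_small[OF level_small])
    then have D: "(\<Sum>ks\<in>compo (Suc n). d_chain (frag_of (fw ks))) + ?S - d_chain (frag_of (ew (Suc n))) \<in> small M" for M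
      by (simp only: d_chain_lin d_chain_sum sum.distrib)
    have "((?X (Suc n) - ?X n) - ((?U (Suc n) - Tn (Suc n)) - (?U n - Tn n)))
      = ((\<Sum>ks\<in>compo (Suc n). d_chain (frag_of (fw ks))) + ?S - d_chain (frag_of (ew (Suc n))))
        + - (?S - (Tn (Suc n) - Tn n) + frag_of (un n))"
    proof -
      have *: "((y + f) - (e + w) - (y - e)) - (((u + v) - t') - (u - t)) = (f + s - w) + - (s - (t' - t) + v)"
        for y f e w u v t t' s :: chain by simp
      have u: "?U (Suc n) = ?U n + frag_of (un n)" by simp
      show ?thesis unfolding Y E d_chain_lin(1) d_chain_sum u by (rule *)
    qed
    also have "\<dots> \<in> cyc_null (real (Suc n))" by (rule small_cyc_null[OF D cyc_null_uminus[OF d_level]])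
    finally show "(?X (Suc n) - ?X n) - ((?U (Suc n) - Tn (Suc n)) - (?U n - Tn n)) \<in> cyc_null (real (Suc n))" .
  next
    fix N :: real
    obtain n0 where "N \<le> real n0" using real_arch_simple by blast
    then show "\<exists>n0. \<forall>n\<ge>n0. N \<le> real (Suc n)" by (intro exI[of _ n0]) auto
  qed
  \<comment> \<open>The telescoping remainder \<open>Tn n\<close> has valuation at least n and
    vanishes in the limit.\<close>
  also have "\<dots> = lam_of ?U"
    unfolding lam_of_eq_iff[OF UT U]
  proof (intro exI[of _ "\<lambda>n. 0"] conjI cauchy_chain_0)
    have "\<exists>n0. \<forall>n\<ge>n0. - Tn n \<in> small N" for N
    proof -
      obtain n0 where "\<And>n. n \<ge> n0 \<Longrightarrow> Tn n \<in> small N" using Tsmall[of N] by blast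
      then show ?thesis by (intro exI[of _ n0]) (auto intro: small_uminus)
    qed
    then show "null_chain (\<lambda>n. ?U n - Tn n - ?U n - (0 - t_chain 0))" by (simp add: null_chain_def t_chain_lin)
  qed
  finally have eq: "d_cc (lam_of Yn) - d_cc (exp_cc bb) = lam_of ?U"
    unfolding exp_cc_En d_cc_lam_of[OF Yn_cauchy] d_cc_lam_of[OF En_cauchy]
      lam_of_diff[OF d_chain_cauchy[OF Yn_cauchy] d_chain_cauchy[OF En_cauchy]] .
  have "range un \<subseteq> scalar_words \<inter> words"
    by (rule image_subsetI, rule IntI, rule un_words(3), rule un_words(1))
  then have "d_cc (lam_of Yn) - d_cc (exp_cc bb) \<in> C_lam_Rs"
    unfolding eq C_lam_Rs_def scalar_words_def[symmetric] by (rule infinite_sumsI[OF _ ulim])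
  then show "exp_correction bb (lam_of Yn)" unfolding exp_correction_def by (rule conjI[OF Yn_R_lam])
qed

text \<open>The existence of a correction is included so that the last clause is not vacuous; that
  clause also shows that the value does not depend on the choice.\<close>

theorem proposition22:
  fixes b :: "End_M fps" and c :: "R fps"
  assumes b: "b = Rs_id (fps_exp (- 1) - fps_exp 1)
        * fps_const (End_act (Cl_S (S_const (1 / (2 * T_half)) * z1) * e0))
      - Rs_id (fps_exp (- 1) + fps_exp 1 - 2) * fps_const (End_act (Cl_S (S_const (1 / 2)) * e1))"
    and c: "c = (fps_exp 1 - fps_exp (- 1)) * fps_const T_half"
  shows "b \<in> MC_hat c
    \<and> (\<exists>y. exp_correction b y)
    \<and> (\<forall>y. exp_correction b y \<longrightarrow> Theta (exp_cc b - y) = fps_X)"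
proof -
  have b': "b = bb" unfolding b bb_def A_s_def B_s_def X_b_def Y_b_def by (rule refl)
  have c': "c = cc" unfolding c cc_def by (rule refl)
  show ?thesis
    unfolding b' c'
  proof (intro conjI allI impI)
    show "bb \<in> MC_hat cc" by (rule bb_MC_hat)
    show "\<exists>y. exp_correction bb y" by (rule exp_correction_exists)
    show "Theta (exp_cc bb - y) = fps_X" if "exp_correction bb y" for y using that by (rule Theta_value)
  qed
qed

end
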